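(* Let $p\equiv 5\pmod 8$ be a prime and write $p=2n+1$. Let $\chi$ be a generator of the group of (complex-valued) Dirichlet characters modulo $p$, and let $M_p$ be the $n\times n$ matrix whose entry in row $k$ and column $j$ is $\chi^k(j^2)$, for $1\le k,j\le n=\frac{p-1}{2}$. Then $$\det(M_p)=n^{n/2}(-1)^{(n+2)/4}\times\left(\overline{\tfrac12\, n^{n/2}\,u_p}\cdot(-1)^{(2h(p)+n)/4}\right)\in\mathbb{Z}.$$
   Context: For an odd prime $p$ and a $p$-adic integer $a$ (for instance a rational number with denominator prime to $p$), $\overline{a}$ denotes the unique integer $x$ with $-p/2<x<p/2$ and $x-a$ divisible by $p$. For a prime $p\equiv1\pmod4$: $\varepsilon_p=(u_p+v_p\sqrt p)/2>1$ (with $u_p,v_p$ integers) is the fundamental unit of $\mathbb{Q}(\sqrt p)$, and $h(p)$ is the class number of $\mathbb{Q}(\sqrt p)$. *)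

theory Defs
  imports
    "HOL-Algebra.Generated_Groups"
    "HOL-Algebra.Ideal"
    "HOL-Computational_Algebra.Computational_Algebra"
    "Jordan_Normal_Form.Determinant"
begin

definition dirichlet_character :: "nat \<Rightarrow> (int \<Rightarrow> complex) \<Rightarrow> bool" where
  "dirichlet_character m \<chi> \<longleftrightarrow>
     (\<forall>a. \<chi> (a + int m) = \<chi> a) \<and>
     (\<forall>a b. \<chi> (a * b) = \<chi> a * \<chi> b) \<and>
     (\<forall>a. \<chi> a \<noteq> 0 \<longleftrightarrow> coprime a (int m))"

definition dirichlet_group :: "nat \<Rightarrow> (int \<Rightarrow> complex) monoid" where
  "dirichlet_group m =
     \<lparr>carrier = {\<chi>. dirichlet_character m \<chi>},
      monoid.mult = (\<lambda>\<chi> \<psi> a. \<chi> a * \<psi> a),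
      one = (\<lambda>a. if coprime a (int m) then 1 else 0)\<rparr>"

definition group_generator :: "('a, 'b) monoid_scheme \<Rightarrow> 'a \<Rightarrow> bool" where
  "group_generator G g \<longleftrightarrow> g \<in> carrier G \<and> generate G {g} = carrier G"

(* Divisibility of a by p in the p-adic integers, for a rational number a:
   a = p * (r / s) with s prime to p. *)
definition padic_dvd :: "nat \<Rightarrow> rat \<Rightarrow> bool" where
  "padic_dvd p a \<longleftrightarrow> (\<exists>r s::int. \<not> int p dvd s \<and> a = of_nat p * (of_int r / of_int s))"

(* Meaningful for p an odd prime and a rational with denominator prime to p. *)
definition pbar :: "nat \<Rightarrow> rat \<Rightarrow> int" where
  "pbar p a = (THE x::int. - (of_nat p / 2 :: rat) < of_int x \<and> of_int x < (of_nat p / 2 :: rat)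
                 \<and> padic_dvd p (of_int x - a))"

(* The real quadratic field generated by sqrt d, as a subset of the reals. *)
definition quad_field :: "nat \<Rightarrow> real set" where
  "quad_field d = {of_rat a + of_rat b * sqrt (real d) | a b. True}"

definition quad_integers :: "nat \<Rightarrow> real ring" where
  "quad_integers d =
     \<lparr>carrier = {x \<in> quad_field d. algebraic_int x}, monoid.mult = (*), one = 1, zero = 0, add = (+)\<rparr>"

definition nonzero_ideals :: "('a, 'b) ring_scheme \<Rightarrow> 'a set set" where
  "nonzero_ideals R = {I. ideal I R \<and> I \<noteq> {\<zero>\<^bsub>R\<^esub>}}"

(* Equivalence of nonzero integral ideals: aI = bJ for some nonzero a, b in R.
   Its classes are the elements of the ideal class group of a Dedekind domain R. *)
definition ideal_class_rel :: "('a, 'b) ring_scheme \<Rightarrow> ('a set \<times> 'a set) set" where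
  "ideal_class_rel R =
     {(I, J). I \<in> nonzero_ideals R \<and> J \<in> nonzero_ideals R \<and>
        (\<exists>a \<in> carrier R - {\<zero>\<^bsub>R\<^esub>}. \<exists>b \<in> carrier R - {\<zero>\<^bsub>R\<^esub>}.
           (\<lambda>x. a \<otimes>\<^bsub>R\<^esub> x) ` I = (\<lambda>x. b \<otimes>\<^bsub>R\<^esub> x) ` J)}"

definition quad_class_number :: "nat \<Rightarrow> nat" where
  "quad_class_number d =
     card (nonzero_ideals (quad_integers d) // ideal_class_rel (quad_integers d))"

definition quad_fundamental_unit :: "nat \<Rightarrow> real \<Rightarrow> bool" where
  "quad_fundamental_unit d \<epsilon> \<longleftrightarrow>
     \<epsilon> \<in> Units (quad_integers d) \<and> \<epsilon> > 1 \<and>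
     (\<forall>\<eta> \<in> Units (quad_integers d). \<exists>k::int. \<eta> = \<epsilon> powi k \<or> \<eta> = - (\<epsilon> powi k))"

(* Rows and columns of a matrix are indexed from 0, hence the shifts. *)
definition char_matrix :: "nat \<Rightarrow> (int \<Rightarrow> complex) \<Rightarrow> complex mat" where
  "char_matrix p \<chi> = (let n = (p - 1) div 2 in
     mat n n (\<lambda>(k, j). (\<chi> [^]\<^bsub>dirichlet_group p\<^esub> (k + 1)) ((int (j + 1))\<^sup>2)))"

end

theory Submission
  imports
    "HOL-Number_Theory.Number_Theory"
    "HOL-Real_Asymp.Real_Asymp"
    "HOL-Computational_Algebra.Field_as_Ring"
    "HOL-Computational_Algebra.Nth_Powers"
    Defs
begin

text \<open>
  Write \<open>p = 8 r + 5\<close> and let \<open>c\<close> be the Legendre symbol. In terms of a primitive root the matrix is, up to a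
  permutation of columns, a Vandermonde matrix in the \<open>n\<close>-th roots of unity. Modulo \<open>p\<close> the numbers
  \<open>1, 4, \<dots>, n\<^sup>2\<close> are \<open>n\<close>-th roots of unity permuted in the same way, and the product of their
  differences is \<open>- n!\<close>. Comparing the two gives \<open>det M = s (-1)^r n^(n/2)\<close> with a sign \<open>s\<close> such that
  \<open>n! = s (-1)^r n^(n/2)\<close> modulo \<open>p\<close>.

  The residue of \<open>n!\<close> is determined by Dirichlet's class number formula \<open>2 h ln \<epsilon> = \<surd>p L(1, c)\<close>, which is
  obtained by counting ideals of norm at most \<open>x\<close> in two ways: class by class, as lattice points in a
  hyperbolic sector, and in total, as \<open>\<Sum> c(e)\<close> over the pairs \<open>e k \<le> x\<close>. Evaluating \<open>L(1, c)\<close> by Gauss sums,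
  the formula exponentiates to \<open>\<epsilon>^h \<Prod> sin (\<pi> a / p) = \<Prod> sin (\<pi> b / p)\<close>, where \<open>a\<close> and \<open>b\<close> run over the residues
  and the nonresidues in \<open>1, \<dots>, n\<close>. Divided by suitable powers of \<open>\<xi> - \<xi>\<^sup>-\<^sup>1\<close>, where \<open>\<xi>\<close> is a primitive
  \<open>p\<close>-th root of unity, this is an identity in \<open>\<int>[\<xi>]\<close>. Reducing it modulo \<open>1 - \<xi>\<close> yields
  \<open>u^h = - 2^h n!\<close> modulo \<open>p\<close>. As \<open>u\<^sup>2 = - 4\<close> modulo \<open>p\<close>, this forces \<open>h\<close> to be odd and fixes \<open>s\<close>.
\<close>

text \<open>The sign of the permutation behind the two Vandermonde products is never computed: it
  enters the determinant and the residue of \<open>n!\<close> in the same way, so that residue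
  determines it. The obstacle is that \<open>n!\<close> is easily seen only to be a square root of
  -1 modulo \<open>p\<close>; choosing between the two roots needs global input. The other root at
  hand is \<open>u / 2\<close>, and the class number formula compares it with \<open>n!\<close>.
  Replacing \<epsilon> by its inverse there would reverse the answer (\<open>h\<close> being odd),
  so absolute values do not suffice: the sign of the Gauss sum has to be determined, and \<epsilon>
  has to be shown to have norm -1. The barred number is 1 or -1 because \<open>n^(n/2)\<close> and
  \<open>u / 2\<close> both square to -1 modulo \<open>p\<close>. Finiteness of the class group is
  not presupposed. It results from the count: every class has the same positive density of ideals,
  and all ideals together have the finite density \<open>L(1, c)\<close>.\<close>

hide_const (open) Coset.order Polynomial.order

section \<open>The determinant\<close>

text \<open>Left multiplication by the unitriangular matrix of coefficients of the Newton
  polynomials \<open>q k\<close> makes the matrix upper triangular. The exponents start at 1, as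
  those of the characters do, which accounts for the extra factor \<open>x j\<close>.\<close>

lemma det_vandermonde_Suc:
  fixes x :: "nat \<Rightarrow> 'a :: idom"
  shows "det (mat n n (\<lambda>(k, j). x j ^ Suc k)) = (\<Prod>j<n. x j * (\<Prod>i<j. x j - x i))"
proof -
  define q where "q = (\<lambda>k. \<Prod>i<k. [:- x i, 1:])"
  have deg: "degree (q k) = k" and lc: "coeff (q k) k = 1" for k
  proof -
    have "degree (q k) = k \<and> coeff (q k) k = 1"
    proof (induction k)
      case (Suc k)
      have *: "q (Suc k) = q k * [:- x k, 1:]" by (simp only: q_def prod.lessThan_Suc)
      have "q k \<noteq> 0" using Suc by auto
      with * have "degree (q (Suc k)) = Suc k" using Suc by (simp del: mult_pCons_right add: degree_mult_eq)
      moreover have "coeff (q (Suc k)) (Suc k) = 1"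
        unfolding * using Suc by (simp add: coeff_eq_0)
      ultimately show ?case by simp
    qed (auto simp: q_def)
    then show "degree (q k) = k" "coeff (q k) k = 1" by auto
  qed
  define L where "L = mat n n (\<lambda>(k, l). coeff (q k) l)"
  define V where "V = mat n n (\<lambda>(k, j). x j ^ Suc k)"
  define P where "P = mat n n (\<lambda>(k, j). x j * poly (q k) (x j))"
  have dims: "L \<in> carrier_mat n n" "V \<in> carrier_mat n n" "P \<in> carrier_mat n n"
    by (auto simp: L_def V_def P_def)
  have "L * V = P"
  proof (rule eq_matI)
    fix k j assume "k < dim_row P" "j < dim_col P"
    then have kj: "k < n" "j < n" by (auto simp: P_def)
    have "(L * V) $$ (k, j) = (\<Sum>l<n. coeff (q k) l * x j ^ Suc l)"
      using kj by (simp add: L_def V_def scalar_prod_def atLeast0LessThan)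
    also have "\<dots> = (\<Sum>l\<le>k. coeff (q k) l * x j ^ Suc l)"
      using kj deg[of k] by (intro sum.mono_neutral_right) (auto simp: coeff_eq_0)
    also have "\<dots> = x j * poly (q k) (x j)"
      by (simp add: poly_altdef deg sum_distrib_left mult_ac)
    finally show "(L * V) $$ (k, j) = P $$ (k, j)" using kj by (simp add: P_def)
  qed (use dims in \<open>auto simp: P_def L_def V_def\<close>)
  then have "det L * det V = det P"
    using det_mult[OF dims(1,2)] by simp
  moreover have "det L = prod_list (diag_mat L)"
    by (rule det_lower_triangular[OF _ dims(1)]) (auto simp: L_def coeff_eq_0 deg)
  moreover have "diag_mat L = map (\<lambda>_. 1) [0..<n]"
    by (auto simp: diag_mat_def L_def lc intro!: map_cong)
  moreover have "det P = prod_list (diag_mat P)"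
  proof (rule det_upper_triangular[OF _ dims(3)])
    have "poly (q k) (x j) = 0" if "j < k" for k j
      using that by (auto simp: q_def poly_prod)
    then show "upper_triangular P" by (auto simp: P_def)
  qed
  moreover have "diag_mat P = map (\<lambda>j. x j * (\<Prod>i<j. x j - x i)) [0..<n]"
    by (auto simp: diag_mat_def P_def q_def poly_prod intro!: map_cong prod.cong)
  moreover have "prod_list (map (\<lambda>_. 1::'a) [0..<n]) = 1" by (induction n) auto
  moreover have "prod_list (map f [0..<n]) = (\<Prod>j<n. f j)" for f :: "nat \<Rightarrow> 'a"
    by (induction n) auto
  ultimately show ?thesis by (simp add: V_def)
qed

text \<open>The map \<phi> sorts the image of a pair i < j and thereby permutes these pairs; each
  sorting flips at most one sign. The resulting sign is an integer that does not depend on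
  \<open>F\<close>, which carries one and the same sign from the complex numbers to the residues
  modulo \<open>p\<close>.\<close>

lemma prod_diff_bij:
  fixes F :: "nat \<Rightarrow> 'a :: comm_ring_1"
  assumes "bij_betw \<sigma> {..<n} {..<n}"
  shows "(\<Prod>j<n. \<Prod>i<j. F (\<sigma> j) - F (\<sigma> i)) =
    of_int (\<Prod>j<n. \<Prod>i<j. if \<sigma> i < \<sigma> j then 1 else - 1) * (\<Prod>j<n. \<Prod>i<j. F j - F i)"
proof -
  define P where "P = (SIGMA j:{..<n}. {..<j})"
  define \<phi> where "\<phi> = (\<lambda>(j, i). (max (\<sigma> j) (\<sigma> i), min (\<sigma> j) (\<sigma> i)))"
  have inj: "inj_on \<sigma> {..<n}" and img: "\<sigma> ` {..<n} = {..<n}"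
    using assms by (auto simp: bij_betw_def)
  have ne: "\<sigma> i \<noteq> \<sigma> j" if "i < j" "j < n" for i j
    using inj_onD[OF inj, of i j] that by auto
  have fin: "finite P" by (auto simp: P_def)
  have sub: "\<phi> ` P \<subseteq> P"
  proof
    fix y assume "y \<in> \<phi> ` P"
    then obtain j i where ji: "i < j" "j < n" "y = \<phi> (j, i)" by (auto simp: P_def)
    have "\<sigma> j < n" "\<sigma> i < n" using img ji by auto
    then show "y \<in> P" using ji ne[of i j] by (auto simp: P_def \<phi>_def max_def min_def)
  qed
  have "inj_on \<phi> P"
  proof (rule inj_onI)
    fix x y assume "x \<in> P" "y \<in> P" and eq: "\<phi> x = \<phi> y"
    then obtain j i j' i' where xy: "x = (j, i)" "y = (j', i')" "i < j" "j < n" "i' < j'" "j' < n"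
      by (auto simp: P_def)
    have "{\<sigma> j, \<sigma> i} = {\<sigma> j', \<sigma> i'}"
      using eq by (auto simp: \<phi>_def xy max_def min_def split: if_splits)
    then have "\<sigma> ` {j, i} = \<sigma> ` {j', i'}" by simp
    then have "{j, i} = {j', i'}"
      by (rule inj_on_image_eq_iff[OF inj, THEN iffD1, rotated 2]) (use xy in auto)
    then show "x = y" using xy by (auto simp: doubleton_eq_iff)
  qed
  then have bij: "bij_betw \<phi> P P"
    using endo_inj_surj[OF fin sub] by (auto simp: bij_betw_def)
  have pr: "(\<Prod>j<n. \<Prod>i<j. f j i) = (\<Prod>(j, i)\<in>P. f j i)" for f :: "nat \<Rightarrow> nat \<Rightarrow> 'b :: comm_monoid_mult"
    by (simp add: P_def prod.Sigma)
  have "(\<Prod>(j, i)\<in>P. F (\<sigma> j) - F (\<sigma> i)) =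
      (\<Prod>(j, i)\<in>P. of_int (if \<sigma> i < \<sigma> j then 1 else - 1) * (case \<phi> (j, i) of (j, i) \<Rightarrow> F j - F i))"
    using ne by (intro prod.cong refl) (auto simp: P_def \<phi>_def)
  also have "\<dots> = of_int (\<Prod>(j, i)\<in>P. if \<sigma> i < \<sigma> j then 1 else - 1) * (\<Prod>x\<in>P. case \<phi> x of (j, i) \<Rightarrow> F j - F i)"
    by (simp add: prod.distrib case_prod_unfold)
  also have "(\<Prod>x\<in>P. case \<phi> x of (j, i) \<Rightarrow> F j - F i) = (\<Prod>(j, i)\<in>P. F j - F i)"
    by (rule prod.reindex_bij_betw[OF bij])
  finally show ?thesis by (simp add: pr)
qed

text \<open>With \<open>c d = \<theta>^d - \<tau>^d\<close> one has \<open>\<theta>^(2l) - \<theta>^(2k) = \<theta>^(l+k) c (l-k)\<close> and \<open>c (n-d) = c d\<close>,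
  so the products \<open>C l = c 1 \<cdots> c l\<close> satisfy \<open>C l * C (n-1-l) = C (n-1)\<close>. Working modulo \<open>\<pi>\<close>
  covers both the complex numbers (\<open>\<pi> = 0\<close>) and the residues modulo a prime.\<close>

lemma cong_vandermonde_roots_of_unity:
  fixes \<theta> \<pi> :: "'a :: {unique_euclidean_ring, idom}"
  assumes n: "n = 4 * r + 2"
    and th: "[\<theta> ^ n = - 1] (mod \<pi>)"
    and H: "[(\<Prod>d\<in>{1..<n}. 1 - \<theta> ^ (2 * d)) = of_nat n] (mod \<pi>)"
  shows "[(\<Prod>l<n. \<Prod>k<l. \<theta> ^ (2 * l) - \<theta> ^ (2 * k)) = - ((- 1) ^ r) * of_nat n ^ (2 * r + 1)] (mod \<pi>)"
proof -
  \<comment> \<open>The inverse of \<theta> modulo \<pi>, because \<open>\<theta> ^ n\<close> is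
    -1.\<close>
  define \<tau> where "\<tau> = - (\<theta> ^ (n - 1))"
  have "\<theta> * \<tau> = - (\<theta> ^ n)" using n by (simp add: \<tau>_def power_eq_if)
  then have inv1: "[\<theta> * \<tau> = 1] (mod \<pi>)" using cong_minus_minus_iff[of "\<theta> ^ n" "- 1" \<pi>] th by simp
  have inv: "[\<theta> ^ k * \<tau> ^ k = 1] (mod \<pi>)" for k
    using cong_pow[OF inv1, of k] by (simp add: power_mult_distrib)
  have tn: "[\<tau> ^ n = - 1] (mod \<pi>)"
  proof -
    have "[\<theta> ^ n * \<tau> ^ n = (- 1) * \<tau> ^ n] (mod \<pi>)" by (rule cong_scalar_right[OF th])
    then have "[1 = - (\<tau> ^ n)] (mod \<pi>)" using cong_trans[OF cong_sym[OF inv[of n]]] by simp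
    then show ?thesis using cong_minus_minus_iff[of 1 "- (\<tau> ^ n)" \<pi>] by (simp add: cong_sym_eq)
  qed
  define c where "c = (\<lambda>d. \<theta> ^ d - \<tau> ^ d)"
  have c_refl: "[c (n - d) = c d] (mod \<pi>)" if "d \<le> n" for d
  proof -
    have "[\<theta> ^ (n - d) * (\<theta> ^ d * \<tau> ^ d) = \<theta> ^ (n - d)] (mod \<pi>)"
      using cong_scalar_left[OF inv[of d], of "\<theta> ^ (n - d)"] by simp
    moreover have "\<theta> ^ (n - d) * (\<theta> ^ d * \<tau> ^ d) = \<theta> ^ n * \<tau> ^ d"
      using that by (simp flip: mult.assoc power_add)
    moreover have "[\<theta> ^ n * \<tau> ^ d = - (\<tau> ^ d)] (mod \<pi>)"
      using cong_scalar_right[OF th, of "\<tau> ^ d"] by simp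
    ultimately have 1: "[\<theta> ^ (n - d) = - (\<tau> ^ d)] (mod \<pi>)"
      using cong_trans[OF cong_sym] by simp
    have "[\<tau> ^ (n - d) * (\<theta> ^ d * \<tau> ^ d) = \<tau> ^ (n - d)] (mod \<pi>)"
      using cong_scalar_left[OF inv[of d], of "\<tau> ^ (n - d)"] by simp
    moreover have "\<tau> ^ (n - d) * (\<theta> ^ d * \<tau> ^ d) = \<tau> ^ n * \<theta> ^ d"
      using that by (simp add: mult_ac flip: power_add)
    moreover have "[\<tau> ^ n * \<theta> ^ d = - (\<theta> ^ d)] (mod \<pi>)"
      using cong_scalar_right[OF tn, of "\<theta> ^ d"] by simp
    ultimately have 2: "[\<tau> ^ (n - d) = - (\<theta> ^ d)] (mod \<pi>)"
      using cong_trans[OF cong_sym] by simp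
    show ?thesis using cong_diff[OF 1 2] by (simp add: c_def)
  qed
  define C where "C = (\<lambda>l. \<Prod>d\<in>{1..l}. c d)"
  have C_refl: "[C l * C (n - 1 - l) = C (n - 1)] (mod \<pi>)" if "l < n" for l
  proof -
    have "C (n - 1 - l) = (\<Prod>d\<in>{l+1..n-1}. c (n - d))" unfolding C_def
      by (rule prod.reindex_bij_witness[of _ "\<lambda>d. n - d" "\<lambda>d. n - d"]) (use that in auto)
    moreover have "[(\<Prod>d\<in>{l+1..n-1}. c (n - d)) = (\<Prod>d\<in>{l+1..n-1}. c d)] (mod \<pi>)"
      by (rule cong_prod) (auto intro!: c_refl)
    ultimately have "[C l * C (n - 1 - l) = C l * (\<Prod>d\<in>{l+1..n-1}. c d)] (mod \<pi>)"
      by (simp add: cong_scalar_left)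
    moreover have "C l * (\<Prod>d\<in>{l+1..n-1}. c d) = C (n - 1)"
      unfolding C_def using that by (subst prod.union_disjoint[symmetric]) (auto intro!: prod.cong)
    ultimately show ?thesis by simp
  qed
  have fac: "[\<theta> ^ (2 * l) - \<theta> ^ (2 * k) = \<theta> ^ (l + k) * c (l - k)] (mod \<pi>)" if "k < l" for k l
  proof -
    have "\<theta> ^ (l + k) * c (l - k) = \<theta> ^ (l + k + (l - k)) - \<theta> ^ (2 * k) * (\<theta> ^ (l - k) * \<tau> ^ (l - k))"
      using that by (simp add: c_def algebra_simps flip: power_add mult.assoc)
    moreover have "[\<theta> ^ (2 * k) * (\<theta> ^ (l - k) * \<tau> ^ (l - k)) = \<theta> ^ (2 * k)] (mod \<pi>)"
      using cong_scalar_left[OF inv, of "\<theta> ^ (2 * k)"] by simp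
    moreover have "l + k + (l - k) = 2 * l" using that by simp
    ultimately show ?thesis by (simp add: cong_diff cong_sym)
  qed
  have W1: "[(\<Prod>l<n. \<Prod>k<l. \<theta> ^ (2 * l) - \<theta> ^ (2 * k)) = (\<Prod>l<n. \<Prod>k<l. \<theta> ^ (l + k) * c (l - k))] (mod \<pi>)"
    by (intro cong_prod fac) auto
  have W2: "(\<Prod>l<n. \<Prod>k<l. \<theta> ^ (l + k) * c (l - k)) = \<theta> ^ (\<Sum>l<n. \<Sum>k<l. l + k) * (\<Prod>l<n. C l)"
  proof -
    have "(\<Prod>k<l. c (l - k)) = C l" for l unfolding C_def
      by (rule prod.reindex_bij_witness[of _ "\<lambda>d. l - d" "\<lambda>d. l - d"]) auto
    then show ?thesis by (simp add: prod.distrib power_sum)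
  qed
  have W3: "[(\<Prod>l<n. C l) = C (n - 1) ^ (2 * r + 1)] (mod \<pi>)"
  proof -
    have *: "{..<n} = {..<2*r+1} \<union> {2*r+1..<n}" using n by auto
    have "(\<Prod>l<n. C l) = (\<Prod>l<2*r+1. C l) * (\<Prod>l\<in>{2*r+1..<n}. C l)"
      unfolding * by (rule prod.union_disjoint) auto
    also have "(\<Prod>l\<in>{2*r+1..<n}. C l) = (\<Prod>l<2*r+1. C (n - 1 - l))"
      by (rule prod.reindex_bij_witness[of _ "\<lambda>d. n - 1 - d" "\<lambda>d. n - 1 - d"]) (use n in auto)
    finally have "(\<Prod>l<n. C l) = (\<Prod>l<2*r+1. C l * C (n - 1 - l))" by (simp add: prod.distrib)
    moreover have "[(\<Prod>l<2*r+1. C l * C (n - 1 - l)) = (\<Prod>l<2*r+1. C (n - 1))] (mod \<pi>)"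
      by (intro cong_prod C_refl) (use n in auto)
    ultimately show ?thesis by simp
  qed
  \<comment> \<open>\<open>c d\<close> equals \<open>- (\<tau> ^ d)\<close> times
    \<open>1 - \<theta> ^ (2 * d)\<close>, so \<open>H\<close> evaluates the product. The odd number
    \<open>n - 1\<close> of signs leaves -1, and the exponents of \<tau> add up to n (n - 1) /
    2.\<close>
  have W4: "[C (n - 1) = - (\<tau> ^ ((2 * r + 1) * (n - 1))) * of_nat n] (mod \<pi>)"
  proof -
    have "[c d = - (\<tau> ^ d) * (1 - \<theta> ^ (2 * d))] (mod \<pi>)" for d
    proof -
      have "- (\<tau> ^ d) * (1 - \<theta> ^ (2 * d)) = \<theta> ^ d * (\<theta> ^ d * \<tau> ^ d) - \<tau> ^ d"
        by (simp add: algebra_simps power_mult power2_eq_square flip: power_mult_distrib)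
      moreover have "[\<theta> ^ d * (\<theta> ^ d * \<tau> ^ d) - \<tau> ^ d = \<theta> ^ d * 1 - \<tau> ^ d] (mod \<pi>)"
        by (intro cong_diff cong_scalar_left inv cong_refl)
      ultimately show ?thesis by (simp add: c_def cong_sym)
    qed
    then have a1: "[C (n - 1) = (\<Prod>d\<in>{1..n-1}. - (\<tau> ^ d) * (1 - \<theta> ^ (2 * d)))] (mod \<pi>)"
      unfolding C_def by (intro cong_prod) auto
    have a2: "(\<Prod>d\<in>{1..n-1}. - (\<tau> ^ d) * (1 - \<theta> ^ (2 * d))) =
        (\<Prod>d\<in>{1..n-1}. - (\<tau> ^ d)) * (\<Prod>d\<in>{1..<n}. 1 - \<theta> ^ (2 * d))"
      unfolding prod.distrib using n by (intro arg_cong2[of _ _ _ _ "(*)"] prod.cong) auto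
    have a3: "(\<Prod>d\<in>{1..n-1}. - (\<tau> ^ d)) = - (\<tau> ^ ((2 * r + 1) * (n - 1)))"
    proof -
      have "(\<Prod>d\<in>{1..k}. - (\<tau> ^ d)) = (- 1) ^ k * \<tau> ^ (\<Sum>d\<in>{1..k}. d)" for k
        by (induction k) (auto simp: power_add)
      moreover have "(\<Sum>d\<in>{1..n-1}. d) = (2 * r + 1) * (n - 1)"
        using Sum_Icc_nat[of 1 "n-1"] n by simp
      moreover have "odd (n - 1)" using n by simp
      ultimately show ?thesis by simp
    qed
    have a4: "[- (\<tau> ^ ((2 * r + 1) * (n - 1))) * (\<Prod>d\<in>{1..<n}. 1 - \<theta> ^ (2 * d)) =
      - (\<tau> ^ ((2 * r + 1) * (n - 1))) * of_nat n] (mod \<pi>)"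
      by (rule cong_scalar_left[OF H])
    show ?thesis using cong_trans[OF a1[unfolded a2 a3] a4] .
  qed
  have W5: "(\<Sum>l<n. \<Sum>k<l. l + k) = (2 * r + 1) * (n - 1) * (n - 1)"
  proof -
    have tri: "2 * (\<Sum>k<N. k) = N * (N - 1)" for N :: nat
    proof (induction N)
      case (Suc N)
      then show ?case by (cases N) (auto simp: algebra_simps)
    qed auto
    have sq: "2 * (\<Sum>l<N. \<Sum>k<l. l + k) = N * (N - 1) * (N - 1)" for N :: nat
    proof (induction N)
      case (Suc N)
      have "2 * (\<Sum>k<N. N + k) = 2 * N * N + N * (N - 1)"
        by (simp only: sum.distrib distrib_left tri) simp
      then show ?case using Suc by (cases N) (auto simp: algebra_simps)
    qed auto
    have "2 * (\<Sum>l<n. \<Sum>k<l. l + k) = 2 * ((2 * r + 1) * (n - 1) * (n - 1))"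
      unfolding sq using n by (simp add: algebra_simps)
    then show ?thesis by linarith
  qed
  have W6: "[(\<Prod>l<n. \<Prod>k<l. \<theta> ^ (2 * l) - \<theta> ^ (2 * k)) =
      \<theta> ^ ((2 * r + 1) * (n - 1) * (n - 1)) * (- (\<tau> ^ ((2 * r + 1) * (n - 1))) * of_nat n) ^ (2 * r + 1)] (mod \<pi>)"
    using cong_trans[OF W1[unfolded W2 W5] cong_scalar_left[OF cong_trans[OF W3 cong_pow[OF W4]]]] .
  \<comment> \<open>The exponent of \<theta> is split into a part that cancels against the power of
    \<tau> and a multiple of \<open>n\<close>, where \<open>\<theta> ^ n = - 1\<close>
    applies.\<close>
  have W7: "\<theta> ^ ((2 * r + 1) * (n - 1) * (n - 1)) * (- (\<tau> ^ ((2 * r + 1) * (n - 1))) * of_nat n) ^ (2 * r + 1)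
      = - (of_nat n ^ (2 * r + 1)) * (\<theta> ^ n) ^ ((n - 1) * r) *
        (\<theta> ^ ((2 * r + 1) * (n - 1) * (2 * r + 1)) * \<tau> ^ ((2 * r + 1) * (n - 1) * (2 * r + 1)))"
  proof -
    have e: "(2 * r + 1) * (n - 1) * (n - 1) = n * ((n - 1) * r) + (2 * r + 1) * (n - 1) * (2 * r + 1)"
      using n by (simp add: algebra_simps)
    have neg: "(- x * y) ^ (2 * r + 1) = - (y ^ (2 * r + 1)) * x ^ (2 * r + 1)" for x y :: 'a
      by (simp add: power_mult_distrib mult_ac)
    show ?thesis unfolding neg e power_add[of \<theta> "n * ((n - 1) * r)"] power_mult[of \<theta> n]
        power_mult[of \<tau> "(2 * r + 1) * (n - 1)" "2 * r + 1"]
      by (simp only: mult_ac mult_minus_left mult_minus_right)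
  qed
  have W8: "[- (of_nat n ^ (2 * r + 1)) * (\<theta> ^ n) ^ ((n - 1) * r) *
        (\<theta> ^ ((2 * r + 1) * (n - 1) * (2 * r + 1)) * \<tau> ^ ((2 * r + 1) * (n - 1) * (2 * r + 1))) =
        - (of_nat n ^ (2 * r + 1)) * (- 1) ^ ((n - 1) * r) * 1] (mod \<pi>)"
    by (intro cong_mult cong_refl cong_pow th inv)
  have W9: "- (of_nat n ^ (2 * r + 1)) * (- 1) ^ ((n - 1) * r) * 1 = - ((- 1) ^ r) * (of_nat n :: 'a) ^ (2 * r + 1)"
  proof -
    have "odd (n - 1)" using n by simp
    then show ?thesis by (simp add: power_mult)
  qed
  show ?thesis using cong_trans[OF W6[unfolded W7] W8, unfolded W9] .
qed

section \<open>Primes congruent to 5 modulo 8: Legendre symbol, factorials, primitive root\<close>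

locale prime_5_mod_8 =
  fixes p r :: nat
  assumes prime_p: "prime p" and p_eq: "p = 8 * r + 5"
begin

definition n :: nat where "n = 4 * r + 2"

lemma p_n: "p = 2 * n + 1" "p - 1 = 2 * n" "(p - 1) div 2 = n" and n_pos: "n > 0"
  and p_gt2: "p > 2" and odd_p: "odd p" and even_n: "even n"
  by (simp_all add: n_def p_eq)

abbreviation c :: "int \<Rightarrow> int" where "c a \<equiv> Legendre a (int p)"

lemma prime_int_p: "prime (int p)" using prime_p by simp

lemma cong_euler: "[c a = a ^ n] (mod int p)"
  using euler_criterion[of p a] prime_p p_gt2 p_n by simp

lemma c_cases: "c a = 0 \<or> c a = 1 \<or> c a = - 1"
  by (simp add: Legendre_def)

lemma c_eq_0_iff: "c a = 0 \<longleftrightarrow> int p dvd a"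
  by (simp add: Legendre_def cong_0_iff)

text \<open>The difference is at most 4 in absolute value, and \<open>p\<close> is at least 5. This
  turns congruences between Legendre symbols into equations.\<close>

lemma cong_small_imp_eq:
  assumes "[x = y] (mod int p)" "\<bar>x\<bar> \<le> 2" "\<bar>y\<bar> \<le> 2"
  shows "x = y"
proof (rule ccontr)
  assume "x \<noteq> y"
  moreover have "int p dvd x - y" using assms by (simp add: cong_iff_dvd_diff)
  ultimately have "int p \<le> \<bar>x - y\<bar>" using zdvd_imp_le[of "int p" "\<bar>x - y\<bar>"] by simp
  then have "r = 0" "\<bar>x - y\<bar> \<ge> 5" using assms p_eq by auto
  then show False using assms by linarith
qed

lemma c_abs: "\<bar>c a\<bar> \<le> 1" using c_cases[of a] by auto

lemma c_eqI: assumes "[c a = x] (mod int p)" "\<bar>x\<bar> \<le> 2" shows "c a = x"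
  using cong_small_imp_eq[OF assms(1)] assms(2) c_abs[of a] by linarith

lemma c_mult: "c (a * b) = c a * c b"
proof (rule c_eqI)
  show "[c (a * b) = c a * c b] (mod int p)"
    using cong_trans[OF cong_euler[of "a * b", unfolded power_mult_distrib]
      cong_sym[OF cong_mult[OF cong_euler[of a] cong_euler[of b]]]] .
  show "\<bar>c a * c b\<bar> \<le> 2" using c_cases[of a] c_cases[of b] by auto
qed

lemma c_1 [simp]: "c 1 = 1"
  by (rule c_eqI) (use cong_euler[of 1] in auto)

lemma c_cong: assumes "[a = b] (mod int p)" shows "c a = c b"
proof (rule c_eqI)
  show "[c a = c b] (mod int p)"
    using cong_trans[OF cong_euler cong_trans[OF cong_pow[OF assms] cong_sym[OF cong_euler]]] .
qed (use c_abs[of b] in auto)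

lemma c_minus: "c (- a) = c a"
proof -
  have "c (- 1) = 1" by (rule c_eqI) (use cong_euler[of "- 1"] even_n in auto)
  then show ?thesis using c_mult[of "- 1" a] by simp
qed

text \<open>Wilson's theorem is the case \<open>k = 0\<close>; the induction moves the factor p - 1
  - k, which is - (k + 1) modulo \<open>p\<close>, from one factorial to the other.\<close>

lemma cong_fact_mult_fact:
  "k < p \<Longrightarrow> [fact k * fact (p - 1 - k) = (- 1) ^ Suc k] (mod int p)"
proof (induction k)
  case 0
  then show ?case using wilson_theorem[OF prime_p] by simp
next
  case (Suc k)
  have e: "p - 1 - k = Suc (p - 1 - Suc k)" using Suc by simp
  have "(fact (Suc k) * fact (p - 1 - Suc k) :: int) = int p * (fact k * fact (p - 1 - Suc k)) - fact k * fact (p - 1 - k)"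
    unfolding e fact_Suc using Suc by (simp add: algebra_simps of_nat_diff)
  moreover have "[int p * (fact k * fact (p - 1 - Suc k)) - fact k * fact (p - 1 - k) = 0 - (- 1) ^ Suc k] (mod int p)"
    using Suc by (intro cong_diff Suc.IH) (auto simp: cong_0_iff)
  ultimately show ?case by simp
qed

lemma cong_fact_n_sq: "[(fact n)\<^sup>2 = - 1] (mod int p)"
proof -
  have "p - 1 - n = n" using p_n by simp
  then show ?thesis using cong_fact_mult_fact[of n] p_n even_n by (simp add: power2_eq_square)
qed

lemma c_2: "c 2 = - 1"
proof (rule ccontr)
  assume "c 2 \<noteq> - 1"
  moreover have "c 2 \<noteq> 0" unfolding c_eq_0_iff using p_gt2 zdvd_imp_le[of "int p" 2] by auto
  ultimately have "c 2 = 1" using c_cases[of 2] by auto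
  \<comment> \<open>Gauss's trick: multiply the even numbers up to \<open>p - 1\<close> in two ways.\<close>
  define e where "e = (\<Prod>k\<in>{1..n}. 2 * int k)"
  have e1: "e = 2 ^ n * fact n" by (simp add: e_def prod.distrib fact_prod of_nat_prod)
  have split: "{1..n} = {1..2*r+1} \<union> {2*r+2..n}" by (auto simp: n_def)
  have "e = (\<Prod>k\<in>{1..2*r+1}. 2 * int k) * (\<Prod>k\<in>{2*r+2..n}. 2 * int k)"
    unfolding e_def split by (rule prod.union_disjoint) auto
  \<comment> \<open>Beyond n / 2 the even numbers 2 k are \<open>p\<close> minus the odd numbers 1,
    3, ..., n - 1.\<close>
  also have "(\<Prod>k\<in>{2*r+2..n}. 2 * int k) = (\<Prod>k\<in>{1..2*r+1}. int p - int (2 * k - 1))"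
    by (rule prod.reindex_bij_witness[of _ "\<lambda>k. n + 1 - k" "\<lambda>k. n + 1 - k"]) (auto simp: n_def p_eq)
  finally have "[e = (\<Prod>k\<in>{1..2*r+1}. 2 * int k) * (\<Prod>k\<in>{1..2*r+1}. 0 - int (2 * k - 1))] (mod int p)"
    by (simp only:) (intro cong_mult cong_refl cong_prod cong_diff, simp add: cong_0_iff)
  \<comment> \<open>The number \<open>2 * r + 1\<close> of signs is odd; this distinguishes 5 from 1
    modulo 8.\<close>
  also have "(\<Prod>k\<in>{1..2*r+1}. 0 - int (2 * k - 1)) = - (\<Prod>k\<in>{1..2*r+1}. int (2 * k - 1))"
    using prod_uminus[of "\<lambda>k. int (2 * k - 1)" "{1..2*r+1}"] by simp
  also have "(\<Prod>k\<in>{1..2*r+1}. 2 * int k) * - (\<Prod>k\<in>{1..2*r+1}. int (2 * k - 1)) = - fact n"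
  proof -
    have *: "(\<Prod>k\<in>{1..N}. 2 * int k) * (\<Prod>k\<in>{1..N}. int (2 * k - 1)) = fact (2 * N)" for N
    proof (induction N)
      case (Suc N)
      have "int (2 * Suc N - 1) = 2 * int N + 1" by simp
      then have "(\<Prod>k\<in>{1..Suc N}. 2 * int k) * (\<Prod>k\<in>{1..Suc N}. int (2 * k - 1)) =
          ((\<Prod>k\<in>{1..N}. 2 * int k) * (\<Prod>k\<in>{1..N}. int (2 * k - 1))) * ((2 * int N + 2) * (2 * int N + 1))"
        by (simp add: algebra_simps)
      also have "\<dots> = fact (2 * Suc N)" unfolding Suc by (simp add: algebra_simps)
      finally show ?case .
    qed auto
    have "n = 2 * (2 * r + 1)" by (simp add: n_def)
    then show ?thesis using *[of "2 * r + 1"] by simp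
  qed
  finally have "[2 ^ n * fact n = - 1 * fact n] (mod int p)" by (simp add: e1)
  moreover have "coprime (fact n) (int p)"
  proof -
    have "\<not> p dvd fact n" using prime_p p_n(1) by (subst prime_dvd_fact_iff) auto
    then have "coprime p (fact n)" using prime_p prime_imp_coprime by blast
    then have "coprime (int (fact n)) (int p)" by (simp only: coprime_int_iff coprime_commute)
    then show ?thesis by (simp only: of_nat_fact)
  qed
  ultimately have "[2 ^ n = - 1] (mod int p)" using cong_mult_rcancel by blast
  then have "[c 2 = - 1] (mod int p)" using cong_trans[OF cong_euler] by blast
  then show False using c_eqI[of 2 "- 1"] \<open>c 2 \<noteq> -1\<close> by simp
qed

definition g :: nat where "g = (SOME g. residue_primroot p g)"

lemma residue_primroot_g: "residue_primroot p g"
  unfolding g_def by (rule someI_ex, rule prime_primitive_root_exists) (use prime_p p_gt2 in auto)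

lemma ord_g: "ord p g = 2 * n" and coprime_g: "coprime p g"
  using residue_primroot_g prime_p p_n by (auto simp: residue_primroot_def totient_prime)

lemma cong_g_iff: "[int g ^ i = int g ^ j] (mod int p) \<longleftrightarrow> [i = j] (mod (2 * n))"
  using order_divides_expdiff[OF coprime_g, of i j] by (simp add: ord_g cong_int_iff flip: of_nat_power)

lemma ex_log:
  assumes "\<not> int p dvd a"
  shows "\<exists>i<2*n. [int g ^ i = a] (mod int p)"
proof -
  define b where "b = nat (a mod int p)"
  have b: "int b = a mod int p" using p_gt2 by (simp add: b_def)
  have "a mod int p \<ge> 0" "a mod int p < int p" using p_gt2 by auto
  then have "b > 0" "b < p" using assms b by (auto simp: dvd_eq_mod_eq_0)
  then have "b \<in> totatives p" using prime_p by (auto simp: totatives_prime)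
  then obtain i where "i < totient p" "b = g ^ i mod p"
    using residue_primroot_is_generator[of p g] residue_primroot_g p_gt2 by (auto simp: bij_betw_def)
  then have "i < 2 * n" using prime_p p_n(2) by (simp add: totient_prime)
  moreover have "int g ^ i mod int p = a mod int p"
    using b \<open>b = g ^ i mod p\<close> by (simp flip: of_nat_mod of_nat_power)
  ultimately have "i < 2 * n" "[int g ^ i = a] (mod int p)" unfolding Cong.cong_def by blast+
  then show ?thesis by blast
qed

lemma not_dvd_less: "\<lbrakk>0 < k; k < p\<rbrakk> \<Longrightarrow> \<not> int p dvd int k"
  using nat_dvd_not_less by auto

end

section \<open>Integer polynomials as representatives of elements of Z[\<zeta>], and reduction
  modulo 1 - \<zeta>\<close>

definition ev :: "int poly \<Rightarrow> complex \<Rightarrow> complex" where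
  "ev f z = poly (map_poly of_int f) z"

lemma ev_0 [simp]: "ev 0 z = 0" and ev_1 [simp]: "ev 1 z = 1"
  and ev_pCons [simp]: "ev (pCons a f) z = of_int a + z * ev f z"
  by (simp_all add: ev_def map_poly_pCons)

lemma ev_add [simp]: "ev (f + g) z = ev f z + ev g z"
proof -
  have "map_poly of_int (f + g) = map_poly of_int f + (map_poly of_int g :: complex poly)"
    by (rule poly_eqI) (simp add: coeff_map_poly)
  then show ?thesis by (simp add: ev_def)
qed

lemma ev_smult [simp]: "ev (smult a f) z = of_int a * ev f z"
  by (induction f) (auto simp: algebra_simps)

lemma ev_minus [simp]: "ev (- f) z = - ev f z"
  using ev_smult[of "- 1" f z] by simp

lemma ev_diff [simp]: "ev (f - g) z = ev f z - ev g z"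
  using ev_add[of f "- g" z] by simp

lemma ev_mult [simp]: "ev (f * g) z = ev f z * ev g z"
  by (induction f) (auto simp: algebra_simps)

lemma ev_power [simp]: "ev (f ^ k) z = ev f z ^ k"
  by (induction k) auto

lemma ev_sum [simp]: "ev (\<Sum>x\<in>A. f x) z = (\<Sum>x\<in>A. ev (f x) z)"
  by (induction A rule: infinite_finite_induct) auto

lemma ev_prod [simp]: "ev (\<Prod>x\<in>A. f x) z = (\<Prod>x\<in>A. ev (f x) z)"
  by (induction A rule: infinite_finite_induct) auto

lemma ev_pcompose [simp]: "ev (f \<circ>\<^sub>p g) z = ev f (ev g z)"
  by (induction f) (auto simp: pcompose_pCons)

lemma ev_monom [simp]: "ev (monom a k) z = of_int a * z ^ k"
proof -
  have "monom a k = smult a ([:0, 1:] ^ k)" by (simp add: monom_altdef)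
  then show ?thesis by simp
qed

lemma ev_altdef: "ev f z = (\<Sum>i\<le>degree f. of_int (coeff f i) * z ^ i)"
proof -
  have "ev f z = ev (\<Sum>i\<le>degree f. monom (coeff f i) i) z" by (simp only: poly_as_sum_of_monoms)
  then show ?thesis by simp
qed

lemma root_of_unity_power_eq:
  fixes z :: complex
  assumes "z ^ N = 1" "[i = j] (mod N)"
  shows "z ^ i = z ^ j"
proof -
  have "z ^ i = z ^ (i mod N)" for i
  proof -
    have "z ^ i = z ^ (N * (i div N) + i mod N)" by simp
    then show ?thesis by (simp only: power_add power_mult[of z N] assms power_one mult_1)
  qed
  then show ?thesis using assms(2) by (metis Cong.cong_def)
qed

lemma prime_root_of_unity_power_ne_1:
  fixes z :: complex
  assumes "prime p" "z ^ p = 1" "z \<noteq> 1" "\<not> p dvd i"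
  shows "z ^ i \<noteq> 1"
proof
  assume 1: "z ^ i = 1"
  have "coprime p i" using assms(1,4) by (rule prime_imp_coprime)
  then have "coprime i p" by (rule coprime_commute[THEN iffD1])
  then obtain k where "[i * k = 1] (mod p)" using cong_solve_coprime_nat[of i p] by auto
  then have "z ^ (i * k) = z ^ 1" by (rule root_of_unity_power_eq[OF assms(2)])
  then show False using 1 assms(3) by (simp add: power_mult)
qed

lemma sum_root_of_unity_powers:
  fixes z :: complex
  assumes "prime p" "z ^ p = 1" "z \<noteq> 1"
  shows "(\<Sum>j<p. z ^ (i * j)) = (if p dvd i then of_nat p else 0)"
proof (cases "p dvd i")
  case True
  then obtain q where "i = p * q" by blast
  then have "z ^ (i * j) = 1" for j using assms(2) by (simp add: power_mult)
  then show ?thesis using True by simp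
next
  case False
  then have "z ^ i \<noteq> 1" using prime_root_of_unity_power_ne_1[OF assms] by blast
  moreover have "(z ^ i) ^ p = 1" using assms(2) by (metis mult.commute power_mult power_one)
  ultimately show ?thesis using False by (simp add: power_mult sum_gp_strict)
qed

text \<open>The norm of \<open>f(\<zeta>)\<close> is congruent to \<open>f(1)^(p-1)\<close>; the argument below avoids conjugates by
  summing \<open>f(x) f(x^2) \<cdots> f(x^(p-1))\<close> over all \<open>p\<close>-th roots of unity.\<close>

lemma ev_root_imp_dvd_poly_1:
  fixes \<zeta> :: complex
  assumes p: "prime p" "\<zeta> ^ p = 1" "\<zeta> \<noteq> 1" and f: "ev f \<zeta> = 0"
  shows "int p dvd poly f 1"
proof -
  \<comment> \<open>At a nontrivial \<open>p\<close>-th root of unity one of the factors is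
    evaluated at \<zeta> and vanishes; at 1 every factor is \<open>poly f 1\<close>.\<close>
  define h where "h = (\<Prod>k\<in>{1..<p}. f \<circ>\<^sub>p monom 1 k)"
  have h_zero: "ev h (\<zeta> ^ j) = 0" if j: "j \<in> {1..<p}" for j
  proof -
    have "\<not> p dvd j" using j by (auto dest: dvd_imp_le)
    with p(1) have "coprime p j" by (rule prime_imp_coprime)
    then have "coprime j p" by (rule coprime_commute[THEN iffD1])
    then obtain k where k: "[j * k = 1] (mod p)" using cong_solve_coprime_nat[of j p] by auto
    then have k': "[j * (k mod p) = 1] (mod p)" by (simp add: Cong.cong_def mod_mult_right_eq)
    have "k mod p \<noteq> 0"
    proof
      assume "k mod p = 0"
      then have "[0 = 1] (mod p)" using k' by simp
      then show False using prime_gt_1_nat[OF p(1)] by (simp add: Cong.cong_def)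
    qed
    then have "k mod p \<in> {1..<p}" using prime_gt_0_nat[OF p(1)] by auto
    moreover have "ev (f \<circ>\<^sub>p monom 1 (k mod p)) (\<zeta> ^ j) = 0"
      using f root_of_unity_power_eq[OF p(2) k'] by (simp add: power_mult)
    ultimately show ?thesis unfolding h_def ev_prod by (intro prod_zero) auto
  qed
  have h1: "ev h 1 = of_int (poly f 1 ^ (p - 1))"
  proof -
    have "ev f 1 = of_int (poly f 1)" for f by (induction f) auto
    then show ?thesis by (simp add: h_def poly_prod poly_pcompose poly_monom)
  qed
  have "(\<Sum>j<p. ev h (\<zeta> ^ j)) = ev h 1 + (\<Sum>j\<in>{1..<p}. ev h (\<zeta> ^ j))"
  proof -
    have "{..<p} = insert 0 {1..<p}" using prime_gt_0_nat[OF p(1)] by auto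
    then show ?thesis by simp
  qed
  also have "\<dots> = of_int (poly f 1 ^ (p - 1))" using h_zero h1 by simp
  finally have 1: "(\<Sum>j<p. ev h (\<zeta> ^ j)) = of_int (poly f 1 ^ (p - 1))" .
  \<comment> \<open>Expanded in monomials, the same sum keeps only the exponents divisible by
    \<open>p\<close>, each with a factor \<open>p\<close>.\<close>
  have "(\<Sum>j<p. ev h (\<zeta> ^ j)) = (\<Sum>i\<le>degree h. of_int (coeff h i) * (\<Sum>j<p. \<zeta> ^ (i * j)))"
    unfolding ev_altdef sum_distrib_left
    by (subst sum.swap) (simp add: mult.commute flip: power_mult)
  also have "\<dots> = (\<Sum>i\<le>degree h. of_int (coeff h i) * (if p dvd i then of_nat p else 0))"
    by (simp only: sum_root_of_unity_powers[OF p])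
  also have "\<dots> = of_int (\<Sum>i\<le>degree h. coeff h i * (if p dvd i then int p else 0))"
    by (simp add: if_distrib cong: if_cong)
  finally have "poly f 1 ^ (p - 1) = (\<Sum>i\<le>degree h. coeff h i * (if p dvd i then int p else 0))"
    using 1 by (simp only: of_int_eq_iff)
  moreover have "int p dvd \<dots>" by (intro dvd_sum) auto
  ultimately have "int p dvd poly f 1 ^ (p - 1)" by simp
  then show ?thesis using p(1) by (metis prime_dvd_power prime_nat_int_transfer)
qed

text \<open>This is the total ramification of \<open>p\<close> at \<mu> = \<zeta> - 1. Once the
  coefficients below \<open>j\<close> are divisible by \<open>p\<close>, this \<open>p\<close> is
  traded for \<open>\<mu> ^ (p - 1)\<close>, a power higher than \<open>\<mu> ^ j\<close>. After
  cancelling \<open>\<mu> ^ j\<close> the coefficient in question has moved to the constant term,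
  which the preceding lemma controls.\<close>

lemma ev_root_imp_dvd_coeff:
  fixes \<zeta> :: complex
  assumes p: "prime p" "\<zeta> ^ p = 1" "\<zeta> \<noteq> 1"
  shows "ev f (\<zeta> - 1) = 0 \<Longrightarrow> j < p - 1 \<Longrightarrow> int p dvd coeff f j"
proof (induction j arbitrary: f rule: less_induct)
  case (less j)
  have base: "int p dvd coeff F 0" if "ev F (\<zeta> - 1) = 0" for F
  proof -
    have "ev (F \<circ>\<^sub>p [:- 1, 1:]) \<zeta> = 0" using that by (simp add: algebra_simps)
    from ev_root_imp_dvd_poly_1[OF p this] show ?thesis by (simp add: poly_pcompose poly_0_coeff_0)
  qed
  define \<mu> where "\<mu> = \<zeta> - 1"
  \<comment> \<open>This is ((1 + X)^p - 1) / X, an Eisenstein polynomial with the root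
    \<mu>.\<close>
  define K where "K = (\<Sum>i<p. [:1, 1 :: int:] ^ i)"
  have cK: "coeff K j = int (p choose Suc j)" for j
  proof -
    have "coeff ([:1, 1 :: int:] ^ i) j = int (i choose j)" for i
      by (cases "j \<le> i") (auto simp: coeff_linear_poly_power coeff_eq_0 degree_power_eq binomial_eq_0)
    then have "coeff K j = int (\<Sum>i<p. i choose j)" by (simp add: K_def coeff_sum)
    also have "(\<Sum>i<p. i choose j) = p choose Suc j"
      using sum_choose_upper[of j "p - 1"] prime_gt_0_nat[OF p(1)] by (simp add: lessThan_Suc_atMost[symmetric])
    finally show ?thesis .
  qed
  have K0: "ev K \<mu> = 0"
  proof -
    have "ev K \<mu> = (\<Sum>i<p. \<zeta> ^ i)" by (simp add: K_def \<mu>_def)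
    then show ?thesis using sum_root_of_unity_powers[OF p, of 1] prime_gt_1_nat[OF p(1)] by simp
  qed
  have "\<forall>i. int p dvd coeff (K - monom 1 (p - 1)) i"
  proof
    fix i
    consider "i < p - 1" | "i = p - 1" | "i > p - 1" by linarith
    then show "int p dvd coeff (K - monom 1 (p - 1)) i"
    proof cases
      case 1
      then have "p dvd p choose Suc i" using p(1) by (intro dvd_choose_prime) auto
      then show ?thesis using 1 by (simp add: cK int_dvd_int_iff)
    next
      case 2
      then show ?thesis using prime_gt_0_nat[OF p(1)] by (simp add: cK)
    next
      case 3
      then show ?thesis by (simp add: cK binomial_eq_0)
    qed
  qed
  then have "[:int p:] dvd K - monom 1 (p - 1)" unfolding const_poly_dvd_iff by blast
  then obtain U where U: "K - monom 1 (p - 1) = [:int p:] * U" by (rule dvdE)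
  then have U': "K = monom 1 (p - 1) + smult (int p) U" by (simp add: algebra_simps)
  have "coeff K 0 = int p" by (simp add: cK)
  then have U0: "coeff U 0 = 1"
    using prime_gt_1_nat[OF p(1)] by (simp add: U' )
  \<comment> \<open>Makes \<open>p\<close> and \<open>\<mu> ^ (p - 1)\<close> interchangeable at the
    price of the factor \<open>ev U \<mu>\<close>; as \<open>U\<close> has constant term 1,
    multiplying by it does not disturb constant terms.\<close>
  have pU: "of_nat p * ev U \<mu> = - (\<mu> ^ (p - 1))"
    using K0 unfolding U' by (simp add: eq_neg_iff_add_eq_0 add.commute)
  have "\<forall>i. int p dvd coeff (poly_cutoff j f) i"
    using less.IH[OF _ less.prems(1)] less.prems(2) by (auto simp: coeff_poly_cutoff)
  then have "[:int p:] dvd poly_cutoff j f" unfolding const_poly_dvd_iff by blast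
  then obtain B where "poly_cutoff j f = [:int p:] * B" by (rule dvdE)
  then have B: "poly_cutoff j f = smult (int p) B" by simp
  define F1 where "F1 = poly_shift j f"
  have f: "f = smult (int p) B + monom 1 j * F1"
    by (rule poly_eqI) (auto simp: B[symmetric] F1_def coeff_poly_cutoff coeff_poly_shift coeff_monom_mult)
  have "\<mu> ^ j * ev (U * F1 - monom 1 (p - 1 - j) * B) \<mu> =
      ev U \<mu> * (\<mu> ^ j * ev F1 \<mu>) - \<mu> ^ (j + (p - 1 - j)) * ev B \<mu>"
    by (simp add: algebra_simps power_add)
  also have "\<mu> ^ (j + (p - 1 - j)) = - (of_nat p * ev U \<mu>)" using less.prems(2) pU by simp
  also have "ev U \<mu> * (\<mu> ^ j * ev F1 \<mu>) - - (of_nat p * ev U \<mu>) * ev B \<mu> = ev U \<mu> * ev f \<mu>"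
    unfolding f by (simp add: algebra_simps)
  also have "\<dots> = 0" using less.prems(1) by (simp add: \<mu>_def)
  finally have "ev (U * F1 - monom 1 (p - 1 - j) * B) \<mu> = 0"
    using p(3) by (simp add: \<mu>_def)
  from base[OF this[unfolded \<mu>_def]] have "int p dvd coeff F1 0"
    using less.prems(2) U0 by (auto simp: coeff_monom_mult coeff_mult split: if_splits)
  then show ?case by (simp add: F1_def coeff_poly_shift)
qed

text \<open>X^N - 1 and the product of all X - \<omega>^d have the same leading term and share N
  distinct roots, so they coincide. Dividing by X - 1 and putting X = 1 gives the value.\<close>

lemma prod_one_minus_root_of_unity:
  fixes \<omega> :: complex
  assumes "\<omega> ^ N = 1" "N > 0" and ne: "\<And>d. 0 < d \<Longrightarrow> d < N \<Longrightarrow> \<omega> ^ d \<noteq> 1"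
  shows "(\<Prod>d\<in>{1..<N}. 1 - \<omega> ^ d) = of_nat N"
proof -
  define Q where "Q = (\<Prod>d<N. [:- (\<omega> ^ d), 1:])"
  define S where "S = (\<Sum>i<N. [:0, 1::complex:] ^ i)"
  have w0: "\<omega> \<noteq> 0" using assms(1,2) by (metis zero_neq_one zero_power)
  have inj: "inj_on (\<lambda>d. \<omega> ^ d) {..<N}"
  proof (rule linorder_inj_onI')
    fix i j assume ij: "i \<in> {..<N}" "j \<in> {..<N}" "i < j"
    show "\<omega> ^ i \<noteq> \<omega> ^ j"
    proof
      assume "\<omega> ^ i = \<omega> ^ j"
      moreover have "\<omega> ^ i * \<omega> ^ (j - i) = \<omega> ^ j" using ij by (simp flip: power_add)
      ultimately have "\<omega> ^ i * \<omega> ^ (j - i) = \<omega> ^ i * 1" by simp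
      then have "\<omega> ^ (j - i) = 1" using w0 by simp
      moreover have "0 < j - i" "j - i < N" using ij by (simp_all add: less_imp_diff_less)
      ultimately show False using ne by blast
    qed
  qed
  have Qsplit: "Q = [:- 1, 1:] * (\<Prod>d\<in>{1..<N}. [:- (\<omega> ^ d), 1:])"
  proof -
    have "{..<N} = insert 0 {1..<N}" using assms(2) by auto
    then show ?thesis by (simp add: Q_def)
  qed
  have lQ: "degree Q = N \<and> coeff Q N = 1"
  proof -
    have "degree (\<Prod>d<M. [:- (\<omega> ^ d), 1:]) = M \<and> lead_coeff (\<Prod>d<M. [:- (\<omega> ^ d), 1:]) = 1" for M
      using degree_prod_sum_eq[of "{..<M}" "\<lambda>d. [:- (\<omega> ^ d), 1:]"] lead_coeff_prod[of "\<lambda>d. [:- (\<omega> ^ d), 1:]" "{..<M}"]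
      by simp
    from this[of N] show ?thesis by (auto simp: Q_def)
  qed
  have S1: "[:- 1, 1:] * S = [:0, 1:] ^ N - 1"
  proof -
    have "([:0, 1:] - 1) * S = [:0, 1:] ^ N - 1" unfolding S_def
      using power_diff_1_eq[of "[:0, 1::complex:]" N] by simp
    moreover have "[:0, 1:] - 1 = [:- 1, 1::complex:]" by (simp add: one_pCons)
    ultimately show ?thesis by simp
  qed
  define D where "D = Q - ([:0, 1:] ^ N - 1)"
  have "D = 0"
  proof (rule ccontr)
    assume "D \<noteq> 0"
    have monN: "[:0, 1::complex:] ^ N = monom 1 N" by (simp add: monom_altdef)
    have "degree D \<le> N"
      unfolding D_def using lQ by (intro degree_diff_le) (auto simp: monN degree_monom_le)
    moreover have "coeff D N = 0" using lQ assms(2) by (simp add: D_def monN)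
    ultimately have "degree D < N" using \<open>D \<noteq> 0\<close> by (metis le_neq_implies_less leading_coeff_0_iff)
    have "(\<lambda>d. \<omega> ^ d) ` {..<N} \<subseteq> {x. poly D x = 0}"
    proof safe
      fix d assume "d < N"
      have "poly Q (\<omega> ^ d) = 0" using \<open>d < N\<close> by (auto simp: Q_def poly_prod)
      moreover have "(\<omega> ^ d) ^ N = 1" using assms(1) by (metis mult.commute power_mult power_one)
      ultimately show "poly D (\<omega> ^ d) = 0" by (simp add: D_def)
    qed
    then have "card ((\<lambda>d. \<omega> ^ d) ` {..<N}) \<le> degree D"
      using card_mono[OF poly_roots_finite[OF \<open>D \<noteq> 0\<close>]] card_poly_roots_bound[OF \<open>D \<noteq> 0\<close>] by (meson le_trans)
    then show False using \<open>degree D < N\<close> inj by (simp add: card_image)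
  qed
  then have "[:- 1, 1:] * (\<Prod>d\<in>{1..<N}. [:- (\<omega> ^ d), 1:]) = [:- 1, 1:] * S"
    using Qsplit S1 by (simp add: D_def)
  then have "(\<Prod>d\<in>{1..<N}. [:- (\<omega> ^ d), 1:]) = S"
    by (subst (asm) mult_cancel_left) simp
  then have "poly (\<Prod>d\<in>{1..<N}. [:- (\<omega> ^ d), 1:]) 1 = poly S 1" by simp
  then show ?thesis by (simp add: poly_prod poly_sum S_def)
qed

section \<open>Dirichlet characters and the determinant of the character matrix\<close>

lemma dirichlet_character_cong:
  assumes "dirichlet_character m \<chi>" "[a = b] (mod int m)"
  shows "\<chi> a = \<chi> b"
proof -
  have per: "\<chi> (a + int m * int k) = \<chi> a" for a k
  proof (induction k)
    case (Suc k)
    have "\<chi> (a + int m * int (Suc k)) = \<chi> ((a + int m * int k) + int m)" by (simp add: algebra_simps)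
    then show ?case using assms(1) Suc by (simp add: dirichlet_character_def)
  qed auto
  obtain k where k: "b = a + int m * k" using assms(2) by (metis cong_iff_lin)
  show ?thesis
  proof (cases "k \<ge> 0")
    case True then show ?thesis using per[of a "nat k"] k by simp
  next
    case False
    then show ?thesis using per[of b "nat (- k)"] k by simp
  qed
qed

text \<open>Exponent 0 has to be left out: the zeroth power is the principal character, which
  vanishes at the arguments that are not coprime to \<open>m\<close>.\<close>

lemma dirichlet_group_pow:
  assumes "dirichlet_character m \<chi>"
  shows "(\<chi> [^]\<^bsub>dirichlet_group m\<^esub> Suc k) a = \<chi> a ^ Suc k"
proof (induction k)
  case 0
  then show ?case using assms by (auto simp: dirichlet_group_def nat_pow_def dirichlet_character_def)
next
  case (Suc k)
  have "(\<chi> [^]\<^bsub>dirichlet_group m\<^esub> Suc (Suc k)) a = (\<chi> [^]\<^bsub>dirichlet_group m\<^esub> Suc k) a * \<chi> a"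
    by (simp add: dirichlet_group_def nat_pow_def)
  then show ?case using Suc by simp
qed

lemma group_dirichlet_group: "group (dirichlet_group m)"
proof (rule groupI)
  have "coprime (a + int m) (int m) \<longleftrightarrow> coprime a (int m)" for a
    by (simp add: coprime_iff_gcd_eq_1)
  then show "\<one>\<^bsub>dirichlet_group m\<^esub> \<in> carrier (dirichlet_group m)"
    by (auto simp: dirichlet_group_def dirichlet_character_def)
next
  fix \<chi> assume "\<chi> \<in> carrier (dirichlet_group m)"
  then show "\<one>\<^bsub>dirichlet_group m\<^esub> \<otimes>\<^bsub>dirichlet_group m\<^esub> \<chi> = \<chi>"
    by (auto simp: dirichlet_group_def dirichlet_character_def fun_eq_iff)
next
  fix \<chi> assume "\<chi> \<in> carrier (dirichlet_group m)"
  then have ch: "dirichlet_character m \<chi>" by (simp add: dirichlet_group_def)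
  \<comment> \<open>The pointwise inverse has the right zeros because
    \<open>inverse 0 = 0\<close>.\<close>
  have "dirichlet_character m (\<lambda>a. inverse (\<chi> a))"
    using ch by (auto simp: dirichlet_character_def)
  moreover have "(\<lambda>a. inverse (\<chi> a) * \<chi> a) = (\<lambda>a. if coprime a (int m) then 1 else 0)"
    using ch by (auto simp: dirichlet_character_def fun_eq_iff)
  ultimately show "\<exists>y\<in>carrier (dirichlet_group m). y \<otimes>\<^bsub>dirichlet_group m\<^esub> \<chi> = \<one>\<^bsub>dirichlet_group m\<^esub>"
    by (auto simp: dirichlet_group_def)
qed (auto simp: dirichlet_group_def dirichlet_character_def mult_ac)

context prime_5_mod_8 begin

lemma dirichlet_character_1: assumes "dirichlet_character p \<chi>" shows "\<chi> 1 = 1"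
proof -
  have "\<chi> 1 * \<chi> 1 = \<chi> (1 * 1)" using assms unfolding dirichlet_character_def by metis
  moreover have "\<chi> 1 \<noteq> 0" using assms by (simp add: dirichlet_character_def)
  ultimately show ?thesis by simp
qed

lemma dirichlet_character_power: assumes "dirichlet_character p \<chi>" shows "\<chi> (a ^ k) = \<chi> a ^ k"
  by (induction k) (use assms in \<open>auto simp: dirichlet_character_1 dirichlet_character_def\<close>)

lemma coprime_p_iff: "coprime a (int p) \<longleftrightarrow> \<not> int p dvd a"
  using prime_int_p by (metis coprime_commute prime_imp_coprime coprime_absorb_left not_prime_unit)

lemma coprime_g': "coprime (int g) (int p)"
  using coprime_g coprime_commute[of p g] by (simp only: coprime_int_iff)

text \<open>Discrete logarithms to the base \<open>g\<close> turn a primitive root of unity into a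
  character. It serves as a witness that values of exact order 2 n occur at
  \<open>g\<close>.\<close>

lemma ex_faithful_character:
  "\<exists>\<psi>. dirichlet_character p \<psi> \<and> \<psi> (int g) = cis (2 * pi / real (2 * n))"
proof -
  define ind where "ind = (\<lambda>a. SOME i. [int g ^ i = a] (mod int p))"
  define z where "z = cis (2 * pi / real (2 * n))"
  define \<psi> where "\<psi> = (\<lambda>a. if int p dvd a then 0 else z ^ ind a)"
  have zN: "z ^ (2 * n) = 1" using n_pos by (simp add: z_def DeMoivre)
  have z_cong: "z ^ i = z ^ j" if "[i = j] (mod (2 * n))" for i j
    by (rule root_of_unity_power_eq[OF zN that])
  have ind: "[int g ^ ind a = a] (mod int p)" if "\<not> int p dvd a" for a
    unfolding ind_def by (rule someI_ex) (use ex_log[OF that] in blast)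
  have val: "\<psi> a = z ^ i" if "[int g ^ i = a] (mod int p)" "\<not> int p dvd a" for a i
    using that ind[OF that(2)] by (auto simp: \<psi>_def intro!: z_cong simp flip: cong_g_iff) (metis cong_sym cong_trans)
  have dvd_cong: "int p dvd a \<longleftrightarrow> int p dvd b" if "[a = b] (mod int p)" for a b
    using that by (rule cong_dvd_iff)
  have "dirichlet_character p \<psi>" unfolding dirichlet_character_def
  proof (intro conjI allI)
    fix a show "\<psi> (a + int p) = \<psi> a"
    proof (cases "int p dvd a")
      case False
      have "[int g ^ ind a = a + int p] (mod int p)" using ind[OF False] by (simp add: Cong.cong_def)
      then show ?thesis using val[of "ind a" "a + int p"] val[OF ind[OF False] False] False by simp
    qed (auto simp: \<psi>_def)
  next
    fix a b show "\<psi> (a * b) = \<psi> a * \<psi> b"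
    proof (cases "int p dvd a \<or> int p dvd b")
      case False
      then have "\<not> int p dvd a * b" using prime_int_p by (simp add: prime_dvd_mult_iff)
      moreover have "[int g ^ (ind a + ind b) = a * b] (mod int p)"
        using False ind[of a] ind[of b] by (simp add: power_add cong_mult)
      ultimately show ?thesis using val[of "ind a + ind b" "a * b"] False by (simp add: \<psi>_def power_add)
    qed (auto simp: \<psi>_def)
  next
    fix a show "\<psi> a \<noteq> 0 \<longleftrightarrow> coprime a (int p)" by (simp add: \<psi>_def coprime_p_iff z_def)
  qed
  moreover have "\<psi> (int g) = z"
  proof -
    have "\<not> int p dvd int g" using coprime_g' coprime_p_iff[of "int g"] by simp
    then show ?thesis using val[of 1 "int g"] by simp
  qed
  ultimately show ?thesis unfolding z_def by blast
qed

lemma generator_value_order: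
  assumes "group_generator (dirichlet_group p) \<chi>" "\<chi> (int g) ^ d = 1"
  shows "2 * n dvd d"
proof -
  interpret G: group "dirichlet_group p" by (rule group_dirichlet_group)
  obtain \<psi> where \<psi>: "dirichlet_character p \<psi>" "\<psi> (int g) = cis (2 * pi / real (2 * n))"
    using ex_faithful_character by blast
  have \<chi>: "\<chi> \<in> carrier (dirichlet_group p)" using assms by (simp add: group_generator_def)
  have "\<psi> \<in> generate (dirichlet_group p) {\<chi>}"
    using assms(1) \<psi>(1) by (simp add: group_generator_def dirichlet_group_def)
  then have "\<psi> (int g) ^ d = 1"
  proof (induction rule: generate.induct)
    case one
    then show ?case using coprime_g' by (auto simp: dirichlet_group_def)
  next
    case (incl h) then show ?case using assms by simp
  next
    case (inv h)
    then have "inv\<^bsub>dirichlet_group p\<^esub> \<chi> \<otimes>\<^bsub>dirichlet_group p\<^esub> \<chi> = \<one>\<^bsub>dirichlet_group p\<^esub>" using \<chi> G.l_inv by blast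
    then have "(inv\<^bsub>dirichlet_group p\<^esub> \<chi>) (int g) * \<chi> (int g) = 1"
      using coprime_g' by (auto simp: dirichlet_group_def fun_eq_iff)
    then have "((inv\<^bsub>dirichlet_group p\<^esub> \<chi>) (int g) * \<chi> (int g)) ^ d = 1" by simp
    then show ?case using assms(2) inv by (simp add: power_mult_distrib)
  next
    case (eng h1 h2)
    then show ?case by (simp add: dirichlet_group_def power_mult_distrib)
  qed
  then have "cis (2 * pi * real d / real (2 * n)) = 1" using \<psi>(2) by (simp add: DeMoivre mult_ac)
  then obtain k :: int where "2 * pi * real d / real (2 * n) = 2 * pi * of_int k"
    by (auto simp: complex_eq_iff cos_one_2pi_int mult_ac)
  then have "real d = of_int k * real (2 * n)" using n_pos by (simp add: field_simps)
  then have "of_int (int d) = (of_int (k * int (2 * n)) :: real)" by simp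
  then have "int d = k * int (2 * n)" by (simp only: of_int_eq_iff)
  then show ?thesis by (metis dvd_triv_right int_dvd_int_iff)
qed

text \<open>Multiplied by j + 1, the inner product becomes (2 j + 1)!. Under j -> n - 1 - j these
  odd factorials pair up to (2 j + 1)! (p - 1 - (2 j + 1))!, which is 1 modulo \<open>p\<close>. So
  n! times the product is 1, and (n!)^2 = -1 finishes.\<close>

lemma cong_prod_sq_diff:
  "[(\<Prod>j<n. \<Prod>i<j. (int (j + 1))\<^sup>2 - (int (i + 1))\<^sup>2) = - fact n] (mod int p)"
proof -
  have rising: "fact a * (\<Prod>i<k. int (a + 1 + i)) = fact (a + k)" for a k
  proof (induction k)
    case (Suc k)
    have "fact a * (\<Prod>i<Suc k. int (a + 1 + i)) = fact a * (\<Prod>i<k. int (a + 1 + i)) * int (a + 1 + k)"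
      by (simp only: prod.lessThan_Suc mult.assoc)
    also have "\<dots> = fact (a + Suc k)" unfolding Suc by (simp add: algebra_simps)
    finally show ?case .
  qed auto
  have falling: "(\<Prod>i<k. int (k - i)) = fact k" for k
    using fact_prod_rev[of k, where 'a = int] by (simp add: atLeast0LessThan of_nat_prod)
  have inner: "int (j + 1) * (\<Prod>i<j. (int (j + 1))\<^sup>2 - (int (i + 1))\<^sup>2) = fact (2 * j + 1)" for j
  proof -
    have "(\<Prod>i<j. (int (j + 1))\<^sup>2 - (int (i + 1))\<^sup>2) = (\<Prod>i<j. int (j - i) * int (j + 1 + 1 + i))"
      by (intro prod.cong refl) (auto simp: of_nat_diff power2_eq_square algebra_simps)
    then have "int (j + 1) * (\<Prod>i<j. (int (j + 1))\<^sup>2 - (int (i + 1))\<^sup>2) = fact (j + 1) * (\<Prod>i<j. int (j + 1 + 1 + i))"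
      by (simp only: prod.distrib falling) simp
    also have "\<dots> = fact (j + 1 + j)" by (rule rising)
    also have "j + 1 + j = 2 * j + 1" by simp
    finally show ?thesis .
  qed
  have "fact n * (\<Prod>j<n. \<Prod>i<j. (int (j + 1))\<^sup>2 - (int (i + 1))\<^sup>2) = (\<Prod>j<n. fact (2 * j + 1))"
  proof -
    have "fact k = (\<Prod>j<k. int (j + 1))" for k by (induction k) (auto simp: algebra_simps)
    then have "fact n * (\<Prod>j<n. \<Prod>i<j. (int (j + 1))\<^sup>2 - (int (i + 1))\<^sup>2) =
        (\<Prod>j<n. int (j + 1) * (\<Prod>i<j. (int (j + 1))\<^sup>2 - (int (i + 1))\<^sup>2))"
      by (simp only: prod.distrib)
    then show ?thesis by (simp only: inner)
  qed
  moreover have "[(\<Prod>j<n. fact (2 * j + 1)) = 1] (mod int p)"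
  proof -
    have split: "{..<n} = {..<2*r+1} \<union> {2*r+1..<n}" by (auto simp: n_def)
    have "(\<Prod>j<n. fact (2 * j + 1) :: int) = (\<Prod>j<2*r+1. fact (2 * j + 1)) * (\<Prod>j\<in>{2*r+1..<n}. fact (2 * j + 1))"
      unfolding split by (rule prod.union_disjoint) auto
    also have "(\<Prod>j\<in>{2*r+1..<n}. F (2 * j + 1)) = (\<Prod>j<2*r+1. F (p - 1 - (2 * j + 1)))" for F :: "nat \<Rightarrow> int"
      by (rule prod.reindex_bij_witness[of _ "\<lambda>j. n - 1 - j" "\<lambda>j. n - 1 - j"])
        (auto simp: n_def p_eq intro!: arg_cong[where f = F])
    finally have "(\<Prod>j<n. fact (2 * j + 1) :: int) = (\<Prod>j<2*r+1. fact (2 * j + 1) * fact (p - 1 - (2 * j + 1)))"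
      by (simp only: prod.distrib)
    also have "[\<dots> = (\<Prod>j<2*r+1. (- 1) ^ Suc (2 * j + 1))] (mod int p)"
      by (intro cong_prod cong_fact_mult_fact) (auto simp: p_eq)
    finally show ?thesis by simp
  qed
  ultimately have "[fact n * (\<Prod>j<n. \<Prod>i<j. (int (j + 1))\<^sup>2 - (int (i + 1))\<^sup>2) = 1] (mod int p)" by simp
  from cong_scalar_left[OF this, of "fact n"]
  have 1: "[(fact n)\<^sup>2 * (\<Prod>j<n. \<Prod>i<j. (int (j + 1))\<^sup>2 - (int (i + 1))\<^sup>2) = fact n] (mod int p)"
    by (simp add: power2_eq_square mult.assoc)
  have 2: "[(fact n)\<^sup>2 * (\<Prod>j<n. \<Prod>i<j. (int (j + 1))\<^sup>2 - (int (i + 1))\<^sup>2) = - 1 * (\<Prod>j<n. \<Prod>i<j. (int (j + 1))\<^sup>2 - (int (i + 1))\<^sup>2)] (mod int p)"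
    by (rule cong_scalar_right[OF cong_fact_n_sq])
  show ?thesis using cong_minus_minus_iff[THEN iffD2, OF cong_trans[OF cong_sym[OF 2] 1]] by simp
qed

text \<open>Squares are even powers of \<open>g\<close>, and half the exponent matters only modulo
  \<open>n\<close>. Distinct i, j below \<open>n\<close> have distinct squares, as (i + 1) + (j + 1)
  lies strictly between 0 and \<open>p\<close>.\<close>

lemma ex_half_log:
  "\<exists>\<sigma>. bij_betw \<sigma> {..<n} {..<n} \<and> (\<forall>j<n. [int g ^ (2 * \<sigma> j) = (int (j + 1))\<^sup>2] (mod int p))"
proof -
  have "\<exists>k<n. [int g ^ (2 * k) = (int (j + 1))\<^sup>2] (mod int p)" if "j < n" for j
  proof -
    have "\<not> int p dvd int (j + 1)" using that p_n by (intro not_dvd_less) auto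
    then obtain i where i: "[int g ^ i = int (j + 1)] (mod int p)" using ex_log by blast
    have "[2 * (i mod n) = 2 * i] (mod (2 * n))" unfolding Cong.cong_def mult_mod_right[symmetric] by simp
    then have 1: "[int g ^ (2 * (i mod n)) = int g ^ (2 * i)] (mod int p)" by (simp only: cong_g_iff)
    have 2: "[int g ^ (2 * i) = (int (j + 1))\<^sup>2] (mod int p)"
      using cong_pow[OF i, of 2] by (simp only: power_mult[symmetric] mult.commute[of i 2])
    show ?thesis using n_pos by (intro exI[of _ "i mod n"] conjI cong_trans[OF 1 2]) simp
  qed
  then obtain \<sigma> where \<sigma>: "\<And>j. j < n \<Longrightarrow> \<sigma> j < n" "\<And>j. j < n \<Longrightarrow> [int g ^ (2 * \<sigma> j) = (int (j + 1))\<^sup>2] (mod int p)"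
    by metis
  have "inj_on \<sigma> {..<n}"
  proof (rule inj_onI)
    fix i j assume ij: "i \<in> {..<n}" "j \<in> {..<n}" "\<sigma> i = \<sigma> j"
    then have "[(int (i + 1))\<^sup>2 = (int (j + 1))\<^sup>2] (mod int p)"
      using \<sigma>(2)[of i] \<sigma>(2)[of j] by (auto intro: cong_trans cong_sym)
    then have "int p dvd (int (i + 1) - int (j + 1)) * (int (i + 1) + int (j + 1))"
      by (simp add: cong_iff_dvd_diff power2_eq_square algebra_simps)
    then have "int p dvd int (i + 1) - int (j + 1) \<or> int p dvd int (i + 1) + int (j + 1)"
      using prime_int_p prime_dvd_multD by blast
    moreover have "\<not> int p dvd int (i + 1) + int (j + 1)"
      using not_dvd_less[of "i + 1 + (j + 1)"] ij p_n by simp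
    ultimately have "int p dvd \<bar>int i - int j\<bar>" by simp
    then have "\<bar>int i - int j\<bar> \<noteq> 0 \<Longrightarrow> int p \<le> \<bar>int i - int j\<bar>"
      using zdvd_imp_le[of "int p" "\<bar>int i - int j\<bar>"] by linarith
    moreover have "\<bar>int i - int j\<bar> < int p" using ij p_n(1) by auto
    ultimately show "i = j" by linarith
  qed
  moreover have "\<sigma> ` {..<n} \<subseteq> {..<n}" using \<sigma> by auto
  ultimately have "bij_betw \<sigma> {..<n} {..<n}" using endo_inj_surj[of "{..<n}" \<sigma>] by (auto simp: bij_betw_def)
  then show ?thesis using \<sigma> by blast
qed

text \<open>The evaluation of the Vandermonde product is used twice: with the base \<open>g\<close>
  modulo \<open>p\<close>, and with the base \<open>\<chi> (int g)\<close> modulo 0. Both orderings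
  of the nodes are given by the same \<sigma>, hence the common sign \<open>s\<close>.\<close>

lemma det_char_matrix:
  assumes "group_generator (dirichlet_group p) \<chi>"
  shows "\<exists>s::int. (s = 1 \<or> s = - 1) \<and>
    det (char_matrix p \<chi>) = of_int (s * (- 1) ^ r * int n ^ (2 * r + 1)) \<and>
    [fact n = s * (- 1) ^ r * int n ^ (2 * r + 1)] (mod int p)"
proof -
  obtain \<sigma> where bij: "bij_betw \<sigma> {..<n} {..<n}"
    and \<sigma>: "\<And>j. j < n \<Longrightarrow> [int g ^ (2 * \<sigma> j) = (int (j + 1))\<^sup>2] (mod int p)"
    using ex_half_log by blast
  have ch: "dirichlet_character p \<chi>" using assms by (simp add: group_generator_def dirichlet_group_def)
  define s :: int where "s = (\<Prod>j<n. \<Prod>i<j. if \<sigma> i < \<sigma> j then 1 else - 1)"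
  have pm: "(\<Prod>x\<in>A. f x) = 1 \<or> (\<Prod>x\<in>A. f x) = - 1" if "\<And>x. x \<in> A \<Longrightarrow> f x = 1 \<or> f x = - 1"
    for A :: "nat set" and f :: "nat \<Rightarrow> int"
    using that
  proof (induction A rule: infinite_finite_induct)
    case (insert x F)
    then have "(\<Prod>x\<in>F. f x) = 1 \<or> (\<Prod>x\<in>F. f x) = - 1" "f x = 1 \<or> f x = - 1" by blast+
    then show ?case using insert(1,2) by auto
  qed auto
  have s: "s = 1 \<or> s = - 1" unfolding s_def by (intro pm) auto
  have gn: "[int g ^ n = - 1] (mod int p)"
  proof -
    have "[int g ^ n * int g ^ n = 1] (mod int p)"
      using cong_g_iff[of "2 * n" 0] by (simp add: Cong.cong_def mult_2 power_add)
    then have "int p dvd (int g ^ n - 1) * (int g ^ n + 1)"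
      by (simp add: cong_iff_dvd_diff algebra_simps)
    then have "int p dvd int g ^ n - 1 \<or> int p dvd int g ^ n + 1" using prime_int_p prime_dvd_multD by blast
    moreover have "\<not> int p dvd int g ^ n - 1"
      using cong_g_iff[of n 0] n_pos by (auto simp: cong_iff_dvd_diff Cong.cong_def)
    ultimately show ?thesis by (simp add: cong_iff_dvd_diff)
  qed
  \<comment> \<open>The square of 1 is the zeroth power, so \<sigma> also permutes the nonzero
    indices, over which the product in \<open>Hint\<close> runs.\<close>
  have s0: "\<sigma> 0 = 0"
  proof -
    have "\<sigma> 0 < n" using bij n_pos by (auto simp: bij_betw_def)
    moreover have "[2 * \<sigma> 0 = 0] (mod (2 * n))" using \<sigma>[of 0] n_pos cong_g_iff[of "2 * \<sigma> 0" 0] by simp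
    ultimately show ?thesis by (simp add: Cong.cong_def)
  qed
  have bij': "bij_betw \<sigma> {1..<n} {1..<n}"
  proof -
    have "bij_betw \<sigma> ({..<n} - {0}) ({..<n} - {\<sigma> 0})"
      using bij n_pos by (intro bij_betw_DiffI) (auto simp: bij_betw_def)
    moreover have "{..<n} - {0} = {1..<n}" by auto
    ultimately show ?thesis using s0 by simp
  qed
  have Hint: "[(\<Prod>d\<in>{1..<n}. 1 - int g ^ (2 * d)) = int n] (mod int p)"
  proof -
    define P where "P = (\<Prod>j\<in>{1..<n}. 1 - (int (j + 1))\<^sup>2)"
    have "(\<Prod>d\<in>{1..<n}. 1 - int g ^ (2 * d)) = (\<Prod>j\<in>{1..<n}. 1 - int g ^ (2 * \<sigma> j))"
      by (rule prod.reindex_bij_betw[OF bij', symmetric])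
    also have "[\<dots> = P] (mod int p)"
      unfolding P_def by (intro cong_prod cong_diff cong_refl \<sigma>) auto
    finally have 1: "[(\<Prod>d\<in>{1..<n}. 1 - int g ^ (2 * d)) = P] (mod int p)" .
    \<comment> \<open>1 - (j + 1)^2 = - j (j + 2) multiplies up to two factorials; the factors j + 2
      start at 3, so a 2 is missing.\<close>
    have "2 * (\<Prod>j\<in>{1..<Suc k}. 1 - (int (j + 1))\<^sup>2) = (- 1) ^ k * fact k * fact (k + 2)" for k
    proof (induction k)
      case (Suc k)
      have "2 * (\<Prod>j\<in>{1..<Suc (Suc k)}. 1 - (int (j + 1))\<^sup>2) =
          2 * (\<Prod>j\<in>{1..<Suc k}. 1 - (int (j + 1))\<^sup>2) * (1 - (int (Suc k + 1))\<^sup>2)" by simp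
      also have "1 - (int (Suc k + 1))\<^sup>2 = - (int k + 1) * (int k + 3)"
        by (simp add: power2_eq_square algebra_simps)
      finally have "2 * (\<Prod>j\<in>{1..<Suc (Suc k)}. 1 - (int (j + 1))\<^sup>2) =
          (- 1) ^ k * fact k * fact (k + 2) * (- (int k + 1) * (int k + 3))" unfolding Suc .
      moreover have "fact (Suc k + 2) = (int k + 3) * fact (k + 2)"
        using fact_Suc[of "k + 2", where 'a = int] by (simp del: fact_Suc)
      moreover have "fact (Suc k) = (int k + 1) * fact k" by simp
      ultimately show ?case by (simp only: power_Suc) (simp only: mult_ac mult_minus_left mult_minus_right mult_1)
    qed auto
    from this[of "n - 1"] have P: "2 * P = - (fact (n - 1) * fact (n + 1))"
      using n_pos even_n by (simp add: P_def)
    have "int n * fact (n - 1) = fact n" using n_pos by (simp add: fact_reduce)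
    then have "int n * (2 * P) = - (fact n * fact (n + 1))" unfolding P by (simp add: algebra_simps)
    then have 2: "2 * int n * P = - ((fact n)\<^sup>2 * (int n + 1))"
      by (simp add: power2_eq_square algebra_simps)
    have e: "2 * int n = int p - 1" using p_n(1) by simp
    \<comment> \<open>Instead of dividing by 2 n, it is written as p - 1, which is -1 modulo
      \<open>p\<close>.\<close>
    have "P = int p * P + (fact n)\<^sup>2 * (int n + 1)" using 2[unfolded e] by (simp add: algebra_simps)
    also have "[\<dots> = 0 + (- 1) * (int n + 1)] (mod int p)"
      by (intro cong_add cong_scalar_right cong_fact_n_sq) (auto simp: cong_0_iff)
    also have "[0 + (- 1) * (int n + 1) = int n] (mod int p)"
    proof -
      have "0 + (- 1) * (int n + 1) - int n = - int p" using p_n(1) by simp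
      then show ?thesis by (simp only: cong_iff_dvd_diff dvd_minus_iff dvd_refl)
    qed
    finally show ?thesis using 1 cong_trans by blast
  qed
  have "[- fact n = (\<Prod>j<n. \<Prod>i<j. (int (j + 1))\<^sup>2 - (int (i + 1))\<^sup>2)] (mod int p)"
    by (rule cong_sym[OF cong_prod_sq_diff])
  also have "[(\<Prod>j<n. \<Prod>i<j. (int (j + 1))\<^sup>2 - (int (i + 1))\<^sup>2) =
      (\<Prod>j<n. \<Prod>i<j. int g ^ (2 * \<sigma> j) - int g ^ (2 * \<sigma> i))] (mod int p)"
    by (intro cong_prod cong_diff cong_sym[OF \<sigma>]) auto
  also have "(\<Prod>j<n. \<Prod>i<j. int g ^ (2 * \<sigma> j) - int g ^ (2 * \<sigma> i)) =
      s * (\<Prod>j<n. \<Prod>i<j. int g ^ (2 * j) - int g ^ (2 * i))"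
    unfolding s_def using prod_diff_bij[OF bij, of "\<lambda>k. int g ^ (2 * k)"] by simp
  also have "[s * (\<Prod>j<n. \<Prod>i<j. int g ^ (2 * j) - int g ^ (2 * i)) =
      s * (- ((- 1) ^ r) * int n ^ (2 * r + 1))] (mod int p)"
    using cong_vandermonde_roots_of_unity[OF n_def gn Hint] by (intro cong_scalar_left) simp
  also have "s * (- ((- 1) ^ r) * int n ^ (2 * r + 1)) = - (s * (- 1) ^ r * int n ^ (2 * r + 1))" by simp
  finally have "[fact n = s * (- 1) ^ r * int n ^ (2 * r + 1)] (mod int p)"
    by (rule cong_minus_minus_iff[THEN iffD1])
  moreover have "det (char_matrix p \<chi>) = of_int (s * (- 1) ^ r * int n ^ (2 * r + 1))"
  proof -
    define \<theta> where "\<theta> = \<chi> (int g)"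
    have x: "\<chi> ((int (j + 1))\<^sup>2) = \<theta> ^ (2 * \<sigma> j)" if "j < n" for j
      using dirichlet_character_cong[OF ch \<sigma>[OF that]] by (simp add: dirichlet_character_power[OF ch] \<theta>_def)
    have t2n: "\<theta> ^ (2 * n) = 1"
    proof -
      have "[int g ^ (2 * n) = 1] (mod int p)" using cong_g_iff[of "2 * n" 0] by (simp add: Cong.cong_def)
      then show ?thesis using dirichlet_character_cong[OF ch] dirichlet_character_1[OF ch]
        by (metis \<theta>_def dirichlet_character_power[OF ch])
    qed
    have tn: "\<theta> ^ n = - 1"
    proof -
      have "\<theta> ^ n * \<theta> ^ n = 1" using t2n by (simp only: mult_2 power_add)
      then have "(\<theta> ^ n - 1) * (\<theta> ^ n + 1) = 0" by (simp add: algebra_simps)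
      moreover have "\<theta> ^ n \<noteq> 1"
      proof
        assume "\<theta> ^ n = 1"
        then have "2 * n dvd n" using generator_value_order[OF assms, of n] by (simp add: \<theta>_def)
        then show False using n_pos by (auto dest: dvd_imp_le)
      qed
      ultimately show ?thesis by (simp add: eq_neg_iff_add_eq_0)
    qed
    have H: "(\<Prod>d\<in>{1..<n}. 1 - \<theta> ^ (2 * d)) = of_nat n"
    proof -
      have "(\<Prod>d\<in>{1..<n}. 1 - (\<theta>\<^sup>2) ^ d) = of_nat n"
      proof (rule prod_one_minus_root_of_unity)
        show "(\<theta>\<^sup>2) ^ n = 1" using t2n by (simp add: power_mult)
        fix d assume d: "0 < d" "d < n"
        show "(\<theta>\<^sup>2) ^ d \<noteq> 1"
        proof
          assume "(\<theta>\<^sup>2) ^ d = 1"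
          then have "2 * n dvd 2 * d"
            using generator_value_order[OF assms, of "2 * d"] by (simp add: \<theta>_def power_mult)
          then show False using d by (auto dest: dvd_imp_le)
        qed
      qed (rule n_pos)
      then show ?thesis by (simp only: power_mult)
    qed
    \<comment> \<open>Congruence modulo 0 is equality.\<close>
    have "[(\<Prod>l<n. \<Prod>k<l. \<theta> ^ (2 * l) - \<theta> ^ (2 * k)) = - ((- 1) ^ r) * of_nat n ^ (2 * r + 1)] (mod 0)"
      by (rule cong_vandermonde_roots_of_unity[OF n_def]) (use tn H in simp_all)
    then have W: "(\<Prod>l<n. \<Prod>k<l. \<theta> ^ (2 * l) - \<theta> ^ (2 * k)) = - ((- 1) ^ r) * of_nat n ^ (2 * r + 1)"
      by simp
    have "char_matrix p \<chi> = mat n n (\<lambda>(k, j). \<chi> ((int (j + 1))\<^sup>2) ^ Suc k)"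
      using dirichlet_group_pow[OF ch] by (auto simp: char_matrix_def p_n Let_def intro!: cong_mat)
    also have "\<dots> = mat n n (\<lambda>(k, j). (\<theta> ^ (2 * \<sigma> j)) ^ Suc k)"
      by (intro cong_mat) (auto simp: x[simplified])
    finally have "det (char_matrix p \<chi>) = (\<Prod>j<n. \<theta> ^ (2 * \<sigma> j) * (\<Prod>i<j. \<theta> ^ (2 * \<sigma> j) - \<theta> ^ (2 * \<sigma> i)))"
      by (simp only: det_vandermonde_Suc)
    also have "\<dots> = (\<Prod>j<n. \<theta> ^ (2 * \<sigma> j)) * (\<Prod>j<n. \<Prod>i<j. \<theta> ^ (2 * \<sigma> j) - \<theta> ^ (2 * \<sigma> i))"
      by (rule prod.distrib)
    also have "(\<Prod>j<n. \<theta> ^ (2 * \<sigma> j)) = (\<Prod>j<n. \<theta> ^ (2 * j))"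
      by (rule prod.reindex_bij_betw[OF bij])
    also have "\<dots> = \<theta> ^ (\<Sum>j<n. 2 * j)" by (rule power_sum[symmetric])
    also have "(\<Sum>j<k. 2 * j) = k * (k - 1)" for k :: nat
    proof (induction k)
      case (Suc k) then show ?case by (cases k) auto
    qed auto
    \<comment> \<open>The sign from the extra factors \<open>x j\<close> cancels the minus sign in
      \<open>W\<close>.\<close>
    also have "\<theta> ^ (n * (n - 1)) = - 1" using n_pos even_n by (simp add: power_mult tn)
    also have "(\<Prod>j<n. \<Prod>i<j. \<theta> ^ (2 * \<sigma> j) - \<theta> ^ (2 * \<sigma> i)) =
        of_int s * (\<Prod>j<n. \<Prod>i<j. \<theta> ^ (2 * j) - \<theta> ^ (2 * i))"
      unfolding s_def by (rule prod_diff_bij[OF bij])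
    finally show ?thesis by (simp add: W)
  qed
  ultimately show ?thesis using s by blast
qed

end

section \<open>Gauss sums\<close>

text \<open>Every factor is X times a polynomial, so X^(card A) splits off and the constant terms of
  the cofactors multiply. This yields the lowest coefficient of \<open>Dp\<close> expanded at
  1.\<close>

lemma coeff_prod_zero_at_0:
  assumes "finite A" "\<And>x. x \<in> A \<Longrightarrow> coeff (f x) 0 = (0 :: int)"
  shows "coeff (\<Prod>x\<in>A. f x) (card A) = (\<Prod>x\<in>A. coeff (f x) 1)"
proof -
  define E where "E = (\<lambda>x. poly_shift 1 (f x))"
  have fE: "f x = pCons 0 (E x)" if "x \<in> A" for x
    using assms(2)[OF that] by (intro poly_eqI) (auto simp: E_def coeff_poly_shift coeff_pCons split: nat.splits)
  have "(\<Prod>x\<in>A. f x) = (\<Prod>x\<in>A. monom 1 1 * E x)"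
    using fE by (intro prod.cong refl) (auto simp: monom_Suc)
  also have "\<dots> = monom 1 (card A) * (\<Prod>x\<in>A. E x)"
    by (simp only: prod.distrib prod_constant monom_power mult_1 power_one)
  finally have "coeff (\<Prod>x\<in>A. f x) (card A) = coeff (\<Prod>x\<in>A. E x) 0"
    by (simp add: coeff_monom_mult)
  also have "\<dots> = (\<Prod>x\<in>A. coeff (E x) 0)" by (simp add: poly_prod flip: poly_0_coeff_0)
  finally show ?thesis by (simp add: E_def coeff_poly_shift)
qed

lemma fact_mult_binomial: "fact k * int (a choose k) = (\<Prod>i<k. int a - int i)"
proof -
  have "(of_int (fact k * int (a choose k)) :: rat) = fact k * (of_nat a gchoose k)"
    by (simp add: binomial_gbinomial)
  also have "\<dots> = of_int (\<Prod>i<k. int a - int i)"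
    by (simp add: gbinomial_mult_fact atLeast0LessThan)
  finally show ?thesis by (simp only: of_int_eq_iff)
qed

text \<open>The exponents add up to (2 r + 1) (4 r + 3), which is odd.\<close>

lemma prod_minus_1_power: "(\<Prod>k\<in>{1..4*r+2}. (- 1) ^ k) = (- 1 :: 'a :: comm_ring_1)"
proof (induction r)
  case 0
  have "{1..4*0+2} = {1, 2::nat}" by auto
  then show ?case by simp
next
  case (Suc r)
  have "{1..4 * Suc r + 2} = {1..4*r+2} \<union> {4*r+3, 4*r+4, 4*r+5, 4*r+6}" by auto
  then have "(\<Prod>k\<in>{1..4 * Suc r + 2}. (- 1) ^ k) =
      (\<Prod>k\<in>{1..4*r+2}. (- 1) ^ k) * (\<Prod>k\<in>{4*r+3, 4*r+4, 4*r+5, 4*r+6}. (- 1 :: 'a) ^ k)"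
    by (simp only:) (rule prod.union_disjoint, auto)
  then show ?case unfolding Suc by (simp add: power_add)
qed

context prime_5_mod_8 begin

text \<open>As \<open>p\<close> is odd, the minus sign makes this a \<open>p\<close>-th root of
  unity, while its square is still exp (2 pi i / p). So the half-angle sines sin (pi k / p) come
  from powers of a \<open>p\<close>-th root of unity, without 2 p-th roots.\<close>

definition \<xi> :: complex where "\<xi> = - cis (pi / real p)"

lemma p_pos: "real p > 0" using p_gt2 by simp

lemma xi_power: "\<xi> ^ k = (- 1) ^ k * cis (pi * real k / real p)"
  by (simp add: \<xi>_def power_minus[of "cis _"] DeMoivre mult_ac)

lemma xi_p: "\<xi> ^ p = 1"
  using p_pos odd_p by (simp add: xi_power)

lemma pi_div_p: "0 < pi / real p" "pi / real p < pi"
  using p_gt2 by (auto simp: field_simps)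

lemma sin_pos: assumes "0 < k" "k < p" shows "sin (pi * real k / real p) > 0"
proof (rule sin_gt_zero)
  show "0 < pi * real k / real p" using assms p_pos by simp
  have "pi * real k < pi * real p" using assms by simp
  then show "pi * real k / real p < pi" using p_pos by (simp add: divide_less_eq)
qed

lemma xi_ne_1: "\<xi> \<noteq> 1"
proof
  assume "\<xi> = 1"
  then have "Im \<xi> = 0" by simp
  then show False using sin_gt_zero[OF pi_div_p] by (simp add: \<xi>_def)
qed

lemma xi_power_diff:
  assumes "k \<le> p"
  shows "\<xi> ^ k - \<xi> ^ (p - k) = (- 1) ^ k * (2 * \<i> * of_real (sin (pi * real k / real p)))"
proof -
  have "pi * real (p - k) / real p = pi - pi * real k / real p"
    using assms p_pos by (simp add: of_nat_diff field_simps)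
  then have c: "cis (pi * real (p - k) / real p) = - cis (- (pi * real k / real p))"
    by (simp add: complex_eq_iff cos_diff sin_diff)
  have "(- 1 :: complex) ^ (p - k) = - ((- 1) ^ k)"
    using assms odd_p by (cases "even k") auto
  then have "\<xi> ^ k - \<xi> ^ (p - k) =
      (- 1) ^ k * (cis (pi * real k / real p) - cis (- (pi * real k / real p)))"
    unfolding xi_power c by (simp add: algebra_simps)
  also have "cis (pi * real k / real p) - cis (- (pi * real k / real p)) =
      2 * \<i> * of_real (sin (pi * real k / real p))"
    by (simp add: complex_eq_iff)
  finally show ?thesis .
qed

lemma xi_sq: "\<xi>\<^sup>2 = cis (2 * pi / real p)"
  by (simp add: \<xi>_def DeMoivre power2_minus)

text \<open>The absolute value of 1 - exp (2 i t) is 2 |sin t|, so the product of the 1 - \<xi>^(2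
  d), which is \<open>p\<close>, becomes a product of sines; the factors for d and p - d
  agree.\<close>

lemma prod_sin_sq: "(\<Prod>k\<in>{1..n}. 2 * sin (pi * real k / real p))\<^sup>2 = real p"
proof -
  have "(\<Prod>d\<in>{1..<p}. 1 - (\<xi>\<^sup>2) ^ d) = of_nat p"
  proof (rule prod_one_minus_root_of_unity)
    show "(\<xi>\<^sup>2) ^ p = 1" using xi_p by (simp only: power_mult[symmetric] mult.commute[of 2 p]) (simp only: power_mult power_one)
    fix d assume d: "0 < d" "d < p"
    have "\<not> p dvd 2 * d"
    proof
      assume "p dvd 2 * d"
      then have "p dvd 2 \<or> p dvd d" using prime_p by (simp add: prime_dvd_mult_iff)
      then show False using d p_gt2 by (auto dest: dvd_imp_le)
    qed
    then show "(\<xi>\<^sup>2) ^ d \<noteq> 1"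
      using prime_root_of_unity_power_ne_1[OF prime_p xi_p xi_ne_1] by (simp only: power_mult[symmetric])
  qed (use p_gt2 in simp)
  then have "norm (\<Prod>d\<in>{1..<p}. 1 - (\<xi>\<^sup>2) ^ d) = real p" by simp
  moreover have "norm (\<Prod>d\<in>{1..<p}. 1 - (\<xi>\<^sup>2) ^ d) = (\<Prod>d\<in>{1..<p}. 2 * sin (pi * real d / real p))"
    unfolding prod_norm[symmetric]
  proof (intro prod.cong refl)
    fix d assume "d \<in> {1..<p}"
    then have s: "sin (pi * real d / real p) > 0" by (intro sin_pos) auto
    define t where "t = pi * real d / real p"
    have "(\<xi>\<^sup>2) ^ d = cis (2 * t)" by (simp add: xi_sq DeMoivre t_def mult_ac)
    moreover have "1 - cis (2 * t) = - (2 * \<i> * of_real (sin t)) * cis t"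
      by (simp add: complex_eq_iff cos_double_sin sin_double power2_eq_square)
    ultimately have "norm (1 - (\<xi>\<^sup>2) ^ d) = 2 * \<bar>sin t\<bar>" by (simp add: norm_mult)
    then show "norm (1 - (\<xi>\<^sup>2) ^ d) = 2 * sin (pi * real d / real p)" using s by (simp add: t_def)
  qed
  moreover have "(\<Prod>d\<in>{1..<p}. 2 * sin (pi * real d / real p)) =
      (\<Prod>d\<in>{1..n}. 2 * sin (pi * real d / real p)) * (\<Prod>d\<in>{n+1..<p}. 2 * sin (pi * real d / real p))"
  proof -
    have "{1..<p} = {1..n} \<union> {n+1..<p}" using p_n(1) by auto
    then show ?thesis by (simp only:) (rule prod.union_disjoint, auto)
  qed
  moreover have "(\<Prod>d\<in>{n+1..<p}. 2 * sin (pi * real d / real p)) = (\<Prod>d\<in>{1..n}. 2 * sin (pi * real d / real p))"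
  proof (rule prod.reindex_bij_witness[of _ "\<lambda>d. p - d" "\<lambda>d. p - d"])
    fix d assume "d \<in> {n+1..<p}"
    then have "pi * real (p - d) / real p = pi - pi * real d / real p"
      using p_pos by (simp add: of_nat_diff field_simps)
    then show "2 * sin (pi * real (p - d) / real p) = 2 * sin (pi * real d / real p)" by simp
  qed (use p_n(1) in auto)
  ultimately show ?thesis by (simp add: power2_eq_square)
qed

lemma prod_sin: "(\<Prod>k\<in>{1..n}. 2 * sin (pi * real k / real p)) = sqrt (real p)"
proof (rule real_sqrt_unique[symmetric, OF prod_sin_sq])
  show "0 \<le> (\<Prod>k\<in>{1..n}. 2 * sin (pi * real k / real p))"
  proof (intro prod_nonneg ballI)
    fix k assume "k \<in> {1..n}"
    then have "0 < k" "k < p" using p_n(1) by auto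
    from sin_pos[OF this] show "0 \<le> 2 * sin (pi * real k / real p)" by simp
  qed
qed

text \<open>A polynomial representing sqrt p; the exponent \<open>p - k\<close> stands for -k. Each
  of its factors vanishes at 1, so sqrt p disappears under reduction modulo 1 - \<xi>.\<close>

definition Dp :: "int poly" where "Dp = (\<Prod>k\<in>{1..n}. monom 1 k - monom 1 (p - k))"

text \<open>The signs (-1)^k multiply to -1, and so do the factors \<i>, as \<open>n\<close> is 2
  modulo 4. What remains is the positive product of sines.\<close>

lemma ev_Dp: "ev Dp \<xi> = of_real (sqrt (real p))"
proof -
  have "ev Dp \<xi> = (\<Prod>k\<in>{1..n}. \<xi> ^ k - \<xi> ^ (p - k))" by (simp add: Dp_def)
  also have "\<dots> = (\<Prod>k\<in>{1..n}. (- 1) ^ k * (\<i> * of_real (2 * sin (pi * real k / real p))))"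
  proof (intro prod.cong refl)
    fix k assume "k \<in> {1..n}"
    then have "k \<le> p" using p_n(1) by simp
    then show "\<xi> ^ k - \<xi> ^ (p - k) = (- 1) ^ k * (\<i> * of_real (2 * sin (pi * real k / real p)))"
      by (simp add: xi_power_diff)
  qed
  also have "\<dots> = (\<Prod>k\<in>{1..n}. (- 1) ^ k) * (\<i> ^ n * of_real (\<Prod>k\<in>{1..n}. 2 * sin (pi * real k / real p)))"
  proof -
    have "(\<Prod>k\<in>A. x k * (\<i> * of_real (q k))) = (\<Prod>k\<in>A. x k) * (\<i> ^ card A * of_real (\<Prod>k\<in>A. q k))"
      for A :: "nat set" and x q by (simp add: prod.distrib)
    from this[of "\<lambda>k. (- 1) ^ k" "\<lambda>k. 2 * sin (pi * real k / real p)" "{1..n}"]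
    show ?thesis by (simp only: card_atLeastAtMost diff_Suc_1)
  qed
  also have "(\<Prod>k\<in>{1..n}. (- 1 :: complex) ^ k) = - 1" unfolding n_def by (rule prod_minus_1_power)
  also have "\<i> ^ n = - 1" by (simp add: n_def power_add power_mult)
  finally show ?thesis by (simp only: prod_sin) simp
qed

lemma poly_Dp_1: "poly Dp 1 = 0"
  using n_pos by (auto simp: Dp_def poly_prod poly_monom)

lemma bij_mult_mod:
  assumes "\<not> p dvd t"
  shows "bij_betw (\<lambda>a. a * t mod p) {1..<p} {1..<p}"
proof -
  have cop: "coprime p t" using prime_p assms by (rule prime_imp_coprime)
  have "inj_on (\<lambda>a. a * t mod p) {1..<p}"
  proof (rule inj_onI)
    fix a b assume ab: "a \<in> {1..<p}" "b \<in> {1..<p}" "a * t mod p = b * t mod p"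
    then have "[a * t = b * t] (mod p)" by (simp only: Cong.cong_def)
    then have "[a = b] (mod p)" using cong_mult_rcancel_nat[of t p a b] cop
      by (simp only: coprime_commute[of t p])
    then show "a = b" using ab by (simp add: Cong.cong_def)
  qed
  moreover have "(\<lambda>a. a * t mod p) ` {1..<p} \<subseteq> {1..<p}"
  proof safe
    fix a assume a: "a \<in> {1..<p}"
    have "\<not> p dvd a" using a by (auto dest: dvd_imp_le)
    then have "\<not> p dvd a * t" using assms prime_p by (simp add: prime_dvd_mult_iff)
    then show "a * t mod p \<in> {1..<p}" using p_gt2 by (auto simp: dvd_eq_mod_eq_0)
  qed
  ultimately show ?thesis using endo_inj_surj[of "{1..<p}"] by (simp add: bij_betw_def)
qed

lemma cong_int_mod: "[int (k mod p) = int k] (mod int p)"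
  by (simp add: Cong.cong_def zmod_int)

definition gauss :: "complex \<Rightarrow> complex" where
  "gauss z = (\<Sum>a\<in>{1..<p}. of_int (c (int a)) * z ^ a)"

lemma gauss_mult:
  assumes "z ^ p = 1" "\<not> p dvd t"
  shows "(\<Sum>a\<in>{1..<p}. of_int (c (int a)) * z ^ (a * t)) = of_int (c (int t)) * gauss z"
proof -
  have ct: "c (int t) * c (int t) = 1"
    using c_cases[of "int t"] c_eq_0_iff[of "int t"] assms(2) by (auto simp: int_dvd_int_iff)
  have "gauss z = (\<Sum>a\<in>{1..<p}. of_int (c (int (a * t mod p))) * z ^ (a * t mod p))"
    unfolding gauss_def by (rule sum.reindex_bij_betw[OF bij_mult_mod[OF assms(2)], symmetric])
  also have "\<dots> = (\<Sum>a\<in>{1..<p}. of_int (c (int t)) * (of_int (c (int a)) * z ^ (a * t)))"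
  proof (intro sum.cong refl)
    fix a
    have "c (int (a * t mod p)) = c (int a * int t)" using c_cong[OF cong_int_mod[of "a * t"]] by simp
    moreover have "z ^ (a * t mod p) = z ^ (a * t)"
      by (rule root_of_unity_power_eq[OF assms(1)]) (simp add: Cong.cong_def)
    ultimately show "of_int (c (int (a * t mod p))) * z ^ (a * t mod p) =
        of_int (c (int t)) * (of_int (c (int a)) * z ^ (a * t))" by (simp add: c_mult)
  qed
  also have "\<dots> = of_int (c (int t)) * (\<Sum>a\<in>{1..<p}. of_int (c (int a)) * z ^ (a * t))"
    by (rule sum_distrib_left[symmetric])
  finally have "of_int (c (int t)) * gauss z =
      of_int (c (int t) * c (int t)) * (\<Sum>a\<in>{1..<p}. of_int (c (int a)) * z ^ (a * t))" by simp
  then show ?thesis by (simp only: ct) simp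
qed

text \<open>With z = 1 and the nonresidue t = 2, \<open>gauss_mult\<close> says that the sum is its
  own negative.\<close>

lemma sum_c: "(\<Sum>a\<in>{1..<p}. c (int a)) = 0"
proof -
  have "\<not> p dvd 2" using p_gt2 by (auto dest: dvd_imp_le)
  from gauss_mult[of 1 2, OF _ this]
  have "(of_int (\<Sum>a\<in>{1..<p}. c (int a)) :: complex) = - of_int (\<Sum>a\<in>{1..<p}. c (int a))"
    by (simp add: gauss_def c_2)
  then have "(of_int (\<Sum>a\<in>{1..<p}. c (int a)) :: complex) = of_int (- (\<Sum>a\<in>{1..<p}. c (int a)))"
    by (simp only: of_int_minus)
  then have "(\<Sum>a\<in>{1..<p}. c (int a)) = - (\<Sum>a\<in>{1..<p}. c (int a))" by (simp only: of_int_eq_iff)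
  then show ?thesis by linarith
qed

lemma gauss_mult':
  assumes "z ^ p = 1"
  shows "(\<Sum>a\<in>{1..<p}. of_int (c (int a)) * z ^ (a * t)) = of_int (c (int t)) * gauss z"
proof (cases "p dvd t")
  case True
  then obtain q where "t = p * q" by (rule dvdE)
  then have "z ^ (a * t) = 1" for a
    using assms by (simp only: mult.left_commute[of a p q]) (simp add: power_mult)
  moreover have "c (int t) = 0" using True by (simp add: c_eq_0_iff int_dvd_int_iff)
  moreover have "(\<Sum>a\<in>{1..<p}. of_int (c (int a)) :: complex) = of_int (\<Sum>a\<in>{1..<p}. c (int a))" by simp
  ultimately show ?thesis by (simp only: sum_c) simp
qed (rule gauss_mult[OF assms])

lemma c_sq: assumes "0 < a" "a < p" shows "c (int a) * c (int a) = 1"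
  using c_cases[of "int a"] c_eq_0_iff[of "int a"] not_dvd_less[OF assms] by auto

lemma sum_rotate3:
  "(\<Sum>t\<in>T. \<Sum>a\<in>A. \<Sum>b\<in>B. f t a b) = (\<Sum>a\<in>A. \<Sum>b\<in>B. \<Sum>t\<in>T. f t a b)"
proof -
  have "(\<Sum>t\<in>T. \<Sum>a\<in>A. \<Sum>b\<in>B. f t a b) = (\<Sum>a\<in>A. \<Sum>t\<in>T. \<Sum>b\<in>B. f t a b)" by (rule sum.swap)
  also have "\<dots> = (\<Sum>a\<in>A. \<Sum>b\<in>B. \<Sum>t\<in>T. f t a b)" by (intro sum.cong refl sum.swap)
  finally show ?thesis .
qed

text \<open>The squares of the sums with z^t in place of z are added up over all t modulo
  \<open>p\<close>. Each of them is \<open>(gauss z)\<^sup>2\<close> unless t = 0, when it is 0;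
  expanded, orthogonality leaves only the p - 1 diagonal terms.\<close>

lemma gauss_sq:
  assumes z: "z ^ p = 1" "z \<noteq> 1"
  shows "(gauss z)\<^sup>2 = of_nat p"
proof -
  \<comment> \<open>One of the two factors gets exponents p - b in place of b, which is harmless
    because \<open>c\<close> is even; then the exponent vanishes on the diagonal modulo
    \<open>p\<close>.\<close>
  have reflect: "(\<Sum>b\<in>{1..<p}. of_int (c (int b)) * z ^ ((p - b) * t)) = of_int (c (int t)) * gauss z" for t
  proof -
    have "(\<Sum>b\<in>{1..<p}. of_int (c (int b)) * z ^ ((p - b) * t)) = (\<Sum>b\<in>{1..<p}. of_int (c (int b)) * z ^ (b * t))"
    proof (rule sum.reindex_bij_witness[of _ "\<lambda>b. p - b" "\<lambda>b. p - b"])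
      fix b assume b: "b \<in> {1..<p}"
      have "c (int (p - b)) = c (- int b)" using b by (intro c_cong) (simp add: cong_iff_dvd_diff of_nat_diff)
      then show "of_int (c (int (p - b))) * z ^ ((p - b) * t) = of_int (c (int b)) * z ^ ((p - b) * t)"
        by (simp add: c_minus)
    qed auto
    then show ?thesis using gauss_mult'[OF z(1)] by simp
  qed
  have "(\<Sum>t<p. (of_int (c (int t)) * gauss z) * (of_int (c (int t)) * gauss z)) =
      (\<Sum>t<p. (\<Sum>a\<in>{1..<p}. of_int (c (int a)) * z ^ (a * t)) * (\<Sum>b\<in>{1..<p}. of_int (c (int b)) * z ^ ((p - b) * t)))"
    by (simp only: reflect gauss_mult'[OF z(1)])
  also have "\<dots> = (\<Sum>t<p. \<Sum>a\<in>{1..<p}. \<Sum>b\<in>{1..<p}. of_int (c (int a) * c (int b)) * z ^ ((a + (p - b)) * t))"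
    unfolding sum_product by (intro sum.cong refl) (simp only: power_add distrib_right of_int_mult, simp only: mult_ac)
  also have "\<dots> = (\<Sum>a\<in>{1..<p}. \<Sum>b\<in>{1..<p}. \<Sum>t<p. of_int (c (int a) * c (int b)) * z ^ ((a + (p - b)) * t))"
    by (rule sum_rotate3)
  also have "\<dots> = (\<Sum>a\<in>{1..<p}. \<Sum>b\<in>{1..<p}. if a = (b :: nat) then of_nat p else 0)"
  proof (intro sum.cong refl)
    fix a b assume ab: "a \<in> {1..<p}" "b \<in> {1..<p}"
    have "p dvd a + (p - b) \<longleftrightarrow> a = b"
    proof
      assume "p dvd a + (p - b)"
      then obtain q where q: "a + (p - b) = p * q" by (rule dvdE)
      have "p * q < p * 2" "0 < p * q" using ab unfolding q[symmetric] by auto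
      then have "q = 1" by (cases q) auto
      then show "a = b" using q ab by auto
    qed (use ab in auto)
    moreover have "(\<Sum>t<p. of_int (c (int a) * c (int b)) * z ^ ((a + (p - b)) * t)) =
        of_int (c (int a) * c (int b)) * (\<Sum>t<p. z ^ ((a + (p - b)) * t))"
      by (rule sum_distrib_left[symmetric])
    moreover have "c (int a) * c (int a) = 1" using ab by (intro c_sq) auto
    ultimately show "(\<Sum>t<p. of_int (c (int a) * c (int b)) * z ^ ((a + (p - b)) * t)) = (if a = b then of_nat p else 0)"
      by (auto simp: sum_root_of_unity_powers[OF prime_p z] simp del: of_int_mult)
  qed
  also have "\<dots> = of_nat (p - 1) * of_nat p" by simp
  finally have 1: "(\<Sum>t<p. (of_int (c (int t)) * gauss z) * (of_int (c (int t)) * gauss z)) = of_nat (p - 1) * of_nat p" .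
  have "(\<Sum>t<p. (of_int (c (int t)) * gauss z) * (of_int (c (int t)) * gauss z)) =
      (\<Sum>t\<in>{1..<p}. (of_int (c (int t)) * gauss z) * (of_int (c (int t)) * gauss z))"
    by (rule sum.mono_neutral_right) (auto simp: c_eq_0_iff not_less_eq_eq)
  also have "\<dots> = (\<Sum>t\<in>{1::nat..<p}. (gauss z)\<^sup>2)"
  proof (intro sum.cong refl)
    fix t assume "t \<in> {1..<p}"
    then have ct: "c (int t) * c (int t) = 1" by (intro c_sq) auto
    have "(of_int (c (int t)) * gauss z) * (of_int (c (int t)) * gauss z) = of_int (c (int t) * c (int t)) * (gauss z)\<^sup>2"
      by (simp add: power2_eq_square)
    then show "(of_int (c (int t)) * gauss z) * (of_int (c (int t)) * gauss z) = (gauss z)\<^sup>2"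
      by (simp only: ct) simp
  qed
  finally have "(\<Sum>t\<in>{1::nat..<p}. (gauss z)\<^sup>2) = of_nat (p - 1) * of_nat p" by (simp only: 1)
  then have 2: "of_nat (p - 1) * (gauss z)\<^sup>2 = of_nat (p - 1) * of_nat p"
    by (simp only: sum_constant card_atLeastLessThan)
  have "(of_nat (p - 1) :: complex) \<noteq> 0" using p_gt2 by (simp del: of_nat_diff)
  from mult_left_cancel[OF this] 2 show ?thesis by blast
qed

text \<open>Replacing a by a g multiplies the sum by g^k, which is not 1 modulo
  \<open>p\<close>.\<close>

lemma cong_power_sum:
  assumes "\<not> 2 * n dvd k"
  shows "[(\<Sum>a\<in>{1..<p}. int a ^ k) = 0] (mod int p)"
proof -
  define S where "S = (\<Sum>a\<in>{1..<p}. int a ^ k)"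
  have "\<not> p dvd g"
  proof
    assume "p dvd g"
    then have "p dvd gcd p g" by simp
    then show False using coprime_g p_gt2 by simp
  qed
  then have "S = (\<Sum>a\<in>{1..<p}. int (a * g mod p) ^ k)"
    unfolding S_def by (intro sum.reindex_bij_betw[OF bij_mult_mod, symmetric])
  also have "[\<dots> = (\<Sum>a\<in>{1..<p}. int (a * g) ^ k)] (mod int p)"
    by (intro cong_sum cong_pow cong_int_mod)
  also have "(\<Sum>a\<in>{1..<p}. int (a * g) ^ k) = int g ^ k * S"
    by (simp add: S_def sum_distrib_left power_mult_distrib mult.commute)
  finally have "int p dvd (1 - int g ^ k) * S" by (simp add: cong_iff_dvd_diff algebra_simps)
  then have "int p dvd 1 - int g ^ k \<or> int p dvd S" using prime_dvd_multD[OF prime_int_p] by simp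
  moreover have "\<not> int p dvd 1 - int g ^ k"
    using cong_g_iff[of 0 k] assms by (auto simp: cong_iff_dvd_diff Cong.cong_def mod_eq_0_iff_dvd)
  ultimately show ?thesis by (simp add: S_def cong_0_iff)
qed

text \<open>The sum is the coefficient of degree \<open>n\<close> of the Gauss sum expanded in
  powers of \<xi> - 1. Now \<open>fact n\<close> times the binomial coefficient is a monic
  polynomial of degree \<open>n\<close> in a, and \<open>c\<close> acts as a^n. Of the resulting
  power sums only the one with exponent 2 n survives, and it is p - 1.\<close>

lemma cong_coeff_gauss: "[fact n * (\<Sum>a\<in>{1..<p}. c (int a) * int (a choose n)) = - 1] (mod int p)"
proof -
  define f where "f = (\<Prod>i<n. [:- int i, 1:])"
  have f: "degree f = n \<and> coeff f n = 1"
  proof -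
    have "degree (\<Prod>i<M. [:- int i, 1:]) = M \<and> lead_coeff (\<Prod>i<M. [:- int i, 1:]) = 1" for M
      using degree_prod_sum_eq[of "{..<M}" "\<lambda>d. [:- int d, 1:]"] lead_coeff_prod[of "\<lambda>d. [:- int d, 1:]" "{..<M}"]
      by simp
    from this[of n] show ?thesis by (auto simp: f_def)
  qed
  have fa: "fact n * int (a choose n) = (\<Sum>k\<le>n. coeff f k * int a ^ k)" for a
  proof -
    have "fact n * int (a choose n) = poly f (int a)"
      by (simp add: fact_mult_binomial f_def poly_prod)
    then show ?thesis using f by (simp add: poly_altdef)
  qed
  have "fact n * (\<Sum>a\<in>{1..<p}. c (int a) * int (a choose n)) =
      (\<Sum>a\<in>{1..<p}. c (int a) * (\<Sum>k\<le>n. coeff f k * int a ^ k))"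
    unfolding fa[symmetric] by (simp only: sum_distrib_left mult.left_commute)
  also have "[\<dots> = (\<Sum>a\<in>{1..<p}. int a ^ n * (\<Sum>k\<le>n. coeff f k * int a ^ k))] (mod int p)"
    by (intro cong_sum cong_scalar_right cong_euler)
  also have "(\<Sum>a\<in>{1..<p}. int a ^ n * (\<Sum>k\<le>n. coeff f k * int a ^ k)) =
      (\<Sum>k\<le>n. coeff f k * (\<Sum>a\<in>{1..<p}. int a ^ (n + k)))"
    unfolding sum_distrib_left by (subst sum.swap) (simp add: power_add mult_ac)
  also have "\<dots> = (\<Sum>k<n. coeff f k * (\<Sum>a\<in>{1..<p}. int a ^ (n + k))) + (\<Sum>a\<in>{1..<p}. int a ^ (2 * n))"
    using f by (simp add: lessThan_Suc_atMost[symmetric] mult_2)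
  also have "[\<dots> = (\<Sum>k<n. coeff f k * 0) + (\<Sum>a\<in>{1..<p}. 1)] (mod int p)"
  proof (intro cong_add cong_sum cong_scalar_left)
    fix k assume "k \<in> {..<n}"
    then have "\<not> 2 * n dvd n + k" by (auto dest: dvd_imp_le simp: n_pos)
    then show "[(\<Sum>a\<in>{1..<p}. int a ^ (n + k)) = 0] (mod int p)" by (rule cong_power_sum)
  next
    fix a assume a: "a \<in> {1..<p}"
    have "[int a ^ (2 * n) = (c (int a))\<^sup>2] (mod int p)"
      using cong_pow[OF cong_sym[OF cong_euler[of "int a"]], of 2]
      by (simp only: power_mult[symmetric] mult.commute[of n 2])
    then show "[int a ^ (2 * n) = 1] (mod int p)" using c_sq[of a] a by (simp add: power2_eq_square)
  qed
  also have "(\<Sum>k<n. coeff f k * 0) + (\<Sum>a\<in>{1..<p}. 1) = int p - 1" using p_gt2 by (simp add: of_nat_diff)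
  also have "[int p - 1 = - 1] (mod int p)" by (simp add: cong_iff_dvd_diff)
  finally show ?thesis .
qed

text \<open>The sign of the Gauss sum: both sides are polynomials in \<open>\<xi> - 1\<close>, whose coefficients of
  degree \<open>n\<close> are compared modulo \<open>p\<close>.\<close>

lemma gauss_xi: "gauss \<xi> = - of_real (sqrt (real p))"
proof (rule ccontr)
  assume neg: "gauss \<xi> \<noteq> - of_real (sqrt (real p))"
  have "(gauss \<xi>)\<^sup>2 = (of_real (sqrt (real p)))\<^sup>2"
    unfolding gauss_sq[OF xi_p xi_ne_1] by (simp flip: of_real_power)
  with neg have G: "gauss \<xi> = ev Dp \<xi>" by (simp add: power2_eq_iff ev_Dp)
  define Gp where "Gp = (\<Sum>a\<in>{1..<p}. monom (c (int a)) a)"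
  define f where "f = (Gp - Dp) \<circ>\<^sub>p [:1, 1:]"
  have "ev f (\<xi> - 1) = 0" using G by (simp add: f_def Gp_def gauss_def)
  then have dvd: "int p dvd coeff f n"
    by (rule ev_root_imp_dvd_coeff[OF prime_p xi_p xi_ne_1]) (use p_n(1) n_pos in simp)
  have lin: "coeff ([:1, 1 :: int:] ^ i) j = int (i choose j)" for i j
    by (cases "j \<le> i") (auto simp: coeff_linear_poly_power coeff_eq_0 degree_power_eq binomial_eq_0)
  have mon: "monom a k \<circ>\<^sub>p q = smult a (q ^ k)" for a :: int and k q
  proof -
    have pow: "(h ^ k) \<circ>\<^sub>p q = (h \<circ>\<^sub>p q) ^ k" for h :: "int poly"
      by (induction k) (auto simp: pcompose_mult pcompose_1)
    have "monom a k \<circ>\<^sub>p q = smult a (([:0, 1:] \<circ>\<^sub>p q) ^ k)"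
      unfolding monom_altdef pcompose_smult pow ..
    then show ?thesis by (simp add: pcompose_pCons)
  qed
  have cG: "coeff (Gp \<circ>\<^sub>p [:1, 1:]) n = (\<Sum>a\<in>{1..<p}. c (int a) * int (a choose n))"
    by (simp add: Gp_def pcompose_sum mon coeff_sum lin)
  have cD: "coeff (Dp \<circ>\<^sub>p [:1, 1:]) n = (\<Prod>k\<in>{1..n}. int k - int (p - k))"
  proof -
    have "Dp \<circ>\<^sub>p [:1, 1:] = (\<Prod>k\<in>{1..n}. [:1, 1:] ^ k - [:1, 1:] ^ (p - k))"
      by (simp add: Dp_def pcompose_prod pcompose_diff mon)
    moreover have "coeff (\<Prod>k\<in>{1..n}. [:1, 1 :: int:] ^ k - [:1, 1:] ^ (p - k)) (card {1..n}) =
       (\<Prod>k\<in>{1..n}. coeff ([:1, 1:] ^ k - [:1, 1:] ^ (p - k)) 1)"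
      by (rule coeff_prod_zero_at_0) (auto simp: lin)
    ultimately show ?thesis by (simp add: lin)
  qed
  \<comment> \<open>The Gauss sum contributes -1. \<open>Dp\<close> contributes 2^n (n!)^2, where
    both factors are -1. Had the Gauss sum the wrong sign, the difference -2 would have to be
    divisible by \<open>p\<close>.\<close>
  have "fact n * coeff f n = fact n * (\<Sum>a\<in>{1..<p}. c (int a) * int (a choose n)) - fact n * (\<Prod>k\<in>{1..n}. int k - int (p - k))"
    by (simp add: f_def pcompose_diff cG cD right_diff_distrib)
  also have "[\<dots> = - 1 - fact n * (\<Prod>k\<in>{1..n}. 2 * int k)] (mod int p)"
  proof (intro cong_diff cong_coeff_gauss cong_scalar_left cong_prod)
    fix k assume "k \<in> {1..n}"
    then have "int k - int (p - k) = 2 * int k - int p" using p_n(1) by (simp add: of_nat_diff)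
    then show "[int k - int (p - k) = 2 * int k] (mod int p)" by (simp add: cong_iff_dvd_diff)
  qed
  also have "fact n * (\<Prod>k\<in>{1..n}. 2 * int k) = 2 ^ n * (fact n)\<^sup>2"
    by (simp add: prod.distrib fact_prod of_nat_prod power2_eq_square)
  also have "[- 1 - 2 ^ n * (fact n)\<^sup>2 = - 1 - (- 1) * (- 1)] (mod int p)"
    using cong_euler[of 2] by (intro cong_diff cong_mult cong_refl cong_fact_n_sq) (simp add: c_2 cong_sym)
  finally have "[fact n * coeff f n = - 2] (mod int p)" by simp
  moreover have "[fact n * coeff f n = 0] (mod int p)" using dvd by (simp add: cong_0_iff)
  ultimately have "[- 2 = 0] (mod int p)" using cong_trans cong_sym by blast
  then have "(- 2 :: int) = 0" by (rule cong_small_imp_eq) auto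
  then show False by simp
qed

text \<open>The standard root of unity is \<open>\<xi>\<^sup>2\<close>, and passing from \<xi> to
  its square multiplies the Gauss sum by c 2 = -1, which makes it positive.\<close>

lemma sum_c_cis:
  "(\<Sum>a\<in>{1..<p}. of_int (c (int a)) * cis (2 * pi * real a / real p) ^ t) = of_int (c (int t)) * of_real (sqrt (real p))"
proof -
  have "cis (2 * pi * real a / real p) ^ t = \<xi> ^ (a * (2 * t))" for a
  proof -
    have "\<xi> ^ (a * (2 * t)) = (\<xi>\<^sup>2) ^ (a * t)" by (simp only: power_mult[symmetric] mult_ac)
    then show ?thesis by (simp add: xi_sq DeMoivre mult_ac)
  qed
  then have "(\<Sum>a\<in>{1..<p}. of_int (c (int a)) * cis (2 * pi * real a / real p) ^ t) = of_int (c (int (2 * t))) * gauss \<xi>"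
    using gauss_mult'[OF xi_p, of "2 * t"] by simp
  also have "c (int (2 * t)) = - c (int t)" using c_mult[of 2 "int t"] by (simp add: c_2)
  finally show ?thesis by (simp add: gauss_xi)
qed

end

section \<open>The value of the L-series at 1\<close>

text \<open>Summation by parts. It is applied both to a power series up to its boundary point and to
  the tail of a sum of integer quotients.\<close>

lemma abel_summation_bound:
  fixes b w :: "nat \<Rightarrow> real"
  assumes B: "\<And>N. M \<le> N \<Longrightarrow> \<bar>\<Sum>k\<in>{M..<N}. b k\<bar> \<le> B"
    and w: "\<And>i j. M \<le> i \<Longrightarrow> i \<le> j \<Longrightarrow> w j \<le> w i" "\<And>i. M \<le> i \<Longrightarrow> 0 \<le> w i"
  shows "\<bar>\<Sum>k\<in>{M..<N}. b k * w k\<bar> \<le> B * w M"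
proof (cases "M < N")
  case False
  then show ?thesis using B[of M] w(2)[of M] by simp
next
  case True
  define s where "s = (\<lambda>N. \<Sum>k\<in>{M..<N}. b k)"
  have eq: "(\<Sum>k\<in>{M..<M + Suc m}. b k * w k) = s (M + Suc m) * w (M + m) + (\<Sum>k<m. s (M + Suc k) * (w (M + k) - w (M + Suc k)))" for m
  proof (induction m)
    case (Suc m)
    have "s (M + Suc (Suc m)) = s (M + Suc m) + b (M + Suc m)" by (simp add: s_def)
    then show ?case using Suc by (simp add: algebra_simps)
  qed (simp add: s_def)
  obtain m where m: "N = M + Suc m" using True less_imp_Suc_add by auto
  have "\<bar>\<Sum>k\<in>{M..<N}. b k * w k\<bar> \<le> \<bar>s (M + Suc m) * w (M + m)\<bar> + (\<Sum>k<m. \<bar>s (M + Suc k) * (w (M + k) - w (M + Suc k))\<bar>)"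
    unfolding m eq by (rule order_trans[OF abs_triangle_ineq add_left_mono[OF sum_abs]])
  also have "\<dots> \<le> B * w (M + m) + (\<Sum>k<m. B * (w (M + k) - w (M + Suc k)))"
  proof (intro add_mono sum_mono)
    show "\<bar>s (M + Suc m) * w (M + m)\<bar> \<le> B * w (M + m)"
      unfolding abs_mult using B[of "M + Suc m"] w(2)[of "M + m"] by (simp add: s_def mult_right_mono)
    fix k
    show "\<bar>s (M + Suc k) * (w (M + k) - w (M + Suc k))\<bar> \<le> B * (w (M + k) - w (M + Suc k))"
      unfolding abs_mult using B[of "M + Suc k"] w(1)[of "M + k" "M + Suc k"] by (simp add: s_def mult_right_mono)
  qed
  also have "(\<Sum>k<m. B * (w (M + k) - w (M + Suc k))) = B * (w M - w (M + m))"
    by (induction m) (auto simp: algebra_simps)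
  finally show ?thesis by (simp add: algebra_simps)
qed

text \<open>Abel's limit theorem. Bounded partial sums of \<open>b\<close> bound the tail after M
  terms by B / (M + 1) uniformly for x in [0, 1], so continuity at 1 follows from that of the
  partial sums.\<close>

lemma abel_limit_bounded:
  fixes b :: "nat \<Rightarrow> real"
  assumes B: "\<And>M N. \<bar>\<Sum>k\<in>{M..<N}. b k\<bar> \<le> B"
  defines "F \<equiv> (\<lambda>x. \<Sum>k. b k / real (Suc k) * x ^ Suc k)"
  shows "summable (\<lambda>k. b k / real (Suc k))" and "(F \<longlongrightarrow> (\<Sum>k. b k / real (Suc k))) (at_left 1)"
proof -
  have B0: "B \<ge> 0" using B[of 0 0] by simp
  have bound: "\<bar>\<Sum>k\<in>{M..<N}. b k / real (Suc k) * x ^ Suc k\<bar> \<le> B / real (Suc M)" if x: "0 \<le> x" "x \<le> 1" for x M N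
  proof -
    have "\<bar>\<Sum>k\<in>{M..<N}. b k * (x ^ Suc k / real (Suc k))\<bar> \<le> B * (x ^ Suc M / real (Suc M))"
    proof (rule abel_summation_bound[OF B])
      fix i j :: nat assume "i \<le> j"
      then show "x ^ Suc j / real (Suc j) \<le> x ^ Suc i / real (Suc i)"
        using x by (intro frac_le power_decreasing) auto
    qed (use x in auto)
    also have "\<dots> \<le> B * (1 / real (Suc M))"
      using x B0 by (intro mult_left_mono divide_right_mono power_le_one) auto
    finally show ?thesis by simp
  qed
  have summ: "summable (\<lambda>k. b k / real (Suc k) * x ^ Suc k)" if x: "0 \<le> x" "x \<le> 1" for x
    unfolding summable_Cauchy
  proof (intro allI impI)
    fix e :: real assume "e > 0"
    obtain M where M: "B / e < real M" using reals_Archimedean2 by blast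
    show "\<exists>N. \<forall>m\<ge>N. \<forall>n. norm (\<Sum>k\<in>{m..<n}. b k / real (Suc k) * x ^ Suc k) < e"
    proof (intro exI[of _ M] allI impI)
      fix m n assume "m \<ge> M"
      then have "B / e < real (Suc m)" using M by simp
      then have "B / real (Suc m) < e" using \<open>e > 0\<close> by (simp add: field_simps)
      then show "norm (\<Sum>k\<in>{m..<n}. b k / real (Suc k) * x ^ Suc k) < e"
        using bound[OF x, of m n] by simp
    qed
  qed
  from summ[of 1] show "summable (\<lambda>k. b k / real (Suc k))" by simp
  have tail: "\<bar>F x - (\<Sum>k<M. b k / real (Suc k) * x ^ Suc k)\<bar> \<le> B / real (Suc M)" if x: "0 \<le> x" "x \<le> 1" for x M
  proof -
    have lim: "(\<lambda>N. \<bar>(\<Sum>k<N. b k / real (Suc k) * x ^ Suc k) - (\<Sum>k<M. b k / real (Suc k) * x ^ Suc k)\<bar>)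
        \<longlonglongrightarrow> \<bar>F x - (\<Sum>k<M. b k / real (Suc k) * x ^ Suc k)\<bar>"
      unfolding F_def by (intro tendsto_intros summable_LIMSEQ summ x)
    show ?thesis
    proof (rule LIMSEQ_le_const2[OF lim], intro exI[of _ M] allI impI)
      fix N assume "M \<le> N"
      then have "(\<Sum>k<N. b k / real (Suc k) * x ^ Suc k) - (\<Sum>k<M. b k / real (Suc k) * x ^ Suc k) =
          (\<Sum>k\<in>{M..<N}. b k / real (Suc k) * x ^ Suc k)"
        by (simp only: lessThan_atLeast0) (subst sum.atLeastLessThan_concat[of 0 M N, symmetric], auto)
      then show "\<bar>(\<Sum>k<N. b k / real (Suc k) * x ^ Suc k) - (\<Sum>k<M. b k / real (Suc k) * x ^ Suc k)\<bar> \<le> B / real (Suc M)"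
        using bound[OF x] by (simp only:)
    qed
  qed
  have F1: "F 1 = (\<Sum>k. b k / real (Suc k))" by (simp add: F_def)
  show "(F \<longlongrightarrow> (\<Sum>k. b k / real (Suc k))) (at_left 1)"
  proof (rule tendstoI)
    fix e :: real assume e: "e > 0"
    obtain M where M: "4 * B / e < real M" using reals_Archimedean2 by blast
    then have "4 * B / e < real (Suc M)" by simp
    then have BM: "B / real (Suc M) < e / 4" using e by (simp add: field_simps)
    define P where "P = (\<lambda>x. \<Sum>k<M. b k / real (Suc k) * x ^ Suc k)"
    have "(P \<longlongrightarrow> P 1) (at_left 1)" unfolding P_def by (intro tendsto_intros)
    then have "\<forall>\<^sub>F x in at_left 1. dist (P x) (P 1) < e / 2" using e by (intro tendstoD) auto
    moreover have "\<forall>\<^sub>F x in at_left (1::real). x \<in> {0<..<1}" by (rule eventually_at_left_real) simp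
    ultimately show "\<forall>\<^sub>F x in at_left 1. dist (F x) (\<Sum>k. b k / real (Suc k)) < e"
    proof eventually_elim
      case (elim x)
      have "\<bar>F x - P x\<bar> \<le> B / real (Suc M)" "\<bar>F 1 - P 1\<bar> \<le> B / real (Suc M)"
        unfolding P_def using elim by (intro tail; simp)+
      then show ?case using elim(1) BM unfolding F1[symmetric] dist_real_def by linarith
    qed
  qed
qed

text \<open>The function is the real part of ln (1 - x z) with z = exp (i t), and the series is the
  real part of z / (1 - x z). Working with real parts avoids the complex logarithm.\<close>

lemma has_derivative_half_ln:
  fixes t x :: real
  assumes "\<bar>x\<bar> < 1"
  shows "1 - 2 * x * cos t + x\<^sup>2 > 0"
    and "((\<lambda>x. ln (1 - 2 * x * cos t + x\<^sup>2) / 2) has_field_derivative (x - cos t) / (1 - 2 * x * cos t + x\<^sup>2)) (at x)"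
    and "(\<lambda>k. x ^ k * cos (real (Suc k) * t)) sums (- ((x - cos t) / (1 - 2 * x * cos t + x\<^sup>2)))"
proof -
  have "\<bar>x * cos t\<bar> \<le> \<bar>x\<bar> * 1" unfolding abs_mult by (intro mult_left_mono abs_cos_le_one) simp
  then have "x * cos t \<le> \<bar>x\<bar>" by linarith
  moreover have "(1 - \<bar>x\<bar>)\<^sup>2 > 0" using assms by simp
  moreover have "(1 - \<bar>x\<bar>)\<^sup>2 = 1 - 2 * \<bar>x\<bar> + x\<^sup>2" by (simp add: power2_eq_square algebra_simps flip: abs_mult)
  ultimately show pos: "1 - 2 * x * cos t + x\<^sup>2 > 0" by linarith
  show "((\<lambda>x. ln (1 - 2 * x * cos t + x\<^sup>2) / 2) has_field_derivative (x - cos t) / (1 - 2 * x * cos t + x\<^sup>2)) (at x)"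
    by (rule derivative_eq_intros refl pos | simp)+ (use pos in \<open>simp add: field_simps\<close>)
  define z where "z = cis t"
  have nz: "norm (of_real x * z) < 1" using assms by (simp add: z_def norm_mult)
  have "(\<lambda>k. z * (of_real x * z) ^ k) sums (z * (1 / (1 - of_real x * z)))"
    by (intro sums_mult geometric_sums nz)
  then have "(\<lambda>k. Re (z * (of_real x * z) ^ k)) sums Re (z * (1 / (1 - of_real x * z)))" by (rule sums_Re)
  moreover have "Re (z * (of_real x * z) ^ k) = x ^ k * cos (real (Suc k) * t)" for k
  proof -
    have "z * (of_real x * z) ^ k = of_real (x ^ k) * z ^ Suc k" by (simp add: power_mult_distrib)
    then show ?thesis unfolding z_def DeMoivre by (simp del: of_real_power)
  qed
  moreover have "Re (z * (1 / (1 - of_real x * z))) = - ((x - cos t) / (1 - 2 * x * cos t + x\<^sup>2))"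
  proof -
    have ring1: "(1 - x * C)\<^sup>2 + (x * S)\<^sup>2 = 1 - 2 * x * C + x\<^sup>2 * (C\<^sup>2 + S\<^sup>2)"
      and ring2: "C * (1 - x * C) + S * (- (x * S)) = C - x * (C\<^sup>2 + S\<^sup>2)" for C S :: real
      by (simp_all add: power2_eq_square algebra_simps)
    have d: "(1 - x * cos t)\<^sup>2 + (x * sin t)\<^sup>2 = 1 - 2 * x * cos t + x\<^sup>2"
    proof -
      have "(1 - x * cos t)\<^sup>2 + (x * sin t)\<^sup>2 = 1 - 2 * x * cos t + x\<^sup>2 * ((cos t)\<^sup>2 + (sin t)\<^sup>2)"
        by (rule ring1)
      then show ?thesis by simp
    qed
    have "Re (z / (1 - of_real x * z)) = (cos t * (1 - x * cos t) + sin t * (- (x * sin t))) / ((1 - x * cos t)\<^sup>2 + (- (x * sin t))\<^sup>2)"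
      by (simp add: Re_divide z_def)
    also have "cos t * (1 - x * cos t) + sin t * (- (x * sin t)) = cos t - x * ((cos t)\<^sup>2 + (sin t)\<^sup>2)"
      by (rule ring2)
    finally show ?thesis using d by (simp add: minus_divide_left)
  qed
  ultimately show "(\<lambda>k. x ^ k * cos (real (Suc k) * t)) sums (- ((x - cos t) / (1 - 2 * x * cos t + x\<^sup>2)))" by simp
qed

context prime_5_mod_8 begin

definition L :: real where "L = (\<Sum>k. of_int (c (int (Suc k))) / real (Suc k))"

text \<open>A full period sums to 0, so the initial sums are periodic and bounded by
  \<open>p\<close>.\<close>

lemma abs_sum_c_le: "\<bar>\<Sum>k\<in>{M..<N}. real_of_int (c (int k))\<bar> \<le> 2 * real p"
proof -
  define C where "C = (\<lambda>N. \<Sum>k<N. real_of_int (c (int k)))"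
  have per: "C (N + p) = C N" for N
  proof -
    have "C p = 0"
    proof -
      have "{..<p} = insert 0 {1..<p}" using p_gt2 by auto
      then have "C p = of_int (\<Sum>k\<in>{1..<p}. c (int k))" by (simp add: C_def c_eq_0_iff)
      then show ?thesis by (simp only: sum_c)
    qed
    then show ?thesis
    proof (induction N)
      case (Suc N)
      have "c (int (N + p)) = c (int N)" by (rule c_cong) (simp add: Cong.cong_def)
      then show ?case using Suc by (simp add: C_def)
    qed (simp add: C_def)
  qed
  have per': "C (N + p * q) = C N" for N q
  proof (induction q)
    case (Suc q)
    have "N + p * Suc q = (N + p * q) + p" by simp
    then show ?case using Suc by (simp only: per)
  qed simp
  have "\<bar>C N\<bar> \<le> real N" for N
  proof -
    have "\<bar>C N\<bar> \<le> (\<Sum>k<N. \<bar>real_of_int (c (int k))\<bar>)" unfolding C_def by (rule sum_abs)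
    also have "\<dots> \<le> (\<Sum>k<N. 1)" by (intro sum_mono) (use c_abs in \<open>simp flip: of_int_abs\<close>)
    finally show ?thesis by simp
  qed
  note small = this
  have bd: "\<bar>C N\<bar> \<le> real p" for N
  proof -
    have "C N = C (N mod p)" using per'[of "N mod p" "N div p"] by simp
    moreover have "real (N mod p) \<le> real p" using p_gt2 by (simp add: less_imp_le)
    ultimately show ?thesis using small[of "N mod p"] by simp
  qed
  show ?thesis
  proof (cases "M \<le> N")
    case True
    have "(\<Sum>k\<in>{M..<N}. real_of_int (c (int k))) = C N - C M"
      unfolding C_def lessThan_atLeast0 using sum.atLeastLessThan_concat[of 0 M N "\<lambda>k. real_of_int (c (int k))"] True by simp
    then show ?thesis using bd[of N] bd[of M] by linarith
  qed simp
qed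

lemma abs_sum_c_Suc_le: "\<bar>\<Sum>k\<in>{M..<N}. real_of_int (c (int (Suc k)))\<bar> \<le> 2 * real p"
  using abs_sum_c_le[of "Suc M" "Suc N"] sum.shift_bounds_Suc_ivl[of "\<lambda>k. real_of_int (c (int k))" M N] by simp

lemma summable_L: "summable (\<lambda>k. of_int (c (int (Suc k))) / real (Suc k))"
  using abel_limit_bounded(1)[OF abs_sum_c_Suc_le] .

text \<open>Real parts of Gauss sums express sqrt p c(k) through cosines. Inserted into the power
  series of the terms c(k) x^k / k, this gives a function with the same derivative as -
  \<open>H\<close>, and both vanish at 0. At x = 1 the argument of the logarithm is the square of 2
  sin (pi a / p), and a and p - a contribute equally.\<close>

lemma sqrt_p_mult_L:
  "sqrt (real p) * L = - 2 * (\<Sum>a\<in>{1..n}. of_int (c (int a)) * ln (2 * sin (pi * real a / real p)))"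
proof -
  define \<theta> where "\<theta> = (\<lambda>a. 2 * pi * real a / real p)"
  define b where "b = (\<lambda>k. real_of_int (c (int (Suc k))))"
  define F where "F = (\<lambda>x. \<Sum>k. b k / real (Suc k) * x ^ Suc k)"
  define H where "H = (\<lambda>x. \<Sum>a\<in>{1..<p}. of_int (c (int a)) * (ln (1 - 2 * x * cos (\<theta> a) + x\<^sup>2) / 2))"
  have cosum: "(\<Sum>a\<in>{1..<p}. of_int (c (int a)) * cos (real t * \<theta> a)) = of_int (c (int t)) * sqrt (real p)" for t
  proof -
    have "Re (\<Sum>a\<in>{1..<p}. of_int (c (int a)) * cis (\<theta> a) ^ t) = Re (of_int (c (int t)) * of_real (sqrt (real p)))"
      unfolding \<theta>_def sum_c_cis ..
    then show ?thesis by (simp add: DeMoivre)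
  qed
  have dF: "(F has_field_derivative (\<Sum>k. b k * x ^ k)) (at x)" and sF: "summable (\<lambda>k. b k * x ^ k)"
    if x: "\<bar>x\<bar> < 1" for x
  proof -
    have s: "summable (\<lambda>k. b k * y ^ k)" if "\<bar>y\<bar> < 1" for y :: real
    proof (rule summable_comparison_test')
      show "summable (\<lambda>k. \<bar>y\<bar> ^ k)" using that by (simp add: summable_geometric)
      fix k :: nat
      have "\<bar>b k\<bar> \<le> 1" unfolding b_def using c_abs by (simp flip: of_int_abs)
      then show "norm (b k * y ^ k) \<le> \<bar>y\<bar> ^ k" by (simp add: abs_mult power_abs mult_left_le_one_le)
    qed
    then show "summable (\<lambda>k. b k * x ^ k)" using x .
    have "DERIV (\<lambda>x. \<Sum>k. b k / real (Suc k) * x ^ Suc k) x :> (\<Sum>k. b k / real (Suc k) * real (Suc k) * x ^ k)"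
      by (rule DERIV_power_series'[where R = 1]) (use x s in \<open>auto simp del: of_nat_Suc\<close>)
    then show "(F has_field_derivative (\<Sum>k. b k * x ^ k)) (at x)" by (simp add: F_def del: of_nat_Suc)
  qed
  have dH: "(H has_field_derivative - (sqrt (real p) * (\<Sum>k. b k * x ^ k))) (at x)" if x: "\<bar>x\<bar> < 1" for x
  proof -
    define e where "e = (\<lambda>a. (x - cos (\<theta> a)) / (1 - 2 * x * cos (\<theta> a) + x\<^sup>2))"
    have 1: "(H has_field_derivative (\<Sum>a\<in>{1..<p}. of_int (c (int a)) * e a)) (at x)"
      unfolding H_def e_def by (intro DERIV_sum DERIV_cmult has_derivative_half_ln(2) x)
    have "(\<lambda>k. \<Sum>a\<in>{1..<p}. of_int (c (int a)) * (x ^ k * cos (real (Suc k) * \<theta> a))) sums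
        (\<Sum>a\<in>{1..<p}. of_int (c (int a)) * (- e a))"
      unfolding e_def by (intro sums_sum sums_mult has_derivative_half_ln(3) x)
    moreover have "(\<Sum>a\<in>{1..<p}. of_int (c (int a)) * (x ^ k * cos (real (Suc k) * \<theta> a))) = sqrt (real p) * (b k * x ^ k)" for k
    proof -
      have "(\<Sum>a\<in>{1..<p}. of_int (c (int a)) * (x ^ k * cos (real (Suc k) * \<theta> a))) =
          x ^ k * (\<Sum>a\<in>{1..<p}. of_int (c (int a)) * cos (real (Suc k) * \<theta> a))"
        by (simp only: sum_distrib_left mult.left_commute)
      then show ?thesis unfolding cosum b_def by (simp only: mult_ac)
    qed
    moreover have "(\<lambda>k. sqrt (real p) * (b k * x ^ k)) sums (sqrt (real p) * (\<Sum>k. b k * x ^ k))"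
      by (intro sums_mult summable_sums sF x)
    ultimately have "(\<Sum>a\<in>{1..<p}. of_int (c (int a)) * (- e a)) = sqrt (real p) * (\<Sum>k. b k * x ^ k)"
      by (simp only: sums_unique2)
    then have "(\<Sum>a\<in>{1..<p}. of_int (c (int a)) * e a) = - (sqrt (real p) * (\<Sum>k. b k * x ^ k))"
      by (simp add: sum_negf)
    then show ?thesis using 1 by simp
  qed
  have eq: "sqrt (real p) * F x = - H x" if x: "0 < x" "x < 1" for x
  proof -
    have "sqrt (real p) * F x + H x = sqrt (real p) * F 0 + H 0"
    proof (rule DERIV_isconst3[of "- 1" 1 x 0 "\<lambda>x. sqrt (real p) * F x + H x"])
      fix y :: real assume "y \<in> {- 1<..<1}"
      then have y: "\<bar>y\<bar> < 1" by auto
      from DERIV_add[OF DERIV_cmult[OF dF[OF y], of "sqrt (real p)"] dH[OF y]]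
      show "((\<lambda>x. sqrt (real p) * F x + H x) has_field_derivative 0) (at y)" by simp
    qed (use x in auto)
    also have "F 0 = 0" by (simp add: F_def)
    also have "H 0 = 0" by (simp add: H_def)
    finally show ?thesis by simp
  qed
  have half: "1 - 2 * 1 * cos (\<theta> a) + 1\<^sup>2 = (2 * sin (pi * real a / real p))\<^sup>2" for a
    using cos_double_sin[of "pi * real a / real p"] by (simp add: \<theta>_def power2_eq_square mult_ac)
  have Hlim: "(H \<longlongrightarrow> H 1) (at_left 1)"
    unfolding H_def
  proof (intro tendsto_intros)
    fix a assume "a \<in> {1..<p}"
    then have "0 < a" "a < p" by auto
    from sin_pos[OF this] show "1 - 2 * 1 * cos (\<theta> a) + 1\<^sup>2 \<noteq> 0" unfolding half by simp
  qed auto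
  have Flim: "(F \<longlongrightarrow> L) (at_left 1)"
    unfolding F_def L_def b_def by (rule abel_limit_bounded(2)[OF abs_sum_c_Suc_le])
  have "((\<lambda>x. - H x) \<longlongrightarrow> sqrt (real p) * L) (at_left 1)"
  proof (rule Lim_transform_eventually)
    show "((\<lambda>x. sqrt (real p) * F x) \<longlongrightarrow> sqrt (real p) * L) (at_left 1)" by (intro tendsto_intros Flim)
    have "\<forall>\<^sub>F x in at_left (1::real). x \<in> {0<..<1}" by (rule eventually_at_left_real) simp
    then show "\<forall>\<^sub>F x in at_left 1. sqrt (real p) * F x = - H x"
      by eventually_elim (use eq in auto)
  qed
  moreover have "((\<lambda>x. - H x) \<longlongrightarrow> - H 1) (at_left 1)" by (intro tendsto_intros Hlim)
  ultimately have "sqrt (real p) * L = - H 1" using tendsto_unique[OF trivial_limit_at_left_real] by blast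
  also have "H 1 = (\<Sum>a\<in>{1..<p}. of_int (c (int a)) * ln (2 * sin (pi * real a / real p)))"
    unfolding H_def half
  proof (intro sum.cong refl)
    fix a assume "a \<in> {1..<p}"
    then have "0 < a" "a < p" by auto
    have "ln ((2 * sin (pi * real a / real p))\<^sup>2) = 2 * ln (2 * sin (pi * real a / real p))"
      by (simp only: ln_realpow of_nat_numeral)
    then show "of_int (c (int a)) * (ln ((2 * sin (pi * real a / real p))\<^sup>2) / 2) =
        of_int (c (int a)) * ln (2 * sin (pi * real a / real p))"
      by (simp only: nonzero_mult_div_cancel_left zero_neq_numeral[symmetric] not_False_eq_True)
  qed
  also have "\<dots> = (\<Sum>a\<in>{1..n}. of_int (c (int a)) * ln (2 * sin (pi * real a / real p))) +
      (\<Sum>a\<in>{n+1..<p}. of_int (c (int a)) * ln (2 * sin (pi * real a / real p)))"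
  proof -
    have "{1..<p} = {1..n} \<union> {n+1..<p}" using p_n(1) by auto
    then show ?thesis by (simp only:) (rule sum.union_disjoint, auto)
  qed
  also have "(\<Sum>a\<in>{n+1..<p}. of_int (c (int a)) * ln (2 * sin (pi * real a / real p))) =
      (\<Sum>a\<in>{1..n}. of_int (c (int a)) * ln (2 * sin (pi * real a / real p)))"
  proof (rule sum.reindex_bij_witness[of _ "\<lambda>a. p - a" "\<lambda>a. p - a"])
    fix a assume a: "a \<in> {n+1..<p}"
    then have "pi * real (p - a) / real p = pi - pi * real a / real p"
      using p_pos by (simp add: of_nat_diff field_simps)
    moreover have "c (int (p - a)) = c (int a)"
    proof -
      have "c (int (p - a)) = c (- int a)" using a by (intro c_cong) (simp add: cong_iff_dvd_diff of_nat_diff)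
      then show ?thesis by (simp add: c_minus)
    qed
    ultimately show "of_int (c (int (p - a))) * ln (2 * sin (pi * real (p - a) / real p)) =
        of_int (c (int a)) * ln (2 * sin (pi * real a / real p))" by simp
  qed (use p_n(1) in auto)
  finally show ?thesis by simp
qed

end

section \<open>Counting ideals by their norm\<close>

text \<open>Together with \<open>gcd_mult_of_dvd_coprime\<close> this makes e -> (gcd e a, gcd e b)
  inverse to the multiplication of divisors; both multiplicativity proofs rest on this
  bijection.\<close>

lemma gcd_mult_gcd_coprime:
  fixes e a b :: nat
  assumes "coprime a b" "e dvd a * b"
  shows "gcd e a * gcd e b = e"
proof (rule dvd_antisym)
  have "coprime (gcd e a) (gcd e b)"
    using assms(1) by (rule coprime_divisors[rotated 2]) auto
  then show "gcd e a * gcd e b dvd e" by (intro divides_mult) auto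
  have "e dvd gcd (b * e) (b * a)" using assms(2) by (intro gcd_greatest) (auto simp: mult.commute)
  then have "e dvd b * gcd e a" by (simp only: gcd_mult_distrib_nat)
  then have "e dvd gcd (gcd e a * e) (gcd e a * b)" by (intro gcd_greatest) (auto simp: mult.commute)
  then show "e dvd gcd e a * gcd e b" by (simp only: gcd_mult_distrib_nat)
qed

lemma gcd_mult_of_dvd_coprime:
  fixes x y a b :: nat
  assumes "coprime a b" "x dvd a" "y dvd b"
  shows "gcd (x * y) a = x" "gcd (x * y) b = y"
proof -
  have "coprime a y" using coprime_divisors[OF dvd_refl assms(3) assms(1)] .
  from gcd_mult_left_right_cancel[OF this, of x] show "gcd (x * y) a = x"
    using assms(2) by (simp add: gcd_proj1_iff)
  have "coprime x b" using coprime_divisors[OF assms(2) dvd_refl assms(1)] .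
  then have "coprime b x" by (rule coprime_commute[THEN iffD1])
  from gcd_mult_left_left_cancel[OF this, of y] show "gcd (x * y) b = y"
    using assms(3) by (simp add: gcd_proj1_iff)
qed

lemma div_pos_of_dvd: "(m :: nat) dvd a \<Longrightarrow> a > 0 \<Longrightarrow> a div m > 0"
  by (auto elim!: dvdE)

lemma sum_divisors_coprime_mult:
  fixes f :: "nat \<Rightarrow> 'a :: comm_semiring_1"
  assumes cop: "coprime a b" "a > 0" "b > 0"
    and mult: "\<And>x y. x dvd a \<Longrightarrow> y dvd b \<Longrightarrow> f (x * y) = f x * f y"
  shows "(\<Sum>e | e dvd a * b. f e) = (\<Sum>e | e dvd a. f e) * (\<Sum>e | e dvd b. f e)"
proof -
  have "(\<Sum>e | e dvd a. f e) * (\<Sum>e | e dvd b. f e) = (\<Sum>(x, y)\<in>{e. e dvd a} \<times> {e. e dvd b}. f x * f y)"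
    by (simp add: sum_product sum.cartesian_product)
  also have "\<dots> = (\<Sum>e | e dvd a * b. f e)"
    by (rule sum.reindex_bij_witness[of _ "\<lambda>e. (gcd e a, gcd e b)" "\<lambda>(x, y). x * y"])
      (auto simp: gcd_mult_of_dvd_coprime[OF cop(1)] gcd_mult_gcd_coprime[OF cop(1)] mult mult_dvd_mono)
  finally show ?thesis by simp
qed

lemma sq_dvd_coprime_mult_iff:
  fixes c a b :: nat
  assumes "coprime a b" "c\<^sup>2 dvd a * b"
  shows "(gcd c a)\<^sup>2 dvd a" "(gcd c b)\<^sup>2 dvd b" "gcd c a * gcd c b = c"
proof -
  have "(gcd c a)\<^sup>2 dvd c\<^sup>2" "(gcd c b)\<^sup>2 dvd c\<^sup>2" by (auto intro: dvd_power_same)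
  then have d: "(gcd c a)\<^sup>2 dvd a * b" "(gcd c b)\<^sup>2 dvd a * b" using assms(2) dvd_trans by blast+
  have "coprime (gcd c a) b" by (rule coprime_divisors[OF _ dvd_refl assms(1)]) simp
  then have "coprime ((gcd c a)\<^sup>2) b" by simp
  then show "(gcd c a)\<^sup>2 dvd a" using d(1) by (simp only: coprime_dvd_mult_left_iff)
  have "coprime a (gcd c b)" by (rule coprime_divisors[OF dvd_refl _ assms(1)]) simp
  then have "coprime (gcd c b) a" by (rule coprime_commute[THEN iffD1])
  then have "coprime ((gcd c b)\<^sup>2) a" by simp
  then show "(gcd c b)\<^sup>2 dvd b" using d(2) by (simp only: coprime_dvd_mult_right_iff)
  have "c dvd c\<^sup>2" by (simp add: power2_eq_square)
  then have "c dvd a * b" using assms(2) by (rule dvd_trans)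
  then show "gcd c a * gcd c b = c" by (rule gcd_mult_gcd_coprime[OF assms(1)])
qed

section \<open>Roots of the norm polynomial modulo prime powers\<close>

context prime_5_mod_8 begin

text \<open>This is (p - 1) / 4: the number (1 + sqrt p) / 2 is a root of X^2 - X - d, whose
  discriminant is \<open>p\<close>.\<close>

definition d :: int where "d = 2 * int r + 1"

definition nf :: "int \<Rightarrow> int" where "nf b = b * b + b - d"

lemma four_nf: "4 * nf b = (2 * b + 1)\<^sup>2 - int p"
  by (simp add: nf_def d_def p_eq power2_eq_square algebra_simps)

lemma cong_nf: "[b = b'] (mod m) \<Longrightarrow> [nf b = nf b'] (mod m)"
  unfolding nf_def by (intro cong_diff cong_add cong_mult cong_refl)

lemma dvd_nf_cong: "[b = b'] (mod m) \<Longrightarrow> m dvd nf b \<longleftrightarrow> m dvd nf b'"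
  by (rule cong_dvd_iff[OF cong_nf])

text \<open>The residues b modulo a for which a and b + (1 + sqrt p) / 2 span an ideal; such ideals
  are the primitive ones of norm a.\<close>

definition Sol :: "nat \<Rightarrow> int set" where "Sol a = {b. 0 \<le> b \<and> b < int a \<and> int a dvd nf b}"

definition \<rho> :: "nat \<Rightarrow> nat" where "\<rho> a = card (Sol a)"

lemma finite_Sol [simp]: "finite (Sol a)"
  by (rule finite_subset[of _ "{0..<int a}"]) (auto simp: Sol_def)

lemma rho_1 [simp]: "\<rho> (Suc 0) = 1"
proof -
  have "Sol (Suc 0) = {0}" by (auto simp: Sol_def)
  then show ?thesis by (simp add: \<rho>_def)
qed

lemma rho_mult:
  assumes cop: "coprime a1 a2" and pos: "a1 > 0" "a2 > 0"
  shows "\<rho> (a1 * a2) = \<rho> a1 * \<rho> a2"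
proof -
  define h where "h = (\<lambda>b. (b mod int a1, b mod int a2))"
  have cop': "coprime (int a1) (int a2)" using cop by simp
  have "bij_betw h (Sol (a1 * a2)) (Sol a1 \<times> Sol a2)"
  proof (rule bij_betw_imageI)
    show "inj_on h (Sol (a1 * a2))"
    proof (rule inj_onI)
      fix x y assume xy: "x \<in> Sol (a1 * a2)" "y \<in> Sol (a1 * a2)" "h x = h y"
      then have "[x = y] (mod int a1)" "[x = y] (mod int a2)" by (auto simp: h_def Cong.cong_def)
      then have "[x = y] (mod (int a1 * int a2))" using cop' by (rule coprime_cong_mult)
      then show "x = y" using xy by (auto simp: Sol_def Cong.cong_def)
    qed
    show "h ` Sol (a1 * a2) = Sol a1 \<times> Sol a2"
    proof
      show "h ` Sol (a1 * a2) \<subseteq> Sol a1 \<times> Sol a2"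
      proof
        fix y assume "y \<in> h ` Sol (a1 * a2)"
        then obtain b where b: "b \<in> Sol (a1 * a2)" "y = h b" by blast
        have "int a1 dvd nf b" "int a2 dvd nf b" using b by (auto simp: Sol_def dest: dvd_mult_left dvd_mult_right)
        moreover have "[b mod int a = b] (mod int a)" for a by (simp add: Cong.cong_def)
        ultimately have "int a1 dvd nf (b mod int a1)" "int a2 dvd nf (b mod int a2)"
          using dvd_nf_cong[THEN iffD2] by blast+
        then show "y \<in> Sol a1 \<times> Sol a2" using pos b by (simp add: Sol_def h_def)
      qed
      show "Sol a1 \<times> Sol a2 \<subseteq> h ` Sol (a1 * a2)"
      proof
        fix y assume "y \<in> Sol a1 \<times> Sol a2"
        then obtain u v where uv: "y = (u, v)" "u \<in> Sol a1" "v \<in> Sol a2" by blast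
        obtain x where x: "[x = u] (mod int a1)" "[x = v] (mod int a2)"
          using binary_chinese_remainder_int[OF cop'] by blast
        define b where "b = x mod (int a1 * int a2)"
        have bu: "b mod int a1 = x mod int a1" "b mod int a2 = x mod int a2"
          unfolding b_def by (simp_all add: mod_mod_cancel)
        have hb: "h b = y" using x uv unfolding h_def bu by (auto simp: Sol_def Cong.cong_def)
        have "[b = u] (mod int a1)" "[b = v] (mod int a2)"
          using x bu by (simp_all only: Cong.cong_def)
        moreover have "int a1 dvd nf u" "int a2 dvd nf v" using uv by (auto simp: Sol_def)
        ultimately have "int a1 dvd nf b" "int a2 dvd nf b" by (simp_all only: dvd_nf_cong)
        then have "int a1 * int a2 dvd nf b" using cop' by (intro divides_mult)
        then have "b \<in> Sol (a1 * a2)" using pos by (simp add: Sol_def b_def)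
        then show "y \<in> h ` Sol (a1 * a2)" using hb by blast
      qed
    qed
  qed
  from bij_betw_same_card[OF this] show ?thesis by (simp add: \<rho>_def card_cartesian_product)
qed

text \<open>An ideal is a positive integer c times a primitive ideal, and its norm is c^2 times the
  norm of the latter.\<close>

definition num_ideals :: "nat \<Rightarrow> nat" where "num_ideals m = (\<Sum>c | c\<^sup>2 dvd m. \<rho> (m div c\<^sup>2))"

lemma finite_sq_dvd: "m > 0 \<Longrightarrow> finite {c :: nat. c\<^sup>2 dvd m}"
proof (rule finite_subset)
  assume m: "m > 0"
  show "{c. c\<^sup>2 dvd m} \<subseteq> {..m}"
  proof
    fix c :: nat assume "c \<in> {c. c\<^sup>2 dvd m}"
    then have "c\<^sup>2 \<le> m" using m by (auto dest: dvd_imp_le)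
    moreover have "c \<le> c\<^sup>2" by (cases c) (auto simp: power2_eq_square)
    ultimately show "c \<in> {..m}" by simp
  qed
qed simp

lemma num_ideals_mult:
  assumes cop: "coprime a b" and pos: "a > 0" "b > 0"
  shows "num_ideals (a * b) = num_ideals a * num_ideals b"
proof -
  have val: "\<rho> (a div x\<^sup>2) * \<rho> (b div y\<^sup>2) = \<rho> (a * b div (x * y)\<^sup>2)" if "x\<^sup>2 dvd a" "y\<^sup>2 dvd b" for x y
  proof -
    have "a div x\<^sup>2 dvd a" "b div y\<^sup>2 dvd b"
      using dvd_triv_left[of "a div x\<^sup>2" "x\<^sup>2"] dvd_triv_left[of "b div y\<^sup>2" "y\<^sup>2"]
      by (simp_all only: dvd_div_mult_self[OF that(1)] dvd_div_mult_self[OF that(2)])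
    then have "coprime (a div x\<^sup>2) (b div y\<^sup>2)" by (rule coprime_divisors[OF _ _ cop])
    moreover have "a div x\<^sup>2 > 0" "b div y\<^sup>2 > 0"
      using div_pos_of_dvd[OF that(1) pos(1)] div_pos_of_dvd[OF that(2) pos(2)] by blast+
    ultimately have "\<rho> (a div x\<^sup>2 * (b div y\<^sup>2)) = \<rho> (a div x\<^sup>2) * \<rho> (b div y\<^sup>2)" by (rule rho_mult)
    moreover have "a div x\<^sup>2 * (b div y\<^sup>2) = a * b div (x * y)\<^sup>2"
      using that by (simp add: div_mult_div_if_dvd power_mult_distrib)
    ultimately show ?thesis by simp
  qed
  have gd: "gcd (x * y) a = x" "gcd (x * y) b = y" if "x\<^sup>2 dvd a" "y\<^sup>2 dvd b" for x y
  proof -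
    have "x dvd a" "y dvd b" using that by (auto simp: power2_eq_square dest: dvd_mult_left)
    then show "gcd (x * y) a = x" "gcd (x * y) b = y" using gcd_mult_of_dvd_coprime[OF cop] by blast+
  qed
  have "num_ideals a * num_ideals b = (\<Sum>(x, y)\<in>{c. c\<^sup>2 dvd a} \<times> {c. c\<^sup>2 dvd b}. \<rho> (a div x\<^sup>2) * \<rho> (b div y\<^sup>2))"
    by (simp add: num_ideals_def sum_product sum.cartesian_product)
  also have "\<dots> = num_ideals (a * b)" unfolding num_ideals_def
  proof (rule sum.reindex_bij_witness[of _ "\<lambda>c. (gcd c a, gcd c b)" "\<lambda>(x, y). x * y"])
    fix c assume "c \<in> {c. c\<^sup>2 dvd a * b}"
    then have c: "c\<^sup>2 dvd a * b" by simp
    show "(case (gcd c a, gcd c b) of (x, y) \<Rightarrow> x * y) = c" using sq_dvd_coprime_mult_iff[OF cop c] by simp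
    show "(gcd c a, gcd c b) \<in> {c. c\<^sup>2 dvd a} \<times> {c. c\<^sup>2 dvd b}" using sq_dvd_coprime_mult_iff[OF cop c] by simp
  qed (auto simp: gd val power_mult_distrib mult_dvd_mono)
  finally show ?thesis by simp
qed

lemma prime_not_dvd:
  assumes "prime q" "q \<noteq> p"
  shows "\<not> int p dvd int q" "\<not> int q dvd int p"
  using assms prime_p primes_dvd_imp_eq[of p q] primes_dvd_imp_eq[of q p] by auto

lemma not_dvd_2b1:
  assumes q: "prime q" "q \<noteq> p" and dvd: "int q dvd nf b"
  shows "\<not> int q dvd 2 * b + 1"
proof
  assume "int q dvd 2 * b + 1"
  then have "int q dvd (2 * b + 1)\<^sup>2" by (simp add: power2_eq_square)
  moreover have "int p = (2 * b + 1)\<^sup>2 - 4 * nf b" using four_nf[of b] by simp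
  ultimately have "int q dvd int p" using dvd by (simp add: dvd_diff)
  then show False using prime_not_dvd[OF q] by simp
qed

text \<open>For odd q this asks whether \<open>p\<close> is a square modulo q, since 4 nf b = (2 b +
  1)^2 - p; reciprocity has no sign as \<open>n\<close> is even. For q = 2 all values of
  \<open>nf\<close> are odd, in accordance with c 2 = -1.\<close>

lemma ex_root_iff:
  assumes q: "prime q" "q \<noteq> p"
  shows "(\<exists>b. int q dvd nf b) \<longleftrightarrow> c (int q) = 1"
proof (cases "q = 2")
  case True
  have "\<not> 2 dvd nf b" for b by (simp add: nf_def d_def)
  then show ?thesis using True c_2 by simp
next
  case False
  then have q2: "q > 2" using prime_ge_2_nat[OF q(1)] by simp
  then have oddq: "odd q" using q(1) prime_odd_nat by blast
  have rec: "Legendre (int p) (int q) * c (int q) = 1"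
    using Quadratic_Reciprocity[OF prime_p p_gt2 q(1) q2] q(2) even_n unfolding p_n(3) by simp
  have ndvd: "\<not> [int p = 0] (mod int q)"
    using prime_not_dvd[OF q] by (simp add: cong_0_iff)
  have "c (int q) = 1 \<longleftrightarrow> QuadRes (int q) (int p)"
    using rec ndvd by (auto simp: Legendre_def[of "int p"] split: if_splits)
  also have "\<dots> \<longleftrightarrow> (\<exists>b. int q dvd nf b)"
  proof
    assume "QuadRes (int q) (int p)"
    then obtain y where y: "[y\<^sup>2 = int p] (mod int q)" by (auto simp: QuadRes_def)
    \<comment> \<open>Adding the odd number q adjusts the parity, so that z has the form 2 b +
      1.\<close>
    obtain z where z: "odd z" "[z = y] (mod int q)"
    proof (cases "odd y")
      case True then show ?thesis using that[of y] by simp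
    next
      case False
      then show ?thesis using that[of "y + int q"] oddq by (simp add: Cong.cong_def)
    qed
    then obtain b where b: "z = 2 * b + 1" by (elim oddE)
    have "[z\<^sup>2 = int p] (mod int q)" using cong_trans[OF cong_pow[OF z(2)] y] .
    then have "int q dvd 4 * nf b" unfolding four_nf b[symmetric] by (simp add: cong_iff_dvd_diff)
    moreover have "coprime (int q) 4"
    proof -
      have "coprime (int q) 2" using oddq by simp
      then have "coprime (int q) (2 * 2)" by (simp only: coprime_mult_right_iff)
      then show ?thesis by simp
    qed
    ultimately have "int q dvd nf b" by (simp add: coprime_dvd_mult_right_iff)
    then show "\<exists>b. int q dvd nf b" ..
  next
    assume "\<exists>b. int q dvd nf b"
    then obtain b where "int q dvd nf b" ..
    then have "int q dvd (2 * b + 1)\<^sup>2 - int p" unfolding four_nf[symmetric] by simp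
    then show "QuadRes (int q) (int p)" by (auto simp: QuadRes_def cong_iff_dvd_diff)
  qed
  finally show ?thesis by blast
qed

text \<open>Hensel lifting; the derivative 2 b + 1 is invertible modulo q because q does not divide
  the discriminant \<open>p\<close>.\<close>

lemma ex_root_lift:
  assumes q: "prime q" "q \<noteq> p" and root: "int q dvd nf b"
  shows "\<exists>b. int (q ^ Suc k) dvd nf b"
proof (induction k)
  case 0 then show ?case using root by auto
next
  case (Suc k)
  define Q where "Q = int (q ^ Suc k)"
  obtain b1 where b1: "Q dvd nf b1" using Suc by (auto simp: Q_def)
  then obtain e where e: "nf b1 = Q * e" by (rule dvdE)
  have "int q dvd Q" by (simp add: Q_def)
  then have "int q dvd nf b1" using b1 by (rule dvd_trans)
  then have "\<not> int q dvd 2 * b1 + 1" by (rule not_dvd_2b1[OF q])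
  then have "coprime (int q) (2 * b1 + 1)" using q(1) by (intro prime_imp_coprime) auto
  then have "coprime (2 * b1 + 1) (int q)" by (rule coprime_commute[THEN iffD1])
  then obtain i where i: "[(2 * b1 + 1) * i = 1] (mod int q)" using cong_solve_coprime_int by blast
  \<comment> \<open>The Newton correction: it solves e + (2 b1 + 1) t = 0 modulo q.\<close>
  define t where "t = - e * i"
  have "[(2 * b1 + 1) * i * - e = 1 * - e] (mod int q)" by (rule cong_scalar_right[OF i])
  then have "int q dvd e + (2 * b1 + 1) * t" by (simp add: t_def cong_iff_dvd_diff algebra_simps)
  then have "Q * int q dvd Q * (e + (2 * b1 + 1) * t)" by simp
  moreover have "Q * int q dvd Q * Q * (t * t)" using \<open>int q dvd Q\<close> by (intro dvd_mult2 mult_dvd_mono) auto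
  moreover have "nf (b1 + t * Q) = Q * (e + (2 * b1 + 1) * t) + Q * Q * (t * t)"
  proof -
    have "nf (b1 + t * Q) = nf b1 + Q * ((2 * b1 + 1) * t) + Q * Q * (t * t)"
      by (simp add: nf_def algebra_simps)
    then show ?thesis unfolding e by (simp add: algebra_simps)
  qed
  ultimately have "Q * int q dvd nf (b1 + t * Q)" by (simp add: dvd_add)
  moreover have "Q * int q = int (q ^ Suc (Suc k))" by (simp add: Q_def)
  ultimately show ?case by metis
qed

text \<open>If there is a root b1, the other one is -1 - b1. Their difference is prime to q up to
  sign, so q divides at most one of the two linear factors and the whole prime power must divide the
  other.\<close>

lemma rho_prime_power:
  assumes q: "prime q" "q \<noteq> p"
  shows "int (\<rho> (q ^ Suc k)) = 1 + c (int q)"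
proof (cases "c (int q) = 1")
  case False
  have "\<not> int p dvd int q" using prime_not_dvd[OF q] by simp
  then have "c (int q) = - 1" using False c_cases[of "int q"] c_eq_0_iff[of "int q"] by blast
  moreover have "Sol (q ^ Suc k) = {}"
  proof -
    have "False" if "b \<in> Sol (q ^ Suc k)" for b
    proof -
      have "int (q ^ Suc k) dvd nf b" using that by (simp add: Sol_def)
      then have "int q dvd nf b" by (simp add: dvd_mult_left)
      then show False using ex_root_iff[OF q] False by blast
    qed
    then show ?thesis by blast
  qed
  ultimately show ?thesis by (simp add: \<rho>_def)
next
  case True
  define Q where "Q = int (q ^ Suc k)"
  have Q0: "Q > 0" using prime_gt_0_nat[OF q(1)] by (simp add: Q_def)
  obtain b0 where "int q dvd nf b0" using ex_root_iff[OF q] True by blast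
  then obtain b1 where b1: "Q dvd nf b1" unfolding Q_def using ex_root_lift[OF q] by blast
  have qQ: "int q dvd Q" by (simp add: Q_def)
  have nd: "\<not> int q dvd 2 * b1 + 1" by (rule not_dvd_2b1[OF q dvd_trans[OF qQ b1]])
  have primeq: "prime (int q)" using q(1) by simp
  define b2 where "b2 = - 1 - b1"
  have fac: "(b - b1) * (b - b2) = nf b - nf b1" for b by (simp add: nf_def b2_def algebra_simps)
  have b2: "Q dvd nf b2" using fac[of b2] b1 by simp
  have "Sol (q ^ Suc k) = {b1 mod Q, b2 mod Q}"
  proof (intro equalityI subsetI)
    fix b assume "b \<in> Sol (q ^ Suc k)"
    then have b: "0 \<le> b" "b < Q" "Q dvd nf b" by (auto simp: Sol_def Q_def)
    have dv: "Q dvd (b - b1) * (b - b2)" unfolding fac using b(3) b1 by (rule dvd_diff)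
    have "b - b2 - (b - b1) = 2 * b1 + 1" by (simp add: b2_def)
    then have "\<not> (int q dvd b - b1 \<and> int q dvd b - b2)" using nd dvd_diff by metis
    then have "coprime (int q) (b - b1) \<or> coprime (int q) (b - b2)" using primeq prime_imp_coprime by blast
    then have "coprime Q (b - b1) \<or> coprime Q (b - b2)" by (auto simp: Q_def)
    then have "Q dvd b - b2 \<or> Q dvd b - b1" using dv by (auto simp: coprime_dvd_mult_right_iff coprime_dvd_mult_left_iff)
    then have "b mod Q = b2 mod Q \<or> b mod Q = b1 mod Q" by (simp add: mod_eq_dvd_iff)
    then show "b \<in> {b1 mod Q, b2 mod Q}" using b by auto
  next
    fix b assume "b \<in> {b1 mod Q, b2 mod Q}"
    then have "[b = b1] (mod Q) \<or> [b = b2] (mod Q)" by (auto simp: Cong.cong_def)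
    then have "Q dvd nf b" using b1 b2 dvd_nf_cong by blast
    then show "b \<in> Sol (q ^ Suc k)" using \<open>b \<in> _\<close> Q0 by (auto simp: Sol_def Q_def)
  qed
  moreover have "b1 mod Q \<noteq> b2 mod Q"
  proof
    assume "b1 mod Q = b2 mod Q"
    then have "Q dvd b1 - b2" by (simp add: mod_eq_dvd_iff)
    then have "int q dvd 2 * b1 + 1" using dvd_trans[OF qQ] by (simp add: b2_def)
    then show False using nd by simp
  qed
  ultimately show ?thesis using True by (simp add: \<rho>_def)
qed

lemma p_dvd_2b1: assumes "int p dvd nf b" shows "int p dvd 2 * b + 1"
proof -
  have "(2 * b + 1)\<^sup>2 = 4 * nf b + int p" using four_nf[of b] by simp
  then have "int p dvd (2 * b + 1)\<^sup>2" using assms by simp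
  then show ?thesis using prime_int_p prime_dvd_power by blast
qed

lemma rho_p: "\<rho> p = 1"
proof -
  have "Sol p = {int n}"
  proof (intro equalityI subsetI)
    fix b assume "b \<in> Sol p"
    then have b: "0 \<le> b" "b < int p" "int p dvd nf b" by (auto simp: Sol_def)
    from p_dvd_2b1[OF b(3)] obtain t where t: "2 * b + 1 = int p * t" by (rule dvdE)
    have "int p * t > 0" "int p * t < int p * 2" using b(1,2) unfolding t[symmetric] by auto
    then have "t > 0" "t < 2" using p_gt2 by (auto simp: zero_less_mult_iff)
    then have "t = 1" by simp
    then show "b \<in> {int n}" using t p_n(1) by simp
  next
    fix b assume "b \<in> {int n}"
    then have b: "b = int n" by simp
    have "2 * b + 1 = int p" using b p_n(1) by simp
    then have "int p dvd 4 * nf b" unfolding four_nf by (simp add: power2_eq_square)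
    moreover have "coprime (int p) 4"
    proof -
      have "coprime (int p) 2" using odd_p by simp
      then have "coprime (int p) (2 * 2)" by (simp only: coprime_mult_right_iff)
      then show ?thesis by simp
    qed
    ultimately have "int p dvd nf b" by (simp add: coprime_dvd_mult_right_iff)
    then show "b \<in> Sol p" using b p_n(1) by (simp add: Sol_def)
  qed
  then show ?thesis by (simp add: \<rho>_def)
qed

text \<open>If p^2 divided nf b, it would divide (2 b + 1)^2 and hence p = (2 b + 1)^2 - 4 nf
  b.\<close>

lemma rho_p_power: "\<rho> (p ^ Suc (Suc k)) = 0"
proof -
  have "Sol (p ^ Suc (Suc k)) = {}"
  proof -
    have "False" if "b \<in> Sol (p ^ Suc (Suc k))" for b
    proof -
      have "int p * int p * int p ^ k dvd nf b" using that by (simp add: Sol_def mult.assoc)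
      then have pp: "int p * int p dvd nf b" by (rule dvd_mult_left)
      then have "int p dvd 2 * b + 1" using p_dvd_2b1 dvd_mult_left by blast
      then have "int p * int p dvd (2 * b + 1)\<^sup>2" unfolding power2_eq_square by (intro mult_dvd_mono)
      then have "int p * int p dvd (2 * b + 1)\<^sup>2 - 4 * nf b" using pp by (intro dvd_diff) auto
      then have "int p * int p dvd int p" using four_nf[of b] by simp
      then have "int p * int p \<le> int p" using p_gt2 by (intro zdvd_imp_le) auto
      then show False using p_gt2 by (simp add: mult_le_cancel_left1)
    qed
    then show ?thesis by blast
  qed
  then show ?thesis by (simp add: \<rho>_def)
qed

section \<open>Ideal numbers as divisor sums of the Legendre symbol, and their density\<close>

definition sum_c_divisors :: "nat \<Rightarrow> int" where "sum_c_divisors m = (\<Sum>e | e dvd m. c (int e))"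

lemma sum_c_divisors_mult: "coprime a b \<Longrightarrow> a > 0 \<Longrightarrow> b > 0 \<Longrightarrow> sum_c_divisors (a * b) = sum_c_divisors a * sum_c_divisors b"
  unfolding sum_c_divisors_def by (rule sum_divisors_coprime_mult) (simp_all add: c_mult)

lemma c_power: "c (a ^ k) = c a ^ k"
  by (induction k) (auto simp: c_mult)

lemma sum_c_divisors_prime_power:
  assumes "prime q"
  shows "sum_c_divisors (q ^ k) = (\<Sum>i\<le>k. c (int q) ^ i)"
proof -
  have "{e. e dvd q ^ k} = (\<lambda>i. q ^ i) ` {..k}" using divides_primepow_nat[OF assms] by auto
  moreover have "inj_on (\<lambda>i. q ^ i) {..k}" using prime_gt_1_nat[OF assms] by (auto simp: inj_on_def)
  ultimately show ?thesis unfolding sum_c_divisors_def by (simp add: sum.reindex c_power)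
qed

lemma num_ideals_prime_power:
  assumes "prime q"
  shows "num_ideals (q ^ k) = (\<Sum>i | 2 * i \<le> k. \<rho> (q ^ (k - 2 * i)))"
proof -
  have q1: "q > 1" using prime_gt_1_nat[OF assms] .
  have "{c. c\<^sup>2 dvd q ^ k} = (\<lambda>i. q ^ i) ` {i. 2 * i \<le> k}"
  proof (intro equalityI subsetI)
    fix c assume "c \<in> {c. c\<^sup>2 dvd q ^ k}"
    then have c: "c\<^sup>2 dvd q ^ k" by simp
    have "c dvd c\<^sup>2" by (simp add: power2_eq_square)
    then have "c dvd q ^ k" using c by (rule dvd_trans)
    then obtain i where i: "c = q ^ i" using divides_primepow_nat[OF assms] by blast
    have "q ^ (2 * i) dvd q ^ k" using c unfolding i by (simp only: power_mult[symmetric] mult.commute[of i 2])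
    then have "2 * i \<le> k" using q1 by (simp add: power_dvd_imp_le)
    then show "c \<in> (\<lambda>i. q ^ i) ` {i. 2 * i \<le> k}" using i by blast
  next
    fix c assume "c \<in> (\<lambda>i. q ^ i) ` {i. 2 * i \<le> k}"
    then obtain i where i: "c = q ^ i" "2 * i \<le> k" by blast
    then have "q ^ (2 * i) dvd q ^ k" by (simp add: le_imp_power_dvd)
    then show "c \<in> {c. c\<^sup>2 dvd q ^ k}" unfolding i by (simp only: mem_Collect_eq power_mult[symmetric] mult.commute[of i 2])
  qed
  moreover have "inj_on (\<lambda>i. q ^ i) {i. 2 * i \<le> k}" using q1 by (auto simp: inj_on_def)
  ultimately have "num_ideals (q ^ k) = (\<Sum>i | 2 * i \<le> k. \<rho> (q ^ k div (q ^ i)\<^sup>2))"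
    unfolding num_ideals_def by (simp add: sum.reindex)
  also have "\<dots> = (\<Sum>i | 2 * i \<le> k. \<rho> (q ^ (k - 2 * i)))"
  proof (intro sum.cong refl)
    fix i assume "i \<in> {i. 2 * i \<le> k}"
    then have "2 * i \<le> k" by simp
    then have "q ^ k div q ^ (2 * i) = q ^ (k - 2 * i)" using q1 by (simp add: power_diff)
    then show "\<rho> (q ^ k div (q ^ i)\<^sup>2) = \<rho> (q ^ (k - 2 * i))"
      by (simp only: power_mult[symmetric] mult.commute[of i 2])
  qed
  finally show ?thesis .
qed

text \<open>Separating the primitive ideals gives a recursion with step 2: raising the exponent from
  k to k + 2 adds \<rho> of the new prime power on the one side and the two highest powers of c q on
  the other. These agree for c q = 1, 0 and -1 alike.\<close>

lemma num_ideals_eq_prime_power: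
  assumes q: "prime q"
  shows "int (num_ideals (q ^ k)) = sum_c_divisors (q ^ k)"
proof (induction k rule: induct_nat_012)
  case 0
  have "{i. 2 * i \<le> (0::nat)} = {0}" by auto
  then show ?case unfolding num_ideals_prime_power[OF q] sum_c_divisors_prime_power[OF q] by simp
next
  case 1
  have "{i. 2 * i \<le> Suc 0} = {0}" by auto
  then have "int (num_ideals (q ^ Suc 0)) = int (\<rho> q)" unfolding num_ideals_prime_power[OF q] by simp
  moreover have "int (\<rho> q) = 1 + c (int q)"
    using rho_prime_power[OF q, of 0] rho_p c_eq_0_iff[of "int p"] by (cases "q = p") auto
  ultimately show ?case unfolding sum_c_divisors_prime_power[OF q] by simp
next
  case (ge2 k)
  have "{i. 2 * i \<le> Suc (Suc k)} = insert 0 (Suc ` {i. 2 * i \<le> k})"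
  proof (intro equalityI subsetI)
    fix i assume "i \<in> {i. 2 * i \<le> Suc (Suc k)}"
    then show "i \<in> insert 0 (Suc ` {i. 2 * i \<le> k})" by (cases i) auto
  qed auto
  moreover have "finite {i. 2 * i \<le> k}" by (rule finite_subset[of _ "{..k}"]) auto
  ultimately have "num_ideals (q ^ Suc (Suc k)) = \<rho> (q ^ Suc (Suc k)) + num_ideals (q ^ k)"
    unfolding num_ideals_prime_power[OF q] by (simp add: sum.reindex)
  moreover have "int (\<rho> (q ^ Suc (Suc k))) = c (int q) ^ Suc k + c (int q) ^ Suc (Suc k)"
  proof (cases "q = p")
    case True
    then show ?thesis using rho_p_power[of k] c_eq_0_iff[of "int p"] by simp
  next
    case False
    have "\<not> int p dvd int q" using prime_not_dvd[OF q False] by simp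
    then have "c (int q) = 1 \<or> c (int q) = - 1" using c_cases[of "int q"] c_eq_0_iff[of "int q"] by blast
    then show ?thesis unfolding rho_prime_power[OF q False] by auto
  qed
  ultimately show ?case using ge2(1) unfolding sum_c_divisors_prime_power[OF q] by simp
qed

text \<open>This is the factorization of the Dedekind zeta function into the Riemann zeta function
  and the L-series, in terms of coefficients. Both sides are multiplicative, so prime powers
  suffice.\<close>

lemma num_ideals_eq: "m > 0 \<Longrightarrow> int (num_ideals m) = sum_c_divisors m"
proof (induction m rule: less_induct)
  case (less m)
  show ?case
  proof (cases "m = 1")
    case True
    then show ?thesis using num_ideals_eq_prime_power[OF two_is_prime_nat, of 0] by simp
  next
    case False
    then obtain q where q: "prime q" "q dvd m" using prime_factor_nat by blast
    have "\<not> is_unit q" using q(1) not_prime_unit by blast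
    then obtain y where y: "m = q ^ multiplicity q m * y" "\<not> q dvd y"
      using multiplicity_decompose'[of m q] less.prems by blast
    define k where "k = multiplicity q m"
    have "k > 0" unfolding k_def using q less.prems by (simp add: prime_multiplicity_gt_zero_iff)
    have y0: "y > 0" using y less.prems by (cases y) auto
    have "q ^ k > 1" using prime_gt_1_nat[OF q(1)] \<open>k > 0\<close> by (rule one_less_power)
    then have "1 * y < q ^ k * y" using y0 by (intro mult_strict_right_mono)
    moreover have m: "m = q ^ k * y" using y(1) by (simp only: k_def)
    ultimately have "y < m" by (simp only: mult_1)
    have "coprime q y" using q(1) y(2) by (rule prime_imp_coprime)
    then have cop: "coprime (q ^ k) y" by simp
    have "int (num_ideals m) = int (num_ideals (q ^ k)) * int (num_ideals y)"
      unfolding m using num_ideals_mult[OF cop] y0 prime_gt_0_nat[OF q(1)] by simp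
    also have "\<dots> = sum_c_divisors (q ^ k) * sum_c_divisors y"
      using num_ideals_eq_prime_power[OF q(1)] less.IH[OF \<open>y < m\<close> y0] by simp
    also have "\<dots> = sum_c_divisors m"
      unfolding m using sum_c_divisors_mult[OF cop] y0 prime_gt_0_nat[OF q(1)] by simp
    finally show ?thesis .
  qed
qed

text \<open>The triple \<open>(a, b, e)\<close> stands for the ideal of norm \<open>a e\<^sup>2\<close> spanned by \<open>e a\<close> and \<open>e (b + w)\<close>, where
  \<open>w = (1 + \<surd>p) / 2\<close>; the norm of \<open>b + w\<close> is \<open>nf b\<close>.\<close>

definition triples :: "nat \<Rightarrow> (nat \<times> int \<times> nat) set" where
  "triples x = {(a, b, e). a > 0 \<and> e > 0 \<and> b \<in> Sol a \<and> a * e\<^sup>2 \<le> x}"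

lemma card_triples: "finite (triples x)" "card (triples x) = (\<Sum>m\<in>{1..x}. num_ideals m)"
proof -
  define S where "S = (SIGMA m:{1..x}. SIGMA e:{e. e\<^sup>2 dvd m}. Sol (m div e\<^sup>2))"
  have fin: "finite S" unfolding S_def using finite_sq_dvd by (intro finite_SigmaI) auto
  have bij: "bij_betw (\<lambda>(m, e, b). (m div e\<^sup>2, b, e)) S (triples x)"
  proof (rule bij_betw_byWitness[where f' = "\<lambda>(a, b, e). (a * e\<^sup>2, e, b)"])
    show "(\<lambda>(m, e, b). (m div e\<^sup>2, b, e)) ` S \<subseteq> triples x"
    proof safe
      fix m e b assume "(m, e, b) \<in> S"
      then have s: "1 \<le> m" "m \<le> x" "e\<^sup>2 dvd m" "b \<in> Sol (m div e\<^sup>2)" by (auto simp: S_def)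
      have "e > 0" using s by (cases e) auto
      moreover have "m div e\<^sup>2 > 0" using s by (intro div_pos_of_dvd) auto
      ultimately show "(m div e\<^sup>2, b, e) \<in> triples x" using s by (simp add: triples_def)
    qed
    show "(\<lambda>(a, b, e). (a * e\<^sup>2, e, b)) ` triples x \<subseteq> S"
      by (auto simp: triples_def S_def)
  qed (auto simp: S_def triples_def)
  show "finite (triples x)" using bij_betw_finite[OF bij] fin by simp
  have "card (triples x) = card S" using bij_betw_same_card[OF bij] by simp
  also have "\<dots> = (\<Sum>m\<in>{1..x}. num_ideals m)"
    unfolding S_def using finite_sq_dvd by (subst card_SigmaI) (auto intro!: finite_SigmaI sum.cong simp: num_ideals_def \<rho>_def)
  finally show "card (triples x) = (\<Sum>m\<in>{1..x}. num_ideals m)" .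
qed

lemma card_multiples: assumes "e > 0" shows "card {m \<in> {1..x}. e dvd m} = x div e"
proof -
  have "{m \<in> {1..x}. e dvd m} = (\<lambda>k. e * k) ` {1..x div e}"
  proof (intro equalityI subsetI)
    fix m assume "m \<in> {m \<in> {1..x}. e dvd m}"
    then obtain k where k: "m = e * k" "1 \<le> m" "m \<le> x" by (auto elim: dvdE)
    then have "k \<ge> 1" by (cases k) auto
    moreover have "k \<le> x div e" using k assms by (simp add: less_eq_div_iff_mult_less_eq mult.commute)
    ultimately show "m \<in> (\<lambda>k. e * k) ` {1..x div e}" using k by auto
  next
    fix m assume "m \<in> (\<lambda>k. e * k) ` {1..x div e}"
    then obtain k where "m = e * k" "k \<in> {1..x div e}" by (rule imageE)
    then have k: "m = e * k" "1 \<le> k" "k \<le> x div e" by auto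
    then have "k * e \<le> x" using assms by (simp add: less_eq_div_iff_mult_less_eq)
    then show "m \<in> {m \<in> {1..x}. e dvd m}" using k assms by (auto simp: mult.commute)
  qed
  moreover have "inj_on (\<lambda>k. e * k) {1..x div e}" using assms by (auto simp: inj_on_def)
  ultimately show ?thesis by (simp add: card_image)
qed

lemma card_triples_eq: "int (card (triples x)) = (\<Sum>e\<in>{1..x}. c (int e) * int (x div e))"
proof -
  have "int (card (triples x)) = (\<Sum>m\<in>{1..x}. sum_c_divisors m)"
    unfolding card_triples(2) of_nat_sum by (intro sum.cong refl num_ideals_eq) auto
  also have "\<dots> = (\<Sum>m\<in>{1..x}. \<Sum>e\<in>{1..x}. if e dvd m then c (int e) else 0)"
  proof (intro sum.cong refl)
    fix m assume m: "m \<in> {1..x}"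
    then have "{e. e dvd m} = {e\<in>{1..x}. e dvd m}" by (auto dest: dvd_imp_le intro: Nat.gr0I)
    then show "sum_c_divisors m = (\<Sum>e\<in>{1..x}. if e dvd m then c (int e) else 0)"
      unfolding sum_c_divisors_def by (simp only: sum.inter_filter[OF finite_atLeastAtMost])
  qed
  also have "\<dots> = (\<Sum>e\<in>{1..x}. \<Sum>m\<in>{1..x}. if e dvd m then c (int e) else 0)" by (rule sum.swap)
  also have "\<dots> = (\<Sum>e\<in>{1..x}. c (int e) * int (x div e))"
  proof (intro sum.cong refl)
    fix e assume "e \<in> {1..x}"
    then have "card {m \<in> {1..x}. e dvd m} = x div e" by (intro card_multiples) auto
    then show "(\<Sum>m\<in>{1..x}. if e dvd m then c (int e) else 0) = c (int e) * int (x div e)"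
      by (simp add: sum.If_cases Int_def)
  qed
  finally show ?thesis .
qed

text \<open>The sum of c(e) (x div e) is cut at a fixed D. Up to D each quotient differs from x / e
  by at most 1, an error of D in all. Beyond D the quotients decrease in e while the sums of
  \<open>c\<close> stay bounded, which leaves at most 2 p x / (D + 1).\<close>

lemma card_triples_asymp: "(\<lambda>x. real (card (triples x)) / real x) \<longlonglongrightarrow> L"
proof (rule LIMSEQ_I)
  fix \<epsilon> :: real assume \<epsilon>: "\<epsilon> > 0"
  define P where "P = (\<lambda>D. \<Sum>k<D. of_int (c (int (Suc k))) / real (Suc k))"
  have "P \<longlonglongrightarrow> L" unfolding P_def L_def by (rule summable_LIMSEQ[OF summable_L])
  then obtain D1 where D1: "\<And>D. D \<ge> D1 \<Longrightarrow> \<bar>P D - L\<bar> < \<epsilon> / 3"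
    using LIMSEQ_D[of P L "\<epsilon> / 3"] \<epsilon> by auto
  obtain D2 where D2: "6 * real p / \<epsilon> < real D2" using reals_Archimedean2 by blast
  define D where "D = max D1 D2"
  have D: "\<bar>P D - L\<bar> < \<epsilon> / 3" "2 * real p / real (Suc D) < \<epsilon> / 3"
  proof -
    show "\<bar>P D - L\<bar> < \<epsilon> / 3" by (rule D1) (simp add: D_def)
    have "6 * real p / \<epsilon> < real (Suc D)" using D2 by (simp add: D_def)
    then show "2 * real p / real (Suc D) < \<epsilon> / 3" using \<epsilon> by (simp add: field_simps del: of_nat_Suc)
  qed
  obtain X where X: "3 * real D / \<epsilon> < real X" using reals_Archimedean2 by blast
  show "\<exists>no. \<forall>x\<ge>no. norm (real (card (triples x)) / real x - L) < \<epsilon>"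
  proof (intro exI[of _ "max (Suc X) (Suc D)"] allI impI)
    fix x assume x: "max (Suc X) (Suc D) \<le> x"
    then have x0: "real x > 0" and xD: "D < x" and "real X < real x" by auto
    have xD': "real D / real x < \<epsilon> / 3"
    proof -
      have "3 * real D / \<epsilon> < real x" using X \<open>real X < real x\<close> by linarith
      then show ?thesis using \<epsilon> x0 by (simp add: field_simps)
    qed
    define b where "b = (\<lambda>k. real_of_int (c (int k)))"
    define w where "w = (\<lambda>k. real (x div k))"
    have "real (card (triples x)) = of_int (\<Sum>e\<in>{1..x}. c (int e) * int (x div e))"
      unfolding card_triples_eq[symmetric] by simp
    also have "\<dots> = (\<Sum>e\<in>{1..<Suc x}. b e * w e)"
      by (simp add: b_def w_def atLeastLessThanSuc_atLeastAtMost)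
    also have "\<dots> = (\<Sum>e\<in>{1..<Suc D}. b e * w e) + (\<Sum>e\<in>{Suc D..<Suc x}. b e * w e)"
      by (rule sum.atLeastLessThan_concat[symmetric]) (use xD in auto)
    finally have split: "real (card (triples x)) = (\<Sum>e\<in>{1..<Suc D}. b e * w e) + (\<Sum>e\<in>{Suc D..<Suc x}. b e * w e)" .
    have "\<bar>\<Sum>e\<in>{Suc D..<Suc x}. b e * w e\<bar> \<le> 2 * real p * w (Suc D)"
    proof (rule abel_summation_bound)
      show "\<bar>\<Sum>k\<in>{Suc D..<N}. b k\<bar> \<le> 2 * real p" for N unfolding b_def by (rule abs_sum_c_le)
      fix i j assume "Suc D \<le> i" "i \<le> j"
      then show "w j \<le> w i" unfolding w_def by (simp add: div_le_mono2)
    qed (simp add: w_def)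
    also have "\<dots> \<le> 2 * real p * (real x / real (Suc D))"
      unfolding w_def by (intro mult_left_mono of_nat_div_le_of_nat) auto
    finally have tail: "\<bar>\<Sum>e\<in>{Suc D..<Suc x}. b e * w e\<bar> \<le> real x * (2 * real p / real (Suc D))" by (simp add: field_simps)
    have head: "\<bar>(\<Sum>e\<in>{1..<Suc D}. b e * w e) - real x * P D\<bar> \<le> real D"
    proof -
      have "P D = (\<Sum>e\<in>{1..<Suc D}. b e / real e)"
        unfolding P_def b_def using sum.shift_bounds_Suc_ivl[of "\<lambda>e. of_int (c (int e)) / real e" 0 D]
        by (simp add: lessThan_atLeast0)
      then have "(\<Sum>e\<in>{1..<Suc D}. b e * w e) - real x * P D = (\<Sum>e\<in>{1..<Suc D}. b e * (w e - real x / real e))"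
        by (simp only: sum_distrib_left sum_subtractf[symmetric]) (intro sum.cong refl, simp add: right_diff_distrib)
      also have "\<bar>\<dots>\<bar> \<le> (\<Sum>e\<in>{1..<Suc D}. \<bar>b e * (w e - real x / real e)\<bar>)" by (rule sum_abs)
      also have "\<dots> \<le> (\<Sum>e\<in>{1..<Suc D}. 1)"
      proof (rule sum_mono)
        fix e assume "e \<in> {1..<Suc D}"
        have "\<bar>b e\<bar> \<le> 1" unfolding b_def using c_abs by (simp flip: of_int_abs)
        moreover have "\<bar>w e - real x / real e\<bar> \<le> 1"
        proof -
          have "w e = of_int \<lfloor>real x / real e\<rfloor>" unfolding w_def by (simp add: floor_divide_of_nat_eq)
          then show ?thesis by linarith
        qed
        ultimately show "\<bar>b e * (w e - real x / real e)\<bar> \<le> 1"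
          unfolding abs_mult by (intro mult_le_one) auto
      qed
      finally show ?thesis by simp
    qed
    have "real (card (triples x)) / real x - L =
        ((\<Sum>e\<in>{1..<Suc D}. b e * w e) - real x * P D) / real x + (\<Sum>e\<in>{Suc D..<Suc x}. b e * w e) / real x + (P D - L)"
      unfolding split using x0 by (simp add: field_simps)
    moreover have "\<bar>((\<Sum>e\<in>{1..<Suc D}. b e * w e) - real x * P D) / real x\<bar> \<le> real D / real x"
      unfolding abs_divide using head x0 by (simp add: divide_right_mono)
    moreover have "\<bar>(\<Sum>e\<in>{Suc D..<Suc x}. b e * w e) / real x\<bar> \<le> 2 * real p / real (Suc D)"
    proof -
      have "\<bar>T / real x\<bar> \<le> e" if "\<bar>T\<bar> \<le> real x * e" for T e
        using that x0 by (simp add: abs_divide field_simps)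
      then show ?thesis using tail .
    qed
    moreover have "\<bar>u + v + t\<bar> < \<epsilon>" if "\<bar>u\<bar> \<le> u'" "u' < \<epsilon> / 3" "\<bar>v\<bar> \<le> v'" "v' < \<epsilon> / 3" "\<bar>t\<bar> < \<epsilon> / 3"
      for u v t u' v' :: real using that by linarith
    ultimately show "norm (real (card (triples x)) / real x - L) < \<epsilon>"
      using D xD' unfolding real_norm_def by (simp only:)
  qed
qed

end

section \<open>The ring of integers and its ideals\<close>

text \<open>All powers of the denominator of r divide \<open>D\<close>; a denominator of at least 2
  would make them exceed \<open>D\<close>.\<close>

lemma rat_in_Ints_of_bounded_denominators:
  fixes r :: rat
  assumes D: "D > 0" and int: "\<And>k. of_int D * r ^ k \<in> \<int>"
  shows "r \<in> \<int>"
proof -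
  obtain u v where uv: "quotient_of r = (u, v)" by (cases "quotient_of r")
  have v0: "v > 0" and cop: "coprime u v" and r: "r = of_int u / of_int v"
    using quotient_of_denom_pos[OF uv] quotient_of_coprime[OF uv] quotient_of_div[OF uv] by auto
  have "v ^ k dvd D" for k
  proof -
    obtain m where "of_int D * r ^ k = of_int m" using int[of k] by (elim Ints_cases)
    then have "of_int D * of_int u ^ k = (of_int m * of_int v ^ k :: rat)"
      using v0 by (simp add: r power_divide divide_eq_eq)
    then have "of_int (D * u ^ k) = (of_int (m * v ^ k) :: rat)" by simp
    then have "D * u ^ k = m * v ^ k" by (simp only: of_int_eq_iff)
    then have "v ^ k dvd D * u ^ k" by simp
    moreover have "coprime (u ^ k) (v ^ k)" using cop by simp
    then have "coprime (v ^ k) (u ^ k)" by (rule coprime_commute[THEN iffD1])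
    ultimately show ?thesis by (simp only: coprime_dvd_mult_left_iff)
  qed
  from zdvd_imp_le[OF this[of "nat D"] D] have "v ^ nat D \<le> D" .
  have "v = 1"
  proof (rule ccontr)
    assume "v \<noteq> 1"
    then have "2 ^ nat D \<le> v ^ nat D" using v0 by (intro power_mono) auto
    moreover have "int (nat D) < 2 ^ nat D" by (rule of_nat_less_two_power)
    ultimately show False using \<open>v ^ nat D \<le> D\<close> D by simp
  qed
  then show ?thesis by (simp add: r)
qed

lemma ex_common_denominator:
  assumes "finite F"
  shows "\<exists>D::int. D > 0 \<and> (\<forall>r\<in>F. of_int D * (r :: rat) \<in> \<int>)"
  using assms
proof (induction F)
  case (insert x F)
  then obtain D where D: "D > 0" "\<And>r. r \<in> F \<Longrightarrow> of_int D * r \<in> \<int>" by blast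
  obtain u v where uv: "quotient_of x = (u, v)" by (cases "quotient_of x")
  have v0: "v > 0" and x: "x = of_int u / of_int v"
    using quotient_of_denom_pos[OF uv] quotient_of_div[OF uv] by auto
  have "of_int (D * v) * r \<in> \<int>" if "r \<in> insert x F" for r
  proof (cases "r = x")
    case True
    have "of_int (D * v) * r = of_int (D * u)" using v0 by (simp add: True x)
    then show ?thesis by (simp only: Ints_of_int)
  next
    case False
    have "of_int (D * v) * r = of_int v * (of_int D * r)" by simp
    moreover have "of_int D * r \<in> \<int>" using D(2)[of r] that False by blast
    ultimately show ?thesis by (simp only: Ints_mult Ints_of_int)
  qed
  then show ?case using D(1) v0 by (intro exI[of _ "D * v"]) auto
qed (auto intro: exI[of _ 1])

lemma rat_in_Ints_of_square:
  fixes r :: rat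
  assumes sq: "r * r = of_int M"
  shows "r \<in> \<int>"
proof -
  obtain D where D: "D > 0" "of_int D * r \<in> \<int>" using ex_common_denominator[of "{r}"] by auto
  have bd: "of_int D * r ^ k \<in> \<int> \<and> of_int D * r ^ Suc k \<in> \<int>" for k
  proof (induction k)
    case (Suc k)
    have "of_int D * r ^ Suc (Suc k) = (r * r) * (of_int D * r ^ k)" by (simp add: mult_ac)
    moreover have "of_int M * (of_int D * r ^ k) \<in> \<int>" using Suc by (blast intro: Ints_mult Ints_of_int)
    ultimately show ?case using Suc by (simp only: sq)
  qed (use D in simp)
  show ?thesis by (rule rat_in_Ints_of_bounded_denominators[OF D(1) conjunct1[OF bd]])
qed

section \<open>The integers of the quadratic field\<close>

context prime_5_mod_8 begin

definition sq :: real where "sq = sqrt (real p)"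

lemma sq_sq: "sq * sq = real p" and sq_pos: "sq > 0"
  using p_gt2 by (simp_all add: sq_def)

lemma square_ne_p: "k * k \<noteq> int p"
proof
  assume k: "k * k = int p"
  then have "int p dvd k * k" by simp
  then have "int p dvd k" using prime_dvd_multD[OF prime_int_p] by blast
  then have "int p * int p dvd int p" using k mult_dvd_mono by metis
  then have "int p * int p \<le> int p" using p_gt2 by (intro zdvd_imp_le) auto
  then show False using p_gt2 by (simp add: mult_le_cancel_left1)
qed

lemma sq_irrational: "sq \<notin> \<rat>"
proof
  assume "sq \<in> \<rat>"
  moreover have "algebraic_int sq" unfolding sq_def by (intro algebraic_int_sqrt int_imp_algebraic_int) auto
  ultimately have "sq \<in> \<int>" by (intro rational_algebraic_int_is_int)
  then obtain k where "sq = of_int k" by (elim Ints_cases)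
  then have "of_int (k * k) = (of_int (int p) :: real)" using sq_sq by simp
  then show False using square_ne_p by (simp only: of_int_eq_iff)
qed

lemma rat_sq_eq:
  assumes "of_rat a + of_rat b * sq = of_rat a' + of_rat b' * sq"
  shows "a = a' \<and> b = b'"
proof -
  have "b = b'"
  proof (rule ccontr)
    assume "b \<noteq> b'"
    then have "(of_rat (b - b') :: real) \<noteq> 0" by simp
    moreover have "of_rat (b - b') * sq = of_rat (a' - a)" using assms by (simp add: of_rat_diff algebra_simps)
    ultimately have "sq = of_rat (a' - a) / of_rat (b - b')" by (simp add: field_simps)
    also have "\<dots> = of_rat ((a' - a) / (b - b'))" by (simp only: of_rat_divide)
    finally show False using sq_irrational Rats_of_rat by metis
  qed
  then show ?thesis using assms by simp
qed

definition w :: real where "w = (1 + sq) / 2"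

definition el :: "int \<Rightarrow> int \<Rightarrow> real" where "el x y = of_int x + of_int y * w"

lemma w_sq: "w * w = w + of_int d"
proof -
  have "4 * (w * w) = 1 + 2 * sq + sq * sq" by (simp add: w_def field_simps)
  moreover have "real p = 4 * of_int d + 1" by (simp add: d_def p_eq)
  ultimately have "4 * (w * w) = 4 * (w + of_int d)" unfolding sq_sq by (simp add: w_def)
  then show ?thesis by simp
qed

lemma el_add: "el x y + el x' y' = el (x + x') (y + y')"
  and el_minus: "- el x y = el (- x) (- y)"
  by (simp_all add: el_def algebra_simps)

lemma el_mult: "el x y * el x' y' = el (x * x' + d * y * y') (x * y' + x' * y + y * y')"
proof -
  have "el x y * el x' y' = of_int (x * x') + of_int (x * y' + x' * y) * w + of_int (y * y') * (w * w)"
    by (simp add: el_def algebra_simps)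
  then show ?thesis by (simp add: w_sq el_def algebra_simps)
qed

lemma el_rat: "el x y = of_rat (of_int x + of_int y / 2) + of_rat (of_int y / 2) * sq"
proof -
  have r: "of_rat (of_int y / 2) = (of_int y / 2 :: real)" by (simp add: of_rat_divide)
  have "of_rat (of_int x + of_int y / 2) = (of_int x + of_int y / 2 :: real)"
    unfolding of_rat_add r by simp
  then show ?thesis unfolding r by (simp add: el_def w_def algebra_simps)
qed

lemma el_eq_iff: "el x y = el x' y' \<longleftrightarrow> x = x' \<and> y = y'"
proof
  assume eq: "el x y = el x' y'"
  from eq have "of_int x + of_int y / 2 = (of_int x' + of_int y' / 2 :: rat) \<and> of_int y / 2 = (of_int y' / 2 :: rat)"
    unfolding el_rat by (rule rat_sq_eq)
  then show "x = x' \<and> y = y'" by auto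
qed simp

lemma el_0 [simp]: "el 0 0 = 0" and el_1: "el 1 0 = 1" and el_int: "el x 0 = of_int x"
  by (simp_all add: el_def)

lemma el_eq_0_iff: "el x y = 0 \<longleftrightarrow> x = 0 \<and> y = 0"
  using el_eq_iff[of x y 0 0] by simp

definition N :: "int \<Rightarrow> int \<Rightarrow> int" where "N x y = x * x + x * y - d * y * y"

lemma el_norm: "el x y * el (x + y) (- y) = of_int (N x y)"
  unfolding el_mult N_def by (simp add: el_int[symmetric] el_eq_iff algebra_simps)

lemma four_N: "4 * N x y = (2 * x + y)\<^sup>2 - int p * y\<^sup>2"
  by (simp add: N_def d_def p_eq power2_eq_square algebra_simps)

lemma algebraic_int_el: "algebraic_int (el x y)"
proof -
  define f :: "int poly" where "f = [:N x y, - (2 * x + y), 1:]"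
  have "of_int (N x y) = el x y * (of_int (2 * x + y) - el x y)"
    unfolding el_norm[symmetric] by (simp add: el_def algebra_simps)
  then have "poly (map_poly of_int f) (el x y) = 0"
    by (simp add: f_def map_poly_pCons) (simp add: algebra_simps)
  moreover have "lead_coeff f = 1" by (simp add: f_def)
  ultimately show ?thesis unfolding algebraic_int_altdef_ipoly by (intro exI[of _ f]) simp
qed

text \<open>The minimal polynomial is avoided. By the monic equation for z, the coordinates
  \<open>P k\<close> and \<open>Q k\<close> of its powers satisfy an integral recursion and have a
  common denominator \<open>D\<close>. Hence the powers of the norm \<open>Nz\<close> and of the
  trace 2 A have bounded denominators, so both numbers are integers.\<close>

lemma algebraic_int_quad_imp_el:
  assumes z: "z = of_rat A + of_rat B * sq" and alg: "algebraic_int z"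
  shows "\<exists>x y. z = el x y"
proof -
  obtain f :: "int poly" where f: "poly (map_poly of_int f) z = 0" "lead_coeff f = 1"
    using alg unfolding algebraic_int_altdef_ipoly by blast
  define m where "m = degree f"
  have rel: "z ^ m = - (\<Sum>i<m. of_int (coeff f i) * z ^ i)"
  proof -
    have "0 = (\<Sum>i\<le>m. of_int (coeff f i) * z ^ i)" using f(1) by (simp add: poly_altdef m_def degree_map_poly coeff_map_poly)
    also have "\<dots> = (\<Sum>i<m. of_int (coeff f i) * z ^ i) + z ^ m"
      using f(2) by (simp add: lessThan_Suc_atMost[symmetric] m_def)
    finally show ?thesis by simp
  qed
  define PQ where "PQ = (\<lambda>k. ((\<lambda>(P, Q). (A * P + of_nat p * B * Q, A * Q + B * P)) ^^ k) (1, 0 :: rat))"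
  define P where "P = (\<lambda>k. fst (PQ k))"
  define Q where "Q = (\<lambda>k. snd (PQ k))"
  have rec: "P 0 = 1" "Q 0 = 0" "P (Suc k) = A * P k + of_nat p * B * Q k" "Q (Suc k) = A * Q k + B * P k" for k
    by (simp_all add: P_def Q_def PQ_def case_prod_unfold)
  have zk: "z ^ k = of_rat (P k) + of_rat (Q k) * sq" for k
  proof (induction k)
    case (Suc k)
    have "z ^ Suc k = (of_rat A + of_rat B * sq) * (of_rat (P k) + of_rat (Q k) * sq)" using Suc z by simp
    also have "\<dots> = of_rat A * of_rat (P k) + of_rat B * of_rat (Q k) * (sq * sq) + (of_rat A * of_rat (Q k) + of_rat B * of_rat (P k)) * sq"
      by (simp add: algebra_simps)
    finally show ?case unfolding sq_sq by (simp add: rec of_rat_add of_rat_mult algebra_simps)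
  qed (simp add: rec)
  have relP: "P (k + m) = - (\<Sum>i<m. of_int (coeff f i) * P (k + i)) \<and> Q (k + m) = - (\<Sum>i<m. of_int (coeff f i) * Q (k + i))" for k
  proof -
    have "z ^ (k + m) = - (\<Sum>i<m. of_int (coeff f i) * z ^ (k + i))"
      unfolding power_add rel by (simp add: sum_distrib_left mult_ac)
    also have "\<dots> = of_rat (- (\<Sum>i<m. of_int (coeff f i) * P (k + i))) + of_rat (- (\<Sum>i<m. of_int (coeff f i) * Q (k + i))) * sq"
      unfolding zk by (simp add: of_rat_minus of_rat_sum of_rat_mult sum_distrib_right sum.distrib distrib_left mult.assoc)
    finally show ?thesis unfolding zk by (rule rat_sq_eq)
  qed
  obtain D where D0: "D > 0" and D: "\<And>r. r \<in> P ` {..<m} \<union> Q ` {..<m} \<Longrightarrow> of_int D * r \<in> \<int>"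
    using ex_common_denominator[of "P ` {..<m} \<union> Q ` {..<m}"] by auto
  have DPQ: "of_int D * P k \<in> \<int> \<and> of_int D * Q k \<in> \<int>" for k
  proof (induction k rule: less_induct)
    case (less k)
    show ?case
    proof (cases "k < m")
      case True then show ?thesis using D by auto
    next
      case False
      then have k: "k = (k - m) + m" by simp
      have sm: "of_int D * - (\<Sum>i<m. of_int (coeff f i) * R (k - m + i)) = (\<Sum>i<m. of_int (- coeff f i) * (of_int D * R (k - m + i)))"
        for R :: "nat \<Rightarrow> rat" by (simp add: sum_distrib_left sum_negf mult_ac)
      have "of_int D * P k = (\<Sum>i<m. of_int (- coeff f i) * (of_int D * P (k - m + i)))"
        "of_int D * Q k = (\<Sum>i<m. of_int (- coeff f i) * (of_int D * Q (k - m + i)))"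
        using relP[of "k - m"] sm[of P] sm[of Q] k by simp_all
      moreover have "of_int (- coeff f i) * (of_int D * P (k - m + i)) \<in> \<int> \<and>
          of_int (- coeff f i) * (of_int D * Q (k - m + i)) \<in> \<int>" if "i \<in> {..<m}" for i
      proof -
        have "k - m + i < k" using that False by auto
        then have IH: "of_int D * P (k - m + i) \<in> \<int>" "of_int D * Q (k - m + i) \<in> \<int>"
          using less.IH[of "k - m + i"] by blast+
        show ?thesis by (intro conjI Ints_mult[OF Ints_of_int IH(1)] Ints_mult[OF Ints_of_int IH(2)])
      qed
      then have "(\<Sum>i<m. of_int (- coeff f i) * (of_int D * P (k - m + i))) \<in> \<int>"
        "(\<Sum>i<m. of_int (- coeff f i) * (of_int D * Q (k - m + i))) \<in> \<int>"
        by (intro Ints_sum; blast)+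
      ultimately show ?thesis by simp
    qed
  qed
  \<comment> \<open>The norm of z. Its powers are the norms of the powers of z, with denominators
    dividing D^2.\<close>
  define Nz where "Nz = A\<^sup>2 - of_nat p * B\<^sup>2"
  have Nzk: "Nz ^ k = (P k)\<^sup>2 - of_nat p * (Q k)\<^sup>2" for k
  proof (induction k)
    case (Suc k)
    have "Nz ^ Suc k = (A\<^sup>2 - of_nat p * B\<^sup>2) * ((P k)\<^sup>2 - of_nat p * (Q k)\<^sup>2)" using Suc by (simp add: Nz_def)
    then show ?case by (simp add: rec power2_eq_square algebra_simps)
  qed (simp add: rec)
  have DN: "of_int (D * D) * Nz ^ k = (of_int D * P k) * (of_int D * P k) - of_int (int p) * ((of_int D * Q k) * (of_int D * Q k))" for k
    unfolding Nzk by (simp add: power2_eq_square algebra_simps)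
  have DD: "of_int (D * D) * Nz ^ k \<in> \<int>" for k
  proof -
    obtain u v where uv: "of_int D * P k = of_int u" "of_int D * Q k = of_int v"
      using DPQ[of k] by (auto elim!: Ints_cases)
    have "of_int (D * D) * Nz ^ k = of_int (u * u - int p * (v * v))" unfolding DN uv by simp
    then show ?thesis by (simp only: Ints_of_int)
  qed
  have NzZ: "Nz \<in> \<int>" by (rule rat_in_Ints_of_bounded_denominators[OF mult_pos_pos[OF D0 D0] DD])
  \<comment> \<open>From z^2 = 2 A z - Nz. It lets powers of 2 A be absorbed into integral
    combinations of the \<open>P k\<close>, so that they inherit the denominator
    \<open>D\<close>.\<close>
  have PP: "2 * A * P (Suc k) = P (Suc (Suc k)) + Nz * P k" for k
    by (simp add: rec Nz_def power2_eq_square algebra_simps)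
  have SA: "of_int D * ((2 * A) ^ k * P j) \<in> \<int>" for k j
  proof (induction k arbitrary: j)
    case (Suc k)
    show ?case
    proof (cases j)
      case 0
      have "of_int D * ((2 * A) ^ Suc k * P j) = 2 * (of_int D * ((2 * A) ^ k * P 1))" by (simp add: 0 rec)
      then show ?thesis using Ints_mult[OF Ints_numeral Suc[of 1]] by (simp only:)
    next
      case (Suc i)
      have "of_int D * ((2 * A) ^ Suc k * P j) = of_int D * ((2 * A) ^ k * (2 * A * P (Suc i)))" by (simp add: Suc mult_ac)
      also have "\<dots> = of_int D * ((2 * A) ^ k * P (Suc (Suc i))) + Nz * (of_int D * ((2 * A) ^ k * P i))"
        unfolding PP by (simp add: algebra_simps)
      finally show ?thesis using Ints_add[OF Suc.IH Ints_mult[OF NzZ Suc.IH]] by (simp only:)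
    qed
  qed (simp only: power_0 mult_1 conjunct1[OF DPQ])
  have "of_int D * (2 * A) ^ k \<in> \<int>" for k
    using SA[of k 0] by (simp only: rec mult_1_right)
  then have "2 * A \<in> \<int>" by (rule rat_in_Ints_of_bounded_denominators[OF D0])
  then obtain s where s: "2 * A = of_int s" by (elim Ints_cases)
  obtain N0 where N0: "Nz = of_int N0" using NzZ by (elim Ints_cases)
  \<comment> \<open>The extra factor \<open>p\<close> makes the square an integer; it is removed
    below, as \<open>p\<close> divides the root t.\<close>
  have B2: "(2 * of_nat p * B)\<^sup>2 = of_int (int p * (s * s - 4 * N0))"
  proof -
    have "of_nat p * (2 * B)\<^sup>2 = (2 * A)\<^sup>2 - 4 * Nz" by (simp add: Nz_def power2_eq_square algebra_simps)
    then have "of_nat p * (of_nat p * (2 * B)\<^sup>2) = of_nat p * ((2 * A)\<^sup>2 - 4 * Nz)" by simp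
    then show ?thesis unfolding s N0 by (simp add: power2_eq_square mult_ac)
  qed
  then have "2 * of_nat p * B \<in> \<int>" unfolding power2_eq_square by (rule rat_in_Ints_of_square)
  then obtain t where t: "2 * of_nat p * B = of_int t" by (elim Ints_cases)
  have "of_int (t * t) = (of_int (int p * (s * s - 4 * N0)) :: rat)" using B2 unfolding t power2_eq_square by simp
  then have tt: "t * t = int p * (s * s - 4 * N0)" by (simp only: of_int_eq_iff)
  then have "int p dvd t * t" by simp
  then have "int p dvd t" using prime_dvd_multD[OF prime_int_p] by blast
  then obtain y where y: "t = int p * y" by (rule dvdE)
  have B: "2 * B = of_int y" using t p_gt2 by (simp add: y)
  have "int p * (int p * y * y) = int p * (s * s - 4 * N0)" using tt by (simp add: y mult_ac)
  then have sy: "s * s - int p * y * y = 4 * N0" using p_gt2 by simp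
  \<comment> \<open>Equal parity of s and y is what (s + y sqrt p) / 2 needs in order to be an
    integral combination of 1 and \<open>w\<close>.\<close>
  have "even (s * s - int p * y * y)" unfolding sy by simp
  then have "even (s - y)" using odd_p by simp
  then obtain x where x: "s - y = 2 * x" by (rule evenE)
  have "of_rat (2 * A) + of_rat (2 * B) * sq = (of_int s + of_int y * sq :: real)" unfolding s B by simp
  then have "2 * z = of_int s + of_int y * sq" by (simp add: z of_rat_mult algebra_simps)
  moreover have "of_int s = (2 * of_int x + of_int y :: real)" using x by linarith
  ultimately have "z = el x y" by (simp add: el_def w_def field_simps)
  then show ?thesis by blast
qed

abbreviation R where "R \<equiv> quad_integers p"

lemma carrier_R: "carrier R = {el x y |x y. True}"
proof
  show "carrier R \<subseteq> {el x y |x y. True}"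
  proof
    fix z assume "z \<in> carrier R"
    then have "algebraic_int z" "\<exists>A B. z = of_rat A + of_rat B * sq"
      by (auto simp: quad_integers_def quad_field_def sq_def)
    then show "z \<in> {el x y |x y. True}" using algebraic_int_quad_imp_el by blast
  qed
  show "{el x y |x y. True} \<subseteq> carrier R"
  proof
    fix z assume "z \<in> {el x y |x y. True}"
    then obtain x y where z: "z = el x y" by blast
    have "el x y \<in> quad_field p" using el_rat[of x y] unfolding quad_field_def sq_def by blast
    then show "z \<in> carrier R" using algebraic_int_el by (simp add: z quad_integers_def)
  qed
qed

lemma el_in_R [simp]: "el x y \<in> carrier R" by (auto simp: carrier_R)

lemma in_R_E: assumes "z \<in> carrier R" obtains x y where "z = el x y"
  using assms by (auto simp: carrier_R)

lemma R_simps [simp]: "\<one>\<^bsub>R\<^esub> = 1" "\<zero>\<^bsub>R\<^esub> = 0" "x \<oplus>\<^bsub>R\<^esub> y = x + y" "x \<otimes>\<^bsub>R\<^esub> y = x * y"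
  by (simp_all add: quad_integers_def)

lemma R_add: "\<lbrakk>x \<in> carrier R; y \<in> carrier R\<rbrakk> \<Longrightarrow> x + y \<in> carrier R"
  and R_mult: "\<lbrakk>x \<in> carrier R; y \<in> carrier R\<rbrakk> \<Longrightarrow> x * y \<in> carrier R"
  and R_minus: "x \<in> carrier R \<Longrightarrow> - x \<in> carrier R"
  by (auto elim!: in_R_E simp: el_add el_mult el_minus)

lemma R_0: "0 \<in> carrier R" and R_1: "1 \<in> carrier R" and R_int: "of_int k \<in> carrier R"
  using el_in_R[of 0 0] el_in_R[of 1 0] el_in_R[of k 0] unfolding el_int by simp_all

lemma cring_R: "cring R"
proof (rule cringI)
  show "abelian_group R"
  proof (rule abelian_groupI)
    fix x assume "x \<in> carrier R"
    then show "\<exists>y\<in>carrier R. y \<oplus>\<^bsub>R\<^esub> x = \<zero>\<^bsub>R\<^esub>" using R_minus by (intro bexI[of _ "- x"]) auto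
  qed (auto simp: R_add R_0)
  show "Group.comm_monoid R"
    by (rule comm_monoidI) (auto simp: R_mult R_1)
qed (auto simp: distrib_right)

lemma ideal_R_iff:
  "ideal I R \<longleftrightarrow> I \<subseteq> carrier R \<and> 0 \<in> I \<and> (\<forall>x\<in>I. \<forall>y\<in>I. x + y \<in> I) \<and> (\<forall>r\<in>carrier R. \<forall>x\<in>I. r * x \<in> I)"
proof
  assume "ideal I R"
  then interpret ideal I R .
  show "I \<subseteq> carrier R \<and> 0 \<in> I \<and> (\<forall>x\<in>I. \<forall>y\<in>I. x + y \<in> I) \<and> (\<forall>r\<in>carrier R. \<forall>x\<in>I. r * x \<in> I)"
  proof (intro conjI ballI)
    show "I \<subseteq> carrier R" by (rule additive_subgroup.a_subset[OF is_additive_subgroup])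
    show "0 \<in> I" using additive_subgroup.zero_closed[OF is_additive_subgroup] unfolding R_simps .
    show "x + y \<in> I" if "x \<in> I" "y \<in> I" for x y
      using additive_subgroup.a_closed[OF is_additive_subgroup that] unfolding R_simps .
    show "r * x \<in> I" if "r \<in> carrier R" "x \<in> I" for r x
      using I_l_closed[OF that(2,1)] unfolding R_simps .
  qed
next
  assume I: "I \<subseteq> carrier R \<and> 0 \<in> I \<and> (\<forall>x\<in>I. \<forall>y\<in>I. x + y \<in> I) \<and> (\<forall>r\<in>carrier R. \<forall>x\<in>I. r * x \<in> I)"
  interpret R: cring R by (rule cring_R)
  show "ideal I R"
  proof (rule idealI)
    show "ring R" by (rule R.ring_axioms)
    show "subgroup I (add_monoid R)"
    proof (rule group.subgroupI[OF R.a_group])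
      fix a assume a: "a \<in> I"
      have "inv\<^bsub>add_monoid R\<^esub> a = - a"
      proof -
        have "\<ominus>\<^bsub>R\<^esub> a = - a" using a I R_minus by (intro R.minus_equality) auto
        then show ?thesis by (simp add: a_inv_def)
      qed
      moreover have "of_int (- 1) * a \<in> I" using I a R_int by blast
      ultimately show "inv\<^bsub>add_monoid R\<^esub> a \<in> I" by simp
    qed (use I in auto)
    show "x \<otimes>\<^bsub>R\<^esub> a \<in> I" if "a \<in> I" "x \<in> carrier R" for a x using I that by simp
    show "a \<otimes>\<^bsub>R\<^esub> x \<in> I" if "a \<in> I" "x \<in> carrier R" for a x
    proof -
      have "x * a \<in> I" using I that by blast
      then show ?thesis by (simp add: mult.commute)
    qed
  qed
qed

section \<open>Normal form of the nonzero ideals\<close>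

definition Jset :: "nat \<times> int \<times> nat \<Rightarrow> real set" where
  "Jset = (\<lambda>(a, b, e). {el (int e * (m * int a + k * b)) (int e * k) |m k. True})"

definition valid :: "nat \<times> int \<times> nat \<Rightarrow> bool" where
  "valid = (\<lambda>(a, b, e). a > 0 \<and> e > 0 \<and> b \<in> Sol a)"

lemma el_in_Jset_iff: "el x y \<in> Jset (a, b, e) \<longleftrightarrow> (\<exists>m k. x = int e * (m * int a + k * b) \<and> y = int e * k)"
  by (auto simp: Jset_def el_eq_iff)

lemma odd_nf: "odd (nf b)"
  by (simp add: nf_def d_def)

lemma ideal_Jset:
  assumes "valid (a, b, e)"
  shows "Jset (a, b, e) \<in> nonzero_ideals R"
proof -
  have a: "a > 0" "e > 0" "int a dvd nf b" using assms by (auto simp: valid_def Sol_def)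
  obtain q where q: "nf b = int a * q" using a(3) by (rule dvdE)
  then have d: "d = b * b + b - int a * q" by (simp add: nf_def)
  have "ideal (Jset (a, b, e)) R"
    unfolding ideal_R_iff
  proof (intro conjI ballI)
    show "Jset (a, b, e) \<subseteq> carrier R" by (auto simp: Jset_def)
    have "el 0 0 \<in> Jset (a, b, e)" unfolding el_in_Jset_iff by (intro exI[of _ 0]) simp
    then show "0 \<in> Jset (a, b, e)" by simp
  next
    fix x y assume "x \<in> Jset (a, b, e)" "y \<in> Jset (a, b, e)"
    then obtain m k m' k' where xy: "x = el (int e * (m * int a + k * b)) (int e * k)"
      "y = el (int e * (m' * int a + k' * b)) (int e * k')" by (auto simp: Jset_def)
    show "x + y \<in> Jset (a, b, e)" unfolding xy el_add el_in_Jset_iff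
      by (intro exI[of _ "m + m'"] exI[of _ "k + k'"]) (simp add: algebra_simps)
  next
    fix r x assume "r \<in> carrier R" "x \<in> Jset (a, b, e)"
    then obtain u v m k where rx: "r = el u v" "x = el (int e * (m * int a + k * b)) (int e * k)"
      by (auto simp: Jset_def elim!: in_R_E)
    \<comment> \<open>The witnesses come from w a = a (b + w) - b a and w (b + w) = (b + 1) (b + w)
      - q a.\<close>
    show "r * x \<in> Jset (a, b, e)" unfolding rx el_mult el_in_Jset_iff
      by (intro exI[of _ "u * m - v * k * q - v * m * b"] exI[of _ "u * k + v * (m * int a + k * b) + v * k"])
        (simp add: d algebra_simps)
  qed
  moreover have "el (int e * int a) 0 \<in> Jset (a, b, e)" unfolding el_in_Jset_iff
    by (intro exI[of _ 1] exI[of _ 0]) simp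
  moreover have "el (int e * int a) 0 \<noteq> 0" using a by (simp add: el_eq_0_iff)
  ultimately show ?thesis by (auto simp: nonzero_ideals_def)
qed

text \<open>A Hermite normal form: e is the least positive w-coordinate in the ideal, A the least
  positive integer in it. Closure under multiplication by \<open>w\<close> then forces that e
  divides everything and that a = A / e divides nf b.\<close>

lemma ideal_imp_Jset:
  assumes "I \<in> nonzero_ideals R"
  shows "\<exists>t. valid t \<and> I = Jset t"
proof -
  have id: "ideal I R" and nz: "I \<noteq> {0}" using assms by (auto simp: nonzero_ideals_def)
  have sub: "I \<subseteq> carrier R" and I0: "0 \<in> I" and add: "\<And>x y. x \<in> I \<Longrightarrow> y \<in> I \<Longrightarrow> x + y \<in> I"
    and mult: "\<And>r x. r \<in> carrier R \<Longrightarrow> x \<in> I \<Longrightarrow> r * x \<in> I"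
    using id unfolding ideal_R_iff by blast+
  have lin: "el (u * x + v * x') (u * y + v * y') \<in> I" if "el x y \<in> I" "el x' y' \<in> I" for u v x y x' y'
  proof -
    have "of_int u * el x y + of_int v * el x' y' \<in> I" using that by (intro add mult R_int)
    then show ?thesis by (simp add: el_def algebra_simps)
  qed
  have wI: "el (d * y) (x + y) \<in> I" if "el x y \<in> I" for x y
    using mult[OF el_in_R[of 0 1] that] unfolding el_mult by simp
  obtain z where "z \<in> I" "z \<noteq> 0" using nz I0 by blast
  then obtain x1 y1 where xy1: "el x1 y1 \<in> I" "x1 \<noteq> 0 \<or> y1 \<noteq> 0"
    using sub by (auto simp: carrier_R el_eq_0_iff)
  have "\<exists>x y. el x y \<in> I \<and> y \<noteq> 0"
  proof (cases "y1 = 0")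
    case True
    then show ?thesis using wI[OF xy1(1)] xy1(2) by auto
  qed (use xy1 in auto)
  then obtain x2 y2 where "el x2 y2 \<in> I" "y2 \<noteq> 0" by blast
  then have "\<exists>e>0. \<exists>x. el x (int e) \<in> I"
  proof (cases "y2 > 0")
    case True
    then show ?thesis using \<open>el x2 y2 \<in> I\<close> by (intro exI[of _ "nat y2"]) auto
  next
    case False
    then have "el (- x2) (int (nat (- y2))) \<in> I" using lin[OF \<open>el x2 y2 \<in> I\<close> \<open>el x2 y2 \<in> I\<close>, of "- 1" 0] by simp
    then show ?thesis using False \<open>y2 \<noteq> 0\<close> by (intro exI[of _ "nat (- y2)"]) auto
  qed
  define e where "e = (LEAST e. e > 0 \<and> (\<exists>x. el x (int e) \<in> I))"
  have eI: "e > 0 \<and> (\<exists>x. el x (int e) \<in> I)" unfolding e_def by (rule LeastI_ex) fact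
  then obtain B where e0: "e > 0" and B: "el B (int e) \<in> I" by blast
  have e_dvd: "int e dvd y" if xy: "el x y \<in> I" for x y
  proof (rule ccontr)
    assume "\<not> int e dvd y"
    then have "y mod int e \<noteq> 0" by (simp add: dvd_eq_mod_eq_0)
    moreover have "y mod int e \<ge> 0" "y mod int e < int e" using e0 by simp_all
    ultimately have m: "y mod int e > 0" "y mod int e < int e" by linarith+
    have md: "1 * y + (- (y div int e)) * int e = y mod int e"
      using div_mult_mod_eq[of y "int e"] by (simp only: mult_1 mult_minus_left)
    have "el (1 * x + (- (y div int e)) * B) (y mod int e) \<in> I"
      using lin[OF xy B, of 1 "- (y div int e)"] unfolding md .
    then have "nat (y mod int e) > 0 \<and> (\<exists>x. el x (int (nat (y mod int e))) \<in> I)" using m by auto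
    then have "e \<le> nat (y mod int e)" unfolding e_def by (rule Least_le)
    then show False using m by linarith
  qed
  obtain B1 where B1: "B = int e * B1"
  proof -
    have "int e dvd B + int e" using e_dvd[OF wI[OF B]] .
    then have "int e dvd B" by simp
    then show ?thesis using that by (auto elim: dvdE)
  qed
  \<comment> \<open>This is e (B1 + w) times the conjugate B1 + 1 - w of B1 + w: a multiple of the
    norm, hence free of w.\<close>
  have nfI: "el (int e * nf B1) 0 \<in> I"
    using lin[OF wI[OF B] B, of "- 1" "B1 + 1"] by (simp add: B1 nf_def algebra_simps)
  have "\<exists>A>0. el (int A) 0 \<in> I"
  proof (intro exI[of _ "nat \<bar>int e * nf B1\<bar>"] conjI)
    have "nf B1 \<noteq> 0" using odd_nf[of B1] by auto
    then show "nat \<bar>int e * nf B1\<bar> > 0" using e0 by simp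
    have "int (nat \<bar>int e * nf B1\<bar>) = int e * nf B1 \<or> int (nat \<bar>int e * nf B1\<bar>) = - (int e * nf B1)"
      by linarith
    moreover have "el (- (int e * nf B1)) 0 \<in> I" using lin[OF nfI nfI, of "- 1" 0] by simp
    ultimately show "el (int (nat \<bar>int e * nf B1\<bar>)) 0 \<in> I" using nfI by (elim disjE) (simp_all only:)
  qed
  define A where "A = (LEAST A. A > 0 \<and> el (int A) 0 \<in> I)"
  have A: "A > 0 \<and> el (int A) 0 \<in> I" unfolding A_def by (rule LeastI_ex) fact
  have A_dvd: "int A dvd x" if x: "el x 0 \<in> I" for x
  proof (rule ccontr)
    assume "\<not> int A dvd x"
    then have "x mod int A \<noteq> 0" by (simp add: dvd_eq_mod_eq_0)
    moreover have "x mod int A \<ge> 0" "x mod int A < int A" using A by simp_all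
    ultimately have m: "x mod int A > 0" "x mod int A < int A" by linarith+
    have md: "1 * x + (- (x div int A)) * int A = x mod int A"
      using div_mult_mod_eq[of x "int A"] by (simp only: mult_1 mult_minus_left)
    have "el (x mod int A) (1 * 0 + (- (x div int A)) * 0) \<in> I"
      using lin[OF x conjunct2[OF A], of 1 "- (x div int A)"] unfolding md .
    then have "nat (x mod int A) > 0 \<and> el (int (nat (x mod int A))) 0 \<in> I" using m by simp
    then have "A \<le> nat (x mod int A)" unfolding A_def by (rule Least_le)
    then show False using m by linarith
  qed
  have "int e dvd int A" using e_dvd[OF wI[OF conjunct2[OF A]]] by simp
  then have "e dvd A" by simp
  then obtain a where a: "A = e * a" by (rule dvdE)
  have a0: "a > 0" using A a by (cases a) auto
  define b where "b = B1 mod int a"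
  have bB: "b = B1 - (B1 div int a) * int a" by (simp add: b_def minus_div_mult_eq_mod)
  have be: "el (int e * b) (int e) \<in> I"
    using lin[OF B conjunct2[OF A], of 1 "- (B1 div int a)"] by (simp add: B1 a bB algebra_simps)
  have rep: "\<exists>m k. x = int e * (m * int a + k * b) \<and> y = int e * k" if xy: "el x y \<in> I" for x y
  proof -
    obtain k where k: "y = int e * k" using e_dvd[OF xy] by (rule dvdE)
    have "el (x - k * (int e * b)) 0 \<in> I" using lin[OF xy be, of 1 "- k"] by (simp add: k mult.commute)
    then have "int A dvd x - k * (int e * b)" by (rule A_dvd)
    then obtain m where "x - k * (int e * b) = int A * m" by (rule dvdE)
    then have "x = int e * (m * int a + k * b)" by (simp add: a algebra_simps)
    then show ?thesis using k by blast
  qed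
  have IJ: "I = Jset (a, b, e)"
  proof
    show "I \<subseteq> Jset (a, b, e)"
    proof
      fix z assume z: "z \<in> I"
      then obtain x y where xy: "z = el x y" using sub by (auto simp: carrier_R)
      show "z \<in> Jset (a, b, e)" using rep[of x y] z unfolding xy el_in_Jset_iff by blast
    qed
    show "Jset (a, b, e) \<subseteq> I"
    proof
      fix z assume "z \<in> Jset (a, b, e)"
      then obtain m k where z: "z = el (int e * (m * int a + k * b)) (int e * k)" by (auto simp: Jset_def)
      show "z \<in> I" using lin[OF conjunct2[OF A] be, of m k] by (simp add: z a algebra_simps)
    qed
  qed
  have "int a dvd nf b"
  proof -
    \<comment> \<open>The generator e (b + w) is multiplied by \<open>w\<close> and written in the
      basis again; comparing coordinates exhibits nf b as a multiple of a.\<close>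
    from rep[OF wI[OF be]] obtain m k where mk: "d * int e = int e * (m * int a + k * b)" "int e * b + int e = int e * k" by blast
    have "int e * k = int e * (b + 1)" using mk(2) by (simp add: algebra_simps)
    then have "k = b + 1" using e0 by simp
    moreover have "int e * d = int e * (m * int a + k * b)" using mk(1) by (simp add: mult.commute)
    then have "d = m * int a + k * b" using e0 by simp
    ultimately have "nf b = int a * (- m)" by (simp add: nf_def algebra_simps)
    then show ?thesis by simp
  qed
  moreover have "0 \<le> b" "b < int a" using a0 by (auto simp: b_def)
  ultimately have "valid (a, b, e)" using a0 e0 by (simp add: valid_def Sol_def)
  then show ?thesis using IJ by blast
qed

text \<open>The ideal determines its data: e generates the w-coordinates, e a generates the integers
  in it, and b is fixed modulo a and reduced.\<close>

lemma inj_Jset: assumes "valid t" "valid t'" "Jset t = Jset t'" shows "t = t'"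
proof -
  obtain a b e where t: "t = (a, b, e)" by (cases t)
  obtain a' b' e' where t': "t' = (a', b', e')" by (cases t')
  have v: "a > 0" "e > 0" "0 \<le> b" "b < int a" "a' > 0" "e' > 0" "0 \<le> b'" "b' < int a'"
    using assms(1,2) by (auto simp: t t' valid_def Sol_def)
  have main: "e' dvd e \<and> (e = e' \<longrightarrow> a' dvd a \<and> [b = b'] (mod int a'))"
    if J: "Jset (a, b, e) \<subseteq> Jset (a', b', e')" and e0: "e > 0" for a b e a' b' e'
  proof -
    have "el (int e * b) (int e) \<in> Jset (a, b, e)" unfolding el_in_Jset_iff by (intro exI[of _ 0] exI[of _ 1]) simp
    then obtain m k where mk: "int e * b = int e' * (m * int a' + k * b')" "int e = int e' * k"
      using J el_in_Jset_iff by blast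
    have "el (int e * int a) 0 \<in> Jset (a, b, e)" unfolding el_in_Jset_iff by (intro exI[of _ 1] exI[of _ 0]) simp
    then obtain m' k' where mk': "int e * int a = int e' * (m' * int a' + k' * b')" "0 = int e' * k'"
      using J el_in_Jset_iff by blast
    have "int e' dvd int e" using mk(2) by simp
    then have 1: "e' dvd e" by simp
    have 2: "a' dvd a \<and> [b = b'] (mod int a')" if "e = e'"
    proof -
      have "k = 1" using mk(2) e0 that by simp
      then have "b = m * int a' + b'" using mk(1) e0 that by simp
      then have "[b = b'] (mod int a')" by (simp add: cong_iff_dvd_diff)
      moreover have "k' = 0" using mk'(2) e0 that by simp
      then have "int a = m' * int a'" using mk'(1) e0 that by simp
      then have "int a' dvd int a" by simp
      then have "a' dvd a" by simp
      ultimately show ?thesis by blast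
    qed
    show ?thesis using 1 2 by blast
  qed
  have J: "Jset (a, b, e) = Jset (a', b', e')" using assms(3) by (simp add: t t')
  have ee: "e = e'" using main[of a b e a' b' e'] main[of a' b' e' a b e] J v by (auto intro: dvd_antisym)
  then have "a' dvd a" "a dvd a'" "[b = b'] (mod int a')"
    using main[of a b e a' b' e'] main[of a' b' e' a b e] J v by auto
  then have "a = a'" by (auto intro: dvd_antisym)
  moreover have "b = b'" using \<open>[b = b'] (mod int a')\<close> v \<open>a = a'\<close> by (simp add: Cong.cong_def)
  ultimately show ?thesis using ee by (simp add: t t')
qed

end

section \<open>Lattice points in a hyperbolic sector\<close>

text \<open>\<open>f t\<close> is the height at t of the region between the line s = C q t and the
  hyperbola s^2 = 4 X + q^2 t^2, and \<tau> is where they meet. As \<open>f\<close> decreases, the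
  sum differs from the area by boundary terms only.\<close>

lemma hyperbola_sum_bounds:
  fixes q C X :: real
  assumes q: "q > 0" and C: "C > 1" and X: "X > 0"
  defines "f \<equiv> (\<lambda>t. sqrt (4 * X + (q * t)\<^sup>2) - C * q * t)"
  defines "\<tau> \<equiv> 2 * sqrt X / (q * sqrt (C\<^sup>2 - 1))"
  shows "\<And>t. t \<ge> 0 \<Longrightarrow> 0 \<le> f t \<longleftrightarrow> t \<le> \<tau>"
    and "\<bar>(\<Sum>k\<le>nat \<lfloor>\<tau>\<rfloor>. f (real k)) - X * ln ((C + 1) / (C - 1)) / q\<bar> \<le> C * q + 2 * sqrt X"
proof -
  define g where "g = (\<lambda>t. sqrt (4 * X + (q * t)\<^sup>2))"
  \<comment> \<open>A primitive of \<open>f\<close>, as checked in \<open>dF\<close>.\<close>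
  define F where "F = (\<lambda>t. t * g t / 2 + 2 * X / q * ln (q * t + g t) - C * q * t\<^sup>2 / 2)"
  have C2: "C\<^sup>2 - 1 > 0" using C by (simp add: power_gt1_lemma power2_eq_square less_1_mult)
  have gpos: "g t > 0" and g2: "g t * g t = 4 * X + q * q * t * t" for t
  proof -
    have "4 * X + (q * t)\<^sup>2 > 0" using X by (intro add_pos_nonneg) auto
    then show "g t > 0" "g t * g t = 4 * X + q * q * t * t" by (simp_all add: g_def power2_eq_square mult_ac)
  qed
  have gq: "q * t \<le> g t" for t
    unfolding g_def using X by (intro real_le_rsqrt) simp
  have fg: "f t = g t - C * q * t" for t by (simp add: f_def g_def)
  have \<tau>pos: "\<tau> > 0" using q X C2 by (simp add: \<tau>_def)
  have \<tau>2: "q * q * (C\<^sup>2 - 1) * (\<tau> * \<tau>) = 4 * X"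
  proof -
    have "\<tau> * \<tau> = 4 * (sqrt X * sqrt X) / (q * q * (sqrt (C\<^sup>2 - 1) * sqrt (C\<^sup>2 - 1)))"
      by (simp add: \<tau>_def)
    also have "\<dots> = 4 * X / (q * q * (C\<^sup>2 - 1))" using X C2 by simp
    finally show ?thesis using q C2 by simp
  qed
  show nonneg: "0 \<le> f t \<longleftrightarrow> t \<le> \<tau>" if t: "t \<ge> 0" for t
  proof -
    have "0 \<le> f t \<longleftrightarrow> C * q * t \<le> g t" by (simp add: fg)
    also have "\<dots> \<longleftrightarrow> (C * q * t)\<^sup>2 \<le> (g t)\<^sup>2"
      using C q t gpos[of t] by (intro power_mono_iff[symmetric]) auto
    also have "\<dots> \<longleftrightarrow> q * q * (C\<^sup>2 - 1) * (t * t) \<le> 4 * X"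
      unfolding power2_eq_square g2 by (simp add: algebra_simps)
    also have "\<dots> \<longleftrightarrow> q * q * (C\<^sup>2 - 1) * (t * t) \<le> q * q * (C\<^sup>2 - 1) * (\<tau> * \<tau>)"
      unfolding \<tau>2 ..
    also have "\<dots> \<longleftrightarrow> t * t \<le> \<tau> * \<tau>" using q C2 by (intro mult_le_cancel_left_pos) simp
    also have "\<dots> \<longleftrightarrow> t \<le> \<tau>" unfolding power2_eq_square[symmetric] using t \<tau>pos by (intro power_mono_iff) auto
    finally show ?thesis .
  qed
  have g_lip: "g t \<le> g s + q * (t - s)" if "0 \<le> s" "s \<le> t" for s t
  proof -
    have "(g t)\<^sup>2 \<le> (g s + q * (t - s))\<^sup>2"
    proof -
      have "q * s * (q * (t - s)) \<le> g s * (q * (t - s))" using that q gq by (intro mult_right_mono) auto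
      then show ?thesis unfolding power2_eq_square distrib_left distrib_right g2 by (simp add: algebra_simps)
    qed
    moreover have "0 \<le> q * (t - s)" using q that by simp
    then have "0 \<le> g s + q * (t - s)" using gpos[of s] by linarith
    ultimately show ?thesis by (rule power2_le_imp_le)
  qed
  have g_mono: "g s \<le> g t" if "0 \<le> s" "s \<le> t" for s t
  proof -
    have "q * s \<le> q * t" "0 \<le> q * s" using q that by (simp_all add: mult_left_mono)
    then have "(q * s)\<^sup>2 \<le> (q * t)\<^sup>2" by (rule power_mono)
    then show ?thesis unfolding g_def by simp
  qed
  have f_anti: "f t \<le> f s" if "0 \<le> s" "s \<le> t" for s t
  proof -
    have "q * (t - s) \<le> C * q * (t - s)" using C q that by (intro mult_right_mono) auto
    then show ?thesis using g_lip[OF that] by (simp add: fg algebra_simps)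
  qed
  have dF: "(F has_real_derivative f t) (at t)" if t: "t \<ge> 0" for t
  proof -
    have dg: "(g has_real_derivative (q * q * t / g t)) (at t)"
    proof -
      have pos: "4 * X + (q * t)\<^sup>2 > 0" using X by (intro add_pos_nonneg) auto
      have "((\<lambda>t. 4 * X + (q * t)\<^sup>2) has_real_derivative 2 * (q * t) * q) (at t)"
        by (rule derivative_eq_intros refl | simp)+
      from DERIV_chain2[OF DERIV_real_sqrt[OF pos] this]
      have "(g has_real_derivative (inverse (sqrt (4 * X + (q * t)\<^sup>2)) / 2) * (2 * (q * t) * q)) (at t)"
        unfolding g_def .
      moreover have "sqrt (4 * X + (q * t)\<^sup>2) = g t" by (simp only: g_def)
      moreover have "(inverse (g t) / 2) * (2 * (q * t) * q) = q * q * t / g t"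
        using gpos[of t] by (simp add: field_simps)
      ultimately show ?thesis by simp
    qed
    have pos: "q * t + g t > 0" using gpos[of t] q t by (intro add_nonneg_pos) auto
    have dF0: "(F has_real_derivative ((1 * g t + q * q * t / g t * t) / 2 + 2 * X / q * ((q * 1 + q * q * t / g t) / (q * t + g t)) - C * q * (2 * t) / 2)) (at t)"
      unfolding F_def
    proof (intro DERIV_add DERIV_diff DERIV_cmult DERIV_cdivide)
      show "((\<lambda>t. t * g t) has_real_derivative 1 * g t + q * q * t / g t * t) (at t)"
        by (rule DERIV_mult[OF DERIV_ident dg])
      have "((\<lambda>t. q * t + g t) has_real_derivative q * 1 + q * q * t / g t) (at t)"
        by (intro DERIV_add DERIV_cmult DERIV_ident dg)
      from DERIV_chain2[OF DERIV_ln_divide[OF pos] this]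
      show "((\<lambda>t. ln (q * t + g t)) has_real_derivative (q * 1 + q * q * t / g t) / (q * t + g t)) (at t)" by simp
      show "(power2 has_real_derivative 2 * t) (at t)" using DERIV_pow[of 2 t] by simp
    qed
    have e1: "2 * X / q * ((q * 1 + q * q * t / g t) / (q * t + g t)) = 2 * X / g t"
    proof -
      have "2 * X / q * ((q * 1 + q * q * t / G) / (q * t + G)) = 2 * X / G" if "G > 0" "q * t + G > 0" for G
      proof -
        have "q * 1 + q * q * t / G = q * (q * t + G) / G" using that by (simp add: distrib_left add_divide_distrib mult.assoc)
        then have "2 * X / q * ((q * 1 + q * q * t / G) / (q * t + G)) = 2 * X / q * (q * (q * t + G) / G / (q * t + G))" by (simp only:)
        then show ?thesis using that q by simp
      qed
      then show ?thesis using pos gpos[of t] by blast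
    qed
    have e2: "(1 * g t + q * q * t / g t * t) / 2 + 2 * X / g t = g t"
    proof -
      have "(1 * G + q * q * t / G * t) / 2 + 2 * X / G = (G * G + q * q * t * t + 4 * X) / (2 * G)" if "G > 0" for G
      proof -
        have "4 * X / (2 * G) = 2 * X / G" "G * G / (2 * G) = G / 2" using that by simp_all
        then show ?thesis unfolding add_divide_distrib by (simp only: mult_1) (simp add: mult_ac)
      qed
      then have "(1 * g t + q * q * t / g t * t) / 2 + 2 * X / g t = (g t * g t + q * q * t * t + 4 * X) / (2 * g t)"
        using gpos[of t] by blast
      also have "\<dots> = (2 * (g t * g t)) / (2 * g t)" by (simp add: g2)
      finally show ?thesis using gpos[of t] by simp
    qed
    have "(1 * g t + q * q * t / g t * t) / 2 + 2 * X / q * ((q * 1 + q * q * t / g t) / (q * t + g t)) - C * q * (2 * t) / 2 = f t"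
      unfolding e1 e2 by (simp add: fg)
    from dF0[unfolded this] show ?thesis .
  qed
  have mvt: "\<exists>z. s < z \<and> z < t \<and> F t - F s = (t - s) * f z" if "0 \<le> s" "s < t" for s t
    using MVT2[OF that(2), of F f] dF that by auto
  have step: "f (t + 1) \<le> F (t + 1) - F t \<and> F (t + 1) - F t \<le> f t" if "0 \<le> t" for t
  proof -
    obtain z where "t < z" "z < t + 1" "F (t + 1) - F t = (t + 1 - t) * f z" using mvt[of t "t + 1"] \<open>0 \<le> t\<close> by auto
    then show ?thesis using f_anti[of t z] f_anti[of z "t + 1"] \<open>0 \<le> t\<close> by simp
  qed
  define K where "K = nat \<lfloor>\<tau>\<rfloor>"
  have K: "real K \<le> \<tau>" "\<tau> < real K + 1" using \<tau>pos unfolding K_def by linarith+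
  have lower: "F (real (Suc k)) - F 0 \<le> (\<Sum>j\<le>k. f (real j))" for k
  proof (induction k)
    case 0
    then show ?case using step[of 0] by simp
  next
    case (Suc k)
    then show ?case using step[of "real (Suc k)"] by (simp add: add.commute)
  qed
  have upper: "(\<Sum>j\<le>k. f (real j)) \<le> f 0 + (F (real k) - F 0)" for k
  proof (induction k)
    case (Suc k)
    then show ?case using step[of "real k"] by (simp add: add.commute)
  qed simp
  have FK: "F (real K) \<le> F \<tau>"
  proof (cases "real K = \<tau>")
    case False
    then obtain z where z: "real K < z" "z < \<tau>" "F \<tau> - F (real K) = (\<tau> - real K) * f z"
      using mvt[of "real K" \<tau>] K by auto
    moreover have "f z \<ge> 0" using nonneg[of z] z by auto
    ultimately have "F \<tau> - F (real K) \<ge> 0" using K by simp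
    then show ?thesis by simp
  qed simp
  \<comment> \<open>The last unit interval reaches beyond \<tau> by at most 1, where
    \<open>f\<close> is negative but not below - C q.\<close>
  have FK1: "F \<tau> - C * q \<le> F (real (Suc K))"
  proof -
    obtain z where z: "\<tau> < z" "z < real (Suc K)" "F (real (Suc K)) - F \<tau> = (real (Suc K) - \<tau>) * f z"
      using mvt[of \<tau> "real (Suc K)"] K \<tau>pos by auto
    have "f \<tau> \<ge> 0" using nonneg[of \<tau>] \<tau>pos by simp
    moreover have "f z \<ge> f \<tau> - C * q * (z - \<tau>)" using g_mono[of \<tau> z] z \<tau>pos by (simp add: fg algebra_simps)
    moreover have "C * q * (z - \<tau>) \<le> C * q * 1" using z K C q by (intro mult_left_mono) auto
    ultimately have fz: "f z \<ge> - (C * q)" by simp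
    have "(real (Suc K) - \<tau>) * f z \<ge> - (C * q)"
    proof (cases "f z \<ge> 0")
      case True
      then have "(real (Suc K) - \<tau>) * f z \<ge> 0" using K by simp
      moreover have "C * q > 0" using C q by simp
      ultimately show ?thesis by linarith
    next
      case False
      then have "(real (Suc K) - \<tau>) * (- f z) \<le> 1 * (- f z)" using K by (intro mult_right_mono) auto
      then show ?thesis using fz by simp
    qed
    then show ?thesis using z(3) by linarith
  qed
  \<comment> \<open>At \<tau> the root equals C q \<tau>, so the two algebraic terms of
    \<open>F\<close> cancel and only the logarithms remain.\<close>
  have main: "F \<tau> - F 0 = X * ln ((C + 1) / (C - 1)) / q"
  proof -
    have "f \<tau> = 0"
    proof (rule antisym)
      show "f \<tau> \<le> 0"
      proof (rule ccontr)
        assume "\<not> f \<tau> \<le> 0"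
        then have f0: "f \<tau> > 0" by simp
        define \<delta> where "\<delta> = f \<tau> / (C * q)"
        have \<delta>: "\<delta> > 0" using f0 C q by (simp add: \<delta>_def)
        have "f (\<tau> + \<delta>) \<ge> f \<tau> - C * q * \<delta>" using g_mono[of \<tau> "\<tau> + \<delta>"] \<delta> \<tau>pos by (simp add: fg algebra_simps)
        then have "f (\<tau> + \<delta>) \<ge> 0" using C q by (simp add: \<delta>_def)
        then show False using nonneg[of "\<tau> + \<delta>"] \<delta> \<tau>pos by simp
      qed
    qed (use nonneg[of \<tau>] \<tau>pos in simp)
    then have g\<tau>: "g \<tau> = C * q * \<tau>" by (simp add: fg)
    have "F \<tau> = 2 * X / q * ln (q * \<tau> * (C + 1))" unfolding F_def g\<tau> by (simp add: power2_eq_square algebra_simps)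
    moreover have "F 0 = 2 * X / q * ln (2 * sqrt X)" using X by (simp add: F_def g_def real_sqrt_mult)
    moreover have "ln (q * \<tau> * (C + 1)) - ln (2 * sqrt X) = ln (q * \<tau> * (C + 1) / (2 * sqrt X))"
      using q \<tau>pos C X by (intro ln_divide_pos[symmetric]) auto
    moreover have "q * \<tau> * (C + 1) / (2 * sqrt X) = sqrt ((C + 1) / (C - 1))"
    proof -
      have "sqrt (C\<^sup>2 - 1) = sqrt (C + 1) * sqrt (C - 1)"
        by (simp add: real_sqrt_mult[symmetric] power2_eq_square algebra_simps)
      moreover have "q * \<tau> * (C + 1) / (2 * sqrt X) = (C + 1) / sqrt (C\<^sup>2 - 1)"
        using q X by (simp add: \<tau>_def)
      moreover have "C + 1 = sqrt (C + 1) * sqrt (C + 1)" using C by simp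
      ultimately have "q * \<tau> * (C + 1) / (2 * sqrt X) = (sqrt (C + 1) * sqrt (C + 1)) / (sqrt (C + 1) * sqrt (C - 1))"
        by metis
      also have "\<dots> = sqrt (C + 1) / sqrt (C - 1)" using C by (intro mult_divide_mult_cancel_left) simp
      finally show ?thesis by (simp add: real_sqrt_divide)
    qed
    moreover have "ln (sqrt ((C + 1) / (C - 1))) = ln ((C + 1) / (C - 1)) / 2" using C by (intro ln_sqrt) auto
    ultimately have "F \<tau> - F 0 = 2 * X / q * (ln ((C + 1) / (C - 1)) / 2)" by (simp only: right_diff_distrib[symmetric])
    then show ?thesis by simp
  qed
  have f0: "f 0 = 2 * sqrt X" using X by (simp add: f_def real_sqrt_mult)
  have Cq: "C * q > 0" using C q by simp
  have sX: "sqrt X > 0" using X by simp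
  show "\<bar>(\<Sum>k\<le>nat \<lfloor>\<tau>\<rfloor>. f (real k)) - X * ln ((C + 1) / (C - 1)) / q\<bar> \<le> C * q + 2 * sqrt X"
    unfolding K_def[symmetric] main[symmetric]
    using lower[of K] upper[of K] FK FK1 f0 Cq sX by linarith
qed

lemma card_int_interval: "card {m :: int. u < of_int m \<and> of_int m \<le> v} = nat (\<lfloor>v\<rfloor> - \<lfloor>u\<rfloor>)"
  and finite_int_interval: "finite {m :: int. u < of_int m \<and> of_int m \<le> v}" for u v :: real
proof -
  have "{m :: int. u < of_int m \<and> of_int m \<le> v} = {\<lfloor>u\<rfloor>+1..\<lfloor>v\<rfloor>}"
    by (auto simp: le_floor_iff floor_less_iff less_le_trans) linarith+
  then show "card {m :: int. u < of_int m \<and> of_int m \<le> v} = nat (\<lfloor>v\<rfloor> - \<lfloor>u\<rfloor>)"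
    "finite {m :: int. u < of_int m \<and> of_int m \<le> v}" by simp_all
qed

text \<open>The points of a lattice in the \<open>(t, s)\<close>-plane below the hyperbola \<open>s\<^sup>2 - q\<^sup>2 t\<^sup>2 = 4 X\<close> and
  above the line \<open>s = C q t\<close>, counted along the lines of constant \<open>t\<close>.\<close>

lemma card_hyperbolic_sector:
  fixes q C x :: real and a :: nat and \<beta> :: int
  assumes q: "q > 0" and C: "C > 1" and a: "a > 0" and x: "x > 0"
  defines "T \<equiv> {(t :: int, m :: int). t \<ge> 0 \<and> C * q * of_int t < of_int (2 * int a * m - \<beta> * t) \<and>
      (of_int (2 * int a * m - \<beta> * t))\<^sup>2 - q\<^sup>2 * (of_int t)\<^sup>2 \<le> 4 * (real a * x)}"
  shows "finite T" and "\<bar>real (card T) - x * ln ((C + 1) / (C - 1)) / (2 * q)\<bar> \<le>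
    (2 * sqrt (real a * x) / (q * sqrt (C\<^sup>2 - 1)) + 1) + (C * q + 2 * sqrt (real a * x)) / (2 * real a)"
proof -
  define X where "X = real a * x"
  have X: "X > 0" using a x by (simp add: X_def)
  define f where "f = (\<lambda>t. sqrt (4 * X + (q * t)\<^sup>2) - C * q * t)"
  define \<tau> where "\<tau> = 2 * sqrt X / (q * sqrt (C\<^sup>2 - 1))"
  define K where "K = nat \<lfloor>\<tau>\<rfloor>"
  have hyp1: "0 \<le> f t \<longleftrightarrow> t \<le> \<tau>" if "t \<ge> 0" for t
    using hyperbola_sum_bounds(1)[OF q C X that] unfolding f_def \<tau>_def .
  have hyp2: "\<bar>(\<Sum>k\<le>K. f (real k)) - X * ln ((C + 1) / (C - 1)) / q\<bar> \<le> C * q + 2 * sqrt X"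
    using hyperbola_sum_bounds(2)[OF q C X] unfolding f_def \<tau>_def K_def .
  have C2: "C\<^sup>2 - 1 > 0" using C by (simp add: power2_eq_square less_1_mult)
  have \<tau>pos: "\<tau> > 0" using q X C2 by (simp add: \<tau>_def)
  have K: "real K \<le> \<tau>" "\<tau> < real K + 1" using \<tau>pos unfolding K_def by linarith+
  \<comment> \<open>On the line of constant t the bounds on s = 2 a m - \<beta> t are solved for
    m.\<close>
  define lo where "lo = (\<lambda>t::nat. (C * q * real t + of_int \<beta> * real t) / (2 * real a))"
  define hi where "hi = (\<lambda>t::nat. (sqrt (4 * X + (q * real t)\<^sup>2) + of_int \<beta> * real t) / (2 * real a))"
  define M where "M = (\<lambda>t. {m :: int. lo t < of_int m \<and> of_int m \<le> hi t})"
  have mem: "(int t, m) \<in> T \<longleftrightarrow> m \<in> M t" for t m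
  proof -
    define s where "s = real_of_int (2 * int a * m - \<beta> * int t)"
    have s: "s = 2 * real a * of_int m - of_int \<beta> * real t" by (simp add: s_def)
    have "(int t, m) \<in> T \<longleftrightarrow> C * q * real t < s \<and> s\<^sup>2 - q\<^sup>2 * (real t)\<^sup>2 \<le> 4 * X"
      by (simp add: T_def s_def X_def)
    also have "\<dots> \<longleftrightarrow> C * q * real t < s \<and> s \<le> sqrt (4 * X + (q * real t)\<^sup>2)"
    proof (rule conj_cong[OF refl])
      assume "C * q * real t < s"
      moreover have "C * q * real t \<ge> 0" using C q by simp
      ultimately have s0: "s \<ge> 0" by linarith
      have "s \<le> sqrt (4 * X + (q * real t)\<^sup>2) \<longleftrightarrow> s\<^sup>2 \<le> 4 * X + (q * real t)\<^sup>2"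
      proof
        assume "s \<le> sqrt (4 * X + (q * real t)\<^sup>2)"
        then have "s\<^sup>2 \<le> (sqrt (4 * X + (q * real t)\<^sup>2))\<^sup>2" using s0 by (intro power_mono)
        then show "s\<^sup>2 \<le> 4 * X + (q * real t)\<^sup>2" using X by simp
      qed (rule real_le_rsqrt)
      then show "s\<^sup>2 - q\<^sup>2 * (real t)\<^sup>2 \<le> 4 * X \<longleftrightarrow> s \<le> sqrt (4 * X + (q * real t)\<^sup>2)"
        by (simp add: power_mult_distrib algebra_simps)
    qed
    also have "C * q * real t < s \<longleftrightarrow> lo t < of_int m"
      unfolding s lo_def using a by (simp add: divide_less_eq algebra_simps)
    also have "s \<le> sqrt (4 * X + (q * real t)\<^sup>2) \<longleftrightarrow> of_int m \<le> hi t"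
      unfolding s hi_def using a by (simp add: le_divide_eq algebra_simps)
    finally show ?thesis by (simp add: M_def)
  qed
  have hilo: "hi t - lo t = f (real t) / (2 * real a)" for t
    by (simp add: hi_def lo_def f_def diff_divide_distrib[symmetric] algebra_simps)
  have M_empty: "M t = {}" if "t > K" for t
  proof -
    have "\<not> real t \<le> \<tau>" using that K by linarith
    then have "f (real t) < 0" using hyp1[of "real t"] by simp
    then have "f (real t) / (2 * real a) < 0" using a by (intro divide_neg_pos) auto
    then have "hi t < lo t" using hilo[of t] by linarith
    then show ?thesis by (auto simp: M_def)
  qed
  have TS: "T = (\<lambda>(t, m). (int t, m)) ` (SIGMA t:{..K}. M t)"
  proof (intro equalityI subsetI)
    fix y assume y: "y \<in> T"
    then obtain t m where ytm: "y = (t, m)" "t \<ge> 0" by (auto simp: T_def)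
    then have yt: "y = (int (nat t), m)" by simp
    then have "m \<in> M (nat t)" using mem y by blast
    moreover from this have "nat t \<le> K" using M_empty[of "nat t"] by (cases "nat t > K") auto
    ultimately show "y \<in> (\<lambda>(t, m). (int t, m)) ` (SIGMA t:{..K}. M t)" using yt by force
  next
    fix y assume "y \<in> (\<lambda>(t, m). (int t, m)) ` (SIGMA t:{..K}. M t)"
    then show "y \<in> T" using mem by auto
  qed
  have finM: "finite (M t)" for t unfolding M_def by (rule finite_int_interval)
  have finS: "finite (SIGMA t:{..K}. M t)" using finM by (intro finite_SigmaI) auto
  then show "finite T" unfolding TS by (rule finite_imageI)
  have "card T = card (SIGMA t:{..K}. M t)" unfolding TS
    by (rule card_image) (auto simp: inj_on_def)
  also have "\<dots> = (\<Sum>t\<le>K. card (M t))" using finM by (intro card_SigmaI) auto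
  finally have cT: "real (card T) = (\<Sum>t\<le>K. real (card (M t)))" by simp
  have cM: "\<bar>real (card (M t)) - f (real t) / (2 * real a)\<bar> \<le> 1" if "t \<le> K" for t
  proof -
    have "f (real t) \<ge> 0" using hyp1[of "real t"] that K by simp
    then have "f (real t) / (2 * real a) \<ge> 0" by simp
    then have "lo t \<le> hi t" using hilo[of t] by linarith
    then have "\<lfloor>lo t\<rfloor> \<le> \<lfloor>hi t\<rfloor>" by (rule floor_mono)
    then have "real (card (M t)) = of_int \<lfloor>hi t\<rfloor> - of_int \<lfloor>lo t\<rfloor>"
      unfolding M_def card_int_interval by simp
    then show ?thesis unfolding hilo[symmetric] by linarith
  qed
  have "\<bar>real (card T) - (\<Sum>t\<le>K. f (real t)) / (2 * real a)\<bar> = \<bar>\<Sum>t\<le>K. real (card (M t)) - f (real t) / (2 * real a)\<bar>"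
    unfolding cT by (simp add: sum_subtractf sum_divide_distrib)
  also have "\<dots> \<le> (\<Sum>t\<le>K. \<bar>real (card (M t)) - f (real t) / (2 * real a)\<bar>)" by (rule sum_abs)
  also have "\<dots> \<le> (\<Sum>t\<le>K. 1)" by (intro sum_mono cM) simp
  \<comment> \<open>There are at most \<tau> + 1 lines, each miscounted by at most 1.\<close>
  also have "\<dots> \<le> \<tau> + 1" using K by simp
  finally have e1: "\<bar>real (card T) - (\<Sum>t\<le>K. f (real t)) / (2 * real a)\<bar> \<le> \<tau> + 1" .
  have "\<bar>(\<Sum>t\<le>K. f (real t)) / (2 * real a) - (X * ln ((C + 1) / (C - 1)) / q) / (2 * real a)\<bar> \<le> (C * q + 2 * sqrt X) / (2 * real a)"
    unfolding diff_divide_distrib[symmetric] abs_divide using hyp2 a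
    by (simp add: divide_right_mono)
  moreover have "(X * ln ((C + 1) / (C - 1)) / q) / (2 * real a) = x * ln ((C + 1) / (C - 1)) / (2 * q)"
    using a by (simp add: X_def)
  ultimately have "\<bar>(\<Sum>t\<le>K. f (real t)) / (2 * real a) - x * ln ((C + 1) / (C - 1)) / (2 * q)\<bar> \<le> (C * q + 2 * sqrt X) / (2 * real a)"
    by simp
  with e1 show "\<bar>real (card T) - x * ln ((C + 1) / (C - 1)) / (2 * q)\<bar> \<le>
    (2 * sqrt (real a * x) / (q * sqrt (C\<^sup>2 - 1)) + 1) + (C * q + 2 * sqrt (real a * x)) / (2 * real a)"
    unfolding \<tau>_def X_def by linarith
qed

text \<open>The errors of \<open>card_hyperbolic_sector\<close> are of order sqrt x. The limit
  depends neither on a nor on \<beta>, which is why all ideal classes get the same density.\<close>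

lemma tendsto_card_hyperbolic_sector:
  fixes q C :: real and a :: nat and \<beta> :: int
  assumes q: "q > 0" and C: "C > 1" and a: "a > 0"
  defines "T \<equiv> (\<lambda>x::nat. {(t :: int, m :: int). t \<ge> 0 \<and> C * q * of_int t < of_int (2 * int a * m - \<beta> * t) \<and>
      (of_int (2 * int a * m - \<beta> * t))\<^sup>2 - q\<^sup>2 * (of_int t)\<^sup>2 \<le> 4 * (real a * real x)})"
  shows "(\<lambda>x. real (card (T x)) / real x) \<longlonglongrightarrow> ln ((C + 1) / (C - 1)) / (2 * q)"
proof -
  define l where "l = ln ((C + 1) / (C - 1)) / (2 * q)"
  define A where "A = 2 * sqrt (real a) / (q * sqrt (C\<^sup>2 - 1)) + 2 * sqrt (real a) / (2 * real a)"
  define B where "B = 1 + C * q / (2 * real a)"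
  have bound: "\<bar>real (card (T x)) / real x - l\<bar> \<le> (A * sqrt (real x) + B) / real x" if "x > 0" for x
  proof -
    have "\<bar>real (card (T x)) - real x * l\<bar> \<le> A * sqrt (real x) + B"
      using card_hyperbolic_sector(2)[OF q C a, of "real x" \<beta>] that
      by (simp add: T_def l_def A_def B_def real_sqrt_mult add_divide_distrib algebra_simps)
    then have "\<bar>real (card (T x)) - real x * l\<bar> / real x \<le> (A * sqrt (real x) + B) / real x"
      by (rule divide_right_mono) simp
    moreover have "\<bar>real (card (T x)) / real x - l\<bar> = \<bar>real (card (T x)) - real x * l\<bar> / real x"
    proof -
      have "real (card (T x)) / real x - l = (real (card (T x)) - real x * l) / real x"
        using that by (simp add: diff_divide_distrib)
      then show ?thesis by (simp add: abs_divide)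
    qed
    ultimately show ?thesis by simp
  qed
  have "(\<lambda>x. real (card (T x)) / real x - l) \<longlonglongrightarrow> 0"
  proof (rule tendsto_rabs_zero_cancel, rule tendsto_sandwich)
    show "\<forall>\<^sub>F x in sequentially. 0 \<le> \<bar>real (card (T x)) / real x - l\<bar>" by simp
    show "\<forall>\<^sub>F x in sequentially. \<bar>real (card (T x)) / real x - l\<bar> \<le> (A * sqrt (real x) + B) / real x"
      using eventually_gt_at_top[of 0] by eventually_elim (rule bound)
    show "(\<lambda>x::nat. 0::real) \<longlonglongrightarrow> 0" by simp
    show "(\<lambda>x. (A * sqrt (real x) + B) / real x) \<longlonglongrightarrow> 0" by real_asymp
  qed
  then show ?thesis unfolding l_def[symmetric] by (simp only: LIM_zero_iff)
qed

section \<open>Units\<close>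

lemma coprime_mult_square:
  fixes a b y :: int
  assumes "coprime a b" "a * b = y * y" "a > 0" "b > 0"
  shows "\<exists>k m. a = k * k \<and> b = m * m \<and> k > 0 \<and> m > 0"
proof -
  have "nat a * nat b = nat \<bar>y\<bar> * nat \<bar>y\<bar>"
    using assms(2-4) by (simp flip: nat_mult_distrib abs_mult)
  then have "is_nth_power 2 (nat a * nat b)" by (auto simp: is_nth_power_def power2_eq_square)
  moreover have "coprime (nat a) (nat b)"
  proof -
    have "coprime (int (nat a)) (int (nat b))" using assms by simp
    then show ?thesis by (simp only: coprime_int_iff)
  qed
  ultimately have "is_nth_power 2 (nat a)" "is_nth_power 2 (nat b)"
    using is_nth_power_mult_coprime_natD[of "nat a" "nat b" 2] assms(3,4) by auto
  then obtain k m where km: "nat a = k\<^sup>2" "nat b = m\<^sup>2" by (auto simp: is_nth_power_def)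
  have "a = int k * int k" "b = int m * int m"
    using km assms(3,4) by (simp_all add: power2_eq_square nat_eq_iff)
  moreover have "k > 0" "m > 0" using km assms(3,4) by (auto intro: Nat.gr0I)
  ultimately show ?thesis by (intro exI[of _ "int k"] exI[of _ "int m"]) auto
qed

context prime_5_mod_8 begin

text \<open>Conjugation, with w sent to 1 - w. It is a function on the reals for convenience and
  meaningful only on the ring, where coordinates are unique.\<close>

definition cj :: "real \<Rightarrow> real" where
  "cj z = (case (SOME (x, y). z = el x y) of (x, y) \<Rightarrow> el (x + y) (- y))"

lemma cj_el [simp]: "cj (el x y) = el (x + y) (- y)"
proof -
  have "(SOME (x', y'). el x y = el x' y') = (x, y)"
    by (rule some_equality) (auto simp: el_eq_iff)
  then show ?thesis by (simp add: cj_def)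
qed

lemma cj_R: "z \<in> carrier R \<Longrightarrow> cj z \<in> carrier R"
  by (auto elim!: in_R_E)

lemma cj_mult: "z \<in> carrier R \<Longrightarrow> z' \<in> carrier R \<Longrightarrow> cj (z * z') = cj z * cj z'"
  by (auto elim!: in_R_E simp: el_mult el_eq_iff algebra_simps)

lemma cj_1 [simp]: "cj 1 = 1"
  using cj_el[of 1 0] by (simp add: el_1)

lemma cj_minus: "z \<in> carrier R \<Longrightarrow> cj (- z) = - cj z"
  by (auto elim!: in_R_E simp: el_minus)

lemma el_half: "el x y = (of_int (2 * x + y) + of_int y * sq) / 2"
  by (simp add: el_def w_def field_simps)

lemma cj_half: "cj (el x y) = (of_int (2 * x + y) - of_int y * sq) / 2"
  by (simp only: cj_el) (simp add: el_def w_def field_simps)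

lemma N_eq_0_iff: "N x y = 0 \<longleftrightarrow> x = 0 \<and> y = 0"
proof
  assume "N x y = 0"
  then have "el x y * el (x + y) (- y) = 0" using el_norm[of x y] by simp
  then show "x = 0 \<and> y = 0" by (auto simp: el_eq_0_iff)
qed (simp add: N_def)

lemma Units_R: "u \<in> Units R \<longleftrightarrow> u \<in> carrier R \<and> (\<exists>v\<in>carrier R. u * v = 1)"
  by (auto simp: Units_def mult.commute)

lemma Units_norm:
  assumes "u \<in> Units R"
  shows "u * cj u = 1 \<or> u * cj u = - 1"
proof -
  obtain v where v: "u \<in> carrier R" "v \<in> carrier R" "u * v = 1" using assms by (auto simp: Units_R)
  obtain x y where u: "u = el x y" using v(1) by (rule in_R_E)
  obtain x' y' where v': "v = el x' y'" using v(2) by (rule in_R_E)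
  have "cj u * cj v = 1" using cj_mult[OF v(1,2)] v(3) by simp
  moreover have "(u * cj u) * (v * cj v) = (u * v) * (cj u * cj v)" by (simp only: mult_ac)
  ultimately have "(u * cj u) * (v * cj v) = 1" using v(3) by simp
  then have "of_int (N x y * N x' y') = (1 :: real)" unfolding u v' cj_el el_norm by simp
  then have "N x y * N x' y' = 1" by (simp only: of_int_eq_1_iff)
  then have "N x y = 1 \<or> N x y = - 1" by (auto simp: zmult_eq_1_iff)
  then show ?thesis unfolding u cj_el el_norm by auto
qed

lemma unit_of_norm:
  assumes "z \<in> carrier R" "z * cj z = 1 \<or> z * cj z = - 1"
  shows "z \<in> Units R"
proof -
  have "z * cj z = 1 \<or> z * (- cj z) = 1" using assms(2) by auto
  then show ?thesis using assms(1) cj_R[OF assms(1)] R_minus unfolding Units_R by blast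
qed

end

locale quad_unit = prime_5_mod_8 +
  fixes \<epsilon> :: real
  assumes fundamental: "quad_fundamental_unit p \<epsilon>"
begin

lemma eps_unit: "\<epsilon> \<in> Units R" and eps_gt_1: "\<epsilon> > 1"
  and unit_power: "\<And>\<eta>. \<eta> \<in> Units R \<Longrightarrow> \<exists>k::int. \<eta> = \<epsilon> powi k \<or> \<eta> = - (\<epsilon> powi k)"
  using fundamental by (auto simp: quad_fundamental_unit_def)

lemma eps_R: "\<epsilon> \<in> carrier R" using eps_unit by (simp add: Units_R)

lemma inverse_unit: assumes "u \<in> Units R" shows "inverse u \<in> Units R" "cj (inverse u) = inverse (cj u)" "u \<noteq> 0"
proof -
  obtain v where v: "u \<in> carrier R" "v \<in> carrier R" "u * v = 1" using assms by (auto simp: Units_R)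
  show "u \<noteq> 0" using v(3) by auto
  have iv: "inverse u = v" using v(3) by (rule inverse_unique)
  have "v * u = 1" using v(3) by (simp add: mult.commute)
  then show "inverse u \<in> Units R" unfolding iv using v by (auto simp: Units_R)
  have "cj u * cj v = 1" using cj_mult[OF v(1,2)] v(3) by simp
  then show "cj (inverse u) = inverse (cj u)" unfolding iv by (rule inverse_unique[symmetric])
qed

lemma power_unit: "u \<in> Units R \<Longrightarrow> u ^ k \<in> Units R \<and> cj (u ^ k) = cj u ^ k"
proof (induction k)
  case 0
  then show ?case using R_1 by (auto simp: Units_R)
next
  case (Suc k)
  then have u: "u \<in> carrier R" "u ^ k \<in> carrier R" by (auto simp: Units_R)
  obtain v v' where v: "v \<in> carrier R" "u * v = 1" "v' \<in> carrier R" "u ^ k * v' = 1" using Suc by (auto simp: Units_R)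
  have "(u * u ^ k) * (v * v') = (u * v) * (u ^ k * v')" by (simp only: mult_ac)
  then have "(u * u ^ k) * (v * v') = 1" using v by simp
  moreover have "u * u ^ k \<in> carrier R" "v * v' \<in> carrier R" using u v R_mult by blast+
  ultimately have "u ^ Suc k \<in> Units R" unfolding Units_R power_Suc by blast
  moreover have "cj (u ^ Suc k) = cj u ^ Suc k" using Suc cj_mult[OF u] by simp
  ultimately show ?case by blast
qed

lemma powi_unit: assumes "u \<in> Units R" shows "u powi k \<in> Units R \<and> cj (u powi k) = cj u powi k"
proof (cases "k \<ge> 0")
  case True
  then show ?thesis using power_unit[OF assms, of "nat k"] by (simp add: power_int_def)
next
  case False
  have i: "inverse u \<in> Units R" "cj (inverse u) = inverse (cj u)" using inverse_unit[OF assms] by blast+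
  show ?thesis using power_unit[OF i(1), of "nat (- k)"] False i(2) by (simp add: power_int_def)
qed

lemma no_square_root_unit: "\<eta> \<in> Units R \<Longrightarrow> \<eta> * \<eta> \<noteq> \<epsilon>"
proof
  assume \<eta>: "\<eta> \<in> Units R" "\<eta> * \<eta> = \<epsilon>"
  obtain k :: int where k: "\<eta> = \<epsilon> powi k \<or> \<eta> = - (\<epsilon> powi k)" using unit_power[OF \<eta>(1)] by blast
  have e0: "\<epsilon> \<noteq> 0" using eps_gt_1 by simp
  have "\<eta> * \<eta> = \<epsilon> powi k * \<epsilon> powi k" using k by auto
  moreover have "\<epsilon> powi (k + k) = \<epsilon> powi k * \<epsilon> powi k" using e0 by (intro power_int_add) auto
  ultimately have "\<epsilon> powi (k + k) = \<epsilon> powi 1" using \<eta>(2) by (simp only: power_int_1_right)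
  then have "k + k = 1" using eps_gt_1 power_int_strict_increasing[of "k + k" 1 \<epsilon>] power_int_strict_increasing[of 1 "k + k" \<epsilon>]
    by (metis less_irrefl linorder_neqE_linordered_idom)
  then show False by presburger
qed

lemma no_negative_norm_unit:
  assumes "\<epsilon> * cj \<epsilon> = 1" "\<eta> \<in> Units R"
  shows "\<eta> * cj \<eta> \<noteq> - 1"
proof -
  obtain k :: int where k: "\<eta> = \<epsilon> powi k \<or> \<eta> = - (\<epsilon> powi k)" using unit_power[OF assms(2)] by blast
  have pk: "\<epsilon> powi k \<in> carrier R" "cj (\<epsilon> powi k) = cj \<epsilon> powi k" using powi_unit[OF eps_unit, of k] by (auto simp: Units_R)
  have "\<eta> * cj \<eta> = \<epsilon> powi k * cj \<epsilon> powi k" using k cj_minus[OF pk(1)] pk(2) by auto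
  also have "\<dots> = 1" by (simp flip: power_int_mult_distrib add: assms(1))
  finally show ?thesis by simp
qed

text \<open>If \<open>\<epsilon> = (s + y \<surd>p) / 2\<close> had norm 1, then in \<open>(s - 2) (s + 2) = p y\<^sup>2\<close> the factors would be a square
  and \<open>p\<close> times a square, up to common factors; one distribution makes \<open>\<epsilon>\<close> a square, the other gives a
  unit of norm -1.\<close>

lemma norm_eps: "\<epsilon> * cj \<epsilon> = - 1"
proof (rule ccontr)
  assume "\<epsilon> * cj \<epsilon> \<noteq> - 1"
  then have n1: "\<epsilon> * cj \<epsilon> = 1" using Units_norm[OF eps_unit] by blast
  obtain x y where e: "\<epsilon> = el x y" using eps_R by (rule in_R_E)
  define s where "s = 2 * x + y"
  have "of_int (N x y) = (1 :: real)" using n1 unfolding e cj_el el_norm .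
  then have "N x y = 1" by (simp only: of_int_eq_1_iff)
  then have s4: "(s - 2) * (s + 2) = int p * (y * y)"
    using four_N[of x y] by (simp add: s_def power2_eq_square algebra_simps)
  have eps_half: "2 * \<epsilon> = of_int s + of_int y * sq" "2 * cj \<epsilon> = of_int s - of_int y * sq"
    unfolding e cj_half by (simp_all add: el_half s_def)
  have cje: "cj \<epsilon> = inverse \<epsilon>" using n1 by (metis inverse_unique)
  have cj01: "0 < cj \<epsilon>" "cj \<epsilon> < 1" unfolding cje using eps_gt_1 by (simp_all add: inverse_less_1_iff)
  have "of_int y * sq > 0" using eps_half cj01 eps_gt_1 by linarith
  then have y0: "y > 0" using sq_pos by (simp add: zero_less_mult_iff)
  have s2: "s > 2"
  proof -
    have "(\<epsilon> - 1) * (\<epsilon> - 1) > 0" using eps_gt_1 by simp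
    then have "2 * \<epsilon> < \<epsilon> * \<epsilon> + 1" by (simp add: algebra_simps)
    then have "2 * \<epsilon> < (\<epsilon> + cj \<epsilon>) * \<epsilon>" using n1 by (simp add: algebra_simps)
    then have "2 < \<epsilon> + cj \<epsilon>" using eps_gt_1 by (simp add: mult_less_cancel_right)
    then have "2 < (of_int s :: real)" using eps_half by linarith
    then show ?thesis by simp
  qed
  \<comment> \<open>(m + k sqrt p) / 2 would be a unit of norm -1.\<close>
  have neg_case: False if "m * m - int p * (k * k) = - 4" for m k
  proof -
    have "even (m * m - int p * (k * k))" unfolding that by simp
    then have "even (m - k)" using odd_p by simp
    then obtain a where a: "m - k = 2 * a" by (rule evenE)
    have "4 * N a k = - 4" unfolding four_N using a that by (simp add: power2_eq_square algebra_simps)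
    then have "el a k * cj (el a k) = - 1" unfolding cj_el el_norm by simp
    then show False using no_negative_norm_unit[OF n1] unit_of_norm[OF el_in_R] by blast
  qed
  \<comment> \<open>(m + k sqrt p) / 2 would be a unit whose square is \<epsilon>.\<close>
  have pos_case: False if "m * m - int p * (k * k) = 4" "m * m = s + 2" "m * k = y" for m k
  proof -
    have "even (m * m - int p * (k * k))" unfolding that(1) by simp
    then have "even (m - k)" using odd_p by simp
    then obtain a where a: "m - k = 2 * a" by (rule evenE)
    have m: "m = 2 * a + k" using a by simp
    have "4 * N a k = 4" unfolding four_N using m that(1) by (simp add: power2_eq_square)
    then have u: "el a k \<in> Units R" by (intro unit_of_norm el_in_R) (simp add: el_norm)
    have "int p * (k * k) = s - 2" using that by simp
    then have "of_int (int p * (k * k)) = (of_int (s - 2) :: real)" by (simp only:)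
    then have pk: "real p * (of_int k * of_int k) = of_int s - 2" by simp
    have "of_int (m * m) = (of_int (s + 2) :: real)" using that(2) by (simp only:)
    then have mm: "of_int m * of_int m = (of_int s + 2 :: real)" by simp
    have "of_int (m * k) = (of_int y :: real)" using that(3) by (simp only:)
    then have mk: "of_int m * of_int k = (of_int y :: real)" by simp
    have "el a k * el a k = (of_int m + of_int k * sq) * (of_int m + of_int k * sq) / 4"
      unfolding el_half m by simp
    also have "(of_int m + of_int k * sq) * (of_int m + of_int k * sq) =
        of_int m * of_int m + (sq * sq) * (of_int k * of_int k) + 2 * (of_int m * of_int k) * sq"
      by (simp add: algebra_simps)
    also have "\<dots> = 2 * (of_int s + of_int y * sq)" unfolding sq_sq pk mm mk by (simp add: algebra_simps)
    also have "\<dots> = 4 * \<epsilon>" unfolding eps_half(1)[symmetric] by simp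
    finally have "el a k * el a k = \<epsilon>" by simp
    then show False using no_square_root_unit[OF u] by blast
  qed
  have sqrt_y: "m * k = y" if "m * m * (k * k) = y * y" "m > 0" "k > 0" for m k
  proof -
    have "(m * k)\<^sup>2 = y\<^sup>2" using that(1) by (simp add: power2_eq_square mult_ac)
    then show ?thesis using that y0 by (simp add: power2_eq_iff_nonneg)
  qed
  have pdvd: "int p dvd s - 2 \<or> int p dvd s + 2"
    using s4 prime_dvd_multD[OF prime_int_p, of "s - 2" "s + 2"] by simp
  show False
  proof (cases "even s")
    case False
    have cop: "coprime (s - 2) (s + 2)"
    proof (rule coprimeI)
      fix l assume l: "l dvd s - 2" "l dvd s + 2"
      have "l dvd (s + 2) - (s - 2)" by (rule dvd_diff[OF l(2,1)])
      then have "l dvd 2 * 2" by simp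
      moreover have "coprime l 2"
      proof -
        have "odd l"
        proof
          assume "even l"
          then have "even (s - 2)" using l(1) by (rule dvd_trans)
          then show False using False by simp
        qed
        then show ?thesis by simp
      qed
      ultimately show "is_unit l" by (metis coprime_dvd_mult_left_iff coprime_absorb_left)
    qed
    from pdvd show False
    proof
      assume "int p dvd s - 2"
      then obtain a where a: "s - 2 = int p * a" by (rule dvdE)
      have a0: "a > 0" using a s2 p_gt2 by (metis diff_gt_0_iff_gt of_nat_0_less_iff zero_less_mult_pos p_gt2 less_trans zero_less_numeral)
      have "int p * (a * (s + 2)) = int p * (y * y)" using s4 unfolding a by (simp add: mult.assoc)
      then have "a * (s + 2) = y * y" using p_gt2 by simp
      moreover have "coprime a (s + 2)" using cop unfolding a by simp
      ultimately obtain k m where km: "a = k * k" "s + 2 = m * m" "k > 0" "m > 0"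
        using coprime_mult_square[of a "s + 2" y] a0 s2 by auto
      have "m * m - int p * (k * k) = 4" using km a by simp
      moreover have "m * m = s + 2" using km(2) by simp
      moreover have "m * k = y" by (rule sqrt_y) (use \<open>a * (s + 2) = y * y\<close> km in \<open>simp_all add: mult_ac\<close>)
      ultimately show False by (rule pos_case)
    next
      assume "int p dvd s + 2"
      then obtain a where a: "s + 2 = int p * a" by (rule dvdE)
      have a0: "a > 0"
      proof -
        have "int p * a > 0" using a s2 by simp
        then show ?thesis using p_gt2 by (simp add: zero_less_mult_iff)
      qed
      have "int p * ((s - 2) * a) = int p * (y * y)" using s4 unfolding a by (simp add: mult_ac)
      then have "(s - 2) * a = y * y" using p_gt2 by simp
      moreover have "coprime (s - 2) a" using cop unfolding a by simp
      ultimately obtain k m where km: "s - 2 = m * m" "a = k * k"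
        using coprime_mult_square[of "s - 2" a y] a0 s2 by auto
      have "m * m - int p * (k * k) = - 4" using km a by simp
      then show False by (rule neg_case)
    qed
  next
    case True
    then obtain S where S: "s = 2 * S" by (rule evenE)
    have "even (int p * (y * y))" unfolding s4[symmetric] using True by simp
    then have "even y" using odd_p by simp
    then obtain Y where Y: "y = 2 * Y" by (rule evenE)
    have SY: "S * S = 1 + int p * (Y * Y)" using s4 by (simp add: S Y algebra_simps)
    \<comment> \<open>If S were even, Y would be odd, and with p = 1 modulo 4 the right side of
      \<open>SY\<close> would be 2 modulo 4.\<close>
    have oddS: "odd S"
    proof
      assume "even S"
      then obtain S' where S': "S = 2 * S'" by (rule evenE)
      have *: "int p * (Y * Y) = 4 * (S' * S') - 1" using SY by (simp add: S')
      have "odd (int p * (Y * Y))" unfolding * by simp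
      then have "odd Y" by simp
      then obtain Y' where Y': "Y = 2 * Y' + 1" by (rule oddE)
      have "4 * (S' * S') = 1 + int p * (4 * (Y' * Y' + Y') + 1)" using SY by (simp add: S' Y' algebra_simps)
      also have "int p = 4 * (2 * int r + 1) + 1" by (simp add: p_eq)
      finally have "4 * (S' * S') = 4 * ((2 * int r + 1) * (4 * (Y' * Y' + Y') + 1) + (Y' * Y' + Y')) + 2"
        by (simp add: algebra_simps)
      then show False by presburger
    qed
    then obtain A where A: "S = 2 * A + 1" by (rule oddE)
    have "4 * (A * (A + 1)) = int p * (Y * Y)" using SY by (simp add: A algebra_simps)
    then have "even (int p * (Y * Y))" by (metis dvd_triv_left even_mult_iff even_numeral)
    then have "even Y" using odd_p by simp
    then obtain Z where Z: "Y = 2 * Z" by (rule evenE)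
    \<comment> \<open>Here s - 2 = 4 A and s + 2 = 4 (A + 1): for even s the two factors become
      coprime after division by 4.\<close>
    have AZ: "A * (A + 1) = int p * (Z * Z)" using \<open>4 * (A * (A + 1)) = int p * (Y * Y)\<close> by (simp add: Z algebra_simps)
    have A0: "A > 0" using s2 by (simp add: S A)
    have cop: "coprime A (A + 1)" by simp
    have "int p dvd A \<or> int p dvd A + 1" using AZ prime_dvd_multD[OF prime_int_p, of A "A + 1"] by simp
    then show False
    proof
      assume "int p dvd A"
      then obtain a where a: "A = int p * a" by (rule dvdE)
      have a0: "a > 0"
      proof -
        have "int p * a > 0" using a A0 by simp
        then show ?thesis using p_gt2 by (simp add: zero_less_mult_iff)
      qed
      have "int p * (a * (A + 1)) = int p * (Z * Z)" using AZ a by (metis mult.assoc)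
      then have aZ: "a * (A + 1) = Z * Z" using p_gt2 by simp
      have "coprime (int p * a) (A + 1)" using cop unfolding a[symmetric] .
      then have "coprime a (A + 1)" by simp
      then obtain k m where km: "a = k * k" "A + 1 = m * m" "k > 0" "m > 0"
        using coprime_mult_square[OF _ aZ] a0 A0 by auto
      have "(2 * m) * (2 * m) - int p * ((2 * k) * (2 * k)) = 4" using km a by simp
      moreover have "(2 * m) * (2 * m) = s + 2" using km by (simp add: S A)
      moreover have "(2 * m) * (2 * k) = y"
        by (rule sqrt_y) (use aZ km in \<open>simp_all add: Y Z mult_ac\<close>)
      ultimately show False by (rule pos_case)
    next
      assume "int p dvd A + 1"
      then obtain a where a: "A + 1 = int p * a" by (rule dvdE)
      have a0: "a > 0"
      proof -
        have "int p * a > 0" using a A0 by simp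
        then show ?thesis using p_gt2 by (simp add: zero_less_mult_iff)
      qed
      have "int p * (A * a) = int p * (Z * Z)" using AZ unfolding a by (simp add: mult_ac)
      then have aZ: "A * a = Z * Z" using p_gt2 by simp
      have "coprime A (int p * a)" using cop unfolding a[symmetric] .
      then have "coprime A a" by simp
      then obtain k m where km: "A = m * m" "a = k * k"
        using coprime_mult_square[OF _ aZ] a0 A0 by auto
      have "(2 * m) * (2 * m) - int p * ((2 * k) * (2 * k)) = - 4" using km a by simp
      then show False by (rule neg_case)
    qed
  qed
qed

end

section \<open>The class number formula\<close>

context prime_5_mod_8 begin

text \<open>Each basis is an integral combination of the other, so the determinants divide each
  other.\<close>

lemma int_basis_det_eq:
  fixes p1 p2 q1 q2 r1 r2 s1 s2 :: int
  assumes eq: "{(m * p1 + k * q1, m * p2 + k * q2) |m k. True} = {(m * r1 + k * s1, m * r2 + k * s2) |m k. True}"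
  shows "\<bar>p1 * q2 - p2 * q1\<bar> = \<bar>r1 * s2 - r2 * s1\<bar>"
proof -
  have dvd: "r1 * s2 - r2 * s1 dvd p1 * q2 - p2 * q1"
    if sub: "{(m * p1 + k * q1, m * p2 + k * q2) |m k. True} \<subseteq> {(m * r1 + k * s1, m * r2 + k * s2) |m k. True}"
    for p1 p2 q1 q2 r1 r2 s1 s2 :: int
  proof -
    have "(1 * p1 + 0 * q1, 1 * p2 + 0 * q2) \<in> {(m * r1 + k * s1, m * r2 + k * s2) |m k. True}"
      using sub by blast
    then obtain a b where ab: "p1 = a * r1 + b * s1" "p2 = a * r2 + b * s2" by auto
    have "(0 * p1 + 1 * q1, 0 * p2 + 1 * q2) \<in> {(m * r1 + k * s1, m * r2 + k * s2) |m k. True}"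
      using sub by blast
    then obtain e f where ef: "q1 = e * r1 + f * s1" "q2 = e * r2 + f * s2" by auto
    have "p1 * q2 - p2 * q1 = (r1 * s2 - r2 * s1) * (a * f - b * e)"
      unfolding ab ef by (simp add: algebra_simps)
    then show ?thesis by simp
  qed
  show ?thesis by (rule zdvd_antisym_abs[OF dvd dvd]) (use eq in auto)
qed

lemma image_lattice_eq:
  assumes "\<And>m k. s * G m k = el (U m k) (V m k)"
  shows "(*) s ` {z. \<exists>(m :: int) (k :: int). z = G m k} = (\<lambda>(u, v). el u v) ` {(U m k, V m k) |m k. True}"
proof (intro Set.set_eqI iffI)
  fix z assume "z \<in> (*) s ` {z. \<exists>m k. z = G m k}"
  then obtain m k where "z = s * G m k" by blast
  then have "z = (\<lambda>(u, v). el u v) (U m k, V m k)" using assms by simp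
  then show "z \<in> (\<lambda>(u, v). el u v) ` {(U m k, V m k) |m k. True}" by blast
next
  fix z assume "z \<in> (\<lambda>(u, v). el u v) ` {(U m k, V m k) |m k. True}"
  then obtain m k where "z = el (U m k) (V m k)" by auto
  then have "z = s * G m k" using assms by simp
  then show "z \<in> (*) s ` {z. \<exists>m k. z = G m k}" by blast
qed

text \<open>The reference ideal of a class: dropping the integer factor e leaves the class
  unchanged.\<close>

definition Jp :: "nat \<Rightarrow> int \<Rightarrow> real set" where "Jp a b = Jset (a, b, 1)"

lemma Jp_iff: "z \<in> Jp a b \<longleftrightarrow> (\<exists>m k. z = of_int m * of_nat a + of_int k * el b 1)"
proof -
  have "el (int 1 * (m * int a + k * b)) (int 1 * k) = of_int m * of_nat a + of_int k * el b 1" for m k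
    by (simp add: el_def algebra_simps)
  then show ?thesis by (auto simp: Jp_def Jset_def)
qed

lemma Jset_iff: "z \<in> Jset (a, b, e) \<longleftrightarrow> (\<exists>m k. z = of_nat e * (of_int m * of_nat a + of_int k * el b 1))"
proof -
  have "el (int e * (m * int a + k * b)) (int e * k) = of_nat e * (of_int m * of_nat a + of_int k * el b 1)" for m k
    by (simp add: el_def algebra_simps)
  then show ?thesis by (auto simp: Jset_def)
qed

text \<open>Both sides are lattices in the coordinates of \<open>el\<close>, and their determinants
  agree. This is the multiplicativity of the ideal norm, as far as it is needed.\<close>

lemma norm_scaled_ideal:
  assumes eq: "(*) (of_nat a0) ` Jset (a, b, e) = (*) (el x y) ` Jp a0 b0" and a0: "a0 > 0"
  shows "int (a * e\<^sup>2) * int a0 = \<bar>N x y\<bar>"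
proof -
  have Js: "Jset (a, b, e) = {z. \<exists>m k. z = of_nat e * (of_int m * of_nat a + of_int k * el b 1)}"
    and Js0: "Jp a0 b0 = {z. \<exists>m k. z = of_int m * of_nat a0 + of_int k * el b0 1}"
    using Jset_iff Jp_iff by blast+
  have 1: "(*) (of_nat a0) ` Jset (a, b, e) =
      (\<lambda>(u, v). el u v) ` {(m * (int a0 * int e * int a) + k * (int a0 * int e * b), m * 0 + k * (int a0 * int e)) |m k. True}"
    unfolding Js by (rule image_lattice_eq) (simp add: el_def algebra_simps)
  have 2: "(*) (el x y) ` Jp a0 b0 =
      (\<lambda>(u, v). el u v) ` {(m * (x * int a0) + k * (x * b0 + d * y), m * (y * int a0) + k * (x + y * b0 + y)) |m k. True}"
    unfolding Js0
  proof (rule image_lattice_eq)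
    fix m k
    have "of_int m * of_nat a0 + of_int k * el b0 1 = el (m * int a0 + k * b0) k" by (simp add: el_def algebra_simps)
    then show "el x y * (of_int m * of_nat a0 + of_int k * el b0 1) =
        el (m * (x * int a0) + k * (x * b0 + d * y)) (m * (y * int a0) + k * (x + y * b0 + y))"
      by (simp add: el_eq_iff el_mult algebra_simps)
  qed
  have inj: "inj (\<lambda>(u, v). el u v)" by (auto simp: inj_on_def el_eq_iff)
  have "{(m * (int a0 * int e * int a) + k * (int a0 * int e * b), m * 0 + k * (int a0 * int e)) |m k. True} =
      {(m * (x * int a0) + k * (x * b0 + d * y), m * (y * int a0) + k * (x + y * b0 + y)) |m k. True}"
    using eq unfolding 1 2 by (rule inj_image_eq_iff[OF inj, THEN iffD1])
  from int_basis_det_eq[OF this]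
  have "\<bar>(int a0 * int e * int a) * (int a0 * int e) - 0 * (int a0 * int e * b)\<bar> =
      \<bar>(x * int a0) * (x + y * b0 + y) - (y * int a0) * (x * b0 + d * y)\<bar>" .
  moreover have "(x * int a0) * (x + y * b0 + y) - (y * int a0) * (x * b0 + d * y) = int a0 * N x y"
    by (simp add: N_def algebra_simps)
  moreover have "(int a0 * int e * int a) * (int a0 * int e) - 0 * (int a0 * int e * b) = int a0 * (int (a * e\<^sup>2) * int a0)"
    by (simp add: power2_eq_square algebra_simps)
  ultimately have "\<bar>int a0 * (int (a * e\<^sup>2) * int a0)\<bar> = \<bar>int a0 * N x y\<bar>" by (simp only:)
  then have "int a0 * \<bar>int (a * e\<^sup>2) * int a0\<bar> = int a0 * \<bar>N x y\<bar>" by (simp only: abs_mult abs_of_nat)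
  then have "\<bar>int (a * e\<^sup>2) * int a0\<bar> = \<bar>N x y\<bar>" using a0 by simp
  then show ?thesis by simp
qed

lemma el_b_mult: "el x y * el b0 1 = el (x * b0 + d * y) (x + y * b0 + y)"
  by (simp add: el_mult el_eq_iff)

text \<open>The divisibility says that \<open>el x y\<close> lies in the conjugate of
  \<open>Jp a0 b0\<close>. An ideal times its conjugate lies in the multiples of its norm, here a0,
  so the product can be divided by a0 within the ring.\<close>

lemma ex_scaled_ideal:
  assumes a0: "a0 > 0" "int a0 dvd nf b0" and g: "int a0 dvd x + y * (b0 + 1)" and nz: "el x y \<noteq> 0"
  shows "\<exists>t. valid t \<and> (*) (of_nat a0) ` Jset t = (*) (el x y) ` Jp a0 b0"
proof -
  define I where "I = {z. of_nat a0 * z \<in> (*) (el x y) ` Jp a0 b0}"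
  have valid0: "valid (a0, b0 mod int a0, 1)"
  proof -
    have "[b0 mod int a0 = b0] (mod int a0)" by (simp add: Cong.cong_def)
    then have "int a0 dvd nf (b0 mod int a0)" using a0(2) dvd_nf_cong by blast
    then show ?thesis using a0 by (simp add: valid_def Sol_def)
  qed
  obtain h where h: "x + y * (b0 + 1) = int a0 * h" using g by (rule dvdE)
  obtain q where q: "nf b0 = int a0 * q" using a0(2) by (rule dvdE)
  have d: "d = b0 * b0 + b0 - int a0 * q" using q by (simp add: nf_def)
  have x: "x = int a0 * h - y * (b0 + 1)" using h by simp
  have prod: "el x y * (of_int m * of_nat a0 + of_int k * el b0 1) =
      of_nat a0 * el (m * x + k * (h * b0 - y * q)) (m * y + k * h)" for m k
  proof -
    have e: "x * b0 + d * y = int a0 * (h * b0 - y * q)" "x + y * b0 + y = int a0 * h"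
      unfolding x d by (simp_all add: algebra_simps)
    have "el x y * el b0 1 = of_nat a0 * el (h * b0 - y * q) h"
      unfolding el_b_mult e by (simp add: el_def algebra_simps)
    then have *: "el x y * (of_int k * el b0 1) = of_int k * (of_nat a0 * el (h * b0 - y * q) h)" by (simp add: mult.left_commute)
    show ?thesis unfolding distrib_left * by (simp add: el_def algebra_simps)
  qed
  have I_iff: "z \<in> I \<longleftrightarrow> (\<exists>m k. z = el (m * x + k * (h * b0 - y * q)) (m * y + k * h))" for z
  proof -
    have "z \<in> I \<longleftrightarrow> (\<exists>m k. of_nat a0 * z = el x y * (of_int m * of_nat a0 + of_int k * el b0 1))"
      unfolding I_def mem_Collect_eq image_iff Bex_def Jp_iff by blast
    also have "\<dots> \<longleftrightarrow> (\<exists>m k. z = el (m * x + k * (h * b0 - y * q)) (m * y + k * h))"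
      unfolding prod using a0(1) by simp
    finally show ?thesis .
  qed
  have id: "ideal (Jp a0 b0) R"
  proof -
    have "Jp a0 b0 = Jset (a0, b0 mod int a0, 1)"
    proof -
      define l where "l = b0 div int a0"
      have b0: "b0 = int a0 * l + b0 mod int a0" by (simp add: l_def)
      have e: "el b0 1 = of_int l * of_nat a0 + el (b0 mod int a0) 1"
      proof -
        have "of_int b0 = (of_int (int a0 * l + b0 mod int a0) :: real)" using b0 by (simp only:)
        then show ?thesis by (simp add: el_def)
      qed
      show ?thesis
      proof (intro Set.set_eqI iffI)
        fix z assume "z \<in> Jp a0 b0"
        then obtain m k where "z = of_int m * of_nat a0 + of_int k * el b0 1" unfolding Jp_iff by blast
        then have "z = of_nat 1 * (of_int (m + k * l) * of_nat a0 + of_int k * el (b0 mod int a0) 1)"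
          unfolding e by (simp add: algebra_simps)
        then show "z \<in> Jset (a0, b0 mod int a0, 1)" unfolding Jset_iff by blast
      next
        fix z assume "z \<in> Jset (a0, b0 mod int a0, 1)"
        then obtain m k where "z = of_nat 1 * (of_int m * of_nat a0 + of_int k * el (b0 mod int a0) 1)"
          unfolding Jset_iff by blast
        then have "z = of_int (m - k * l) * of_nat a0 + of_int k * el b0 1"
          unfolding e by (simp add: algebra_simps)
        then show "z \<in> Jp a0 b0" unfolding Jp_iff by blast
      qed
    qed
    then show ?thesis using ideal_Jset[OF valid0] by (simp add: nonzero_ideals_def)
  qed
  then have J: "0 \<in> Jp a0 b0" "\<And>u v. u \<in> Jp a0 b0 \<Longrightarrow> v \<in> Jp a0 b0 \<Longrightarrow> u + v \<in> Jp a0 b0"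
    "\<And>r u. r \<in> carrier R \<Longrightarrow> u \<in> Jp a0 b0 \<Longrightarrow> r * u \<in> Jp a0 b0"
    unfolding ideal_R_iff by blast+
  have "ideal I R" unfolding ideal_R_iff
  proof (intro conjI ballI)
    show "I \<subseteq> carrier R"
    proof
      fix z assume "z \<in> I"
      then obtain m k where "z = el (m * x + k * (h * b0 - y * q)) (m * y + k * h)" unfolding I_iff by blast
      then show "z \<in> carrier R" by simp
    qed
    show "0 \<in> I" unfolding I_def using J(1) by (auto simp: image_iff)
  next
    fix u v assume "u \<in> I" "v \<in> I"
    then obtain j j' where j: "of_nat a0 * u = el x y * j" "j \<in> Jp a0 b0" "of_nat a0 * v = el x y * j'" "j' \<in> Jp a0 b0"
      by (auto simp: I_def)
    then have "of_nat a0 * (u + v) = el x y * (j + j')" by (simp add: distrib_left)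
    then show "u + v \<in> I" unfolding I_def using J(2)[OF j(2,4)] by blast
  next
    fix r u assume "r \<in> carrier R" "u \<in> I"
    then obtain j where j: "of_nat a0 * u = el x y * j" "j \<in> Jp a0 b0" by (auto simp: I_def)
    have "of_nat a0 * (r * u) = el x y * (r * j)" using j(1) by (simp add: mult.left_commute)
    then show "r * u \<in> I" unfolding I_def using J(3)[OF \<open>r \<in> carrier R\<close> j(2)] by blast
  qed
  moreover have "el (1 * x + 0 * (h * b0 - y * q)) (1 * y + 0 * h) \<in> I" unfolding I_iff by blast
  then have "el x y \<in> I" by simp
  ultimately have "I \<in> nonzero_ideals R" using nz by (auto simp: nonzero_ideals_def)
  then obtain t where t: "valid t" "I = Jset t" using ideal_imp_Jset by blast
  have "(*) (of_nat a0) ` I = (*) (el x y) ` Jp a0 b0"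
  proof
    show "(*) (of_nat a0) ` I \<subseteq> (*) (el x y) ` Jp a0 b0" by (auto simp: I_def)
    show "(*) (el x y) ` Jp a0 b0 \<subseteq> (*) (of_nat a0) ` I"
    proof
      fix z assume z: "z \<in> (*) (el x y) ` Jp a0 b0"
      then obtain j where j: "j \<in> Jp a0 b0" "z = el x y * j" by blast
      from j(1)[unfolded Jp_iff] obtain m k where "j = of_int m * of_nat a0 + of_int k * el b0 1" by blast
      then have "z = el x y * (of_int m * of_nat a0 + of_int k * el b0 1)" using j(2) by simp
      then have "z = of_nat a0 * el (m * x + k * (h * b0 - y * q)) (m * y + k * h)" unfolding prod .
      moreover have "el (m * x + k * (h * b0 - y * q)) (m * y + k * h) \<in> I" unfolding I_iff by blast
      ultimately show "z \<in> (*) (of_nat a0) ` I" by blast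
    qed
  qed
  then show ?thesis using t by blast
qed

text \<open>The converse of \<open>ex_scaled_ideal\<close>, read off from the w-coordinate of the
  product with the generator b0 + w.\<close>

lemma dvd_of_scaled_ideal:
  assumes eq: "(*) (of_nat a0) ` Jset t = (*) (el x y) ` Jp a0 b0" and t: "valid t"
  shows "int a0 dvd x + y * (b0 + 1)"
proof -
  have "el b0 1 \<in> Jp a0 b0" unfolding Jp_iff by (intro exI[of _ 0] exI[of _ 1]) simp
  then have "el x y * el b0 1 \<in> (*) (of_nat a0) ` Jset t" unfolding eq by blast
  then obtain z where z: "el x y * el b0 1 = of_nat a0 * z" "z \<in> Jset t" by blast
  have "Jset t \<subseteq> carrier R" using t ideal_Jset ideal_R_iff by (cases t) (auto simp: nonzero_ideals_def)
  then obtain u v where "z = el u v" using z(2) by (auto simp: carrier_R)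
  then have "el (x * b0 + d * y) (x + y * b0 + y) = el (int a0 * u) (int a0 * v)"
    using z(1) unfolding el_b_mult by (simp add: el_def algebra_simps)
  then have "x + y * b0 + y = int a0 * v" unfolding el_eq_iff by blast
  then have "x + y * (b0 + 1) = int a0 * v" by (simp add: algebra_simps)
  then show ?thesis by simp
qed

lemma quad_field_quotient:
  assumes "el x y \<noteq> 0"
  shows "\<exists>A B. el u v / el x y = of_rat A + of_rat B * sq"
proof -
  have N0: "N x y \<noteq> 0" using assms by (simp add: N_eq_0_iff el_eq_0_iff)
  obtain u' v' where uv': "el u v * el (x + y) (- y) = el u' v'" unfolding el_mult by blast
  have "el u v / el x y = el u v * el (x + y) (- y) / (el x y * el (x + y) (- y))"
  proof -
    have "el (x + y) (- y) \<noteq> 0"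
    proof
      assume "el (x + y) (- y) = 0"
      then have "(of_int (N x y) :: real) = 0" unfolding el_norm[symmetric] by simp
      then show False using N0 by simp
    qed
    then show ?thesis by simp
  qed
  also have "\<dots> = el u' v' / of_int (N x y)" unfolding uv' el_norm ..
  also have "\<dots> = of_rat ((of_int u' + of_int v' / 2) / of_int (N x y)) + of_rat ((of_int v' / 2) / of_int (N x y)) * sq"
    unfolding el_rat of_rat_divide of_rat_of_int_eq by (simp add: add_divide_distrib)
  finally show ?thesis by blast
qed

text \<open>The quotient maps the lattice \<open>Jp a0 b0\<close> into itself, so it is a root of
  the characteristic polynomial of an integer matrix and thus an algebraic integer; the same holds
  for its inverse.\<close>

lemma scaled_ideals_unit:
  assumes eq: "(*) (el u v) ` Jp a0 b0 = (*) (el x y) ` Jp a0 b0" and nz: "el u v \<noteq> 0" "el x y \<noteq> 0" and a0: "a0 > 0"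
  shows "\<exists>\<eta>\<in>Units R. el u v = \<eta> * el x y"
proof -
  have q_in_R: "el u v / el x y \<in> carrier R"
    if eq: "(*) (el u v) ` Jp a0 b0 = (*) (el x y) ` Jp a0 b0" and nz: "el x y \<noteq> 0" for u v x y
  proof -
    define \<eta> where "\<eta> = el u v / el x y"
    have e: "el u v = \<eta> * el x y" using nz by (simp add: \<eta>_def)
    have J: "\<exists>m k. \<eta> * j = of_int m * of_nat a0 + of_int k * el b0 1" if "j \<in> Jp a0 b0" for j
    proof -
      have "el u v * j \<in> (*) (el x y) ` Jp a0 b0" using that eq by blast
      then obtain j' where j': "\<eta> * el x y * j = el x y * j'" "j' \<in> Jp a0 b0" unfolding e by blast
      then have "\<eta> * j = j'" using nz by (simp add: mult_ac)
      then show ?thesis using j'(2) unfolding Jp_iff by blast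
    qed
    have "of_nat a0 \<in> Jp a0 b0" "el b0 1 \<in> Jp a0 b0" unfolding Jp_iff
      by (intro exI[of _ 1] exI[of _ 0], simp) (intro exI[of _ 0] exI[of _ 1], simp)
    from J[OF this(1)] J[OF this(2)] obtain m k m' k' where
      1: "\<eta> * of_nat a0 = of_int m * of_nat a0 + of_int k * el b0 1" and
      2: "\<eta> * el b0 1 = of_int m' * of_nat a0 + of_int k' * el b0 1" by blast
    \<comment> \<open>Multiplying the two rearranged equations eliminates the basis and leaves the
      characteristic equation.\<close>
    have "(\<eta> - of_int m) * of_nat a0 * ((\<eta> - of_int k') * el b0 1) = (of_int k * el b0 1) * (of_int m' * of_nat a0)"
    proof -
      have "(\<eta> - of_int m) * of_nat a0 = of_int k * el b0 1" using 1 by (simp add: algebra_simps)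
      moreover have "(\<eta> - of_int k') * el b0 1 = of_int m' * of_nat a0" using 2 by (simp add: algebra_simps)
      ultimately show ?thesis by (simp only:)
    qed
    then have "(of_nat a0 * el b0 1) * ((\<eta> - of_int m) * (\<eta> - of_int k')) = (of_nat a0 * el b0 1) * (of_int k * of_int m')"
      by (simp only: mult_ac)
    moreover have "of_nat a0 * el b0 1 \<noteq> 0" using a0 by (simp add: el_eq_0_iff)
    ultimately have root: "(\<eta> - of_int m) * (\<eta> - of_int k') = of_int k * of_int m'" by simp
    define f :: "int poly" where "f = [:m * k' - k * m', - (m + k'), 1:]"
    have "poly (map_poly of_int f) \<eta> = 0"
      using root by (simp add: f_def map_poly_pCons) (simp add: algebra_simps)
    moreover have "lead_coeff f = 1" by (simp add: f_def)
    ultimately have "algebraic_int \<eta>" unfolding algebraic_int_altdef_ipoly by (intro exI[of _ f]) simp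
    moreover obtain A B where "\<eta> = of_rat A + of_rat B * sq" using quad_field_quotient[OF nz] unfolding \<eta>_def by blast
    ultimately obtain x y where "\<eta> = el x y" using algebraic_int_quad_imp_el by blast
    then show ?thesis unfolding \<eta>_def[symmetric] by simp
  qed
  have 1: "el u v / el x y \<in> carrier R" by (rule q_in_R[OF eq nz(2)])
  have 2: "el x y / el u v \<in> carrier R" by (rule q_in_R[OF eq[symmetric] nz(1)])
  have "(el u v / el x y) * (el x y / el u v) = 1" using nz by simp
  then have "el u v / el x y \<in> Units R" unfolding Units_R using 1 2 by blast
  moreover have "el u v = (el u v / el x y) * el x y" using nz by simp
  ultimately show ?thesis by blast
qed

lemma scaled_unit_Jp:
  assumes "\<eta> \<in> Units R" "ideal (Jp a0 b0) R"
  shows "(*) (\<eta> * z) ` Jp a0 b0 = (*) z ` Jp a0 b0"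
proof -
  obtain v where v: "\<eta> \<in> carrier R" "v \<in> carrier R" "\<eta> * v = 1" using assms(1) by (auto simp: Units_R)
  have J: "\<And>r u. r \<in> carrier R \<Longrightarrow> u \<in> Jp a0 b0 \<Longrightarrow> r * u \<in> Jp a0 b0"
    using assms(2) unfolding ideal_R_iff by blast
  show ?thesis
  proof
    show "(*) (\<eta> * z) ` Jp a0 b0 \<subseteq> (*) z ` Jp a0 b0"
    proof
      fix t assume "t \<in> (*) (\<eta> * z) ` Jp a0 b0"
      then obtain j where j: "t = \<eta> * z * j" "j \<in> Jp a0 b0" by blast
      then have "t = z * (\<eta> * j)" by (simp only: mult_ac)
      then show "t \<in> (*) z ` Jp a0 b0" using J[OF v(1) j(2)] by blast
    qed
    show "(*) z ` Jp a0 b0 \<subseteq> (*) (\<eta> * z) ` Jp a0 b0"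
    proof
      fix t assume "t \<in> (*) z ` Jp a0 b0"
      then obtain j where j: "t = z * j" "j \<in> Jp a0 b0" by blast
      have "(\<eta> * z) * (v * j) = (\<eta> * v) * (z * j)" by (simp only: mult_ac)
      then have "t = (\<eta> * z) * (v * j)" unfolding v(3) j(1) by simp
      then show "t \<in> (*) (\<eta> * z) ` Jp a0 b0" using J[OF v(2) j(2)] by blast
    qed
  qed
qed

text \<open>Equivalence in the form \<alpha> I = \<beta> J is normalized to a multiplier a0 on the
  left: as a0 lies in J, \<beta> a0 = \<alpha> \<gamma> for some \<gamma> in I, and then a0 I =
  \<gamma> J.\<close>

lemma class_rel_iff:
  assumes "I \<in> nonzero_ideals R" "Jp a0 b0 \<in> nonzero_ideals R" and a0: "a0 > 0"
  shows "(I, Jp a0 b0) \<in> ideal_class_rel R \<longleftrightarrow> (\<exists>x y. el x y \<noteq> 0 \<and> (*) (of_nat a0) ` I = (*) (el x y) ` Jp a0 b0)"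
proof
  assume "(I, Jp a0 b0) \<in> ideal_class_rel R"
  then obtain \<alpha> \<beta> where ab: "\<alpha> \<in> carrier R" "\<alpha> \<noteq> 0" "\<beta> \<in> carrier R" "\<beta> \<noteq> 0" "(*) \<alpha> ` I = (*) \<beta> ` Jp a0 b0"
    by (auto simp: ideal_class_rel_def)
  have "of_nat a0 \<in> Jp a0 b0" unfolding Jp_iff by (intro exI[of _ 1] exI[of _ 0]) simp
  then have "\<beta> * of_nat a0 \<in> (*) \<alpha> ` I" unfolding ab(5) by blast
  then obtain \<gamma> where g: "\<beta> * of_nat a0 = \<alpha> * \<gamma>" "\<gamma> \<in> I" by blast
  have "I \<subseteq> carrier R" using assms(1) ideal_R_iff by (auto simp: nonzero_ideals_def)
  then obtain x y where xy: "\<gamma> = el x y" using g(2) by (auto simp: carrier_R)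
  have "el x y \<noteq> 0" using g(1) ab a0 by (auto simp: xy)
  moreover have "(*) (of_nat a0) ` I = (*) (el x y) ` Jp a0 b0"
  proof
    show "(*) (of_nat a0) ` I \<subseteq> (*) (el x y) ` Jp a0 b0"
    proof
      fix t assume "t \<in> (*) (of_nat a0) ` I"
      then obtain z where z: "t = of_nat a0 * z" "z \<in> I" by blast
      then have "\<alpha> * z \<in> (*) \<beta> ` Jp a0 b0" using ab(5) by blast
      then obtain j where j: "\<alpha> * z = \<beta> * j" "j \<in> Jp a0 b0" by blast
      have "\<alpha> * t = of_nat a0 * (\<alpha> * z)" unfolding z(1) by (simp only: mult_ac)
      also have "\<dots> = (\<beta> * of_nat a0) * j" unfolding j(1) by (simp only: mult_ac)
      also have "\<dots> = \<alpha> * (el x y * j)" unfolding g(1) xy by (simp only: mult_ac)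
      finally have "t = el x y * j" using ab(2) by simp
      then show "t \<in> (*) (el x y) ` Jp a0 b0" using j(2) by blast
    qed
    show "(*) (el x y) ` Jp a0 b0 \<subseteq> (*) (of_nat a0) ` I"
    proof
      fix t assume "t \<in> (*) (el x y) ` Jp a0 b0"
      then obtain j where j: "t = el x y * j" "j \<in> Jp a0 b0" by blast
      then have "\<beta> * j \<in> (*) \<alpha> ` I" unfolding ab(5) by blast
      then obtain z where z: "\<beta> * j = \<alpha> * z" "z \<in> I" by blast
      have "\<alpha> * t = (\<alpha> * el x y) * j" unfolding j(1) by (simp only: mult_ac)
      also have "\<dots> = (\<beta> * j) * of_nat a0" unfolding xy[symmetric] g(1)[symmetric] by (simp only: mult_ac)
      also have "\<dots> = \<alpha> * (of_nat a0 * z)" unfolding z(1) by (simp only: mult_ac)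
      finally have "t = of_nat a0 * z" using ab(2) by simp
      then show "t \<in> (*) (of_nat a0) ` I" using z(2) by blast
    qed
  qed
  ultimately show "\<exists>x y. el x y \<noteq> 0 \<and> (*) (of_nat a0) ` I = (*) (el x y) ` Jp a0 b0" by blast
next
  assume "\<exists>x y. el x y \<noteq> 0 \<and> (*) (of_nat a0) ` I = (*) (el x y) ` Jp a0 b0"
  then obtain x y where xy: "el x y \<noteq> 0" "(*) (of_nat a0) ` I = (*) (el x y) ` Jp a0 b0" by blast
  have "of_nat a0 \<in> carrier R - {0}" using R_int[of "int a0"] a0 by simp
  moreover have "el x y \<in> carrier R - {0}" using xy(1) by simp
  ultimately show "(I, Jp a0 b0) \<in> ideal_class_rel R"
    using assms(1,2) xy(2) unfolding ideal_class_rel_def R_simps mem_Collect_eq case_prod_conv by blast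
qed

lemma equiv_class_rel: "equiv (nonzero_ideals R) (ideal_class_rel R)"
proof (rule equivI)
  show "ideal_class_rel R \<subseteq> nonzero_ideals R \<times> nonzero_ideals R" by (auto simp: ideal_class_rel_def)
  show "refl_on (nonzero_ideals R) (ideal_class_rel R)"
    unfolding refl_on_def ideal_class_rel_def using R_1 by (auto intro!: bexI[of _ 1])
  show "sym (ideal_class_rel R)"
    unfolding sym_def ideal_class_rel_def by (auto; metis DiffI singletonD)
  show "trans (ideal_class_rel R)"
  proof (rule transI)
    fix I J K assume "(I, J) \<in> ideal_class_rel R" "(J, K) \<in> ideal_class_rel R"
    then obtain a b a' b' where ab: "a \<in> carrier R" "a \<noteq> 0" "b \<in> carrier R" "b \<noteq> 0" "(*) a ` I = (*) b ` J"
      and ab': "a' \<in> carrier R" "a' \<noteq> 0" "b' \<in> carrier R" "b' \<noteq> 0" "(*) a' ` J = (*) b' ` K"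
      and nz: "I \<in> nonzero_ideals R" "K \<in> nonzero_ideals R"
      by (auto simp: ideal_class_rel_def)
    have comp: "(*) (s * t) ` A = (*) s ` ((*) t ` A)" for s t :: real and A
      by (simp add: image_image mult.assoc)
    have "(*) (a' * a) ` I = (*) (b * b') ` K"
    proof -
      have "(*) (a' * a) ` I = (*) a' ` ((*) b ` J)" unfolding comp ab(5) ..
      also have "\<dots> = (*) b ` ((*) a' ` J)" unfolding comp[symmetric] by (simp only: mult.commute)
      also have "\<dots> = (*) (b * b') ` K" unfolding ab'(5) comp ..
      finally show ?thesis .
    qed
    moreover have "a' * a \<in> carrier R - {0}" "b * b' \<in> carrier R - {0}" using ab ab' R_mult by auto
    ultimately show "(I, K) \<in> ideal_class_rel R"
      using nz unfolding ideal_class_rel_def R_simps mem_Collect_eq case_prod_conv by blast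
  qed
qed

end

section \<open>A fundamental domain for the units and the density of a class\<close>

context quad_unit begin

text \<open>The hyperbolic cotangent of 2 ln \<epsilon>. With this slope, the line s = C q t with q
  = sqrt p is the locus where the quotient of an element by its conjugate is \<epsilon>^4.\<close>

definition C :: real where "C = (\<epsilon> ^ 4 + 1) / (\<epsilon> ^ 4 - 1)"

lemma eps4: "\<epsilon> ^ 4 > 1" using eps_gt_1 by (simp add: one_less_power)

lemma C_gt_1: "C > 1" using eps4 by (simp add: C_def)

lemma ln_C: "ln ((C + 1) / (C - 1)) = 4 * ln \<epsilon>"
proof -
  have "C + 1 = 2 * \<epsilon> ^ 4 / (\<epsilon> ^ 4 - 1)" "C - 1 = 2 / (\<epsilon> ^ 4 - 1)"
    using eps4 by (simp_all add: C_def field_simps)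
  then have "(C + 1) / (C - 1) = \<epsilon> ^ 4" using eps4 by simp
  then show ?thesis by (simp add: ln_realpow)
qed

text \<open>Multiplying \<open>z\<close> by \<open>\<epsilon>\<^sup>2\<close> multiplies the quotient of \<open>z\<close> and its conjugate by \<open>\<epsilon>^4\<close>, so this selects one
  element from each orbit of the units.\<close>

definition unit_domain :: "real \<Rightarrow> real \<Rightarrow> bool" where "unit_domain y z \<longleftrightarrow> z \<le> y \<and> y < \<epsilon> ^ 4 * z"

lemma unit_domain_pos: assumes "unit_domain y z" shows "z > 0" "y > 0"
proof -
  have "(\<epsilon> ^ 4 - 1) * z > 0" using assms by (simp add: unit_domain_def algebra_simps)
  then show "z > 0" using eps4 by (simp add: zero_less_mult_iff)
  then show "y > 0" using assms by (simp add: unit_domain_def)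
qed

lemma unit_domain_iff:
  "unit_domain ((s + t * sq) / 2) ((s - t * sq) / 2) \<longleftrightarrow> t \<ge> 0 \<and> C * sq * t < s"
proof -
  have "(s - t * sq) / 2 \<le> (s + t * sq) / 2 \<longleftrightarrow> t * sq \<ge> 0" by simp
  also have "\<dots> \<longleftrightarrow> t \<ge> 0" using sq_pos by (simp add: zero_le_mult_iff)
  finally have 1: "(s - t * sq) / 2 \<le> (s + t * sq) / 2 \<longleftrightarrow> t \<ge> 0" .
  have "(s + t * sq) / 2 < \<epsilon> ^ 4 * ((s - t * sq) / 2) \<longleftrightarrow> (\<epsilon> ^ 4 + 1) * (sq * t) < s * (\<epsilon> ^ 4 - 1)"
    by (simp add: algebra_simps)
  also have "\<dots> \<longleftrightarrow> (\<epsilon> ^ 4 + 1) * (sq * t) / (\<epsilon> ^ 4 - 1) < s"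
    using eps4 by (intro pos_divide_less_eq[symmetric]) simp
  also have "(\<epsilon> ^ 4 + 1) * (sq * t) / (\<epsilon> ^ 4 - 1) = C * sq * t" by (simp add: C_def)
  finally show ?thesis using 1 by (simp add: unit_domain_def)
qed

lemma eps_powi_pos: "\<epsilon> powi k > 0" using eps_gt_1 by simp

lemma norm_powi: "\<epsilon> powi k * cj (\<epsilon> powi k) = (if even k then 1 else - 1)"
proof -
  have "\<epsilon> powi k * cj (\<epsilon> powi k) = (\<epsilon> * cj \<epsilon>) powi k"
    using powi_unit[OF eps_unit, of k] by (simp add: power_int_mult_distrib)
  then show ?thesis by (simp add: norm_eps power_int_minus_left)
qed

text \<open>A factor \<epsilon>, of norm -1, makes the norm positive if necessary, and a sign then
  makes element and conjugate positive. A power of \<epsilon>^2, found by rounding a logarithm,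
  finally moves their quotient into [1, \<epsilon>^4).\<close>

lemma ex_unit_unit_domain:
  assumes "z \<in> carrier R" "z \<noteq> 0"
  shows "\<exists>\<eta>\<in>Units R. unit_domain (\<eta> * z) (cj (\<eta> * z))"
proof -
  have cjz: "z * cj z \<noteq> 0"
  proof -
    obtain x y where z: "z = el x y" using assms(1) by (rule in_R_E)
    then have "N x y \<noteq> 0" using assms(2) by (simp add: N_eq_0_iff el_eq_0_iff)
    then show ?thesis unfolding z cj_el el_norm by simp
  qed
  have one: "1 \<in> Units R" and mone: "- 1 \<in> Units R"
    using R_1 R_minus[OF R_1] by (auto simp: Units_R intro: bexI[of _ "- 1"])
  have Um: "u * v \<in> Units R" if uv: "u \<in> Units R" "v \<in> Units R" for u v
  proof -
    obtain u' v' where *: "u \<in> carrier R" "u' \<in> carrier R" "u * u' = 1" "v \<in> carrier R" "v' \<in> carrier R" "v * v' = 1"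
      using uv unfolding Units_R by blast
    have "(u * v) * (u' * v') = (u * u') * (v * v')" by (simp only: mult_ac)
    then have "(u * v) * (u' * v') = 1" using * by simp
    then show ?thesis unfolding Units_R using * R_mult by blast
  qed
  have pos: "\<exists>\<eta>\<in>Units R. \<eta> * y > 0 \<and> cj (\<eta> * y) > 0" if "y \<in> carrier R" "y * cj y > 0" for y
  proof (cases "y > 0")
    case True
    then show ?thesis using that one by (intro bexI[of _ 1]) (auto simp: zero_less_mult_iff)
  next
    case False
    then show ?thesis using that mone by (intro bexI[of _ "- 1"]) (auto simp: zero_less_mult_iff cj_minus)
  qed
  have "\<exists>\<eta>\<in>Units R. \<eta> * z > 0 \<and> cj (\<eta> * z) > 0"
  proof (cases "z * cj z > 0")
    case True then show ?thesis using pos[OF assms(1)] by blast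
  next
    case False
    have ez: "\<epsilon> * z \<in> carrier R" using eps_R assms(1) R_mult by blast
    have "(\<epsilon> * z) * cj (\<epsilon> * z) = (\<epsilon> * cj \<epsilon>) * (z * cj z)"
      using cj_mult[OF eps_R assms(1)] by (simp only: mult_ac)
    then have "(\<epsilon> * z) * cj (\<epsilon> * z) = - (z * cj z)" by (simp add: norm_eps)
    then have "(\<epsilon> * z) * cj (\<epsilon> * z) > 0" using False cjz by linarith
    then obtain \<eta> where "\<eta> \<in> Units R" "\<eta> * (\<epsilon> * z) > 0" "cj (\<eta> * (\<epsilon> * z)) > 0" using pos[OF ez] by blast
    then show ?thesis using Um[OF _ eps_unit] by (intro bexI[of _ "\<eta> * \<epsilon>"]) (simp_all add: mult.assoc)
  qed
  then obtain \<eta>1 where e1: "\<eta>1 \<in> Units R" "\<eta>1 * z > 0" "cj (\<eta>1 * z) > 0" by blast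
  define z1 where "z1 = \<eta>1 * z"
  define h1 where "h1 = cj z1"
  have z1: "z1 > 0" "h1 > 0" "z1 \<in> carrier R"
    using e1(2,3) R_mult[OF _ assms(1)] e1(1) unfolding h1_def z1_def Units_R by blast+
  define k where "k = \<lfloor>ln (z1 / h1) / (4 * ln \<epsilon>)\<rfloor>"
  define P where "P = \<epsilon> powi (2 * k)"
  have P: "P > 0" unfolding P_def by (rule eps_powi_pos)
  have le: "ln \<epsilon> > 0" using eps_gt_1 by simp
  have "of_int k \<le> ln (z1 / h1) / (4 * ln \<epsilon>)" "ln (z1 / h1) / (4 * ln \<epsilon>) < of_int k + 1"
    unfolding k_def by linarith+
  then have kk: "of_int k * (4 * ln \<epsilon>) \<le> ln (z1 / h1)" "ln (z1 / h1) < (of_int k + 1) * (4 * ln \<epsilon>)"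
    using le by (simp_all add: pos_le_divide_eq pos_divide_less_eq)
  have lnP: "ln (P * P) = of_int k * (4 * ln \<epsilon>)"
  proof -
    have "P = \<epsilon> powr (2 * of_int k)" using eps_gt_1 powr_real_of_int'[of \<epsilon> "2 * k"] by (simp add: P_def)
    then have "ln P = 2 * of_int k * ln \<epsilon>" using eps_gt_1 by (simp add: ln_powr)
    then show ?thesis using P by (simp add: ln_mult_pos)
  qed
  have lnP4: "ln (P * P * \<epsilon> ^ 4) = (of_int k + 1) * (4 * ln \<epsilon>)"
  proof -
    have "ln (P * P * \<epsilon> ^ 4) = ln (P * P) + ln (\<epsilon> ^ 4)" using P eps_gt_1 by (intro ln_mult_pos) auto
    then show ?thesis unfolding lnP by (simp add: ln_realpow algebra_simps)
  qed
  have r0: "z1 / h1 > 0" using z1 by simp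
  have a: "P * P \<le> z1 / h1" using kk(1) P r0 unfolding lnP[symmetric] by simp
  have b: "z1 / h1 < P * P * \<epsilon> ^ 4" using kk(2) P r0 eps_gt_1 unfolding lnP4[symmetric] by simp
  define \<eta>2 where "\<eta>2 = \<epsilon> powi (- (2 * k))"
  have e2: "\<eta>2 \<in> Units R" unfolding \<eta>2_def using powi_unit[OF eps_unit] by blast
  have e2P: "\<eta>2 = inverse P" by (simp add: \<eta>2_def P_def power_int_minus)
  have "\<eta>2 * cj \<eta>2 = 1" unfolding \<eta>2_def norm_powi by simp
  then have cj2: "cj \<eta>2 = P" unfolding e2P using P by (simp add: field_simps)
  have z2: "\<eta>2 * z1 = z1 / P" "cj (\<eta>2 * z1) = P * h1"
    using cj_mult[of \<eta>2 z1] e2 z1(3) cj2 by (simp_all add: e2P h1_def Units_R divide_inverse mult.commute)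
  have "unit_domain (\<eta>2 * z1) (cj (\<eta>2 * z1))"
    unfolding unit_domain_def z2(2) unfolding z2(1) using a b P z1 by (simp add: field_simps)
  moreover have "\<eta>2 * z1 = (\<eta>2 * \<eta>1) * z" by (simp add: z1_def mult.assoc)
  ultimately show ?thesis using Um[OF e2 e1(1)] by (intro bexI[of _ "\<eta>2 * \<eta>1"]) (simp_all only:)
qed

text \<open>Positivity of both elements and their conjugates forces \<eta> to be an even power of
  \<epsilon>. A nonzero even exponent changes the quotient by a factor of at least \<epsilon>^4,
  which leaves the half-open domain.\<close>

lemma unit_domain_unique:
  assumes \<eta>: "\<eta> \<in> Units R" and z: "z \<in> carrier R" and d1: "unit_domain z (cj z)" and d2: "unit_domain (\<eta> * z) (cj (\<eta> * z))"
  shows "\<eta> = 1"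
proof -
  have no: False if "k \<ge> 2" "unit_domain y y1" "unit_domain x x1" "x = \<epsilon> powi k * y" "y1 = \<epsilon> powi k * x1" for k y y1 x x1
  proof -
    have "\<epsilon> powi 2 \<le> \<epsilon> powi k" using that(1) eps_gt_1 by (intro power_int_increasing) auto
    then have e2: "\<epsilon> ^ 2 \<le> \<epsilon> powi k" by simp
    have "\<epsilon> ^ 4 * x1 = \<epsilon> ^ 2 * (\<epsilon> ^ 2 * x1)" by (simp add: power2_eq_square power4_eq_xxxx mult_ac)
    also have "\<dots> \<le> \<epsilon> powi k * (\<epsilon> powi k * x1)"
      using e2 unit_domain_pos[OF that(3)] eps_gt_1 by (intro mult_mono) auto
    also have "\<dots> \<le> \<epsilon> powi k * y" unfolding that(5)[symmetric] using that(2) eps_powi_pos[of k]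
      by (intro mult_left_mono) (auto simp: unit_domain_def)
    finally show False using that(3) unfolding that(4) by (simp add: unit_domain_def)
  qed
  obtain k :: int where k: "\<eta> = \<epsilon> powi k \<or> \<eta> = - (\<epsilon> powi k)" using unit_power[OF \<eta>] by blast
  have "\<eta> > 0" using unit_domain_pos[OF d1] unit_domain_pos[OF d2] by (simp add: zero_less_mult_iff)
  then have ek: "\<eta> = \<epsilon> powi k" using k eps_powi_pos[of k] by auto
  have \<eta>R: "\<eta> \<in> carrier R" using \<eta> by (simp add: Units_R)
  have cjm: "cj (\<eta> * z) = cj \<eta> * cj z" by (rule cj_mult[OF \<eta>R z])
  then have "cj \<eta> > 0" using unit_domain_pos[OF d1] unit_domain_pos[OF d2] by (simp add: zero_less_mult_iff)
  then have "\<eta> * cj \<eta> > 0" using \<open>\<eta> > 0\<close> by simp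
  then have ev: "even k" using norm_powi[of k] unfolding ek[symmetric] by (auto split: if_splits)
  then have n1: "\<eta> * cj \<eta> = 1" using norm_powi[of k] unfolding ek[symmetric] by simp
  have hz: "cj z = \<epsilon> powi k * cj (\<eta> * z)"
  proof -
    have "\<epsilon> powi k * cj (\<eta> * z) = (\<eta> * cj \<eta>) * cj z" unfolding cjm unfolding ek by (simp only: mult.assoc)
    then show ?thesis by (simp add: n1)
  qed
  have "\<not> k \<ge> 2" using no[of k z "cj z" "\<eta> * z" "cj (\<eta> * z)"] d1 d2 hz ek by blast
  moreover have "\<not> - k \<ge> 2"
  proof
    assume "- k \<ge> 2"
    have inv: "\<epsilon> powi (- k) * \<epsilon> powi k = 1" using eps_gt_1 by (simp add: power_int_minus)
    have "z = \<epsilon> powi (- k) * (\<eta> * z)" unfolding ek mult.assoc[symmetric] inv by simp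
    moreover have "cj (\<eta> * z) = \<epsilon> powi (- k) * cj z" by (subst hz) (simp only: mult.assoc[symmetric] inv mult_1)
    ultimately show False using no[of "- k" "\<eta> * z" "cj (\<eta> * z)" z "cj z"] \<open>- k \<ge> 2\<close> d1 d2 by blast
  qed
  ultimately have "k = 0" using ev by presburger
  then show ?thesis using ek by simp
qed

text \<open>Coordinates for the elements x1 + t w of the conjugate of the reference ideal, with x1 +
  t (b0 + 1) = a0 m. The quantity 2 a0 m - (2 b0 + 1) t is the trace 2 x1 + t, and the second
  condition bounds the norm by a0 x.\<close>

definition sector :: "nat \<Rightarrow> int \<Rightarrow> nat \<Rightarrow> (int \<times> int) set" where
  "sector a0 b0 x = {(t :: int, m :: int). t \<ge> 0 \<and> C * sq * of_int t < of_int (2 * int a0 * m - (2 * b0 + 1) * t) \<and>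
      (of_int (2 * int a0 * m - (2 * b0 + 1) * t))\<^sup>2 - sq\<^sup>2 * (of_int t)\<^sup>2 \<le> 4 * (real a0 * real x)}"

lemma sector_iff:
  assumes X: "\<And>t m. X t m = int a0 * m - t * (b0 + 1)"
  shows "(t, m) \<in> sector a0 b0 x \<longleftrightarrow> unit_domain (el (X t m) t) (cj (el (X t m) t)) \<and> N (X t m) t \<le> int (a0 * x)"
proof -
  have s: "2 * X t m + t = 2 * int a0 * m - (2 * b0 + 1) * t" by (simp add: X algebra_simps)
  have "unit_domain (el (X t m) t) (cj (el (X t m) t)) \<longleftrightarrow> (of_int t :: real) \<ge> 0 \<and> C * sq * of_int t < of_int (2 * int a0 * m - (2 * b0 + 1) * t)"
    unfolding cj_half unfolding el_half s by (rule unit_domain_iff)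
  moreover have "N (X t m) t \<le> int (a0 * x) \<longleftrightarrow>
      (of_int (2 * int a0 * m - (2 * b0 + 1) * t))\<^sup>2 - sq\<^sup>2 * (of_int t)\<^sup>2 \<le> 4 * (real a0 * real x)"
  proof -
    have "N (X t m) t \<le> int (a0 * x) \<longleftrightarrow> 4 * N (X t m) t \<le> 4 * int (a0 * x)" by simp
    also have "\<dots> \<longleftrightarrow> (of_int (4 * N (X t m) t) :: real) \<le> of_int (4 * int (a0 * x))" by (simp only: of_int_le_iff)
    also have "of_int (4 * int (a0 * x)) = 4 * (real a0 * real x)" by simp
    also have "(of_int (4 * N (X t m) t) :: real) = (of_int (2 * int a0 * m - (2 * b0 + 1) * t))\<^sup>2 - sq\<^sup>2 * (of_int t)\<^sup>2"
      unfolding four_N s by (simp add: power2_eq_square[of sq] sq_sq)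
    finally show ?thesis .
  qed
  ultimately show ?thesis by (auto simp: sector_def)
qed

text \<open>A point of the sector stands for a multiplier z, and \<psi> sends it to the ideal z J /
  a0 with J the reference ideal. An ideal determines z up to a unit, and the sector contains one
  representative of each unit orbit.\<close>

lemma card_class_eq:
  assumes v: "valid (a0, b0, 1)"
  shows "card {\<tau> \<in> triples x. (Jset \<tau>, Jp a0 b0) \<in> ideal_class_rel R} = card (sector a0 b0 x)"
proof -
  have a0: "a0 > 0" "int a0 dvd nf b0" using v by (auto simp: valid_def Sol_def)
  have Jnz: "Jp a0 b0 \<in> nonzero_ideals R" unfolding Jp_def by (rule ideal_Jset[OF v])
  then have Jid: "ideal (Jp a0 b0) R" by (simp add: nonzero_ideals_def)
  define X where "X = (\<lambda>t m. int a0 * m - t * (b0 + 1))"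
  have X: "X t m = int a0 * m - t * (b0 + 1)" for t m by (simp add: X_def)
  note sec = sector_iff[OF X, of _ _ x]
  define ok where "ok = (\<lambda>(t, m) \<tau>. valid \<tau> \<and> (*) (of_nat a0) ` Jset \<tau> = (*) (el (X t m) t) ` Jp a0 b0)"
  define \<psi> where "\<psi> = (\<lambda>y. SOME \<tau>. ok y \<tau>)"
  have nz: "el (X t m) t \<noteq> 0" if "(t, m) \<in> sector a0 b0 x" for t m
    using that unit_domain_pos unfolding sec by force
  have ok: "ok (t, m) (\<psi> (t, m))" if "(t, m) \<in> sector a0 b0 x" for t m
  proof -
    have "int a0 dvd X t m + t * (b0 + 1)" by (simp add: X_def)
    from ex_scaled_ideal[OF a0 this nz[OF that]] have "\<exists>\<tau>. ok (t, m) \<tau>" by (simp add: ok_def)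
    then show ?thesis unfolding \<psi>_def by (rule someI_ex)
  qed
  have uniq: "\<tau> = \<tau>'" if "ok y \<tau>" "ok y \<tau>'" for y \<tau> \<tau>'
  proof -
    have "(*) (of_nat a0 :: real) ` Jset \<tau> = (*) (of_nat a0) ` Jset \<tau>'" and v: "valid \<tau>" "valid \<tau>'"
      using that by (auto simp: ok_def split: prod.splits)
    moreover have "inj ((*) (of_nat a0 :: real))" using a0 by (auto simp: inj_on_def)
    ultimately have "Jset \<tau> = Jset \<tau>'" by (simp only: inj_image_eq_iff)
    then show ?thesis by (rule inj_Jset[OF v])
  qed
  have "bij_betw \<psi> (sector a0 b0 x) {\<tau> \<in> triples x. (Jset \<tau>, Jp a0 b0) \<in> ideal_class_rel R}"
  proof (rule bij_betw_imageI)
    show "inj_on \<psi> (sector a0 b0 x)"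
    proof (rule inj_onI)
      fix y y' assume y: "y \<in> sector a0 b0 x" "y' \<in> sector a0 b0 x" "\<psi> y = \<psi> y'"
      obtain t m where tm: "y = (t, m)" by (cases y)
      obtain t' m' where tm': "y' = (t', m')" by (cases y')
      have s: "(t, m) \<in> sector a0 b0 x" "(t', m') \<in> sector a0 b0 x" using y tm tm' by auto
      have "(*) (el (X t m) t) ` Jp a0 b0 = (*) (el (X t' m') t') ` Jp a0 b0"
        using ok[OF s(1)] ok[OF s(2)] y(3) by (simp add: ok_def tm tm')
      from scaled_ideals_unit[OF this nz[OF s(1)] nz[OF s(2)] a0(1)]
      obtain \<eta> where \<eta>: "\<eta> \<in> Units R" "el (X t m) t = \<eta> * el (X t' m') t'" by blast
      have "\<eta> = 1" using s unfolding sec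
        by (intro unit_domain_unique[OF \<eta>(1) el_in_R[of "X t' m'" t']]) (simp_all only: \<eta>(2)[symmetric])
      then have "el (X t m) t = el (X t' m') t'" using \<eta>(2) by simp
      then have "X t m = X t' m' \<and> t = t'" unfolding el_eq_iff .
      then show "y = y'" using a0 by (auto simp: X_def tm tm')
    qed
    show "\<psi> ` sector a0 b0 x = {\<tau> \<in> triples x. (Jset \<tau>, Jp a0 b0) \<in> ideal_class_rel R}"
    proof (intro equalityI subsetI)
      fix \<tau> assume "\<tau> \<in> \<psi> ` sector a0 b0 x"
      then obtain t m where tm: "(t, m) \<in> sector a0 b0 x" "\<tau> = \<psi> (t, m)" by auto
      obtain a b e where abe: "\<tau> = (a, b, e)" by (cases \<tau>)
      have o: "valid (a, b, e)" "(*) (of_nat a0) ` Jset (a, b, e) = (*) (el (X t m) t) ` Jp a0 b0"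
        using ok[OF tm(1)] unfolding tm(2)[symmetric] abe by (auto simp: ok_def)
      have "el (X t m) t * cj (el (X t m) t) > 0" using tm(1) unit_domain_pos unfolding sec by (blast intro: mult_pos_pos)
      then have "N (X t m) t > 0" unfolding cj_el el_norm by simp
      then have "int (a * e\<^sup>2) * int a0 = N (X t m) t" using norm_scaled_ideal[OF o(2) a0(1)] by simp
      also have "\<dots> \<le> int (a0 * x)" using tm(1) unfolding sec by blast
      finally have "int (a * e\<^sup>2) * int a0 \<le> int x * int a0" by (simp add: mult.commute)
      then have "int (a * e\<^sup>2) \<le> int x" using a0(1) by (simp only: mult_le_cancel_right_pos of_nat_0_less_iff)
      then have "a * e\<^sup>2 \<le> x" by (simp only: of_nat_le_iff)
      then have "\<tau> \<in> triples x" using o(1) by (simp add: triples_def abe valid_def)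
      moreover have "(Jset \<tau>, Jp a0 b0) \<in> ideal_class_rel R"
        using class_rel_iff[OF ideal_Jset[OF o(1)] Jnz a0(1)] o(2) nz[OF tm(1)] unfolding abe by blast
      ultimately show "\<tau> \<in> {\<tau> \<in> triples x. (Jset \<tau>, Jp a0 b0) \<in> ideal_class_rel R}" by blast
    next
      fix \<tau> assume \<tau>: "\<tau> \<in> {\<tau> \<in> triples x. (Jset \<tau>, Jp a0 b0) \<in> ideal_class_rel R}"
      obtain a b e where abe: "\<tau> = (a, b, e)" by (cases \<tau>)
      have val: "valid (a, b, e)" and nx: "a * e\<^sup>2 \<le> x" using \<tau> by (auto simp: abe triples_def valid_def)
      have "(Jset (a, b, e), Jp a0 b0) \<in> ideal_class_rel R" using \<tau> by (simp add: abe)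
      then obtain x0 y0 where xy: "el x0 y0 \<noteq> 0" "(*) (of_nat a0) ` Jset (a, b, e) = (*) (el x0 y0) ` Jp a0 b0"
        using class_rel_iff[OF ideal_Jset[OF val] Jnz a0(1)] by blast
      obtain \<eta> where \<eta>: "\<eta> \<in> Units R" "unit_domain (\<eta> * el x0 y0) (cj (\<eta> * el x0 y0))"
        using ex_unit_unit_domain[OF el_in_R xy(1)] by blast
      have "\<eta> * el x0 y0 \<in> carrier R" using \<eta>(1) R_mult by (simp add: Units_R)
      then obtain x1 t where x1: "\<eta> * el x0 y0 = el x1 t" by (rule in_R_E)
      have eq: "(*) (of_nat a0) ` Jset (a, b, e) = (*) (el x1 t) ` Jp a0 b0"
        using scaled_unit_Jp[OF \<eta>(1) Jid, of "el x0 y0"] xy(2) unfolding x1 by simp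
      obtain m where m: "x1 + t * (b0 + 1) = int a0 * m" using dvd_of_scaled_ideal[OF eq val] by (rule dvdE)
      have x1X: "x1 = X t m" using m by (simp add: X_def)
      have dom: "unit_domain (el x1 t) (cj (el x1 t))" using \<eta>(2) unfolding x1 .
      have "el x1 t * cj (el x1 t) > 0" using unit_domain_pos[OF dom] by simp
      then have "N x1 t > 0" unfolding cj_el el_norm by simp
      then have "N x1 t = int (a * e\<^sup>2) * int a0" using norm_scaled_ideal[OF eq a0(1)] by simp
      also have "\<dots> \<le> int x * int a0" using nx by (intro mult_right_mono) (simp_all only: of_nat_le_iff of_nat_0_le_iff)
      finally have "N x1 t \<le> int (a0 * x)" by (simp add: mult.commute)
      then have s: "(t, m) \<in> sector a0 b0 x" using dom unfolding sec x1X by blast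
      have "ok (t, m) \<tau>" using val eq by (simp add: ok_def abe x1X)
      then have "\<tau> = \<psi> (t, m)" using uniq ok[OF s] by blast
      then show "\<tau> \<in> \<psi> ` sector a0 b0 x" using s by blast
    qed
  qed
  from bij_betw_same_card[OF this] show ?thesis by simp
qed

text \<open>Every class contains some \<open>Jp a b\<close>, and the limit of the sector counts is 4
  ln \<epsilon> / (2 sqrt p) whatever a and b are.\<close>

lemma card_class_asymp:
  assumes K: "K \<in> nonzero_ideals R // ideal_class_rel R"
  shows "(\<lambda>x. real (card {\<tau> \<in> triples x. Jset \<tau> \<in> K}) / real x) \<longlonglongrightarrow> 2 * ln \<epsilon> / sq"
proof -
  obtain I where I: "I \<in> nonzero_ideals R" "K = ideal_class_rel R `` {I}" using K by (rule quotientE)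
  obtain a b e where t: "valid (a, b, e)" "I = Jset (a, b, e)" using ideal_imp_Jset[OF I(1)] by auto
  have a0: "a > 0" "e > 0" using t(1) by (auto simp: valid_def)
  have v: "valid (a, b, 1)" using t(1) by (simp add: valid_def)
  have IJ: "(I, Jp a b) \<in> ideal_class_rel R"
  proof -
    have "(*) (1 :: real) ` I = (*) (of_nat e) ` Jp a b"
    proof -
      have "I = (*) (of_nat e) ` Jp a b" unfolding t(2)
      proof (intro Set.set_eqI iffI)
        fix z assume "z \<in> Jset (a, b, e)"
        then obtain m k where "z = of_nat e * (of_int m * of_nat a + of_int k * el b 1)" unfolding Jset_iff by blast
        then show "z \<in> (*) (of_nat e) ` Jp a b" using Jp_iff by blast
      next
        fix z assume "z \<in> (*) (of_nat e) ` Jp a b"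
        then obtain j where "z = of_nat e * j" "j \<in> Jp a b" by blast
        then show "z \<in> Jset (a, b, e)" unfolding Jset_iff Jp_iff by blast
      qed
      then show ?thesis by simp
    qed
    moreover have "1 \<in> carrier R - {0}" using R_1 by simp
    moreover have "of_nat e \<in> carrier R - {0}" using R_int[of "int e"] a0 by simp
    moreover have "Jp a b \<in> nonzero_ideals R" unfolding Jp_def by (rule ideal_Jset[OF v])
    ultimately show ?thesis
      using I(1) unfolding ideal_class_rel_def R_simps mem_Collect_eq case_prod_conv by blast
  qed
  have "Jset \<tau> \<in> K \<longleftrightarrow> (Jset \<tau>, Jp a b) \<in> ideal_class_rel R" for \<tau>
  proof -
    have sy: "sym (ideal_class_rel R)" and tr: "trans (ideal_class_rel R)"
      using equiv_class_rel by (auto simp: equiv_def)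
    have "Jset \<tau> \<in> K \<longleftrightarrow> (I, Jset \<tau>) \<in> ideal_class_rel R" by (simp add: I(2))
    also have "\<dots> \<longleftrightarrow> (Jset \<tau>, Jp a b) \<in> ideal_class_rel R"
      using IJ symD[OF sy] transD[OF tr] by blast
    finally show ?thesis .
  qed
  then have "card {\<tau> \<in> triples x. Jset \<tau> \<in> K} = card (sector a b x)" for x
    using card_class_eq[OF v] by simp
  moreover have "(\<lambda>x. real (card (sector a b x)) / real x) \<longlonglongrightarrow> ln ((C + 1) / (C - 1)) / (2 * sq)"
    unfolding sector_def by (rule tendsto_card_hyperbolic_sector[OF sq_pos C_gt_1 a0(1)])
  ultimately show ?thesis by (simp add: ln_C)
qed

text \<open>The ideals of norm at most x are split according to their classes, each of density
  \<kappa>, and their total density is \<open>L\<close>.\<close>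

theorem class_number_formula: "real (quad_class_number p) * (2 * ln \<epsilon> / sq) = L"
proof -
  define Q where "Q = nonzero_ideals R // ideal_class_rel R"
  define \<kappa> where "\<kappa> = 2 * ln \<epsilon> / sq"
  have \<kappa>: "\<kappa> > 0" using eps_gt_1 sq_pos by (simp add: \<kappa>_def)
  define cnt where "cnt = (\<lambda>K x. {\<tau> \<in> triples x. Jset \<tau> \<in> K})"
  have fin: "finite (cnt K x)" for K x using card_triples(1)[of x] by (simp add: cnt_def)
  have disj: "cnt K x \<inter> cnt K' x = {}" if "K \<in> Q" "K' \<in> Q" "K \<noteq> K'" for K K' x
    using quotient_disj[OF equiv_class_rel, of K K'] that by (auto simp: Q_def cnt_def)
  have card_Un: "card (\<Union>K\<in>F. cnt K x) = (\<Sum>K\<in>F. card (cnt K x))" if "finite F" "F \<subseteq> Q" for F x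
  proof (rule card_UN_disjoint[OF that(1)])
    show "\<forall>K\<in>F. finite (cnt K x)" using fin by blast
    show "\<forall>K\<in>F. \<forall>K'\<in>F. K \<noteq> K' \<longrightarrow> cnt K x \<inter> cnt K' x = {}" using disj that(2) by blast
  qed
  have lim: "(\<lambda>x. \<Sum>K\<in>F. real (card (cnt K x)) / real x) \<longlonglongrightarrow> real (card F) * \<kappa>" if "finite F" "F \<subseteq> Q" for F
  proof -
    have "(\<lambda>x. \<Sum>K\<in>F. real (card (cnt K x)) / real x) \<longlonglongrightarrow> (\<Sum>K\<in>F. \<kappa>)"
      unfolding cnt_def \<kappa>_def by (intro tendsto_sum card_class_asymp) (use that in \<open>auto simp: Q_def\<close>)
    then show ?thesis by simp
  qed
  have sum_eq: "(\<Sum>K\<in>F. real (card (cnt K x)) / real x) = real (card (\<Union>K\<in>F. cnt K x)) / real x" if "finite F" "F \<subseteq> Q" for F x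
    unfolding card_Un[OF that] by (simp add: sum_divide_distrib)
  have bound: "real (card F) * \<kappa> \<le> L" if F: "finite F" "F \<subseteq> Q" for F
  proof (rule LIMSEQ_le[OF lim[OF F] card_triples_asymp], intro exI[of _ 0] allI impI)
    fix x
    have "card (\<Union>K\<in>F. cnt K x) \<le> card (triples x)"
      by (rule card_mono[OF card_triples(1)]) (auto simp: cnt_def)
    then show "(\<Sum>K\<in>F. real (card (cnt K x)) / real x) \<le> real (card (triples x)) / real x"
      unfolding sum_eq[OF F] by (simp add: divide_right_mono)
  qed
  \<comment> \<open>More than L / \<kappa> classes would exceed the total density. Finiteness also
    gives \<open>card\<close> in the class number its intended meaning, as infinite sets have
    \<open>card\<close> 0.\<close>
  have finQ: "finite Q"
  proof (rule ccontr)
    assume inf: "infinite Q"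
    obtain M :: nat where M: "L / \<kappa> < real M" using reals_Archimedean2 by blast
    obtain F where F: "finite F" "card F = M" "F \<subseteq> Q" using infinite_arbitrarily_large[OF inf] by blast
    have "real M * \<kappa> \<le> L" using bound[OF F(1,3)] F(2) by simp
    then have "real M \<le> L / \<kappa>" using \<kappa> by (simp add: pos_le_divide_eq)
    then show False using M by simp
  qed
  have "(\<Union>K\<in>Q. cnt K x) = triples x" for x
  proof
    show "(\<Union>K\<in>Q. cnt K x) \<subseteq> triples x" by (auto simp: cnt_def)
    show "triples x \<subseteq> (\<Union>K\<in>Q. cnt K x)"
    proof
      fix \<tau> assume \<tau>: "\<tau> \<in> triples x"
      obtain a b e where abe: "\<tau> = (a, b, e)" by (cases \<tau>)
      have "valid \<tau>" using \<tau> by (auto simp: abe triples_def valid_def)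
      then have J: "Jset \<tau> \<in> nonzero_ideals R" unfolding abe by (rule ideal_Jset)
      then have "ideal_class_rel R `` {Jset \<tau>} \<in> Q" unfolding Q_def by (rule quotientI)
      moreover have "Jset \<tau> \<in> ideal_class_rel R `` {Jset \<tau>}" using equiv_class_self[OF equiv_class_rel J] .
      ultimately show "\<tau> \<in> (\<Union>K\<in>Q. cnt K x)" using \<tau> unfolding cnt_def by blast
    qed
  qed
  then have "(\<lambda>x. \<Sum>K\<in>Q. real (card (cnt K x)) / real x) \<longlonglongrightarrow> L"
    using card_triples_asymp sum_eq[OF finQ subset_refl] by simp
  then have "real (card Q) * \<kappa> = L" using LIMSEQ_unique lim[OF finQ subset_refl] by blast
  then show ?thesis by (simp add: quad_class_number_def Q_def \<kappa>_def)
qed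

end

section \<open>The class number formula modulo the prime\<close>

text \<open>Two candidates differ by less than \<open>p\<close> in absolute value, and their
  difference is divisible by \<open>p\<close> after clearing denominators prime to
  \<open>p\<close>.\<close>

lemma pbar_eqI:
  assumes p: "prime p" and x: "2 * \<bar>x\<bar> + 2 < int p" and pd: "padic_dvd p (of_int x - a)"
  shows "pbar p a = x"
proof -
  have bound: "- (of_nat p / 2 :: rat) < of_int y \<and> of_int y < (of_nat p / 2 :: rat) \<longleftrightarrow> 2 * \<bar>y\<bar> < int p" for y
  proof -
    have "- (of_nat p / 2 :: rat) < of_int y \<longleftrightarrow> (of_int (- int p) :: rat) < of_int (2 * y)" by auto
    moreover have "of_int y < (of_nat p / 2 :: rat) \<longleftrightarrow> (of_int (2 * y) :: rat) < of_int (int p)" by auto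
    ultimately show ?thesis unfolding of_int_less_iff by linarith
  qed
  have unique: "y = x" if y: "2 * \<bar>y\<bar> < int p" "padic_dvd p (of_int y - a)" for y
  proof -
    obtain r s where rs: "\<not> int p dvd s" "of_int x - a = of_nat p * (of_int r / of_int s)"
      using pd by (auto simp: padic_dvd_def)
    obtain r' s' where rs': "\<not> int p dvd s'" "of_int y - a = of_nat p * (of_int r' / of_int s')"
      using y(2) by (auto simp: padic_dvd_def)
    have nz: "s \<noteq> 0" "s' \<noteq> 0" using rs(1) rs'(1) by auto
    have "(of_int y - of_int x :: rat) = (of_int y - a) - (of_int x - a)" by simp
    also have "\<dots> = of_nat p * (of_int r' / of_int s' - of_int r / of_int s)" unfolding rs(2) rs'(2) by (simp add: algebra_simps)
    finally have "(of_int y - of_int x :: rat) = of_nat p * (of_int r' / of_int s' - of_int r / of_int s)" .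
    then have "(of_int y - of_int x :: rat) * (of_int s * of_int s') = of_nat p * ((of_int r' / of_int s' - of_int r / of_int s) * (of_int s * of_int s'))"
      by (simp only: mult.assoc)
    also have "(of_int r' / of_int s' - of_int r / of_int s) * (of_int s * of_int s') = (of_int (r' * s - r * s') :: rat)"
      using nz by (simp add: left_diff_distrib)
    finally have "(of_int ((y - x) * (s * s')) :: rat) = of_int (int p * (r' * s - r * s'))" by simp
    then have "(y - x) * (s * s') = int p * (r' * s - r * s')" by (simp only: of_int_eq_iff)
    then have dv: "int p dvd (y - x) * (s * s')" by simp
    have pp: "prime (int p)" using p by simp
    have "int p dvd y - x" using prime_dvd_multD[OF pp dv] prime_dvd_multD[OF pp, of s s'] rs(1) rs'(1) by blast
    moreover have "\<bar>y - x\<bar> < int p" using x y(1) by linarith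
    ultimately show ?thesis using zdvd_not_zless[of "\<bar>y - x\<bar>" "int p"] by auto
  qed
  show ?thesis unfolding pbar_def
  proof (rule the_equality)
    have "2 * \<bar>x\<bar> < int p" using x by linarith
    then show "- (of_nat p / 2 :: rat) < of_int x \<and> of_int x < (of_nat p / 2 :: rat) \<and> padic_dvd p (of_int x - a)"
      using pd bound[of x] by blast
  next
    fix y assume y: "- (of_nat p / 2 :: rat) < of_int y \<and> of_int y < (of_nat p / 2 :: rat) \<and> padic_dvd p (of_int y - a)"
    show "y = x" by (rule unique) (use y bound[of y] in blast)+
  qed
qed

section \<open>Residues and nonresidues below p / 2, and cyclotomic units\<close>

context prime_5_mod_8 begin

lemma c_reflect: "a < p \<Longrightarrow> c (int (p - a)) = c (int a)"
proof -
  assume "a < p"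
  then have "c (int (p - a)) = c (- int a)" by (intro c_cong) (simp add: cong_iff_dvd_diff of_nat_diff)
  then show ?thesis by (simp add: c_minus)
qed

lemma sum_c_half: "(\<Sum>a\<in>{1..n}. c (int a)) = 0"
proof -
  have "(\<Sum>a\<in>{n+1..<p}. c (int a)) = (\<Sum>a\<in>{1..n}. c (int a))"
    by (rule sum.reindex_bij_witness[of _ "\<lambda>a. p - a" "\<lambda>a. p - a"]) (use p_n(1) c_reflect in auto)
  moreover have "(\<Sum>a\<in>{1..n} \<union> {n+1..<p}. c (int a)) = (\<Sum>a\<in>{1..n}. c (int a)) + (\<Sum>a\<in>{n+1..<p}. c (int a))"
    by (rule sum.union_disjoint) auto
  moreover have "{1..n} \<union> {n+1..<p} = {1..<p}" using p_n(1) by auto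
  ultimately show ?thesis using sum_c by simp
qed

definition half :: "int \<Rightarrow> nat set" where "half s = {a \<in> {1..n}. c (int a) = s}"

lemma sum_c_mult:
  assumes "finite A" "A \<subseteq> {1..<p}"
  shows "(\<Sum>a\<in>A. of_int (c (int a)) * f a) =
      (\<Sum>a\<in>{a\<in>A. c (int a) = 1}. f a) - (\<Sum>a\<in>{a\<in>A. c (int a) = - 1}. f a :: 'a :: comm_ring_1)"
proof -
  have "(\<Sum>a\<in>A. of_int (c (int a)) * f a) =
      (\<Sum>a\<in>A. (if c (int a) = 1 then f a else 0) - (if c (int a) = - 1 then f a else 0))"
  proof (rule sum.cong)
    fix a assume "a \<in> A"
    show "of_int (c (int a)) * f a = (if c (int a) = 1 then f a else 0) - (if c (int a) = - 1 then f a else 0)"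
      using c_cases[of "int a"] by auto
  qed (rule refl)
  also have "\<dots> = (\<Sum>a\<in>A. if c (int a) = 1 then f a else 0) - (\<Sum>a\<in>A. if c (int a) = - 1 then f a else 0)"
    by (rule sum_subtractf)
  finally show ?thesis unfolding sum.inter_filter[OF assms(1)] .
qed

lemma c_partition:
  assumes "finite A" "A \<subseteq> {1..<p}"
  shows "{a\<in>A. c (int a) = 1} \<union> {a\<in>A. c (int a) = - 1} = A"
proof -
  have "c (int a) = 1 \<or> c (int a) = - 1" if "a \<in> A" for a
    using c_cases[of "int a"] c_eq_0_iff[of "int a"] not_dvd_less[of a] assms(2) that by auto
  then show ?thesis by blast
qed

lemma card_c:
  assumes "finite A" "A \<subseteq> {1..<p}" and sum: "(\<Sum>a\<in>A. c (int a)) = 0"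
  shows "2 * card {a\<in>A. c (int a) = 1} = card A" "2 * card {a\<in>A. c (int a) = - 1} = card A"
proof -
  have "int (card {a\<in>A. c (int a) = 1}) - int (card {a\<in>A. c (int a) = - 1}) = 0"
    using sum_c_mult[OF assms(1,2), of "\<lambda>_. 1 :: int"] sum by simp
  moreover have "card A = card {a\<in>A. c (int a) = 1} + card {a\<in>A. c (int a) = - 1}"
  proof -
    have "card ({a\<in>A. c (int a) = 1} \<union> {a\<in>A. c (int a) = - 1}) = card {a\<in>A. c (int a) = 1} + card {a\<in>A. c (int a) = - 1}"
      by (rule card_Un_disjoint) (use assms(1) in auto)
    then show ?thesis unfolding c_partition[OF assms(1,2)] .
  qed
  ultimately show "2 * card {a\<in>A. c (int a) = 1} = card A" "2 * card {a\<in>A. c (int a) = - 1} = card A" by auto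
qed

lemma half_subset: "{1..n} \<subseteq> {1..<p}" using p_n(1) by auto

lemma finite_half [simp]: "finite (half s)" by (simp add: half_def)

lemma halfD: "a \<in> half s \<Longrightarrow> 0 < a \<and> a < p" unfolding half_def using half_subset by fastforce

lemma card_half: "card (half 1) = 2 * r + 1" "card (half (- 1)) = 2 * r + 1"
  using card_c[OF _ half_subset sum_c_half] by (simp_all add: half_def n_def)

lemma prod_half: "(\<Prod>a\<in>half 1. f a) * (\<Prod>a\<in>half (- 1). f a) = (\<Prod>a\<in>{1..n}. f a :: 'a :: comm_monoid_mult)"
proof -
  have "(\<Prod>a\<in>half 1 \<union> half (- 1). f a) = (\<Prod>a\<in>half 1. f a) * (\<Prod>a\<in>half (- 1). f a)"
    by (rule prod.union_disjoint) (auto simp: half_def)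
  then show ?thesis using c_partition[OF _ half_subset] by (simp add: half_def)
qed

text \<open>The squares of $1, \dots, n$ run over the quadratic residues, and so do the $a$ and $p - a$ for
  $a$ in \<open>half 1\<close>.\<close>

lemma cong_prod_half_sq: "[(\<Prod>a\<in>half 1. int a)\<^sup>2 = 1] (mod int p)"
proof -
  define Q where "Q = {a\<in>{1..<p}. c (int a) = 1}"
  have cardQ: "card Q = n"
    using card_c(1)[OF _ subset_refl sum_c] p_n(1) by (simp add: Q_def)
  define \<phi> where "\<phi> = (\<lambda>x::nat. x\<^sup>2 mod p)"
  have \<phi>: "[int (\<phi> x) = (int x)\<^sup>2] (mod int p)" for x unfolding \<phi>_def by (rule cong_trans[OF cong_int_mod]) simp
  have inj: "inj_on \<phi> {1..n}"
  proof (rule inj_onI)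
    fix x y assume xy: "x \<in> {1..n}" "y \<in> {1..n}" "\<phi> x = \<phi> y"
    have "[(int x)\<^sup>2 = (int y)\<^sup>2] (mod int p)"
      using cong_trans[OF cong_sym[OF \<phi>[of x]], of "(int y)\<^sup>2"] \<phi>[of y] xy(3) by simp
    then have "int p dvd (int x)\<^sup>2 - (int y)\<^sup>2" by (simp add: cong_iff_dvd_diff)
    then have "int p dvd (int x - int y) * (int x + int y)" by (simp add: power2_eq_square algebra_simps)
    then have "int p dvd int x - int y \<or> int p dvd int x + int y" by (rule prime_dvd_multD[OF prime_int_p])
    moreover have "\<not> int p dvd int x + int y"
      using xy(1,2) p_n(1) not_dvd_less[of "x + y"] by simp
    ultimately have "int p dvd \<bar>int x - int y\<bar>" by simp
    then have "\<not> (0 < \<bar>int x - int y\<bar> \<and> \<bar>int x - int y\<bar> < int p)" using zdvd_not_zless by blast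
    moreover have "\<bar>int x - int y\<bar> < int p"
    proof -
      have "x < p" "y < p" using xy(1,2) half_subset by auto
      then show ?thesis by arith
    qed
    ultimately show "x = y" by simp
  qed
  have "\<phi> ` {1..n} \<subseteq> Q"
  proof
    fix a assume "a \<in> \<phi> ` {1..n}"
    then obtain x where x: "a = \<phi> x" "x \<in> {1..n}" by blast
    have "c (int a) = c (int x * int x)" using c_cong[OF \<phi>[of x]] x by (simp add: power2_eq_square)
    also have "\<dots> = 1"
    proof -
      have "0 < x" "x < p" using x(2) half_subset by auto
      then show ?thesis unfolding c_mult by (rule c_sq)
    qed
    finally have 1: "c (int a) = 1" .
    have "a < p" using p_gt2 by (simp add: x(1) \<phi>_def)
    moreover have "a \<noteq> 0"
    proof
      assume "a = 0"
      then have "c (int a) = 0" unfolding c_eq_0_iff by simp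
      then show False using 1 by simp
    qed
    ultimately show "a \<in> Q" using 1 by (simp add: Q_def)
  qed
  moreover have "finite Q" by (simp add: Q_def)
  ultimately have "\<phi> ` {1..n} = Q" using card_image[OF inj] cardQ by (intro card_subset_eq) auto
  then have "(\<Prod>a\<in>Q. int a) = (\<Prod>x\<in>{1..n}. int (\<phi> x))" using prod.reindex[OF inj, of int] by simp
  also have "[\<dots> = (\<Prod>x\<in>{1..n}. (int x)\<^sup>2)] (mod int p)" by (rule cong_prod) (rule \<phi>)
  also have "(\<Prod>x\<in>{1..n}. (int x)\<^sup>2) = (fact n)\<^sup>2" by (simp add: prod_power_distrib fact_prod)
  also have "[\<dots> = - 1] (mod int p)" by (rule cong_fact_n_sq)
  finally have 1: "[(\<Prod>a\<in>Q. int a) = - 1] (mod int p)" .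
  have "(\<Prod>a\<in>Q. int a) = (\<Prod>a\<in>half 1. int a) * (\<Prod>a\<in>(\<lambda>a. p - a) ` half 1. int a)"
  proof -
    have "half 1 \<union> (\<lambda>a. p - a) ` half 1 = Q"
    proof (intro Set.set_eqI iffI)
      fix a assume "a \<in> half 1 \<union> (\<lambda>a. p - a) ` half 1"
      then obtain b where b: "b \<in> half 1" "a = b \<or> a = p - b" by blast
      have "0 < b" "b < p" "c (int b) = 1" using b(1) halfD by (auto simp: half_def)
      then show "a \<in> Q" using b(2) c_reflect[of b] by (auto simp: Q_def)
    next
      fix a assume a: "a \<in> Q"
      show "a \<in> half 1 \<union> (\<lambda>a. p - a) ` half 1"
      proof (cases "a \<le> n")
        case False
        have a': "a < p" "c (int a) = 1" using a by (auto simp: Q_def)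
        have "p - a \<le> n" using False p_n(1) by linarith
        then have "p - a \<in> half 1" using a' c_reflect[of a] by (simp add: half_def)
        moreover have "a = p - (p - a)" using a' by simp
        ultimately show ?thesis by blast
      qed (use a in \<open>simp add: half_def Q_def\<close>)
    qed
    moreover have "(\<Prod>a\<in>half 1 \<union> (\<lambda>a. p - a) ` half 1. int a) = (\<Prod>a\<in>half 1. int a) * (\<Prod>a\<in>(\<lambda>a. p - a) ` half 1. int a)"
    proof (rule prod.union_disjoint)
      show "half 1 \<inter> (\<lambda>a. p - a) ` half 1 = {}"
      proof (rule equals0I)
        fix a assume "a \<in> half 1 \<inter> (\<lambda>a. p - a) ` half 1"
        then obtain b where "a \<le> n" "b \<le> n" "a = p - b" by (auto simp: half_def)
        then show False using p_n(1) by linarith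
      qed
    qed simp_all
    ultimately show ?thesis by simp
  qed
  also have "(\<Prod>a\<in>(\<lambda>a. p - a) ` half 1. int a) = (\<Prod>a\<in>half 1. int (p - a))"
  proof -
    have "inj_on (\<lambda>a. p - a) (half 1)" by (rule inj_onI) (use halfD in force)
    from prod.reindex[OF this, of int] show ?thesis by simp
  qed
  also have "[(\<Prod>a\<in>half 1. int a) * (\<Prod>a\<in>half 1. int (p - a)) = (\<Prod>a\<in>half 1. int a) * (\<Prod>a\<in>half 1. (- 1) * int a)] (mod int p)"
  proof (intro cong_mult cong_prod)
    fix a assume "a \<in> half 1"
    then have "a < p" using halfD by blast
    then show "[int (p - a) = - 1 * int a] (mod int p)" by (simp add: cong_iff_dvd_diff of_nat_diff)
  qed simp
  \<comment> \<open>The sign is -1 because \<open>half 1\<close> has the odd number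
    \<open>2 * r + 1\<close> of elements; it cancels the -1 from (n!)^2.\<close>
  also have "(\<Prod>a\<in>half 1. int a) * (\<Prod>a\<in>half 1. (- 1) * int a) = - ((\<Prod>a\<in>half 1. int a)\<^sup>2)"
    by (simp only: prod.distrib prod_constant card_half) (simp add: power2_eq_square)
  finally have "[- ((\<Prod>a\<in>half 1. int a)\<^sup>2) = - 1] (mod int p)" using 1 by (blast intro: cong_trans cong_sym)
  then show ?thesis by (rule cong_minus_minus_iff[THEN iffD1])
qed

definition chord :: "nat \<Rightarrow> real" where "chord a = 2 * sin (pi * real a / real p)"

lemma chord_pos: "0 < a \<Longrightarrow> a < p \<Longrightarrow> chord a > 0" by (simp add: chord_def sin_pos)

text \<open>Polynomials representing the cyclotomic units $(\xi^a - \xi^{-a}) / (\xi - \xi^{-1})$ up to sign.\<close>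

definition cyclotomic_unit :: "nat \<Rightarrow> int poly" where
  "cyclotomic_unit a = smult ((- 1) ^ a) (monom 1 ((p - 1) * (a - 1)) * (\<Sum>j<a. monom 1 (2 * j)))"

lemma poly_cyclotomic_unit_1: "poly (cyclotomic_unit a) 1 = (- 1) ^ a * int a"
  by (simp add: cyclotomic_unit_def poly_sum poly_monom)

text \<open>A geometric sum in \<xi>^2, shifted by a power of \<xi>^(p - 1) = \<xi>^(-1). The sign
  (-1)^a in the polynomial cancels the one in \<open>xi_power_diff\<close>, which leaves the
  positive number \<open>chord a\<close>.\<close>

lemma ev_cyclotomic_unit:
  assumes "0 < a" "a < p"
  shows "ev (cyclotomic_unit a) \<xi> * (\<xi> - \<xi> ^ (p - 1)) = \<i> * of_real (chord a)"
proof -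
  define y where "y = \<xi> ^ (p - 1)"
  have "\<xi> * y = \<xi> ^ Suc (p - 1)" by (simp add: y_def)
  then have xy: "\<xi> * y = 1" using p_gt2 xi_p by simp
  have geo: "(\<xi>\<^sup>2) ^ a - 1 = (\<xi>\<^sup>2 - 1) * (\<Sum>j<a. (\<xi>\<^sup>2) ^ j)" by (rule power_diff_1_eq)
  obtain b where b: "a = Suc b" using assms(1) gr0_implies_Suc by blast
  have e: "ev (cyclotomic_unit a) \<xi> = (- 1) ^ a * (y ^ b * (\<Sum>j<a. (\<xi>\<^sup>2) ^ j))"
    by (simp add: cyclotomic_unit_def b y_def flip: power_mult)
  have zy: "\<xi> - y = y * (\<xi>\<^sup>2 - 1)"
  proof -
    have "y * (\<xi>\<^sup>2 - 1) = (\<xi> * y) * \<xi> - y" by (simp add: power2_eq_square algebra_simps)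
    then show ?thesis using xy by simp
  qed
  have "ev (cyclotomic_unit a) \<xi> * (\<xi> - y) = (- 1) ^ a * (y ^ a * ((\<xi>\<^sup>2 - 1) * (\<Sum>j<a. (\<xi>\<^sup>2) ^ j)))"
    unfolding e zy by (simp only: b power_Suc mult_ac)
  also have "\<dots> = (- 1) ^ a * ((\<xi> * y) ^ a * \<xi> ^ a - y ^ a)"
    unfolding geo[symmetric] by (simp add: power_mult_distrib power2_eq_square algebra_simps)
  also have "y ^ a = \<xi> ^ (p - a)"
  proof -
    have "[(p - 1) * a = p - a] (mod p)"
    proof -
      have "(p - 1) * a = p * b + (p - a)"
        using assms by (simp add: b diff_mult_distrib algebra_simps)
      then show ?thesis by (simp add: Cong.cong_def)
    qed
    from root_of_unity_power_eq[OF xi_p this] show ?thesis by (simp add: y_def power_mult)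
  qed
  also have "(\<xi> * y) ^ a * \<xi> ^ a - \<xi> ^ (p - a) = (- 1) ^ a * (2 * \<i> * of_real (sin (pi * real a / real p)))"
    unfolding xy using xi_power_diff[of a] assms by simp
  also have "(- 1) ^ a * ((- 1) ^ a * (2 * \<i> * of_real (sin (pi * real a / real p)))) = \<i> * of_real (chord a)"
    by (simp add: chord_def mult.assoc[symmetric] power_mult_distrib[symmetric])
  finally show ?thesis by (simp add: y_def)
qed

text \<open>Residues and nonresidues are equally many below p / 2, so the same power of \<xi> -
  \<xi>^(-1) and of \<i> occurs for both and drops out of their comparison.\<close>

lemma ev_prod_cyclotomic_unit:
  assumes "card (half s) = 2 * r + 1"
  shows "ev (\<Prod>a\<in>half s. cyclotomic_unit a) \<xi> * (\<xi> - \<xi> ^ (p - 1)) ^ (2 * r + 1) = \<i> ^ (2 * r + 1) * of_real (\<Prod>a\<in>half s. chord a)"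
proof -
  have "(\<Prod>a\<in>half s. ev (cyclotomic_unit a) \<xi> * (\<xi> - \<xi> ^ (p - 1))) = (\<Prod>a\<in>half s. \<i> * of_real (chord a))"
    by (intro prod.cong refl ev_cyclotomic_unit) (use halfD in blast)+
  then show ?thesis unfolding prod.distrib prod_constant assms ev_prod of_real_prod .
qed

lemma xi_diff_ne_0: "\<xi> - \<xi> ^ (p - 1) \<noteq> 0"
proof
  assume "\<xi> - \<xi> ^ (p - 1) = 0"
  then have "\<i> * of_real (chord 1) = 0" using ev_cyclotomic_unit[of 1] p_gt2 by simp
  then show False using chord_pos[of 1] p_gt2 by simp
qed

end

context quad_unit begin

lemma eps_power_class_number:
  "\<epsilon> ^ quad_class_number p * (\<Prod>a\<in>half 1. chord a) = (\<Prod>a\<in>half (- 1). chord a)"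
proof -
  define h where "h = quad_class_number p"
  have pos: "chord a > 0" if "a \<in> half s" for a s using halfD[OF that] chord_pos by blast
  have ppos: "(\<Prod>a\<in>half s. chord a) > 0" for s by (rule prod_pos) (rule pos)
  have lnp: "ln (\<Prod>a\<in>half s. chord a) = (\<Sum>a\<in>half s. ln (chord a))" for s
    by (rule ln_prod) (auto dest: pos)
  have "sq * (real h * (2 * ln \<epsilon> / sq)) = sq * L" using class_number_formula by (simp add: h_def)
  also have "\<dots> = - 2 * (\<Sum>a\<in>{1..n}. of_int (c (int a)) * ln (chord a))"
    using sqrt_p_mult_L by (simp add: sq_def chord_def)
  also have "(\<Sum>a\<in>{1..n}. of_int (c (int a)) * ln (chord a)) = (\<Sum>a\<in>half 1. ln (chord a)) - (\<Sum>a\<in>half (- 1). ln (chord a))"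
    unfolding half_def by (rule sum_c_mult[OF _ half_subset]) simp
  finally have "real h * ln \<epsilon> + (\<Sum>a\<in>half 1. ln (chord a)) = (\<Sum>a\<in>half (- 1). ln (chord a))"
    using sq_pos by simp
  then have "ln (\<epsilon> ^ h) + ln (\<Prod>a\<in>half 1. chord a) = ln (\<Prod>a\<in>half (- 1). chord a)"
    unfolding lnp using eps_gt_1 by (simp add: ln_realpow)
  moreover have "ln (\<epsilon> ^ h * (\<Prod>a\<in>half 1. chord a)) = ln (\<epsilon> ^ h) + ln (\<Prod>a\<in>half 1. chord a)"
    using eps_gt_1 ppos by (intro ln_mult_pos) auto
  ultimately have "ln (\<epsilon> ^ h * (\<Prod>a\<in>half 1. chord a)) = ln (\<Prod>a\<in>half (- 1). chord a)" by simp
  then show ?thesis using eps_gt_1 ppos by (simp add: h_def)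
qed

lemma norm_uv:
  assumes "\<epsilon> = (of_int u + of_int v * sq) / 2"
  shows "u * u - int p * (v * v) = - 4"
proof -
  obtain X Y where e: "\<epsilon> = el X Y" using eps_R by (rule in_R_E)
  have "el (u - v) (2 * v) = 2 * \<epsilon>" unfolding assms by (simp add: el_half)
  also have "\<dots> = el (2 * X) (2 * Y)" unfolding e by (simp add: el_def algebra_simps)
  finally have uv: "u = 2 * X + Y" "v = Y" unfolding el_eq_iff by auto
  have "of_int (N X Y) = (- 1 :: real)" using norm_eps unfolding e cj_el el_norm .
  then have "of_int (N X Y) = (of_int (- 1) :: real)" by simp
  then have "N X Y = - 1" by (simp only: of_int_eq_iff)
  then show ?thesis using four_N[of X Y] unfolding uv by (simp add: power2_eq_square)
qed

text \<open>As \<open>sq * sq\<close> is \<open>p\<close>, only u^k survives modulo \<open>p\<close>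
  in the rational part. \<open>B\<close> may stay unspecified, since its companion sqrt p is
  represented by \<open>Dp\<close>, which vanishes at 1.\<close>

lemma power_uv:
  fixes u v :: int
  shows "\<exists>A B. (of_int u + of_int v * sq) ^ k = of_int (u ^ k + int p * A) + of_int B * sq"
proof (induction k)
  case 0
  show ?case by (intro exI[of _ 0]) simp
next
  case (Suc k)
  then obtain A B where AB: "(of_int u + of_int v * sq) ^ k = of_int (u ^ k + int p * A) + of_int B * sq" by blast
  have "(of_int u + of_int v * sq) ^ Suc k = (of_int u + of_int v * sq) * (of_int (u ^ k + int p * A) + of_int B * sq)"
    unfolding power_Suc AB ..
  also have "\<dots> = of_int u * of_int (u ^ k + int p * A) + (sq * sq) * (of_int v * of_int B) +
      (of_int u * of_int B + of_int v * of_int (u ^ k + int p * A)) * sq"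
    by (simp add: algebra_simps)
  also have "\<dots> = of_int (u ^ Suc k + int p * (u * A + v * B)) + of_int (u * B + v * (u ^ k + int p * A)) * sq"
    unfolding sq_sq by (simp add: algebra_simps)
  finally show ?case by blast
qed

lemma cong_u_power_class_number:
  assumes \<epsilon>: "\<epsilon> = (of_int u + of_int v * sq) / 2"
  shows "[u ^ quad_class_number p = - (2 ^ quad_class_number p * fact n)] (mod int p)"
proof -
  define h where "h = quad_class_number p"
  obtain A B where AB: "(of_int u + of_int v * sq) ^ h = of_int (u ^ h + int p * A) + of_int B * sq"
    using power_uv by blast
  define F where "F = (\<lambda>s. \<Prod>a\<in>half s. cyclotomic_unit a)"
  \<comment> \<open>The identity for \<epsilon>^h with all denominators cleared, so that
    \<open>f\<close> has integer coefficients and vanishes at \<xi>; its value at 1 is then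
    divisible by \<open>p\<close>.\<close>
  define f where "f = smult (2 ^ h) (F (- 1)) - ([:u ^ h + int p * A:] + smult B Dp) * F 1"
  have "ev f \<xi> * (\<xi> - \<xi> ^ (p - 1)) ^ (2 * r + 1) = 0"
  proof -
    have E: "of_int (u ^ h + int p * A) + of_int B * ev Dp \<xi> = complex_of_real (2 ^ h * \<epsilon> ^ h)"
    proof -
      have "2 ^ h * \<epsilon> ^ h = (2 * \<epsilon>) ^ h" by (rule power_mult_distrib[symmetric])
      also have "2 * \<epsilon> = of_int u + of_int v * sq" unfolding \<epsilon> by simp
      finally show ?thesis unfolding AB unfolding ev_Dp sq_def by simp
    qed
    have "ev f \<xi> = 2 ^ h * ev (F (- 1)) \<xi> - complex_of_real (2 ^ h * \<epsilon> ^ h) * ev (F 1) \<xi>"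
      unfolding f_def E[symmetric] by simp
    then have "ev f \<xi> * (\<xi> - \<xi> ^ (p - 1)) ^ (2 * r + 1) =
        2 ^ h * (ev (F (- 1)) \<xi> * (\<xi> - \<xi> ^ (p - 1)) ^ (2 * r + 1)) -
        complex_of_real (2 ^ h * \<epsilon> ^ h) * (ev (F 1) \<xi> * (\<xi> - \<xi> ^ (p - 1)) ^ (2 * r + 1))"
      by (simp only: left_diff_distrib mult.assoc)
    also have "\<dots> = 2 ^ h * \<i> ^ (2 * r + 1) * (of_real (\<Prod>a\<in>half (- 1). chord a) - of_real (\<epsilon> ^ h * (\<Prod>a\<in>half 1. chord a)))"
      unfolding F_def ev_prod_cyclotomic_unit[OF card_half(1)] ev_prod_cyclotomic_unit[OF card_half(2)] by (simp add: right_diff_distrib mult_ac)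
    also have "\<dots> = 0" using eps_power_class_number by (simp add: h_def)
    finally show ?thesis .
  qed
  then have "ev f \<xi> = 0" using xi_diff_ne_0 by simp
  from ev_root_imp_dvd_poly_1[OF prime_p xi_p xi_ne_1 this]
  have dv: "int p dvd poly f 1" .
  define T where "T = (\<lambda>s. \<Prod>a\<in>half s. (- 1) ^ a * int a)"
  have "poly f 1 = 2 ^ h * T (- 1) - (u ^ h + int p * A) * T 1"
    by (simp add: f_def F_def T_def poly_prod poly_cyclotomic_unit_1 poly_Dp_1)
  then have "poly f 1 + int p * (A * T 1) = 2 ^ h * T (- 1) - u ^ h * T 1" by (simp add: algebra_simps)
  then have "int p dvd 2 ^ h * T (- 1) - u ^ h * T 1" using dv by (metis dvd_add dvd_triv_left)
  then have "[2 ^ h * T (- 1) = u ^ h * T 1] (mod int p)" by (simp add: cong_iff_dvd_diff)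
  \<comment> \<open>Since T 1 is its own inverse modulo \<open>p\<close>, multiplying by it moves
    the residues to the side of the nonresidues, where together they form n! up to sign.\<close>
  then have 1: "[u ^ h * T 1 * T 1 = 2 ^ h * T (- 1) * T 1] (mod int p)" by (rule cong_scalar_right[OF cong_sym])
  have "T 1 * T 1 = (\<Prod>a\<in>half 1. int a)\<^sup>2"
  proof -
    have "T 1 * T 1 = (\<Prod>a\<in>half 1. ((- 1) ^ a * int a) * ((- 1) ^ a * int a))" by (simp only: T_def prod.distrib)
    also have "\<dots> = (\<Prod>a\<in>half 1. int a * int a)"
      by (intro prod.cong refl) (simp add: minus_one_power_iff)
    finally show ?thesis by (simp only: prod.distrib power2_eq_square)
  qed
  then have "[T 1 * T 1 = 1] (mod int p)" using cong_prod_half_sq by simp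
  then have "[u ^ h * (T 1 * T 1) = u ^ h * 1] (mod int p)" by (rule cong_scalar_left)
  then have "[u ^ h = 2 ^ h * T (- 1) * T 1] (mod int p)" using 1 by (simp only: mult.assoc mult_1_right) (rule cong_trans[OF cong_sym])
  also have "2 ^ h * T (- 1) * T 1 = 2 ^ h * (\<Prod>a\<in>{1..n}. (- 1) ^ a * int a)"
    using prod_half[of "\<lambda>a. (- 1) ^ a * int a"] by (simp add: T_def mult_ac)
  also have "\<dots> = - (2 ^ h * fact n)"
    unfolding prod.distrib prod_minus_1_power[of r, folded n_def] fact_prod by simp
  finally show ?thesis by (simp add: h_def)
qed

lemma not_dvd_4_power: "\<not> int p dvd 4 ^ k"
proof
  assume "int p dvd 4 ^ k"
  then have "int p dvd 4" using prime_dvd_power prime_int_p by blast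
  then have "int p \<le> 4" by (rule zdvd_imp_le) simp
  then show False using p_eq by simp
qed

text \<open>Squaring the congruence for u^h and using u^2 = -4 and (n!)^2 = -1 gives (-4)^h = - 4^h,
  impossible for even h. For h = 2 k + 1 the factor u^(2 k) = (-4)^k is replaced and 4^k
  cancelled.\<close>

lemma odd_class_number:
  assumes \<epsilon>: "\<epsilon> = (of_int u + of_int v * sq) / 2"
  obtains k where "quad_class_number p = 2 * k + 1" "[u * (- 1) ^ k = - (2 * fact n)] (mod int p)"
proof -
  define h where "h = quad_class_number p"
  have uh: "[u ^ h = - (2 ^ h * fact n)] (mod int p)" using cong_u_power_class_number[OF \<epsilon>] by (simp add: h_def)
  have "u * u - (- 4) = int p * (v * v)" using norm_uv[OF \<epsilon>] by simp
  then have u2: "[u * u = - 4] (mod int p)" by (simp add: cong_iff_dvd_diff)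
  have "odd h"
  proof
    assume "even h"
    have "(2 :: int) ^ h * 2 ^ h = 4 ^ h" by (simp flip: power_mult_distrib)
    moreover have "(2 ^ h * fact n) * (2 ^ h * fact n) = (2 ^ h * 2 ^ h) * (fact n :: int)\<^sup>2"
      by (simp only: power2_eq_square mult_ac)
    ultimately have "(2 ^ h * fact n) * (2 ^ h * fact n) = 4 ^ h * (fact n :: int)\<^sup>2" by simp
    then have "[u ^ h * u ^ h = 4 ^ h * (fact n)\<^sup>2] (mod int p)"
      using cong_mult[OF uh uh] by (simp only: minus_mult_minus)
    from cong_trans[OF this cong_scalar_left[OF cong_fact_n_sq]]
    have 1: "[u ^ h * u ^ h = 4 ^ h * - 1] (mod int p)" .
    have "(- 4) ^ h = (4 :: int) ^ h" using \<open>even h\<close> by simp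
    then have "[u ^ h * u ^ h = 4 ^ h] (mod int p)"
      using cong_pow[OF u2, of h] by (simp only: power_mult_distrib)
    from cong_trans[OF cong_sym[OF this] 1] have "[4 ^ h = 4 ^ h * - 1] (mod int p)" .
    then have "int p dvd 2 * 4 ^ h" by (simp add: cong_iff_dvd_diff)
    then have "int p dvd 2 \<or> int p dvd 4 ^ h" by (rule prime_dvd_multD[OF prime_int_p])
    moreover have "\<not> int p dvd 2" using zdvd_not_zless[of 2 "int p"] p_gt2 by simp
    ultimately show False using not_dvd_4_power by blast
  qed
  then obtain k where k: "h = 2 * k + 1" by (rule oddE)
  have "u ^ h = u * (u * u) ^ k" by (simp add: k power_mult power2_eq_square)
  moreover have "[u * (u * u) ^ k = u * (- 4) ^ k] (mod int p)" by (rule cong_scalar_left[OF cong_pow[OF u2]])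
  moreover have "u * (- 4) ^ k = 4 ^ k * (u * (- 1) ^ k)" by (simp add: power_minus[of 4])
  moreover have "- (2 ^ h * fact n) = 4 ^ k * (- (2 * fact n :: int))" by (simp add: k power_mult)
  ultimately have "[4 ^ k * (u * (- 1) ^ k) = 4 ^ k * (- (2 * fact n))] (mod int p)"
    using uh by (simp only:) (rule cong_trans[OF cong_sym])
  moreover have "coprime (4 ^ k) (int p)"
    using prime_imp_coprime[OF prime_int_p not_dvd_4_power[of k]] by (simp only: coprime_commute)
  ultimately have "[u * (- 1) ^ k = - (2 * fact n)] (mod int p)" by (simp only: cong_mult_lcancel)
  then show thesis using that[of k] k by (simp add: h_def)
qed

text \<open>Multiplying u (-1)^k = - 2 n! by n^(n/2) and inserting the residue of n! leaves n^n =
  -1, so that n^(n/2) u / 2 is the sign \<open>x\<close> modulo \<open>p\<close>.\<close>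

theorem det_char_matrix_pbar:
  assumes \<chi>: "group_generator (dirichlet_group p) \<chi>" and \<epsilon>: "\<epsilon> = (of_int u + of_int v * sq) / 2"
  defines "h \<equiv> quad_class_number p"
  shows "4 dvd n + 2 \<and> 4 dvd 2 * h + n \<and>
     det (char_matrix p \<chi>) =
       of_int (int n ^ (n div 2) * (- 1) ^ ((n + 2) div 4) *
         (pbar p (1 / 2 * of_nat n ^ (n div 2) * of_int u) * (- 1) ^ ((2 * h + n) div 4)))"
proof -
  obtain s where s: "s = 1 \<or> s = - 1" "det (char_matrix p \<chi>) = of_int (s * (- 1) ^ r * int n ^ (2 * r + 1))"
    "[fact n = s * (- 1) ^ r * int n ^ (2 * r + 1)] (mod int p)"
    using det_char_matrix[OF \<chi>] by blast
  obtain k where k: "h = 2 * k + 1" "[u * (- 1) ^ k = - (2 * fact n)] (mod int p)"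
    using odd_class_number[OF \<epsilon>] unfolding h_def by blast
  have n2: "n div 2 = 2 * r + 1" by (simp add: n_def)
  define x where "x = s * (- 1) ^ (r + k)"
  have x1: "\<bar>x\<bar> = 1" using s(1) by (auto simp: x_def abs_mult power_abs)
  \<comment> \<open>2 n is -1 modulo \<open>p\<close>; -1 is a residue and 2 is not.\<close>
  have cn: "c (int n) = - 1"
  proof -
    have "2 * int n - (- 1) = int p" by (subst p_n(1)) simp
    then have "[2 * int n = - 1] (mod int p)" by (simp only: cong_iff_dvd_diff dvd_refl)
    then have "c (2 * int n) = c (- 1)" by (rule c_cong)
    then show ?thesis using c_minus[of 1] by (simp add: c_mult c_2)
  qed
  have nn: "[int n ^ (2 * r + 1) * int n ^ (2 * r + 1) = - 1] (mod int p)"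
  proof -
    have "int n ^ (2 * r + 1) * int n ^ (2 * r + 1) = int n ^ n"
      by (simp add: n_def flip: power_add)
    then show ?thesis using cong_euler[of "int n"] unfolding cn by (simp only: cong_sym_eq)
  qed
  have kk: "(- 1) ^ k * (- 1) ^ k = (1 :: int)" by (simp flip: power_mult_distrib)
  have "[int n ^ (2 * r + 1) * u = 2 * x] (mod int p)"
  proof -
    have "int n ^ (2 * r + 1) * u = int n ^ (2 * r + 1) * (- 1) ^ k * (u * (- 1) ^ k)"
    proof -
      have "int n ^ (2 * r + 1) * (- 1) ^ k * (u * (- 1) ^ k) = int n ^ (2 * r + 1) * u * ((- 1) ^ k * (- 1) ^ k)"
        by (simp only: mult_ac)
      then show ?thesis unfolding kk by simp
    qed
    also have "[\<dots> = int n ^ (2 * r + 1) * (- 1) ^ k * (- (2 * fact n))] (mod int p)"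
      by (rule cong_scalar_left[OF k(2)])
    also have "int n ^ (2 * r + 1) * (- 1) ^ k * (- (2 * fact n)) = (- 2 * int n ^ (2 * r + 1) * (- 1) ^ k) * fact n" by simp
    also have "[\<dots> = (- 2 * int n ^ (2 * r + 1) * (- 1) ^ k) * (s * (- 1) ^ r * int n ^ (2 * r + 1))] (mod int p)"
      by (rule cong_scalar_left[OF s(3)])
    also have "(- 2 * int n ^ (2 * r + 1) * (- 1) ^ k) * (s * (- 1) ^ r * int n ^ (2 * r + 1)) =
        - 2 * x * (int n ^ (2 * r + 1) * int n ^ (2 * r + 1))"
      unfolding x_def power_add[of "- 1 :: int" r k] by (simp only: mult_ac)
    also have "[\<dots> = - 2 * x * - 1] (mod int p)" by (rule cong_scalar_left[OF nn])
    finally show ?thesis by simp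
  qed
  then obtain q where q: "int n ^ (2 * r + 1) * u - 2 * x = int p * q" unfolding cong_iff_dvd_diff by (rule dvdE)
  have pb: "pbar p (1 / 2 * of_nat n ^ (n div 2) * of_int u) = x"
  proof (rule pbar_eqI[OF prime_p])
    show "2 * \<bar>x\<bar> + 2 < int p" using x1 p_eq by simp
    have half: "y - 1 / 2 * a * b = P * (- Q / 2)" if "a * b - 2 * y = P * Q" for a b y P Q :: rat
    proof -
      have y: "y = (a * b - P * Q) / 2" using that by (simp add: field_simps)
      show ?thesis unfolding y by (simp add: diff_divide_distrib)
    qed
    have "(of_int (int n ^ (2 * r + 1) * u - 2 * x) :: rat) = of_int (int p * q)" by (simp only: q)
    then have "of_nat n ^ (2 * r + 1) * of_int u - 2 * of_int x = (of_nat p * of_int q :: rat)"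
      by (simp only: of_int_diff of_int_mult of_int_power of_int_of_nat_eq of_int_numeral)
    from half[OF this]
    have "of_int x - 1 / 2 * of_nat n ^ (n div 2) * of_int u = (of_nat p * (of_int (- q) / of_int 2) :: rat)"
      unfolding n2 by (simp only: of_int_minus of_int_numeral)
    moreover have "\<not> int p dvd 2" using zdvd_not_zless[of 2 "int p"] p_gt2 by simp
    ultimately show "padic_dvd p (of_int x - 1 / 2 * of_nat n ^ (n div 2) * of_int u)" unfolding padic_dvd_def by blast
  qed
  have dv: "n + 2 = 4 * (r + 1)" "2 * h + n = 4 * (k + r + 1)" by (simp_all add: n_def k(1))
  \<comment> \<open>The exponents r + 1, r + k and k + r + 1 add up to r modulo 2, so the unknown
    parity of k disappears and \<open>s\<close> times (-1)^r is recovered.\<close>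
  have "(- 1) ^ (r + 1) * (x * (- 1) ^ (k + r + 1)) = s * (- 1) ^ r * (((- 1) ^ r * (- 1) ^ r) * ((- 1) ^ k * (- 1) ^ k))"
    by (simp add: x_def power_add)
  also have "\<dots> = s * (- 1) ^ r" by (simp flip: power_mult_distrib)
  finally have sg: "(- 1) ^ (r + 1) * (x * (- 1) ^ (k + r + 1)) = s * (- 1) ^ r" .
  have div4: "4 dvd n + 2" "4 dvd 2 * h + n" "(n + 2) div 4 = r + 1" "(2 * h + n) div 4 = k + r + 1" unfolding dv by simp_all
  have "int n ^ (n div 2) * (- 1) ^ ((n + 2) div 4) * (x * (- 1) ^ ((2 * h + n) div 4)) =
      int n ^ (2 * r + 1) * ((- 1) ^ (r + 1) * (x * (- 1) ^ (k + r + 1)))"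
    unfolding div4 n2 by (simp only: mult.assoc)
  also have "\<dots> = s * (- 1) ^ r * int n ^ (2 * r + 1)" unfolding sg by (simp only: mult_ac)
  finally have E: "int n ^ (n div 2) * (- 1) ^ ((n + 2) div 4) * (x * (- 1) ^ ((2 * h + n) div 4)) = s * (- 1) ^ r * int n ^ (2 * r + 1)" .
  show ?thesis unfolding pb E using div4(1,2) s(2) by blast
qed

end

text \<open>The two divisibilities in the conclusion express that the natural-number divisions by 4
  in the exponents are exact.\<close>

theorem corollary1:
  fixes p n h :: nat and u v :: int and \<chi> :: "int \<Rightarrow> complex"
  assumes "prime p" and "p mod 8 = 5" and "p = 2 * n + 1"
    and "group_generator (dirichlet_group p) \<chi>"
    and "quad_fundamental_unit p ((of_int u + of_int v * sqrt (real p)) / 2)"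
    and "h = quad_class_number p"
  shows "4 dvd n + 2 \<and> 4 dvd 2 * h + n \<and>
     det (char_matrix p \<chi>) =
       of_int (int n ^ (n div 2) * (- 1) ^ ((n + 2) div 4) *
         (pbar p (1 / 2 * of_nat n ^ (n div 2) * of_int u) * (- 1) ^ ((2 * h + n) div 4))) \<and>
     det (char_matrix p \<chi>) \<in> \<int>"
proof -
  have "p = 8 * (p div 8) + 5" using assms(2) by presburger
  then interpret quad_unit p "p div 8" "(of_int u + of_int v * sqrt (real p)) / 2"
    using assms(1,5) by unfold_locales
  have n: "prime_5_mod_8.n (p div 8) = n" using p_n(1) assms(3) by simp
  have "4 dvd n + 2 \<and> 4 dvd 2 * h + n \<and>
     det (char_matrix p \<chi>) =
       of_int (int n ^ (n div 2) * (- 1) ^ ((n + 2) div 4) *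
         (pbar p (1 / 2 * of_nat n ^ (n div 2) * of_int u) * (- 1) ^ ((2 * h + n) div 4)))"
    using det_char_matrix_pbar[OF assms(4), of u v] unfolding n assms(6) sq_def by blast
  moreover from this have "det (char_matrix p \<chi>) \<in> \<int>" by (metis Ints_of_int)
  ultimately show ?thesis by blast
qed

end
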